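(* Assume Selberg's conjectures (A), (B), (C) stated in the context. If $F\in\mathcal{S}$, then $F$ has no zeros on the line $\sigma=1$.
   Context: Write $\sigma=\Re s$, and for a function $\Phi$ put $\overline{\Phi}(s)=\overline{\Phi(\overline{s})}$. The Selberg class $\mathcal{S}$ is the set of Dirichlet series $F(s)=\sum_{n=1}^{\infty} a_n n^{-s}$ satisfying: (1) Analyticity: $(s-1)^mF(s)$ is (continues to) an entire function of finite order for some non-negative integer $m$. (2) Ramanujan hypothesis: $a_n\ll_\epsilon n^{\epsilon}$ for any fixed $\epsilon>0$. (3) Functional equation: there is a function $\gamma_F(s)=\epsilon Q^s\prod_{i=1}^{k}\Gamma(w_is+\mu_i)$ with $|\epsilon|=1$, $Q>0$, $w_i>0$, $\Re\mu_i\ge 0$ (the product of gamma functions may be empty) such that $\Phi(s)=\gamma_F(s)F(s)$ satisfies $\Phi(s)=\overline{\Phi}(1-s)$. (4) Euler product: $a_1=1$ and $\log F(s)=\sum_{n=1}^{\infty} b_n n^{-s}$ (for $\sigma>1$), where $b_n=0$ unless $n$ is a positive power of a prime, and $b_n\ll n^{\theta}$ for some $\theta<1/2$. $F\in\mathcal{S}$, $F\ne 1$, is primitive if $F=F_1F_2$ with $F_1,F_2\in\mathcal{S}$ implies $F_1=1$ or $F_2=1$. For a primitive Dirichlet character $\chi$, $F^\chi(s)=\sum_{n\ge1} a_n\chi(n)n^{-s}$. Sums over $p$ are over primes. Selberg's conjectures: (A) Regularity of distribution: for each $F\in\mathcal{S}$ with coefficients $a_n$ there is an integer $n_F$ such that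 $\sum_{p\le x}|a_p|^2/p=n_F\log\log x+O(1)$. (B) Orthonormality: if $F$ and $F'$ (with coefficients $a_n$ and $a'_n$) are distinct and primitive, then $n_F=1$ and $\sum_{p\le x}a_p\overline{a'_p}/p=O(1)$. (C) $GL(1)$ twists: if $\chi$ is a primitive Dirichlet character, $F$ and $F^\chi$ are in $\mathcal{S}$, and $F=\prod_{i=1}^kF_i$ with the $F_i$ primitive, then $F^\chi=\prod_{i=1}^kF_i^\chi$ and the $F_i^\chi$ are also primitive elements of $\mathcal{S}$. *)

theory Defs
  imports
    "HOL-Complex_Analysis.Complex_Analysis"
    "HOL-Number_Theory.Number_Theory"
    "HOL-Library.Landau_Symbols"
begin

text \<open>
  A Dirichlet series is represented by its sequence of coefficients. Only the coefficients with
  positive index are meaningful (the summand for index 0 below vanishes, since \<open>0 powr z = 0\<close>);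
  members of the Selberg class are normalised to have coefficient 0 at index 0, so that equality
  of coefficient sequences is equality of Dirichlet series.
\<close>

definition dirichlet_series :: "(nat \<Rightarrow> complex) \<Rightarrow> complex \<Rightarrow> complex" where
  "dirichlet_series a s = (\<Sum>n. a n * of_nat n powr (- s))"

text \<open>
  \<open>nicely_meromorphic_on\<close> makes the continuation unique as a function: it takes the value 0
  at its poles and is analytic elsewhere.
\<close>

definition continues_series :: "(complex \<Rightarrow> complex) \<Rightarrow> (nat \<Rightarrow> complex) \<Rightarrow> bool" where
  "continues_series F a \<longleftrightarrow>
     F nicely_meromorphic_on UNIV \<and> (\<forall>s. Re s > 1 \<longrightarrow> F s = dirichlet_series a s)"

definition entire_of_finite_order :: "(complex \<Rightarrow> complex) \<Rightarrow> bool" where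
  "entire_of_finite_order g \<longleftrightarrow>
     g holomorphic_on UNIV \<and>
     (\<exists>\<rho>::real. (\<lambda>s. norm (g s)) \<in> O[at_infinity](\<lambda>s. exp (norm s powr \<rho>)))"

definition selberg_analyticity :: "(complex \<Rightarrow> complex) \<Rightarrow> bool" where
  "selberg_analyticity F \<longleftrightarrow>
     (\<exists>(m::nat) g. entire_of_finite_order g \<and> (\<forall>s. s \<noteq> 1 \<longrightarrow> g s = (s - 1) ^ m * F s))"

definition ramanujan_hypothesis :: "(nat \<Rightarrow> complex) \<Rightarrow> bool" where
  "ramanujan_hypothesis a \<longleftrightarrow>
     (\<forall>\<epsilon>::real. \<epsilon> > 0 \<longrightarrow> (\<lambda>n. norm (a n)) \<in> O(\<lambda>n. real n powr \<epsilon>))"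

text \<open>
  The functional equation is an identity of meromorphic functions; it is required off a sparse
  set because HOL's \<open>Gamma\<close> and \<open>F\<close> take junk values at their poles.
\<close>

definition selberg_functional_equation :: "(complex \<Rightarrow> complex) \<Rightarrow> bool" where
  "selberg_functional_equation F \<longleftrightarrow>
     (\<exists>(\<epsilon>::complex) (Q::real) (k::nat) (w::nat \<Rightarrow> real) (\<mu>::nat \<Rightarrow> complex).
        norm \<epsilon> = 1 \<and> Q > 0 \<and> (\<forall>i<k. w i > 0 \<and> Re (\<mu> i) \<ge> 0) \<and>
        (let \<Phi> = (\<lambda>s. \<epsilon> * of_real Q powr s * (\<Prod>i<k. Gamma (of_real (w i) * s + \<mu> i)) * F s)
         in \<forall>\<^sub>\<approx>s\<in>UNIV. \<Phi> s = cnj (\<Phi> (cnj (1 - s)))))"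

text \<open>
  The equation \<open>log F(s) = \<Sum> b\<^sub>n n\<^sup>-\<^sup>s\<close> is stated by exponentiating. This pins down the
  branch: \<open>b\<^sub>1 = 0\<close>, so the series is the logarithm that tends to 0 as \<open>Re s\<close> tends to infinity.
\<close>

definition selberg_euler_product :: "(nat \<Rightarrow> complex) \<Rightarrow> bool" where
  "selberg_euler_product a \<longleftrightarrow>
     a 1 = 1 \<and>
     (\<exists>b::nat \<Rightarrow> complex.
        (\<forall>n. \<not> primepow n \<longrightarrow> b n = 0) \<and>
        (\<exists>\<theta>::real. \<theta> < 1/2 \<and> (\<lambda>n. norm (b n)) \<in> O(\<lambda>n. real n powr \<theta>)) \<and>
        (\<forall>s. Re s > 1 \<longrightarrow>
           summable (\<lambda>n. b n * of_nat n powr (- s)) \<and>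
           exp (dirichlet_series b s) = dirichlet_series a s))"

definition selberg_class :: "(nat \<Rightarrow> complex) set" where
  "selberg_class =
     {a. a 0 = 0 \<and> ramanujan_hypothesis a \<and> selberg_euler_product a \<and>
         (\<exists>F. continues_series F a \<and> selberg_analyticity F \<and> selberg_functional_equation F)}"

definition series_one :: "nat \<Rightarrow> complex" where
  "series_one = (\<lambda>n. if n = 1 then 1 else 0)"

definition selberg_primitive :: "(nat \<Rightarrow> complex) \<Rightarrow> bool" where
  "selberg_primitive a \<longleftrightarrow>
     a \<in> selberg_class \<and> a \<noteq> series_one \<and>
     (\<forall>b\<in>selberg_class. \<forall>c\<in>selberg_class.
        (\<forall>s. Re s > 1 \<longrightarrow> dirichlet_series a s = dirichlet_series b s * dirichlet_series c s) \<longrightarrow>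
        b = series_one \<or> c = series_one)"

definition dirichlet_character :: "nat \<Rightarrow> (nat \<Rightarrow> complex) \<Rightarrow> bool" where
  "dirichlet_character q chi \<longleftrightarrow>
     q > 0 \<and> (\<forall>n. chi (n + q) = chi n) \<and> (\<forall>m n. chi (m * n) = chi m * chi n) \<and>
     (\<forall>n. chi n \<noteq> 0 \<longleftrightarrow> coprime n q)"

definition primitive_dirichlet_character :: "nat \<Rightarrow> (nat \<Rightarrow> complex) \<Rightarrow> bool" where
  "primitive_dirichlet_character q chi \<longleftrightarrow>
     dirichlet_character q chi \<and>
     \<not> (\<exists>d \<psi>. d dvd q \<and> d < q \<and> dirichlet_character d \<psi> \<and> (\<forall>n. coprime n q \<longrightarrow> chi n = \<psi> n))"

definition twist :: "(nat \<Rightarrow> complex) \<Rightarrow> (nat \<Rightarrow> complex) \<Rightarrow> nat \<Rightarrow> complex" where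
  "twist chi a = (\<lambda>n. a n * chi n)"

text \<open>\<open>selberg_index a n\<close> says that \<open>n\<close> is the integer \<open>n\<^sub>F\<close> attached to \<open>F\<close>; it is unique if it
  exists, because \<open>ln (ln x)\<close> is unbounded.\<close>

definition selberg_index :: "(nat \<Rightarrow> complex) \<Rightarrow> int \<Rightarrow> bool" where
  "selberg_index a n \<longleftrightarrow>
     (\<lambda>x::real. (\<Sum>p | prime p \<and> real p \<le> x. (norm (a p))\<^sup>2 / real p) - of_int n * ln (ln x))
       \<in> O[at_top](\<lambda>_. 1)"

definition selberg_conjecture_A :: bool where
  "selberg_conjecture_A \<longleftrightarrow> (\<forall>a\<in>selberg_class. \<exists>n. selberg_index a n)"

definition selberg_conjecture_B :: bool where
  "selberg_conjecture_B \<longleftrightarrow>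
     (\<forall>a a'. selberg_primitive a \<longrightarrow> selberg_primitive a' \<longrightarrow> a \<noteq> a' \<longrightarrow>
        selberg_index a 1 \<and>
        (\<lambda>x::real. \<Sum>p | prime p \<and> real p \<le> x. a p * cnj (a' p) / of_nat p) \<in> O[at_top](\<lambda>_. 1))"

definition selberg_conjecture_C :: bool where
  "selberg_conjecture_C \<longleftrightarrow>
     (\<forall>q chi a (k::nat) f.
        primitive_dirichlet_character q chi \<longrightarrow>
        a \<in> selberg_class \<longrightarrow> twist chi a \<in> selberg_class \<longrightarrow>
        (\<forall>i<k. selberg_primitive (f i)) \<longrightarrow>
        (\<forall>s. Re s > 1 \<longrightarrow> dirichlet_series a s = (\<Prod>i<k. dirichlet_series (f i) s)) \<longrightarrow>
        (\<forall>s. Re s > 1 \<longrightarrow>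
           dirichlet_series (twist chi a) s = (\<Prod>i<k. dirichlet_series (twist chi (f i)) s)) \<and>
        (\<forall>i<k. selberg_primitive (twist chi (f i))))"

end

theory Submission
  imports Defs "HOL-Real_Asymp.Real_Asymp"
begin

text \<open>
  If \<open>f \<noteq> \<zeta>\<close> is primitive, then orthogonality of \<open>f\<close> and \<open>\<zeta>\<close> says that \<open>\<Sum> f(p)/p\<close> over \<open>p \<le> x\<close>
  is bounded, hence \<open>log f(1 + \<delta>)\<close> stays bounded as \<open>\<delta> \<rightarrow> 0\<close>; so \<open>f\<close> has neither a zero nor a pole
  at 1. As \<open>f\<close> is then entire, \<open>f(s + it)\<close> is again in the Selberg class, it is primitive because it has
  index 1, and the same argument excludes a zero at \<open>1 + it\<close>. For \<open>\<zeta>\<close> itself the classical 3-4-1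
  inequality applies, and a general member of the class is a product of primitive functions.

  This uses that \<open>\<zeta>\<close> lies in the class and has index 1, that index 1 implies primitivity, and that every
  member factors into primitive functions. The factorization terminates because the degree is additive
  and no member except 1 has degree below 1/3: moving the mean value integral of \<open>n\<^sup>s F(s)\<close> far to
  the left then shows that the Dirichlet series converges absolutely everywhere, so by the functional
  equation the degree is 0.
\<close>

section \<open>Dirichlet series\<close>

text \<open>Poles shape the argument. A factor may have one at the point in question, as zeta does
  at 1, so nonvanishing is proved as a positive lower bound for |f(1 + \<delta> + it)| as \<delta>
  \<rightarrow> 0; such bounds multiply, values do not. The class tolerates a pole at 1 only, so the
  pole has to be excluded before a function is shifted. Conjecture (B) yields index 1 only for a
  primitive function that has a different primitive companion. It is silent about a power of a
  single primitive function; there the integrality in (A) decides, since k^2 n = 1 forces k = 1. The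
  bound 1/3 comes from the crude error n^(c+1) / T in the mean value formula. At height T = n^3 this
  error is small, while the left line contributes n^(-A) T^(dA + O(1)) for degree d, which is small
  for large A if 3d < 1. Any positive gap in the degrees makes the factorization terminate. The
  functional equation of zeta comes from one Mellin transform, that of coth (y/2) / 2 - 1/y,
  computed in two ways on a real interval.\<close>

definition abs_conv :: "(nat \<Rightarrow> complex) \<Rightarrow> real \<Rightarrow> bool" where
  "abs_conv a c \<longleftrightarrow> summable (\<lambda>n. norm (a n) * real n powr (-c))"

lemma norm_nat_powr: "norm (of_nat n powr z :: complex) = real n powr Re z"
  by (simp add: norm_powr_real_powr)

lemma norm_dirichlet_term:
  "norm (a n * of_nat n powr (-s) :: complex) = norm (a n) * real n powr (- Re s)"
  by (simp add: norm_mult norm_nat_powr)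

lemma nat_powr_uminus_mono:
  assumes "c \<le> c'"
  shows "real n powr (-c') \<le> real n powr (-c)"
  using assms by (cases "n = 0") (auto intro!: powr_mono)

lemma abs_conv_mono:
  assumes "abs_conv a c" "c \<le> c'"
  shows "abs_conv a c'"
  unfolding abs_conv_def
proof (rule summable_comparison_test'[where N = 0])
  show "summable (\<lambda>n. norm (a n) * real n powr (-c))" using assms by (simp add: abs_conv_def)
qed (use assms in \<open>auto intro!: mult_left_mono nat_powr_uminus_mono\<close>)

lemma abs_conv_powrI:
  assumes "eventually (\<lambda>n. norm (a n) \<le> C * real n powr e) sequentially" "c > e + 1"
  shows "abs_conv a c"
  unfolding abs_conv_def
proof (rule summable_comparison_test_ev)
  show "summable (\<lambda>n. C * real n powr (e - c))"
    using assms(2) by (intro summable_mult) (simp add: summable_real_powr_iff)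
  show "eventually (\<lambda>n. norm (norm (a n) * real n powr - c) \<le> C * real n powr (e - c)) sequentially"
    using assms(1)
  proof eventually_elim
    case (elim n)
    have "norm (a n) * real n powr - c \<le> C * real n powr e * real n powr - c"
      by (intro mult_right_mono elim) auto
    also have "\<dots> = C * real n powr (e - c)" by (simp flip: powr_add)
    finally show ?case by simp
  qed
qed

lemma abs_conv_imp_summable:
  assumes "abs_conv a c" "c \<le> Re s"
  shows "summable (\<lambda>n. norm (a n * of_nat n powr (-s)))"
  using abs_conv_mono[OF assms] unfolding norm_dirichlet_term abs_conv_def .

lemma dirichlet_series_sums:
  assumes "abs_conv a c" "c \<le> Re s"
  shows "(\<lambda>n. a n * of_nat n powr (-s)) sums dirichlet_series a s"
  unfolding dirichlet_series_def
  by (rule summable_sums[OF summable_norm_cancel[OF abs_conv_imp_summable[OF assms]]])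

lemma norm_dirichlet_series_le:
  assumes "abs_conv a c" "c \<le> Re s"
  shows "norm (dirichlet_series a s) \<le> (\<Sum>n. norm (a n) * real n powr (-c))"
proof -
  have "norm (dirichlet_series a s) \<le> (\<Sum>n. norm (a n * of_nat n powr (-s)))"
    unfolding dirichlet_series_def by (rule summable_norm[OF abs_conv_imp_summable[OF assms]])
  also have "\<dots> \<le> (\<Sum>n. norm (a n) * real n powr (-c))"
    using assms abs_conv_imp_summable[OF assms]
    by (intro suminf_le) (auto simp: norm_dirichlet_term abs_conv_def intro!: mult_left_mono nat_powr_uminus_mono)
  finally show ?thesis .
qed

section \<open>Mean values on vertical lines and recovery of coefficients\<close>

lemma norm_integral_exp_le:
  fixes l T T' :: real
  assumes "l \<noteq> 0" "T \<le> T'"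
  shows "norm (integral {T..T'} (\<lambda>t. exp (\<i> * of_real (l * t)))) \<le> 2 / \<bar>l\<bar>"
proof -
  define G where "G = (\<lambda>t::real. exp (\<i> * of_real (l * t)) / (\<i> * of_real l))"
  have "((\<lambda>t. exp (\<i> * of_real (l * t))) has_integral (G T' - G T)) {T..T'}"
  proof (rule fundamental_theorem_of_calculus)
    fix t assume "t \<in> {T..T'}"
    have "((\<lambda>z. exp (\<i> * of_real l * z) / (\<i> * of_real l)) has_field_derivative exp (\<i> * of_real l * of_real t)) (at (of_real t))"
      using assms by (auto intro!: derivative_eq_intros)
    from has_vector_derivative_real_field[OF this]
    show "(G has_vector_derivative exp (\<i> * of_real (l * t))) (at t within {T..T'})"
      by (simp add: G_def mult_ac has_vector_derivative_at_within)
  qed fact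
  hence "norm (integral {T..T'} (\<lambda>t. exp (\<i> * of_real (l * t)))) = norm (G T' - G T)"
    by (simp add: integral_unique)
  also have "\<dots> \<le> norm (G T') + norm (G T)" by (rule norm_triangle_ineq4)
  also have "\<dots> = 2 / \<bar>l\<bar>" by (simp add: G_def norm_divide norm_mult)
  finally show ?thesis .
qed

text \<open>Both cases are ln x \<le> x - 1 applied to a ratio. For m < n it gives 1/n, for m > n it
  gives 1/(n + 1), and 1/(2n) lies below both.\<close>

lemma abs_ln_nat_diff_ge:
  assumes "n \<ge> 1" "m \<ge> 1" "m \<noteq> (n::nat)"
  shows "\<bar>ln (real n) - ln (real m)\<bar> \<ge> 1 / (2 * real n)"
proof -
  have key: "ln (real y) - ln (real x) \<ge> 1 - real x / real y" if "x \<ge> 1" "y \<ge> 1" for x y :: nat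
  proof -
    have "ln (real x / real y) \<le> real x / real y - 1" using that by (intro ln_le_minus_one) auto
    thus ?thesis using that by (simp add: ln_div)
  qed
  show ?thesis
  proof (cases "m < n")
    case True
    have "1 / (2 * real n) \<le> 1 - real m / real n"
      using True by (simp add: field_simps)
    with key[of m n] assms show ?thesis by linarith
  next
    case False
    hence "m \<ge> n + 1" using assms by simp
    hence mm: "real m \<ge> real n + 1" by linarith
    have "1 / (2 * real n) \<le> 1 / (real n + 1)" using assms by (simp add: field_simps)
    also have "\<dots> = 1 - real n / (real n + 1)" by (simp add: field_simps)
    also have "real n / (real n + 1) \<ge> real n / real m" using mm by (intro divide_left_mono) auto
    hence "1 - real n / (real n + 1) \<le> 1 - real n / real m" by simp
    finally show ?thesis using key[of n m] assms by linarith
  qed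
qed

text \<open>On the line, the m-th term of n^s times the series is a constant times a wave of
  frequency ln n - ln m. Only m = n does not oscillate and contributes T times its coefficient.
  Every other term integrates to at most 2 over its frequency, and the spacing of logarithms turns
  this into 4n. The error therefore does not depend on T.\<close>

lemma dirichlet_series_mean_value:
  assumes "abs_conv a c" "n \<ge> 1" "T \<ge> 0"
  shows "norm (integral {T..2*T} (\<lambda>t. of_nat n powr Complex c t * dirichlet_series a (Complex c t)) - of_real T * a n)
           \<le> 4 * (\<Sum>m. norm (a m) * real m powr (-c)) * real n powr (c + 1)"
proof -
  define S where "S = (\<Sum>m. norm (a m) * real m powr (-c))"
  have sm: "summable (\<lambda>m. norm (a m) * real m powr (-c))" using assms by (simp add: abs_conv_def)
  define u where "u = (\<lambda>(m::nat) (t::real). of_nat n powr Complex c t * (a m * of_nat m powr (- Complex c t)))"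
  define C where "C = (\<lambda>m::nat. a m * of_real (real n powr c * real m powr (-c)))"
  define L where "L = (\<lambda>m::nat. ln (real n) - ln (real m))"
  have pw: "(of_nat k :: complex) powr w = of_real (real k powr Re w) * exp (\<i> * of_real (Im w * ln (real k)))"
    if "k \<ge> 1" for k w
  proof -
    have "(of_nat k :: complex) powr w = exp (w * of_real (ln (real k)))"
      using that by (auto simp: powr_def Ln_of_nat)
    also have "w * of_real (ln (real k)) = of_real (Re w * ln (real k)) + \<i> * of_real (Im w * ln (real k))"
      by (simp add: complex_eq_iff)
    finally show ?thesis using that
      by (simp add: powr_def exp_add flip: exp_of_real)
  qed
  have u_eq: "u m t = C m * exp (\<i> * of_real (L m * t))" for m t
  proof (cases "m = 0")
    case True
    thus ?thesis by (simp add: u_def C_def)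
  next
    case False
    thus ?thesis using assms
      by (simp add: u_def C_def L_def pw exp_diff exp_minus divide_inverse algebra_simps powr_minus)
  qed
  have normC: "norm (C m) = real n powr c * (norm (a m) * real m powr (-c))" for m
    by (simp add: C_def norm_mult)
  have sC: "summable (\<lambda>m. norm (C m))" unfolding normC by (intro summable_mult sm)
  have lim: "uniform_limit {T..2*T} (\<lambda>N t. \<Sum>m<N. u m t) (\<lambda>t. \<Sum>m. u m t) sequentially"
    by (rule Weierstrass_m_test[OF _ sC]) (auto simp: u_eq norm_mult)
  have cont: "continuous_on {T..2*T} (\<lambda>t. \<Sum>m<N. u m t)" for N
    unfolding u_eq by (intro continuous_intros)
  obtain I J where IJ: "\<And>N. ((\<lambda>t. \<Sum>m<N. u m t) has_integral I N) {T..2*T}"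
      "((\<lambda>t. \<Sum>m. u m t) has_integral J) {T..2*T}" "I \<longlonglongrightarrow> J"
    using uniform_limit_integral[OF lim cont] by auto
  have J: "integral {T..2*T} (\<lambda>t. of_nat n powr Complex c t * dirichlet_series a (Complex c t)) = J"
  proof (rule integral_unique)
    have "(\<Sum>m. u m t) = of_nat n powr Complex c t * dirichlet_series a (Complex c t)" for t
      unfolding u_def dirichlet_series_def
      by (rule suminf_mult) (use dirichlet_series_sums[OF assms(1), of "Complex c t"] in \<open>auto simp: sums_iff\<close>)
    with IJ(2) show "((\<lambda>t. of_nat n powr Complex c t * dirichlet_series a (Complex c t)) has_integral J) {T..2*T}"
      by simp
  qed
  have int_u: "u m integrable_on {T..2*T}" for m
    unfolding u_eq by (intro integrable_continuous_interval continuous_intros)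
  have diag: "integral {T..2*T} (u n) = of_real T * a n"
  proof -
    have "u n = (\<lambda>t. a n)" using assms by (auto simp: u_eq C_def L_def fun_eq_iff powr_minus)
    thus ?thesis using assms by (simp add: scaleR_conv_of_real)
  qed
  have off: "norm (integral {T..2*T} (u m)) \<le> 4 * real n powr (c + 1) * (norm (a m) * real m powr (-c))"
    if "m \<noteq> n" for m
  proof (cases "m = 0")
    case False
    have Lm: "\<bar>L m\<bar> \<ge> 1 / (2 * real n)" unfolding L_def using assms that False by (intro abs_ln_nat_diff_ge) auto
    have Lpos: "0 < \<bar>L m\<bar>" by (rule less_le_trans[OF _ Lm]) (use assms in auto)
    have "integral {T..2*T} (u m) = C m * integral {T..2*T} (\<lambda>t. exp (\<i> * of_real (L m * t)))"
      unfolding u_eq by (rule integral_mult_right)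
    hence "norm (integral {T..2*T} (u m)) \<le> norm (C m) * (2 / \<bar>L m\<bar>)"
      using Lpos assms norm_integral_exp_le[of "L m" T "2 * T"]
      by (simp only: norm_mult) (intro mult_left_mono, auto)
    also have "2 / \<bar>L m\<bar> \<le> 4 * real n"
      using Lm Lpos assms by (simp add: field_simps)
    hence "norm (C m) * (2 / \<bar>L m\<bar>) \<le> norm (C m) * (4 * real n)" by (intro mult_left_mono) auto
    also have "\<dots> = 4 * real n powr (c + 1) * (norm (a m) * real m powr (-c))"
      using assms by (simp add: normC powr_add mult_ac)
    finally show ?thesis .
  next
    case True
    hence "u m = (\<lambda>t. 0)" by (auto simp: u_eq C_def)
    thus ?thesis by simp
  qed
  \<comment> \<open>The diagonal term must already be present in the partial sum, hence N >
    n.\<close>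
  have bound: "norm (I N - of_real T * a n) \<le> 4 * S * real n powr (c + 1)" if N: "N > n" for N
  proof -
    have "I N = (\<Sum>m<N. integral {T..2*T} (u m))"
      using IJ(1)[of N] integral_sum[of "{..<N}" u "{T..2*T}"] int_u by (simp add: integral_unique)
    also have "\<dots> = of_real T * a n + (\<Sum>m\<in>{..<N}-{n}. integral {T..2*T} (u m))"
      using N by (subst sum.remove[of _ n]) (auto simp: diag)
    finally have "norm (I N - of_real T * a n) = norm (\<Sum>m\<in>{..<N}-{n}. integral {T..2*T} (u m))" by simp
    also have "\<dots> \<le> (\<Sum>m\<in>{..<N}-{n}. 4 * real n powr (c + 1) * (norm (a m) * real m powr (-c)))"
      by (rule order_trans[OF norm_sum], rule sum_mono) (use off in auto)
    also have "\<dots> \<le> (\<Sum>m<N. 4 * real n powr (c + 1) * (norm (a m) * real m powr (-c)))"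
      by (intro sum_mono2) auto
    also have "\<dots> = 4 * real n powr (c + 1) * (\<Sum>m<N. norm (a m) * real m powr (-c))"
      by (simp add: sum_distrib_left)
    also have "\<dots> \<le> 4 * real n powr (c + 1) * S"
      unfolding S_def by (intro mult_left_mono sum_le_suminf sm) auto
    finally show ?thesis by (simp add: mult_ac)
  qed
  have "norm (J - of_real T * a n) \<le> 4 * S * real n powr (c + 1)"
  proof (rule tendsto_upperbound)
    show "(\<lambda>N. norm (I N - of_real T * a n)) \<longlonglongrightarrow> norm (J - of_real T * a n)"
      by (intro tendsto_intros IJ)
    show "eventually (\<lambda>N. norm (I N - of_real T * a n) \<le> 4 * S * real n powr (c + 1)) sequentially"
      using eventually_gt_at_top[of n] by eventually_elim (rule bound)
  qed auto
  thus ?thesis using J by (simp add: S_def)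
qed

text \<open>Divide the mean value formula by T and let T tend to infinity: the error K/T
  disappears.\<close>

lemma dirichlet_coeff_bound:
  assumes "abs_conv a c" "n \<ge> 1" and B: "\<And>t. norm (dirichlet_series a (Complex c t)) \<le> B"
  shows "norm (a n) \<le> B * real n powr c"
proof -
  define K where "K = 4 * (\<Sum>m. norm (a m) * real m powr (-c)) * real n powr (c + 1)"
  have "norm (a n) \<le> B * real n powr c + K / T" if T: "T > 0" for T
  proof -
    define I where "I = integral {T..2*T} (\<lambda>t. of_nat n powr Complex c t * dirichlet_series a (Complex c t))"
    have "norm I \<le> real n powr c * B * (2 * T - T)"
    \<comment> \<open>A non-integrable integrand has integral 0 by convention, so the bound holds in
      that case too and the regularity of the integrand need not be discussed.\<close>
    proof (cases "(\<lambda>t. of_nat n powr Complex c t * dirichlet_series a (Complex c t)) integrable_on {T..2*T}")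
      case True
      have "norm I \<le> (real n powr c * B) * measure lborel (cbox T (2*T))"
        unfolding I_def
      proof (rule has_integral_bound)
        show "0 \<le> real n powr c * B" using order_trans[OF norm_ge_zero B[of 0]] by auto
        show "((\<lambda>t. of_nat n powr Complex c t * dirichlet_series a (Complex c t)) has_integral
                integral {T..2*T} (\<lambda>t. of_nat n powr Complex c t * dirichlet_series a (Complex c t))) (cbox T (2*T))"
          using integrable_integral[OF True] by simp
      qed (use B in \<open>auto simp: norm_mult norm_nat_powr intro!: mult_left_mono\<close>)
      thus ?thesis using T by simp
    next
      case False
      thus ?thesis using T order_trans[OF norm_ge_zero B[of 0]] by (simp add: I_def not_integrable_integral)
    qed
    moreover have "norm (I - of_real T * a n) \<le> K"
      unfolding I_def K_def by (rule dirichlet_series_mean_value) (use assms T in auto)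
    moreover have "norm (of_real T * a n) \<le> norm I + norm (I - of_real T * a n)"
      by norm
    ultimately have "T * norm (a n) \<le> real n powr c * B * T + K" using T by (simp add: norm_mult)
    thus ?thesis using T by (simp add: field_simps)
  qed
  moreover have "((\<lambda>T. B * real n powr c + K / T) \<longlongrightarrow> B * real n powr c + 0) at_top"
    by (intro tendsto_intros tendsto_divide_0[OF tendsto_const] filterlim_at_top_imp_at_infinity filterlim_ident)
  ultimately show ?thesis
    by (intro tendsto_lowerbound[where F = "at_top :: real filter" and f = "\<lambda>T. B * real n powr c + K / T"])
       (auto intro: eventually_mono[OF eventually_gt_at_top[of 0]])
qed

lemma abs_conv_diff:
  assumes "abs_conv a c" "abs_conv b c"
  shows "abs_conv (\<lambda>n. a n - b n) c"
  unfolding abs_conv_def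
proof (rule summable_comparison_test'[where N = 0])
  show "summable (\<lambda>n. norm (a n) * real n powr (-c) + norm (b n) * real n powr (-c))"
    using assms by (intro summable_add) (auto simp: abs_conv_def)
  fix n :: nat
  show "norm (norm (a n - b n) * real n powr - c) \<le> norm (a n) * real n powr (-c) + norm (b n) * real n powr (-c)"
    using norm_triangle_ineq4[of "a n" "b n"]
    by (simp add: distrib_right[symmetric] mult_right_mono del: distrib_right_numeral)
qed

lemma dirichlet_series_diff:
  assumes "abs_conv a c" "abs_conv b c" "c \<le> Re s"
  shows "dirichlet_series (\<lambda>n. a n - b n) s = dirichlet_series a s - dirichlet_series b s"
  using sums_diff[OF dirichlet_series_sums[OF assms(1,3)] dirichlet_series_sums[OF assms(2,3)]]
  by (simp add: sums_iff dirichlet_series_def left_diff_distrib)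

text \<open>The coefficient bound with B = 0, applied to the difference; equality on a single
  vertical line is enough.\<close>

lemma dirichlet_series_unique:
  assumes "abs_conv a c" "abs_conv b c" "n \<ge> 1"
    and "\<And>t. dirichlet_series a (Complex c t) = dirichlet_series b (Complex c t)"
  shows "a n = b n"
  using dirichlet_coeff_bound[OF abs_conv_diff[OF assms(1,2)] assms(3), of 0] assms
  by (auto simp: dirichlet_series_diff)

section \<open>Termwise differentiation\<close>

lemma has_field_derivative_dirichlet_term:
  fixes a :: "nat \<Rightarrow> complex"
  shows
  "((\<lambda>s. a n * of_nat n powr (-s)) has_field_derivative - (a n * of_real (ln (real n)) * of_nat n powr (-s))) (at s)"
proof (cases "n = 0")
  case False
  have "((\<lambda>s. a n * exp (- s * of_real (ln (real n)))) has_field_derivative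
          - (a n * of_real (ln (real n)) * exp (- s * of_real (ln (real n))))) (at s)"
    by (auto intro!: derivative_eq_intros)
  thus ?thesis using False by (simp add: powr_def Ln_of_nat)
qed auto

text \<open>A logarithm costs an arbitrarily small amount of the abscissa, since ln n is eventually
  below n^(c' - c).\<close>

lemma abs_conv_mult_ln:
  assumes "abs_conv a c" "c < c'"
  shows "abs_conv (\<lambda>n. a n * of_real (ln (real n))) c'"
  unfolding abs_conv_def
proof (rule summable_comparison_test_ev)
  show "summable (\<lambda>n. norm (a n) * real n powr (-c))" using assms by (simp add: abs_conv_def)
  have "eventually (\<lambda>x::real. ln x \<le> x powr (c' - c)) at_top"
    using assms(2) by real_asymp
  hence "eventually (\<lambda>n. ln (real n) \<le> real n powr (c' - c)) sequentially"
    by (rule eventually_compose_filterlim[OF _ filterlim_real_sequentially])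
  thus "eventually (\<lambda>n. norm (norm (a n * of_real (ln (real n))) * real n powr - c') \<le> norm (a n) * real n powr - c) sequentially"
    using eventually_gt_at_top[of 0]
  proof eventually_elim
    case (elim n)
    have "norm (a n * of_real (ln (real n))) * real n powr - c' = norm (a n) * (ln (real n) * real n powr - c')"
      using elim by (simp add: norm_mult)
    also have "\<dots> \<le> norm (a n) * (real n powr (c' - c) * real n powr - c')"
      using elim by (intro mult_left_mono mult_right_mono) auto
    also have "\<dots> = norm (a n) * real n powr - c" by (simp flip: powr_add)
    finally show ?case by simp
  qed
qed

lemma has_field_derivative_dirichlet_series:
  assumes "abs_conv a c" "c < Re s"
  shows "(dirichlet_series a has_field_derivative
           - dirichlet_series (\<lambda>n. a n * of_real (ln (real n))) s) (at s)"
proof -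
  \<comment> \<open>A point strictly between: the gap from c to c' pays for the logarithm in the
    derivative, the gap from c' to Re s leaves room for uniform convergence around s.\<close>
  define c' where "c' = (c + Re s) / 2"
  have c': "c < c'" "c' < Re s" using assms by (auto simp: c'_def)
  define S where "S = {z. Re z > c'}"
  have S: "open S" "convex S" "s \<in> S" using c' by (auto simp: S_def open_halfspace_Re_gt convex_halfspace_Re_gt)
  let ?f = "\<lambda>n s. a n * of_nat n powr (-s)"
  let ?f' = "\<lambda>n s. - (a n * of_real (ln (real n)) * of_nat n powr (-s))"
  let ?al = "\<lambda>n. a n * of_real (ln (real n))"
  have al: "abs_conv ?al c'" using assms c' by (intro abs_conv_mult_ln[of a c])
  have ul: "uniform_limit S (\<lambda>N s. \<Sum>n<N. ?f' n s) (\<lambda>s. \<Sum>n. ?f' n s) sequentially"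
  proof (rule Weierstrass_m_test)
    show "summable (\<lambda>n. norm (?al n) * real n powr (-c'))" using al by (simp add: abs_conv_def)
    fix n z assume "z \<in> S"
    thus "norm (?f' n z) \<le> norm (?al n) * real n powr (-c')"
      by (simp add: norm_mult norm_nat_powr S_def) (intro mult_left_mono nat_powr_uminus_mono; simp)
  qed
  have "\<exists>g. \<forall>x\<in>S. (\<lambda>n. ?f n x) sums g x \<and> (g has_field_derivative (\<Sum>n. ?f' n x)) (at x within S)"
  proof (rule has_complex_derivative_series[OF S(2)])
    show "(?f n has_field_derivative ?f' n x) (at x within S)" for n x
      by (rule has_field_derivative_at_within[OF has_field_derivative_dirichlet_term])
    show "\<exists>N. \<forall>n x. N \<le> n \<longrightarrow> x \<in> S \<longrightarrow> norm ((\<Sum>i<n. ?f' i x) - (\<Sum>n. ?f' n x)) \<le> e" if "e > 0" for e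
      using uniform_limitD[OF ul that] unfolding eventually_sequentially dist_norm
      by (meson less_imp_le)
    show "\<exists>x l. x \<in> S \<and> (\<lambda>n. ?f n x) sums l"
      using dirichlet_series_sums[OF assms(1), of s] S(3) assms(2) by (intro exI conjI) auto
  qed
  then obtain g where g: "\<And>x. x \<in> S \<Longrightarrow> (\<lambda>n. ?f n x) sums g x"
    "\<And>x. x \<in> S \<Longrightarrow> (g has_field_derivative (\<Sum>n. ?f' n x)) (at x within S)" by blast
  have geq: "g x = dirichlet_series a x" if "x \<in> S" for x
    using g(1)[OF that] by (simp add: dirichlet_series_def sums_iff)
  have "(g has_field_derivative (\<Sum>n. ?f' n s)) (at s)"
    using g(2)[OF S(3)] at_within_open[OF S(3,1)] by simp
  moreover have "(\<Sum>n. ?f' n s) = - dirichlet_series ?al s"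
    unfolding dirichlet_series_def
    by (rule suminf_minus) (use dirichlet_series_sums[OF al, of s] c' in \<open>auto simp: sums_iff\<close>)
  ultimately show ?thesis
    using has_field_derivative_transform_within_open[of g _ s S "dirichlet_series a"] S geq by auto
qed

lemma holomorphic_dirichlet_series:
  assumes "abs_conv a c"
  shows "dirichlet_series a holomorphic_on {s. Re s > c}"
  unfolding holomorphic_on_open[OF open_halfspace_Re_gt]
  using has_field_derivative_dirichlet_series[OF assms] by auto

section \<open>Dirichlet convolution and the logarithmic derivative\<close>

definition dconv :: "(nat \<Rightarrow> complex) \<Rightarrow> (nat \<Rightarrow> complex) \<Rightarrow> nat \<Rightarrow> complex" where
  "dconv a b n = (\<Sum>d | d dvd n. a d * b (n div d))"

text \<open>The double sum is regrouped by products through the bijection (d, e) \<mapsto> (de, d).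
  Index 0 has to be discarded because infinitely many pairs have product 0; there
  \<open>dconv\<close> is a sum over an infinite set and so equals 0.\<close>

lemma has_sum_dconv:
  fixes x y :: "nat \<Rightarrow> complex"
  assumes x: "summable (\<lambda>n. norm (x n))" and y: "summable (\<lambda>n. norm (y n))" and "x 0 = 0" "y 0 = 0"
  shows "(dconv x y has_sum (suminf x * suminf y)) UNIV"
proof -
  have hx: "(x has_sum suminf x) UNIV" and hy: "(y has_sum suminf y) UNIV"
    using x y by (auto intro!: norm_summable_imp_has_sum summable_sums summable_norm_cancel)
  have ax: "(\<lambda>n. norm (x n)) summable_on UNIV" and ay: "(\<lambda>n. norm (y n)) summable_on UNIV"
    using x y by (auto intro!: summable_nonneg_imp_summable_on)
  have "(\<lambda>z. norm ((\<lambda>(m,n). x m * y n) z)) summable_on UNIV \<times> UNIV"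
    by (rule summable_on_SigmaI[where g = "\<lambda>m. norm (x m) * infsum (\<lambda>n. norm (y n)) UNIV"])
       (auto simp: norm_mult intro!: has_sum_cmult_right summable_on_cmult_left ax has_sum_infsum ay)
  hence "(\<lambda>(m,n). x m * y n) summable_on UNIV \<times> UNIV" by (rule abs_summable_summable)
  hence "((\<lambda>(m,n). x m * y n) has_sum (suminf x * suminf y)) (UNIV \<times> UNIV)"
    by (intro has_sum_SigmaI[where g = "\<lambda>m. x m * suminf y"])
       (auto intro!: has_sum_cmult_right hy has_sum_cmult_left hx)
  also have "?this \<longleftrightarrow> ((\<lambda>(m,n). x m * y n) has_sum (suminf x * suminf y)) ({1..} \<times> {1..})"
    by (rule has_sum_cong_neutral) (use assms(3,4) in \<open>auto simp: Suc_le_eq intro!: Nat.gr0I\<close>)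
  finally have "((\<lambda>(m,n). x m * y n) has_sum (suminf x * suminf y)) ({1..} \<times> {1..})" .
  also have "?this \<longleftrightarrow> ((\<lambda>(n,d). x d * y (n div d)) has_sum (suminf x * suminf y)) (Sigma {1..} (\<lambda>n. {d. d dvd n}))"
    by (rule has_sum_reindex_bij_witness[of _ "\<lambda>(n,d). (d, n div d)" "\<lambda>(d,e). (d*e, d)"])
       (auto simp: Suc_le_eq dvd_div_eq_0_iff dest: dvd_pos_nat intro!: Nat.gr0I)
  finally have "(dconv x y has_sum (suminf x * suminf y)) {1..}"
    by (rule has_sum_SigmaD) (auto simp: dconv_def intro!: has_sum_finiteI)
  also have "?this \<longleftrightarrow> ?thesis"
    by (rule has_sum_cong_neutral) (auto simp: dconv_def not_le)
  finally show ?thesis .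
qed

lemma
  assumes "abs_conv a c" "abs_conv b c"
  shows abs_conv_dconv: "abs_conv (dconv a b) c"
    and dirichlet_series_dconv:
      "c \<le> Re s \<Longrightarrow> dirichlet_series (dconv a b) s = dirichlet_series a s * dirichlet_series b s"
proof -
  have eq: "dconv (\<lambda>n. f n * of_nat n powr w) (\<lambda>n. g n * of_nat n powr w) n = dconv f g n * of_nat n powr w"
    for f g n w
    unfolding dconv_def sum_distrib_right
  proof (rule sum.cong, goal_cases)
    case (2 d)
    have "(of_nat d powr w) * (of_nat (n div d) powr w) = (of_nat n powr w :: complex)"
    proof -
      have "of_nat n = (of_nat d * of_nat (n div d) :: complex)"
        using 2 by (simp flip: of_nat_mult)
      thus ?thesis by (simp add: powr_times_real)
    qed
    thus ?case by (simp add: mult_ac)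
  qed auto
  have sum: "((\<lambda>n. dconv f g n * of_nat n powr (-s)) has_sum (dirichlet_series f s * dirichlet_series g s)) UNIV"
    if "abs_conv f c" "abs_conv g c" "c \<le> Re s" for f g s
    using has_sum_dconv[OF abs_conv_imp_summable[OF that(1,3)] abs_conv_imp_summable[OF that(2,3)]]
    by (simp add: ext[OF eq] dirichlet_series_def)
  \<comment> \<open>The product formula is used first for the nonnegative coefficients |a(n)| and
    |b(n)|. It gives unordered summability, which for complex terms is absolute, and this majorises
    the convolution of a and b.\<close>
  have "abs_conv (dconv (\<lambda>n. of_real (norm (a n))) (\<lambda>n. of_real (norm (b n)))) c" (is "abs_conv ?ab c")
  proof -
    have "(\<lambda>n. ?ab n * of_nat n powr (- of_real c)) summable_on UNIV"
      by (rule has_sum_imp_summable[OF sum]) (use assms in \<open>auto simp: abs_conv_def\<close>)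
    hence "(\<lambda>n. norm (?ab n * of_nat n powr (- of_real c))) summable_on UNIV"
      by (simp add: summable_on_iff_abs_summable_on_complex)
    thus ?thesis
      using norm_dirichlet_term[of ?ab _ "of_real c"] by (simp add: abs_conv_def summable_on_UNIV_nonneg_real_iff)
  qed
  thus "abs_conv (dconv a b) c"
    unfolding abs_conv_def
  proof (rule summable_comparison_test'[where N = 0])
    fix n :: nat
    have "norm (dconv a b n) \<le> (\<Sum>d | d dvd n. norm (a d) * norm (b (n div d)))"
      unfolding dconv_def by (rule order_trans[OF norm_sum]) (simp add: norm_mult)
    also have "\<dots> = norm (of_real (\<Sum>d | d dvd n. norm (a d) * norm (b (n div d))) :: complex)"
      by (subst norm_of_real, subst abs_of_nonneg) (auto intro!: sum_nonneg)
    also have "\<dots> = norm (?ab n)" by (simp add: dconv_def)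
    finally show "norm (norm (dconv a b n) * real n powr - c) \<le> norm (?ab n) * real n powr - c"
      by (simp add: mult_right_mono)
  qed
  show "dirichlet_series (dconv a b) s = dirichlet_series a s * dirichlet_series b s" if "c \<le> Re s"
    using has_sum_imp_sums[OF sum[OF assms that]] by (simp add: dirichlet_series_def sums_iff)
qed

lemma dconv_prime:
  assumes "prime p"
  shows "dconv a b p = a 1 * b p + a p * b 1"
proof -
  have "{d. d dvd p} = {1, p}" using assms by (auto simp: prime_nat_iff)
  thus ?thesis using prime_gt_1_nat[OF assms] by (simp add: dconv_def)
qed

lemma dconv_1: "dconv a b 1 = a 1 * b 1"
  by (simp add: dconv_def)

text \<open>Differentiating exp B = A gives A' = B' A, and coefficients are compared. Euler
  coefficients are read off from a through this recursion.\<close>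

lemma log_derivative_coeffs:
  assumes a: "abs_conv a c" and b: "abs_conv b c"
    and exp: "\<And>s. c < Re s \<Longrightarrow> exp (dirichlet_series b s) = dirichlet_series a s" and "n \<ge> 1"
  shows "a n * of_real (ln (real n)) = dconv (\<lambda>d. b d * of_real (ln (real d))) a n"
proof (rule dirichlet_series_unique)
  let ?L = "\<lambda>a n. a n * complex_of_real (ln (real n))"
  show 1: "abs_conv (?L a) (c + 1)" by (rule abs_conv_mult_ln[OF a]) simp
  have 2: "abs_conv (?L b) (c + 1)" by (rule abs_conv_mult_ln[OF b]) simp
  have a': "abs_conv a (c + 1)" by (rule abs_conv_mono[OF a]) simp
  show "abs_conv (dconv (?L b) a) (c + 1)" by (rule abs_conv_dconv[OF 2 a'])
  fix t
  define s where "s = Complex (c + 1) t"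
  have s: "c < Re s" by (simp add: s_def)
  have "((\<lambda>s. exp (dirichlet_series b s)) has_field_derivative exp (dirichlet_series b s) * - dirichlet_series (?L b) s) (at s)"
    by (rule DERIV_chain2[OF DERIV_exp has_field_derivative_dirichlet_series[OF b s]])
  hence "(dirichlet_series a has_field_derivative exp (dirichlet_series b s) * - dirichlet_series (?L b) s) (at s)"
    by (rule has_field_derivative_transform_within_open[OF _ open_halfspace_Re_gt[of c]]) (use s exp in auto)
  from DERIV_unique[OF this has_field_derivative_dirichlet_series[OF a s]]
  have "dirichlet_series (?L a) s = dirichlet_series (?L b) s * dirichlet_series a s"
    using exp[OF s] by (simp add: mult_ac)
  also have "\<dots> = dirichlet_series (dconv (?L b) a) s"
    by (rule dirichlet_series_dconv[OF 2 a', symmetric]) (simp add: s_def)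
  finally show "dirichlet_series (?L a) (Complex (c+1) t) = dirichlet_series (dconv (?L b) a) (Complex (c+1) t)"
    by (simp add: s_def)
qed fact

section \<open>Ratios of Gamma values\<close>

text \<open>By the Gauss limit the quotient is the infinite product of (x + k) / |x + k + iy| over k
  \<ge> 0, and each factor increases with x. This monotonicity stands in for Stirling's
  formula.\<close>

lemma norm_Gamma_ratio_mono:
  fixes x h y :: real
  assumes "x > 0" "h \<ge> 0"
  shows "norm (Gamma (Complex x y)) / Gamma x \<le> norm (Gamma (Complex (x + h) y)) / Gamma (x + h)"
proof -
  have ser: "(\<lambda>n. norm (Gamma_series (Complex x y) n) / Gamma_series x n) \<longlonglongrightarrow> norm (Gamma (Complex x y)) / Gamma x"
    if "x > 0" for x y :: real
    using that by (intro tendsto_intros Gamma_series_LIMSEQ) (auto simp: Gamma_eq_zero_iff)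
  have ser_eq: "norm (Gamma_series (Complex x y) n) / Gamma_series x n = (\<Prod>k=0..n. (x + real k) / norm (Complex x y + of_nat k))"
    if "x > 0" "n > 0" for x y :: real and n :: nat
  proof -
    have "norm (exp (Complex x y * of_real (ln (real n)))) = exp (x * ln (real n))"
      by simp
    moreover have "pochhammer x (n+1) = (\<Prod>k=0..n. (x + real k))" "pochhammer (Complex x y) (n+1) = (\<Prod>k=0..n. (Complex x y + of_nat k))"
      by (simp_all add: pochhammer_prod atLeastLessThanSuc_atLeastAtMost)
    ultimately show ?thesis
      by (simp add: Gamma_series_def norm_divide norm_mult prod_norm prod_dividef del: of_nat_Suc)
  qed
  have fac: "(x + real k) / norm (Complex x y + of_nat k) \<le> (x + h + real k) / norm (Complex (x + h) y + of_nat k)" for k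
  proof -
    have nz: "norm (Complex u y + of_nat k) > 0" if "u > 0" for u
      using that by (auto simp: complex_eq_iff)
    have "(x + real k)\<^sup>2 \<le> (x + h + real k)\<^sup>2" using assms by (intro power_mono) auto
    hence "(x + real k)\<^sup>2 * y\<^sup>2 \<le> (x + h + real k)\<^sup>2 * y\<^sup>2" by (intro mult_right_mono) auto
    moreover have nm: "(norm (Complex u y + of_nat k))\<^sup>2 = (u + real k)\<^sup>2 + y\<^sup>2" for u
      by (simp add: cmod_power2)
    ultimately have "((x + real k) * norm (Complex (x + h) y + of_nat k))\<^sup>2 \<le> ((x + h + real k) * norm (Complex x y + of_nat k))\<^sup>2"
      unfolding power_mult_distrib nm by (simp only: distrib_left) (simp add: mult.commute)
    hence "(x + real k) * norm (Complex (x + h) y + of_nat k) \<le> (x + h + real k) * norm (Complex x y + of_nat k)"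
      by (rule power2_le_imp_le) (use assms in auto)
    thus ?thesis using nz[of x] nz[of "x + h"] assms by (simp add: field_simps)
  qed
  show ?thesis
  proof (rule tendsto_le[OF _ ser ser])
    show "eventually (\<lambda>n. norm (Gamma_series (Complex x y) n) / Gamma_series x n \<le>
            norm (Gamma_series (Complex (x+h) y) n) / Gamma_series (x+h) n) sequentially"
      using eventually_gt_at_top[of 0]
    proof eventually_elim
      case (elim n)
      show ?case using elim assms fac by (simp add: ser_eq) (intro prod_mono, auto)
    qed
  qed (use assms in auto)
qed

text \<open>In the Gauss limit the numerators agree in modulus, and each denominator factor |z + k|
  is at least Re z + k.\<close>

lemma norm_Gamma_le_Gamma_Re:
  assumes "Re z > 0"
  shows "norm (Gamma z) \<le> Gamma (Re z)"
proof (rule tendsto_le)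
  show "(\<lambda>n. norm (Gamma_series z n)) \<longlonglongrightarrow> norm (Gamma z)" by (intro tendsto_intros Gamma_series_LIMSEQ)
  show "Gamma_series (Re z) \<longlonglongrightarrow> Gamma (Re z)" by (rule Gamma_series_LIMSEQ)
  show "eventually (\<lambda>n. norm (Gamma_series z n) \<le> Gamma_series (Re z) n) sequentially"
    using eventually_gt_at_top[of 0]
  proof eventually_elim
    case (elim n)
    have "pochhammer (Re z) (n+1) \<le> norm (pochhammer z (n+1))"
      unfolding pochhammer_prod prod_norm[symmetric]
    proof (intro prod_mono conjI)
      fix i show "Re z + of_nat i \<le> norm (z + of_nat i)" using complex_Re_le_cmod[of "z + of_nat i"] by simp
    qed (use assms in auto)
    moreover have "pochhammer (Re z) (n+1) > 0" using assms by (intro pochhammer_pos)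
    ultimately show ?case by (simp add: Gamma_series_def norm_divide norm_mult frac_le)
  qed
qed simp

lemma not_nonpos_Ints_Im: "Im z \<noteq> 0 \<Longrightarrow> z \<notin> \<int>\<^sub>\<le>\<^sub>0"
  by (auto elim!: nonpos_Ints_cases)

text \<open>Each factor z + k has modulus at least |Im z|. Conversely, |Im z| \<ge> 1 lets the real
  part be absorbed into a multiple of |Im z|.\<close>

lemma norm_pochhammer_bounds:
  fixes z :: complex
  assumes "\<bar>Im z\<bar> \<ge> 1"
  shows "\<bar>Im z\<bar> ^ n \<le> norm (pochhammer z n)"
    and "norm (pochhammer z n) \<le> (\<bar>Re z\<bar> + real n + 1) ^ n * \<bar>Im z\<bar> ^ n"
proof -
  have "(\<Prod>i=0..<n. \<bar>Im z\<bar>) \<le> (\<Prod>i=0..<n. norm (z + of_nat i))"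
    using abs_Im_le_cmod[of "z + of_nat i" for i] by (intro prod_mono) auto
  thus "\<bar>Im z\<bar> ^ n \<le> norm (pochhammer z n)" by (simp add: pochhammer_prod prod_norm)
  have "(\<Prod>i=0..<n. norm (z + of_nat i)) \<le> (\<Prod>i=0..<n. (\<bar>Re z\<bar> + real n + 1) * \<bar>Im z\<bar>)"
  proof (intro prod_mono conjI)
    fix i assume i: "i \<in> {0..<n}"
    have "norm (z + of_nat i) \<le> \<bar>Re z + real i\<bar> + \<bar>Im z\<bar>" using cmod_le[of "z + of_nat i"] by simp
    also have "\<dots> \<le> (\<bar>Re z\<bar> + real n) * 1 + \<bar>Im z\<bar>" using i by auto
    also have "\<dots> \<le> (\<bar>Re z\<bar> + real n) * \<bar>Im z\<bar> + \<bar>Im z\<bar>" using assms by (intro add_mono mult_left_mono) auto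
    finally show "norm (z + of_nat i) \<le> (\<bar>Re z\<bar> + real n + 1) * \<bar>Im z\<bar>" by (simp add: algebra_simps)
  qed auto
  thus "norm (pochhammer z n) \<le> (\<bar>Re z\<bar> + real n + 1) ^ n * \<bar>Im z\<bar> ^ n"
    by (simp add: pochhammer_prod prod_norm power_mult_distrib)
qed

text \<open>An integer shift multiplies Gamma by a Pochhammer symbol of known size. A real shift h
  is squeezed by monotonicity between the integer shifts by the floor and the ceiling of h, which
  costs at most one power of |y|.\<close>

lemma Gamma_ratio_bounds_pos:
  fixes x h :: real
  assumes "x > 0" "h \<ge> 0"
  shows "\<exists>c>0. \<exists>C>0. \<forall>y. \<bar>y\<bar> \<ge> 1 \<longrightarrow>
           c * \<bar>y\<bar> ^ nat \<lfloor>h\<rfloor> * norm (Gamma (Complex x y)) \<le> norm (Gamma (Complex (x + h) y)) \<and>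
           norm (Gamma (Complex (x + h) y)) \<le> C * \<bar>y\<bar> ^ nat \<lceil>h\<rceil> * norm (Gamma (Complex x y))"
proof -
  define m n where "m = nat \<lfloor>h\<rfloor>" and "n = nat \<lceil>h\<rceil>"
  have m: "real m \<le> h" and n: "h \<le> real n" using assms unfolding m_def n_def by linarith+
  define c C where "c = Gamma (x + h) / Gamma (x + real m)"
    and "C = Gamma (x + h) / Gamma (x + real n) * (\<bar>x\<bar> + real n + 1) ^ n"
  have G: "Gamma u > 0" if "u > 0" for u :: real using that by (rule Gamma_real_pos)
  have pos: "c > 0" "C > 0" using assms m n by (auto simp: c_def C_def intro!: mult_pos_pos divide_pos_pos G)
  have shift: "Gamma (Complex (x + real k) y) = pochhammer (Complex x y) k * Gamma (Complex x y)" if "\<bar>y\<bar> \<ge> 1" for y k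
  proof -
    have "Complex x y \<notin> \<int>\<^sub>\<le>\<^sub>0" using that by (intro not_nonpos_Ints_Im) auto
    hence "pochhammer (Complex x y) k = Gamma (Complex x y + of_nat k) / Gamma (Complex x y)"
      by (rule pochhammer_Gamma)
    moreover have "Complex x y + of_nat k = Complex (x + real k) y" by (simp add: complex_eq_iff)
    ultimately show ?thesis using \<open>Complex x y \<notin> \<int>\<^sub>\<le>\<^sub>0\<close> by (simp add: Gamma_eq_zero_iff)
  qed
  have "c * \<bar>y\<bar> ^ m * norm (Gamma (Complex x y)) \<le> norm (Gamma (Complex (x + h) y)) \<and>
        norm (Gamma (Complex (x + h) y)) \<le> C * \<bar>y\<bar> ^ n * norm (Gamma (Complex x y))" if y: "\<bar>y\<bar> \<ge> 1" for y
  proof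
    have "c * (\<bar>y\<bar> ^ m * norm (Gamma (Complex x y))) \<le> c * norm (Gamma (Complex (x + real m) y))"
      using norm_pochhammer_bounds(1)[of "Complex x y" m] y pos
      by (intro mult_left_mono) (auto simp: shift norm_mult intro!: mult_right_mono)
    also have "\<dots> \<le> norm (Gamma (Complex (x + h) y))"
      using norm_Gamma_ratio_mono[of "x + real m" "h - real m" y] assms m G[of "x + h"] G[of "x + real m"]
      by (simp add: c_def field_simps)
    finally show "c * \<bar>y\<bar> ^ m * norm (Gamma (Complex x y)) \<le> norm (Gamma (Complex (x + h) y))" by (simp add: mult_ac)
    have "norm (Gamma (Complex (x + h) y)) \<le> Gamma (x + h) / Gamma (x + real n) * norm (Gamma (Complex (x + real n) y))"
      using norm_Gamma_ratio_mono[of "x + h" "real n - h" y] assms n G[of "x + h"] G[of "x + real n"]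
      by (simp add: field_simps)
    also have "\<dots> \<le> Gamma (x + h) / Gamma (x + real n) * ((\<bar>x\<bar> + real n + 1) ^ n * \<bar>y\<bar> ^ n * norm (Gamma (Complex x y)))"
      using norm_pochhammer_bounds(2)[of "Complex x y" n] y assms n G[of "x + h"] G[of "x + real n"]
      by (intro mult_left_mono) (auto simp: shift norm_mult intro!: mult_right_mono)
    finally show "norm (Gamma (Complex (x + h) y)) \<le> C * \<bar>y\<bar> ^ n * norm (Gamma (Complex x y))"
      by (simp add: C_def mult_ac)
  qed
  with pos show ?thesis unfolding m_def n_def by blast
qed

text \<open>A shift by N moves x into the right half-plane. Numerator and denominator both change by
  about |y|^N, so this power cancels and only the constants change.\<close>

lemma Gamma_ratio_bounds:
  fixes x h :: real
  assumes "h \<ge> 0"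
  shows "\<exists>c>0. \<exists>C>0. \<forall>y. \<bar>y\<bar> \<ge> 1 \<longrightarrow>
           c * \<bar>y\<bar> ^ nat \<lfloor>h\<rfloor> * norm (Gamma (Complex x y)) \<le> norm (Gamma (Complex (x + h) y)) \<and>
           norm (Gamma (Complex (x + h) y)) \<le> C * \<bar>y\<bar> ^ nat \<lceil>h\<rceil> * norm (Gamma (Complex x y))"
proof -
  obtain N :: nat where N: "real N > -x" using reals_Archimedean2 by blast
  obtain c C where cC: "c > 0" "C > 0" and *: "\<And>y. \<bar>y\<bar> \<ge> 1 \<Longrightarrow>
           c * \<bar>y\<bar> ^ nat \<lfloor>h\<rfloor> * norm (Gamma (Complex (x + real N) y)) \<le> norm (Gamma (Complex (x + real N + h) y)) \<and>
           norm (Gamma (Complex (x + real N + h) y)) \<le> C * \<bar>y\<bar> ^ nat \<lceil>h\<rceil> * norm (Gamma (Complex (x + real N) y))"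
    using Gamma_ratio_bounds_pos[of "x + real N" h] N assms by auto
  define P where "P = (\<lambda>u. (\<bar>u\<bar> + real N + 1) ^ N)"
  have Ppos: "P u > 0" for u unfolding P_def by (intro zero_less_power) auto
  have shift: "norm (Gamma (Complex (u + real N) y)) = norm (pochhammer (Complex u y) N) * norm (Gamma (Complex u y))" if "\<bar>y\<bar> \<ge> 1" for y u
  proof -
    have "Complex u y \<notin> \<int>\<^sub>\<le>\<^sub>0" using that by (intro not_nonpos_Ints_Im) auto
    hence "pochhammer (Complex u y) N = Gamma (Complex u y + of_nat N) / Gamma (Complex u y)"
      by (rule pochhammer_Gamma)
    moreover have "Complex u y + of_nat N = Complex (u + real N) y" by (simp add: complex_eq_iff)
    ultimately show ?thesis using \<open>Complex u y \<notin> \<int>\<^sub>\<le>\<^sub>0\<close> by (simp add: Gamma_eq_zero_iff norm_mult[symmetric])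
  qed
  have poch: "\<bar>y\<bar> ^ N \<le> norm (pochhammer (Complex u y) N)" "norm (pochhammer (Complex u y) N) \<le> P u * \<bar>y\<bar> ^ N"
    if "\<bar>y\<bar> \<ge> 1" for u y using norm_pochhammer_bounds[of "Complex u y" N] that by (auto simp: P_def)
  have "c / P (x + h) * \<bar>y\<bar> ^ nat \<lfloor>h\<rfloor> * norm (Gamma (Complex x y)) \<le> norm (Gamma (Complex (x + h) y)) \<and>
        norm (Gamma (Complex (x + h) y)) \<le> (C * P x) * \<bar>y\<bar> ^ nat \<lceil>h\<rceil> * norm (Gamma (Complex x y))" if y: "\<bar>y\<bar> \<ge> 1" for y
  proof
    have yN: "\<bar>y\<bar> ^ N > 0" using y by (intro zero_less_power) auto
    have "c * \<bar>y\<bar> ^ nat \<lfloor>h\<rfloor> * (\<bar>y\<bar> ^ N * norm (Gamma (Complex x y))) \<le> c * \<bar>y\<bar> ^ nat \<lfloor>h\<rfloor> * norm (Gamma (Complex (x + real N) y))"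
      using poch(1)[OF y, of x] cC by (intro mult_left_mono) (auto simp: shift[OF y] intro!: mult_right_mono)
    also have "\<dots> \<le> norm (Gamma (Complex (x + h + real N) y))" using *[OF y] by (simp add: add_ac)
    also have "\<dots> \<le> P (x + h) * \<bar>y\<bar> ^ N * norm (Gamma (Complex (x + h) y))"
      using poch(2)[OF y, of "x + h"] by (auto simp: shift[OF y] intro!: mult_right_mono)
    finally have "\<bar>y\<bar> ^ N * (c * \<bar>y\<bar> ^ nat \<lfloor>h\<rfloor> * norm (Gamma (Complex x y))) \<le> \<bar>y\<bar> ^ N * (P (x + h) * norm (Gamma (Complex (x + h) y)))"
      by (simp add: mult_ac)
    thus "c / P (x + h) * \<bar>y\<bar> ^ nat \<lfloor>h\<rfloor> * norm (Gamma (Complex x y)) \<le> norm (Gamma (Complex (x + h) y))"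
      using yN Ppos[of "x + h"] by (simp add: field_simps)
    have "\<bar>y\<bar> ^ N * norm (Gamma (Complex (x + h) y)) \<le> norm (Gamma (Complex (x + h + real N) y))"
      using poch(1)[OF y, of "x + h"] by (auto simp: shift[OF y] intro!: mult_right_mono)
    also have "\<dots> \<le> C * \<bar>y\<bar> ^ nat \<lceil>h\<rceil> * norm (Gamma (Complex (x + real N) y))" using *[OF y] by (simp add: add_ac)
    also have "\<dots> \<le> C * \<bar>y\<bar> ^ nat \<lceil>h\<rceil> * (P x * \<bar>y\<bar> ^ N * norm (Gamma (Complex x y)))"
      using poch(2)[OF y, of x] cC by (intro mult_left_mono) (auto simp: shift[OF y] intro!: mult_right_mono)
    finally have "\<bar>y\<bar> ^ N * norm (Gamma (Complex (x + h) y)) \<le> \<bar>y\<bar> ^ N * ((C * P x) * \<bar>y\<bar> ^ nat \<lceil>h\<rceil> * norm (Gamma (Complex x y)))"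
      by (simp add: mult_ac)
    thus "norm (Gamma (Complex (x + h) y)) \<le> (C * P x) * \<bar>y\<bar> ^ nat \<lceil>h\<rceil> * norm (Gamma (Complex x y))"
      using yN by simp
  qed
  moreover have "c / P (x + h) > 0" "C * P x > 0" using cC Ppos by auto
  ultimately show ?thesis by blast
qed

text \<open>The points with real parts -A and 1 + A are exchanged by s \<mapsto> 1 - cnj s and share
  their imaginary part. The two arguments of Gamma therefore differ by the real number w (1 + 2A)
  alone.\<close>

lemma Gamma_factor_ratio_bounds:
  fixes A w :: real and \<mu> :: complex
  assumes "w > 0" "A \<ge> 1"
  shows "\<exists>c>0. \<exists>C>0. \<exists>T\<ge>1. \<forall>t. \<bar>t\<bar> \<ge> T \<longrightarrow>
     Gamma (of_real w * Complex (-A) t + \<mu>) \<noteq> 0 \<and> 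
     Im (of_real w * Complex (-A) t + \<mu>) \<noteq> 0 \<and>
     c * \<bar>t\<bar> powr (w * (1 + 2 * A) - 1) \<le>
       norm (Gamma (of_real w * Complex (1 + A) t + \<mu>)) / norm (Gamma (of_real w * Complex (-A) t + \<mu>)) \<and>
     norm (Gamma (of_real w * Complex (1 + A) t + \<mu>)) / norm (Gamma (of_real w * Complex (-A) t + \<mu>)) \<le>
       C * \<bar>t\<bar> powr (w * (1 + 2 * A) + 1)"
proof -
  define x h where "x = - w * A + Re \<mu>" and "h = w * (1 + 2 * A)"
  have h: "h \<ge> 0" using assms by (simp add: h_def)
  obtain c C where cC: "c > 0" "C > 0" and *: "\<And>y. \<bar>y\<bar> \<ge> 1 \<Longrightarrow>
           c * \<bar>y\<bar> ^ nat \<lfloor>h\<rfloor> * norm (Gamma (Complex x y)) \<le> norm (Gamma (Complex (x + h) y)) \<and>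
           norm (Gamma (Complex (x + h) y)) \<le> C * \<bar>y\<bar> ^ nat \<lceil>h\<rceil> * norm (Gamma (Complex x y))"
    using Gamma_ratio_bounds[OF h, of x] by auto
  \<comment> \<open>Beyond this height |Im \<mu>| is at most half of w |t|, and w |t| is at least 2.
    So the imaginary part y of the arguments satisfies |y| \<ge> 1 and is comparable with w
    |t|.\<close>
  define T where "T = Max {1, 2 * \<bar>Im \<mu>\<bar> / w, 2 / w}"
  have T: "T \<ge> 1" "T \<ge> 2 * \<bar>Im \<mu>\<bar> / w" "T \<ge> 2 / w" by (auto simp: T_def)
  define m n where "m = nat \<lfloor>h\<rfloor>" and "n = nat \<lceil>h\<rceil>"
  have m: "h - 1 \<le> real m" and n: "real n \<le> h + 1" using h unfolding m_def n_def by linarith+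
  show ?thesis
  proof (rule exI[of _ "c * (w/2) ^ m"], intro conjI, goal_cases)
    case 2
    show ?case
    proof (rule exI[of _ "C * (2*w) ^ n"], intro conjI, goal_cases)
      case 2
      show ?case
      proof (rule exI[of _ T], intro conjI allI impI, fact T(1), goal_cases)
        fix t :: real assume t: "T \<le> \<bar>t\<bar>"
        define y where "y = w * t + Im \<mu>"
        have wt: "w * \<bar>t\<bar> \<ge> 2 * \<bar>Im \<mu>\<bar>" "w * \<bar>t\<bar> \<ge> 2" "\<bar>t\<bar> \<ge> 1"
          using mult_left_mono[OF t, of w] mult_left_mono[OF T(2), of w] mult_left_mono[OF T(3), of w] t T(1) assms
          by (auto intro: order_trans[OF _ mult_left_mono[OF t, of w]])
        have absw: "\<bar>w * t\<bar> = w * \<bar>t\<bar>" using assms by (simp add: abs_mult)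
        have y: "w / 2 * \<bar>t\<bar> \<le> \<bar>y\<bar>" "\<bar>y\<bar> \<le> 2 * w * \<bar>t\<bar>" "\<bar>y\<bar> \<ge> 1"
          using wt absw unfolding y_def by linarith+
        have e1: "of_real w * Complex (-A) t + \<mu> = Complex x y" and e2: "of_real w * Complex (1 + A) t + \<mu> = Complex (x + h) y"
          by (auto simp: complex_eq_iff x_def y_def h_def algebra_simps)
        have nI: "Complex x y \<notin> \<int>\<^sub>\<le>\<^sub>0" using y by (intro not_nonpos_Ints_Im) auto
        show g0: "Gamma (of_real w * Complex (-A) t + \<mu>) \<noteq> 0" unfolding e1 using nI by (simp add: Gamma_eq_zero_iff)
        hence gp: "norm (Gamma (Complex x y)) > 0" unfolding e1 by simp
        show "Im (of_real w * Complex (-A) t + \<mu>) \<noteq> 0" unfolding e1 using y by auto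
        have "c * (w/2) ^ m * \<bar>t\<bar> powr (w * (1 + 2 * A) - 1) \<le> c * ((w/2) ^ m * \<bar>t\<bar> powr real m)"
          unfolding mult.assoc using m wt cC assms by (intro mult_left_mono powr_mono) (auto simp: h_def)
        also have "(w/2) ^ m * \<bar>t\<bar> powr real m = (w / 2 * \<bar>t\<bar>) ^ m"
          using wt by (simp add: powr_realpow power_mult_distrib power_divide)
        also have "c * (w / 2 * \<bar>t\<bar>) ^ m \<le> c * \<bar>y\<bar> ^ m" using y cC assms by (intro mult_left_mono power_mono) auto
        also have "\<dots> \<le> norm (Gamma (Complex (x + h) y)) / norm (Gamma (Complex x y))"
          using *[OF y(3)] gp by (simp add: field_simps m_def)
        finally show "c * (w/2) ^ m * \<bar>t\<bar> powr (w * (1 + 2 * A) - 1) \<le>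
           norm (Gamma (of_real w * Complex (1 + A) t + \<mu>)) / norm (Gamma (of_real w * Complex (-A) t + \<mu>))"
          unfolding e1 e2 .
        have "norm (Gamma (Complex (x + h) y)) / norm (Gamma (Complex x y)) \<le> C * \<bar>y\<bar> ^ n"
          using *[OF y(3)] gp by (simp add: field_simps n_def)
        also have "\<dots> \<le> C * (2 * w * \<bar>t\<bar>) ^ n" using y cC assms by (intro mult_left_mono power_mono) auto
        also have "(2 * w * \<bar>t\<bar>) ^ n = (2*w) ^ n * \<bar>t\<bar> powr real n" 
          using wt by (simp add: powr_realpow power_mult_distrib)
        also have "C * \<dots> \<le> C * ((2*w) ^ n * \<bar>t\<bar> powr (w * (1 + 2 * A) + 1))"
          using n wt cC assms by (intro mult_left_mono powr_mono) (auto simp: h_def)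
        finally show "norm (Gamma (of_real w * Complex (1 + A) t + \<mu>)) / norm (Gamma (of_real w * Complex (-A) t + \<mu>)) \<le>
          C * (2*w) ^ n * \<bar>t\<bar> powr (w * (1 + 2 * A) + 1)"
          unfolding e1 e2 by (simp add: mult_ac)
      qed
    qed (use cC assms in auto)
  qed (use cC assms in auto)
qed

section \<open>Convexity bounds in vertical strips\<close>

text \<open>The multiplier \<open>exp (-\<delta> cos (\<eta> s))\<close> decays doubly exponentially along the strip, so it kills
  every function of finite order.\<close>

lemma phragmen_lindelof_strip:
  fixes f :: "complex \<Rightarrow> complex" and \<alpha> \<beta> \<rho> M R :: real
  assumes ab: "\<alpha> < \<beta>" and cont: "continuous_on {s. \<alpha> \<le> Re s \<and> Re s \<le> \<beta>} f"
    and hol: "f holomorphic_on {s. \<alpha> < Re s \<and> Re s < \<beta>}"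
    and growth: "\<And>s. \<alpha> \<le> Re s \<Longrightarrow> Re s \<le> \<beta> \<Longrightarrow> norm s \<ge> R \<Longrightarrow> norm (f s) \<le> exp (norm s powr \<rho>)"
    and \<rho>: "\<rho> > 0" and M: "M > 0"
    and bd: "\<And>s. Re s = \<alpha> \<or> Re s = \<beta> \<Longrightarrow> norm (f s) \<le> M"
    and s: "\<alpha> \<le> Re s" "Re s \<le> \<beta>"
  shows "norm (f s) \<le> M"
proof -
  \<comment> \<open>Centring at the middle of the strip and scaling by its width keeps the real part
    of the argument of the cosine within [-1/2, 1/2], well inside the range where the cosine is at
    least 1/2.\<close>
  define m \<eta> K where "m = (\<alpha> + \<beta>) / 2" and "\<eta> = 1 / (\<beta> - \<alpha>)" and "K = \<bar>\<alpha>\<bar> + \<bar>\<beta>\<bar>"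
  have \<eta>: "\<eta> > 0" using ab by (simp add: \<eta>_def)
  define E where "E = (\<lambda>s::complex. cos (of_real \<eta> * (s - of_real m)))"
  have ReE: "Re (E z) = cos (\<eta> * (Re z - m)) * cosh (\<eta> * Im z)" for z
    by (simp add: E_def Re_cos cosh_def exp_minus field_simps)
  have cosge: "cos (\<eta> * (x - m)) \<ge> 1/2" if "\<alpha> \<le> x" "x \<le> \<beta>" for x
  proof -
    have "\<bar>x - m\<bar> \<le> (\<beta> - \<alpha>) / 2" using that unfolding m_def by (auto simp: abs_le_iff field_simps)
    hence "\<bar>\<eta> * (x - m)\<bar> \<le> \<eta> * ((\<beta> - \<alpha>) / 2)" using \<eta> by (simp add: abs_mult)
    also have "\<dots> = 1/2" using ab by (simp add: \<eta>_def)
    also have "\<dots> \<le> pi / 3" using pi_gt3 by simp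
    finally have "cos (pi / 3) \<le> cos \<bar>\<eta> * (x - m)\<bar>"
      using pi_gt3 by (intro cos_monotone_0_pi_le) auto
    thus ?thesis by (simp add: cos_60)
  qed
  have expE: "norm (exp (- of_real \<delta> * E z)) \<le> exp (- (\<delta> / 4) * exp (\<eta> * \<bar>Im z\<bar>))"
    if "\<delta> > 0" "\<alpha> \<le> Re z" "Re z \<le> \<beta>" for \<delta> z
  proof -
    have "cosh (\<eta> * Im z) = cosh (\<eta> * \<bar>Im z\<bar>)" by (cases "Im z \<ge> 0") auto
    also have "\<dots> \<ge> exp (\<eta> * \<bar>Im z\<bar>) / 2" by (simp add: cosh_def)
    finally have ch: "cosh (\<eta> * Im z) \<ge> exp (\<eta> * \<bar>Im z\<bar>) / 2" .
    have "1/2 * (exp (\<eta> * \<bar>Im z\<bar>) / 2) \<le> cos (\<eta> * (Re z - m)) * cosh (\<eta> * Im z)"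
      by (intro mult_mono ch cosge that) (use cosge[OF that(2,3)] in auto)
    hence "\<delta> * (exp (\<eta> * \<bar>Im z\<bar>) / 4) \<le> \<delta> * Re (E z)" unfolding ReE using that by (intro mult_left_mono) auto
    thus ?thesis by simp
  qed
  have main: "norm (f s) * norm (exp (- of_real \<delta> * E s)) \<le> M" if d: "\<delta> > 0" for \<delta>
  proof -
    \<comment> \<open>K bounds |Re s| in the strip, so |s| \<le> t + K on the horizontal side at
      height t. The power of t + K loses against exp (\<eta> t), which makes the horizontal sides of
      tall rectangles harmless.\<close>
    have "((\<lambda>t::real. (t + K) powr \<rho> / exp (\<eta> * t)) \<longlongrightarrow> 0) at_top"
      using \<eta> by real_asymp
    hence "eventually (\<lambda>t::real. (t + K) powr \<rho> / exp (\<eta> * t) < \<delta> / 8) at_top"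
      by (rule order_tendstoD) (use d in auto)
    hence ev: "eventually (\<lambda>t::real. exp ((t + K) powr \<rho>) * exp (- (\<delta> / 4) * exp (\<eta> * t)) \<le> exp (- (\<delta> / 8) * exp (\<eta> * t))) at_top"
      by eventually_elim (auto simp: field_simps simp flip: exp_add)
    have "((\<lambda>t::real. exp (- (\<delta> / 8) * exp (\<eta> * t))) \<longlongrightarrow> 0) at_top"
      using d \<eta> by real_asymp
    hence "((\<lambda>t::real. exp ((t + K) powr \<rho>) * exp (- (\<delta> / 4) * exp (\<eta> * t))) \<longlongrightarrow> 0) at_top"
      by (rule Lim_null_comparison[rotated]) (use ev in \<open>auto simp: norm_mult\<close>)
    hence "eventually (\<lambda>t. exp ((t + K) powr \<rho>) * exp (- (\<delta> / 4) * exp (\<eta> * t)) < M) at_top"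
      by (rule order_tendstoD) fact
    moreover have "eventually (\<lambda>t::real. t \<ge> \<bar>R\<bar> \<and> t > \<bar>Im s\<bar>) at_top"
      by (intro eventually_conj eventually_ge_at_top eventually_gt_at_top)
    ultimately have "eventually (\<lambda>t::real. exp ((t + K) powr \<rho>) * exp (- (\<delta> / 4) * exp (\<eta> * t)) < M \<and> t \<ge> \<bar>R\<bar> \<and> t > \<bar>Im s\<bar>) at_top"
      by eventually_elim auto
    then obtain T where T: "exp ((T + K) powr \<rho>) * exp (- (\<delta> / 4) * exp (\<eta> * T)) < M" "T \<ge> \<bar>R\<bar>" "T > \<bar>Im s\<bar>"
      using eventually_happens[of _ "at_top :: real filter"] by force
    define g where "g = (\<lambda>z. f z * exp (- of_real \<delta> * E z))"
    define S where "S = cbox (Complex \<alpha> (-T)) (Complex \<beta> T)"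
    have Ssub: "S \<subseteq> {s. \<alpha> \<le> Re s \<and> Re s \<le> \<beta>}" by (auto simp: S_def in_cbox_complex_iff)
    have "norm (g s) \<le> M"
    proof (rule maximum_modulus_frontier[of g S])
      show "g holomorphic_on interior S"
        unfolding g_def E_def
        by (intro holomorphic_intros holomorphic_on_subset[OF hol]) (auto simp: S_def in_box_complex_iff interior_cbox)
      show "continuous_on (closure S) g"
        unfolding g_def E_def
        by (intro continuous_intros continuous_on_subset[OF cont]) (use Ssub in \<open>auto simp: S_def\<close>)
      show "bounded S" by (simp add: S_def)
      show "s \<in> S" using s T by (auto simp: S_def in_cbox_complex_iff)
      fix z assume "z \<in> frontier S"
      hence z: "\<alpha> \<le> Re z" "Re z \<le> \<beta>" "\<bar>Im z\<bar> \<le> T" "Re z = \<alpha> \<or> Re z = \<beta> \<or> \<bar>Im z\<bar> = T"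
        by (auto simp: S_def frontier_def interior_cbox in_cbox_complex_iff in_box_complex_iff)
      have le1: "norm (exp (- of_real \<delta> * E z)) \<le> 1"
        using expE[OF d z(1,2)] by (rule order_trans) (use d in simp)
      show "norm (g z) \<le> M"
      proof (cases "Re z = \<alpha> \<or> Re z = \<beta>")
        case True
        hence "norm (f z) * norm (exp (- of_real \<delta> * E z)) \<le> M * 1"
          using bd le1 M by (intro mult_mono) auto
        thus ?thesis by (simp add: g_def norm_mult)
      next
        case False
        hence ImT: "\<bar>Im z\<bar> = T" using z by auto
        have nz: "norm z \<le> T + K" using cmod_le[of z] ImT z by (simp add: K_def)
        have "norm z \<ge> R" using abs_Im_le_cmod[of z] ImT T by linarith
        hence "norm (f z) \<le> exp (norm z powr \<rho>)" by (intro growth z)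
        also have "\<dots> \<le> exp ((T + K) powr \<rho>)" using nz \<rho> by (simp add: powr_mono2)
        finally have "norm (f z) * norm (exp (- of_real \<delta> * E z)) \<le> exp ((T + K) powr \<rho>) * exp (- (\<delta> / 4) * exp (\<eta> * T))"
          using expE[OF d z(1,2)] ImT by (intro mult_mono) auto
        thus ?thesis using T(1) by (simp add: g_def norm_mult)
      qed
    qed
    thus ?thesis by (simp add: g_def norm_mult)
  qed
  \<comment> \<open>At the fixed point s the multiplier tends to 1 as \<delta> \<rightarrow>
    0.\<close>
  have "((\<lambda>\<delta>. norm (f s) * norm (exp (- of_real \<delta> * E s))) \<longlongrightarrow> norm (f s) * norm (exp (- of_real 0 * E s))) (at_right 0)"
    by (intro tendsto_intros)
  hence "((\<lambda>\<delta>. norm (f s) * norm (exp (- of_real \<delta> * E s))) \<longlongrightarrow> norm (f s)) (at_right 0)" by simp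
  thus ?thesis
  proof (rule tendsto_upperbound)
    show "eventually (\<lambda>\<delta>. norm (f s) * norm (exp (- of_real \<delta> * E s)) \<le> M) (at_right 0)"
      using eventually_at_right_less[of 0] by (rule eventually_mono) (rule main)
  qed simp
qed

section \<open>Functional equation and degree\<close>

definition gamma_factor :: "complex \<Rightarrow> real \<Rightarrow> nat \<Rightarrow> (nat \<Rightarrow> real) \<Rightarrow> (nat \<Rightarrow> complex) \<Rightarrow> complex \<Rightarrow> complex" where
  "gamma_factor \<epsilon> Q k w \<mu> s = \<epsilon> * of_real Q powr s * (\<Prod>i<k. Gamma (of_real (w i) * s + \<mu> i))"

text \<open>The axiom with its data exposed, so that the weights w can be summed to a
  degree.\<close>

definition functional_equation_with ::
    "(complex \<Rightarrow> complex) \<Rightarrow> complex \<Rightarrow> real \<Rightarrow> nat \<Rightarrow> (nat \<Rightarrow> real) \<Rightarrow> (nat \<Rightarrow> complex) \<Rightarrow> bool" where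
  "functional_equation_with F \<epsilon> Q k w \<mu> \<longleftrightarrow>
     norm \<epsilon> = 1 \<and> Q > 0 \<and> (\<forall>i<k. w i > 0 \<and> Re (\<mu> i) \<ge> 0) \<and>
     (\<forall>\<^sub>\<approx>s\<in>UNIV. gamma_factor \<epsilon> Q k w \<mu> s * F s = cnj (gamma_factor \<epsilon> Q k w \<mu> (cnj (1 - s)) * F (cnj (1 - s))))"

lemma selberg_functional_equation_iff:
  "selberg_functional_equation F \<longleftrightarrow> (\<exists>\<epsilon> Q k w \<mu>. functional_equation_with F \<epsilon> Q k w \<mu>)"
  by (simp add: selberg_functional_equation_def functional_equation_with_def gamma_factor_def Let_def)

definition selberg_function :: "(nat \<Rightarrow> complex) \<Rightarrow> (complex \<Rightarrow> complex) \<Rightarrow> bool" where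
  "selberg_function a F \<longleftrightarrow> continues_series F a \<and> selberg_analyticity F \<and> selberg_functional_equation F"

lemma selberg_classE:
  assumes "a \<in> selberg_class"
  obtains F where "selberg_function a F"
  using assms by (auto simp: selberg_class_def selberg_function_def)

lemma selberg_class_0: "a \<in> selberg_class \<Longrightarrow> a 0 = 0"
  and selberg_class_1: "a \<in> selberg_class \<Longrightarrow> a (Suc 0) = 1"
  by (auto simp: selberg_class_def selberg_euler_product_def)

section \<open>Consequences of the axioms in the half-plane of convergence\<close>

lemma ramanujan_abs_conv:
  assumes "ramanujan_hypothesis a" "c > 1"
  shows "abs_conv a c"
proof -
  have "(\<lambda>n. norm (a n)) \<in> O(\<lambda>n. real n powr ((c - 1) / 2))"
    using assms by (auto simp: ramanujan_hypothesis_def)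
  then obtain C where "eventually (\<lambda>n. norm (norm (a n)) \<le> C * norm (real n powr ((c - 1) / 2))) sequentially"
    by (elim landau_o.bigE)
  thus ?thesis by (intro abs_conv_powrI[of a C "(c-1)/2"]) (use assms in \<open>auto elim: eventually_mono simp: field_simps\<close>)
qed

lemma selberg_abs_conv: "a \<in> selberg_class \<Longrightarrow> c > 1 \<Longrightarrow> abs_conv a c"
  by (rule ramanujan_abs_conv) (auto simp: selberg_class_def)

lemma selberg_function_eq: "selberg_function a F \<Longrightarrow> Re s > 1 \<Longrightarrow> F s = dirichlet_series a s"
  by (auto simp: selberg_function_def continues_series_def)

lemma selberg_functionE:
  assumes "selberg_function a F"
  obtains m g where "g holomorphic_on UNIV" "entire_of_finite_order g" "\<And>s. s \<noteq> 1 \<Longrightarrow> g s = (s - 1) ^ m * F s"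
  using assms by (auto simp: selberg_function_def selberg_analyticity_def entire_of_finite_order_def)

lemma selberg_function_holomorphic:
  assumes "selberg_function a F"
  shows "F holomorphic_on -{1}"
proof -
  obtain m g where g: "g holomorphic_on UNIV" "\<And>s. s \<noteq> 1 \<Longrightarrow> g s = (s - 1) ^ m * F s"
    using selberg_functionE[OF assms] by metis
  have "(\<lambda>s. g s / (s - 1) ^ m) holomorphic_on -{1}"
    by (intro holomorphic_intros holomorphic_on_subset[OF g(1)]) auto
  thus ?thesis by (rule holomorphic_transform) (auto simp: g)
qed

lemma selberg_function_isCont: "selberg_function a F \<Longrightarrow> s \<noteq> 1 \<Longrightarrow> isCont F s"
  using holomorphic_on_imp_continuous_on[OF selberg_function_holomorphic, of a F]
  by (subst (asm) continuous_on_eq_continuous_at) auto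

text \<open>Besides unpacking the axiom, this records that \<theta> < 1/2 makes the logarithm
  converge absolutely at 3/2.\<close>

lemma euler_product_logE:
  assumes "a \<in> selberg_class"
  obtains b \<theta> where "\<And>n. \<not> primepow n \<Longrightarrow> b n = 0" "\<theta> < 1/2"
    "(\<lambda>n. norm (b n)) \<in> O(\<lambda>n. real n powr \<theta>)"
    "\<And>s. Re s > 1 \<Longrightarrow> exp (dirichlet_series b s) = dirichlet_series a s"
    "abs_conv b (3/2)"
proof -
  obtain b \<theta> where b: "\<And>n. \<not> primepow n \<Longrightarrow> b n = 0" "\<theta> < 1/2"
    "(\<lambda>n. norm (b n)) \<in> O(\<lambda>n. real n powr \<theta>)"
    "\<And>s. Re s > 1 \<Longrightarrow> exp (dirichlet_series b s) = dirichlet_series a s"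
    using assms by (auto simp: selberg_class_def selberg_euler_product_def)
  obtain C where "eventually (\<lambda>n. norm (norm (b n)) \<le> C * norm (real n powr \<theta>)) sequentially"
    using b(3) by (elim landau_o.bigE)
  hence "abs_conv b (3/2)"
    by (intro abs_conv_powrI[of b C \<theta>]) (use b(2) in \<open>auto elim: eventually_mono\<close>)
  with b show ?thesis by (intro that)
qed

text \<open>The lower bound is the point: F is the exponential of a series that is bounded for Re s
  \<ge> 2.\<close>

lemma selberg_bounds_right:
  assumes "a \<in> selberg_class"
  shows "\<exists>c>0. \<exists>C>0. \<forall>s. Re s \<ge> 2 \<longrightarrow> c \<le> norm (dirichlet_series a s) \<and> norm (dirichlet_series a s) \<le> C"
proof -
  obtain b where b: "\<And>s. Re s > 1 \<Longrightarrow> exp (dirichlet_series b s) = dirichlet_series a s" "abs_conv b (3/2)"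
    using euler_product_logE[OF assms] by metis
  define B where "B = (\<Sum>n. norm (b n) * real n powr (-(3/2)))"
  have "exp (-B) \<le> norm (dirichlet_series a s) \<and> norm (dirichlet_series a s) \<le> exp B" if "Re s \<ge> 2" for s
  proof -
    have "norm (dirichlet_series b s) \<le> B"
      unfolding B_def by (rule norm_dirichlet_series_le[OF b(2)]) (use that in auto)
    hence "\<bar>Re (dirichlet_series b s)\<bar> \<le> B" using abs_Re_le_cmod order_trans by blast
    moreover have "norm (dirichlet_series a s) = exp (Re (dirichlet_series b s))"
      using that by (simp flip: b(1))
    ultimately show ?thesis by auto
  qed
  thus ?thesis by (intro exI[of _ "exp (-B)"] conjI exI[of _ "exp B"]) auto
qed

text \<open>The identity holds on a punctured neighbourhood of s, and both sides are continuous at s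
  once the poles are avoided. The condition s \<noteq> 0 keeps the reflected point away from
  1.\<close>

lemma functional_equation_at:
  assumes F: "F holomorphic_on -{1}" and fe: "functional_equation_with F \<epsilon> Q k w \<mu>"
    and s: "s \<noteq> 1" "s \<noteq> 0"
    and G: "\<And>i. i < k \<Longrightarrow> of_real (w i) * s + \<mu> i \<notin> \<int>\<^sub>\<le>\<^sub>0" "\<And>i. i < k \<Longrightarrow> of_real (w i) * cnj (1 - s) + \<mu> i \<notin> \<int>\<^sub>\<le>\<^sub>0"
  shows "gamma_factor \<epsilon> Q k w \<mu> s * F s = cnj (gamma_factor \<epsilon> Q k w \<mu> (cnj (1 - s)) * F (cnj (1 - s)))"
proof -
  define \<Phi> where "\<Phi> = (\<lambda>s. gamma_factor \<epsilon> Q k w \<mu> s * F s)"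
  have Q: "Q > 0" using fe by (simp add: functional_equation_with_def)
  have cont: "isCont \<Phi> z" if "z \<noteq> 1" and z: "\<And>i. i < k \<Longrightarrow> of_real (w i) * z + \<mu> i \<notin> \<int>\<^sub>\<le>\<^sub>0" for z
  proof -
    have 1: "isCont F z"
      using holomorphic_on_imp_continuous_on[OF F] that
      by (subst (asm) continuous_on_eq_continuous_at) auto
    have "isCont (\<lambda>s. Gamma (of_real (w i) * s + \<mu> i)) z" if "i < k" for i
      using z[OF that] by (intro continuous_intros) auto
    hence 2: "isCont (\<lambda>s. \<Prod>i<k. Gamma (of_real (w i) * s + \<mu> i)) z" by (intro continuous_prod) auto
    have 3: "isCont (\<lambda>s. \<epsilon> * of_real Q powr s) z" using Q by (intro continuous_intros) auto
    show ?thesis unfolding \<Phi>_def gamma_factor_def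
      by (rule isCont_mult[OF isCont_mult[OF 3 2] 1])
  qed
  have "\<forall>\<^sub>\<approx>s\<in>UNIV. \<Phi> s = cnj (\<Phi> (cnj (1 - s)))"
    using fe unfolding functional_equation_with_def \<Phi>_def by blast
  hence ev: "eventually (\<lambda>s. \<Phi> s = cnj (\<Phi> (cnj (1 - s)))) (at s)"
    by (rule eventually_cosparse_imp_eventually_at) simp
  have "isCont \<Phi> s" by (rule cont) (use s G in auto)
  hence lim: "(\<Phi> \<longlongrightarrow> \<Phi> s) (at s)" by (simp add: isCont_def)
  have s': "cnj (1 - s) \<noteq> 1"
  proof
    assume "cnj (1 - s) = 1"
    hence "cnj (cnj (1 - s)) = cnj 1" by (rule arg_cong)
    thus False using s by simp
  qed
  have cont': "isCont \<Phi> (cnj (1 - s))" by (rule cont[OF s' G(2)])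
  have "((\<lambda>s. cnj (1 - s)) \<longlongrightarrow> cnj (1 - s)) (at s)" by (intro tendsto_intros)
  from tendsto_cnj[OF isCont_tendsto_compose[OF cont' this]]
  have "(\<Phi> \<longlongrightarrow> cnj (\<Phi> (cnj (1 - s)))) (at s)" by (rule tendsto_cong[OF ev, THEN iffD2])
  hence "\<Phi> s = cnj (\<Phi> (cnj (1 - s)))" by (rule tendsto_unique[OF at_neq_bot lim])
  thus ?thesis by (simp add: \<Phi>_def)
qed

section \<open>Growth on lines far to the left\<close>

lemma Gamma_factors_ratio_bounds:
  fixes w :: "nat \<Rightarrow> real" and \<mu> :: "nat \<Rightarrow> complex"
  assumes "\<And>i. i < k \<Longrightarrow> w i > 0" "A \<ge> 1"
  shows "\<exists>c>0. \<exists>C>0. \<exists>T\<ge>1. \<forall>t. \<bar>t\<bar> \<ge> T \<longrightarrow>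
     (\<forall>i<k. Gamma (of_real (w i) * Complex (-A) t + \<mu> i) \<noteq> 0 \<and> Im (of_real (w i) * Complex (-A) t + \<mu> i) \<noteq> 0) \<and>
     c * \<bar>t\<bar> powr ((\<Sum>i<k. w i) * (1 + 2 * A) - real k) \<le>
       (\<Prod>i<k. norm (Gamma (of_real (w i) * Complex (1 + A) t + \<mu> i)) / norm (Gamma (of_real (w i) * Complex (-A) t + \<mu> i))) \<and>
     (\<Prod>i<k. norm (Gamma (of_real (w i) * Complex (1 + A) t + \<mu> i)) / norm (Gamma (of_real (w i) * Complex (-A) t + \<mu> i))) \<le>
       C * \<bar>t\<bar> powr ((\<Sum>i<k. w i) * (1 + 2 * A) + real k)"
  using assms(1)
proof (induction k)
  case 0
  show ?case by (intro exI[of _ 1] conjI) auto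
next
  case (Suc k)
  define r where "r = (\<lambda>i t. norm (Gamma (of_real (w i) * Complex (1 + A) t + \<mu> i)) / norm (Gamma (of_real (w i) * Complex (-A) t + \<mu> i)))"
  have r0: "r i t \<ge> 0" for i t by (simp add: r_def)
  obtain c1 C1 T1 where 1: "c1 > 0" "C1 > 0" "T1 \<ge> 1" "\<And>t. \<bar>t\<bar> \<ge> T1 \<Longrightarrow>
     (\<forall>i<k. Gamma (of_real (w i) * Complex (-A) t + \<mu> i) \<noteq> 0 \<and> Im (of_real (w i) * Complex (-A) t + \<mu> i) \<noteq> 0) \<and>
     c1 * \<bar>t\<bar> powr ((\<Sum>i<k. w i) * (1 + 2 * A) - real k) \<le> (\<Prod>i<k. r i t) \<and>
     (\<Prod>i<k. r i t) \<le> C1 * \<bar>t\<bar> powr ((\<Sum>i<k. w i) * (1 + 2 * A) + real k)"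
    using Suc.IH[OF Suc.prems] unfolding r_def by fastforce
  obtain c2 C2 T2 where 2: "c2 > 0" "C2 > 0" "T2 \<ge> 1" "\<And>t. \<bar>t\<bar> \<ge> T2 \<Longrightarrow>
     Gamma (of_real (w k) * Complex (-A) t + \<mu> k) \<noteq> 0 \<and> Im (of_real (w k) * Complex (-A) t + \<mu> k) \<noteq> 0 \<and>
     c2 * \<bar>t\<bar> powr (w k * (1 + 2 * A) - 1) \<le> r k t \<and> r k t \<le> C2 * \<bar>t\<bar> powr (w k * (1 + 2 * A) + 1)"
    using Gamma_factor_ratio_bounds[of "w k" A "\<mu> k"] Suc.prems[of k] assms(2) unfolding r_def by blast
  have "(\<forall>i<Suc k. Gamma (of_real (w i) * Complex (-A) t + \<mu> i) \<noteq> 0 \<and> Im (of_real (w i) * Complex (-A) t + \<mu> i) \<noteq> 0) \<and>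
     c1 * c2 * \<bar>t\<bar> powr ((\<Sum>i<Suc k. w i) * (1 + 2 * A) - real (Suc k)) \<le> (\<Prod>i<Suc k. r i t) \<and>
     (\<Prod>i<Suc k. r i t) \<le> C1 * C2 * \<bar>t\<bar> powr ((\<Sum>i<Suc k. w i) * (1 + 2 * A) + real (Suc k))"
    if t: "\<bar>t\<bar> \<ge> max T1 T2" for t
  proof (intro conjI)
    have t12: "\<bar>t\<bar> \<ge> T1" "\<bar>t\<bar> \<ge> T2" using t by auto
    show "\<forall>i<Suc k. Gamma (of_real (w i) * Complex (-A) t + \<mu> i) \<noteq> 0 \<and> Im (of_real (w i) * Complex (-A) t + \<mu> i) \<noteq> 0"
      using 1(4)[OF t12(1)] 2(4)[OF t12(2)] by (auto simp: less_Suc_eq)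
    have "c1 * c2 * \<bar>t\<bar> powr ((\<Sum>i<Suc k. w i) * (1 + 2 * A) - real (Suc k)) =
          (c1 * \<bar>t\<bar> powr ((\<Sum>i<k. w i) * (1 + 2 * A) - real k)) * (c2 * \<bar>t\<bar> powr (w k * (1 + 2 * A) - 1))"
      by (simp add: powr_add[symmetric] algebra_simps)
    also have "\<dots> \<le> (\<Prod>i<k. r i t) * r k t"
      using 1(1-3) 1(4)[OF t12(1)] 2(1-3) 2(4)[OF t12(2)] r0 by (intro mult_mono prod_nonneg) auto
    finally show "c1 * c2 * \<bar>t\<bar> powr ((\<Sum>i<Suc k. w i) * (1 + 2 * A) - real (Suc k)) \<le> (\<Prod>i<Suc k. r i t)" by simp
    have "(\<Prod>i<k. r i t) * r k t \<le>
          (C1 * \<bar>t\<bar> powr ((\<Sum>i<k. w i) * (1 + 2 * A) + real k)) * (C2 * \<bar>t\<bar> powr (w k * (1 + 2 * A) + 1))"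
      using 1(1-3) 1(4)[OF t12(1)] 2(1-3) 2(4)[OF t12(2)] r0 by (intro mult_mono prod_nonneg) auto
    also have "\<dots> = C1 * C2 * \<bar>t\<bar> powr ((\<Sum>i<Suc k. w i) * (1 + 2 * A) + real (Suc k))"
      by (simp add: powr_add[symmetric] algebra_simps)
    finally show "(\<Prod>i<Suc k. r i t) \<le> C1 * C2 * \<bar>t\<bar> powr ((\<Sum>i<Suc k. w i) * (1 + 2 * A) + real (Suc k))" by simp
  qed
  moreover have "c1 * c2 > 0" "C1 * C2 > 0" "max T1 T2 \<ge> 1" using 1 2 by auto
  ultimately show ?case unfolding r_def by blast
qed

text \<open>\<open>D\<close> is half the degree of \<open>F\<close>, read off from the growth of \<open>F\<close> on far left vertical lines.\<close>

definition degree_bounds :: "(complex \<Rightarrow> complex) \<Rightarrow> real \<Rightarrow> real \<Rightarrow> bool" where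
  "degree_bounds F D K \<longleftrightarrow> (\<forall>A\<ge>1. \<exists>c>0. \<exists>C>0. \<exists>T\<ge>1. \<forall>t. \<bar>t\<bar> \<ge> T \<longrightarrow>
     c * \<bar>t\<bar> powr (D * (1 + 2 * A) - K) \<le> norm (F (Complex (-A) t)) \<and>
     norm (F (Complex (-A) t)) \<le> C * \<bar>t\<bar> powr (D * (1 + 2 * A) + K))"

text \<open>Taking moduli removes the conjugation. The equation can be solved for F on the left
  because no Gamma value there vanishes, and nonzero imaginary parts keep all arguments off the
  poles.\<close>

lemma norm_reflected:
  assumes F: "F holomorphic_on -{1}" and fe: "functional_equation_with F \<epsilon> Q k w \<mu>" and "A \<ge> 1"
    and G: "\<forall>i<k. Gamma (of_real (w i) * Complex (-A) t + \<mu> i) \<noteq> 0 \<and> Im (of_real (w i) * Complex (-A) t + \<mu> i) \<noteq> 0"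
  shows "norm (F (Complex (-A) t)) = Q powr (1 + 2 * A) *
    (\<Prod>i<k. norm (Gamma (of_real (w i) * Complex (1 + A) t + \<mu> i)) / norm (Gamma (of_real (w i) * Complex (-A) t + \<mu> i))) *
    norm (F (Complex (1 + A) t))"
proof -
  define s where "s = Complex (-A) t"
  have s': "cnj (1 - s) = Complex (1 + A) t" by (simp add: s_def complex_eq_iff)
  have Q: "Q > 0" "norm \<epsilon> = 1" using fe by (auto simp: functional_equation_with_def)
  have "gamma_factor \<epsilon> Q k w \<mu> s * F s = cnj (gamma_factor \<epsilon> Q k w \<mu> (cnj (1 - s)) * F (cnj (1 - s)))"
  proof (rule functional_equation_at[OF F fe])
    show "s \<noteq> 1" "s \<noteq> 0" using assms by (auto simp: s_def complex_eq_iff)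
    fix i assume "i < k"
    thus "of_real (w i) * s + \<mu> i \<notin> \<int>\<^sub>\<le>\<^sub>0" "of_real (w i) * cnj (1 - s) + \<mu> i \<notin> \<int>\<^sub>\<le>\<^sub>0"
      using G unfolding s' unfolding s_def by (auto intro!: not_nonpos_Ints_Im)
  qed
  hence "norm (gamma_factor \<epsilon> Q k w \<mu> s * F s) = norm (gamma_factor \<epsilon> Q k w \<mu> (cnj (1 - s)) * F (cnj (1 - s)))"
    by (simp only: complex_mod_cnj)
  hence eq: "Q powr (-A) * (\<Prod>i<k. norm (Gamma (of_real (w i) * Complex (-A) t + \<mu> i))) * norm (F (Complex (-A) t)) =
        Q powr (1 + A) * (\<Prod>i<k. norm (Gamma (of_real (w i) * Complex (1 + A) t + \<mu> i))) * norm (F (Complex (1 + A) t))"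
    unfolding s' using Q by (simp add: s_def gamma_factor_def norm_mult norm_powr_real_powr prod_norm)
  define P where "P = (\<Prod>i<k. norm (Gamma (of_real (w i) * Complex (-A) t + \<mu> i)))"
  define R where "R = (\<Prod>i<k. norm (Gamma (of_real (w i) * Complex (1 + A) t + \<mu> i)))"
  define X Y where "X = Q powr (-A)" and "Y = Q powr (1 + 2 * A)"
  define u v where "u = norm (F (Complex (-A) t))" and "v = norm (F (Complex (1 + A) t))"
  have P: "P > 0" unfolding P_def using G by (intro prod_pos) auto
  have X: "X > 0" using Q by (simp add: X_def)
  have e: "1 + A = -A + (1 + 2 * A)" by simp
  have XY: "Q powr (1 + A) = X * Y" unfolding X_def Y_def by (subst e, rule powr_add)
  have "X * P * u = X * Y * R * v"
    using eq unfolding XY X_def[symmetric] P_def[symmetric] R_def[symmetric] u_def[symmetric] v_def[symmetric] .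
  hence "X * (P * u) = X * (Y * R * v)" by (simp only: mult.assoc)
  hence "P * u = Y * R * v" using X by simp
  hence "u = Y * (R / P) * v" using P by (simp add: field_simps)
  thus ?thesis unfolding prod_dividef P_def R_def Y_def u_def v_def .
qed

text \<open>At the reflected point the Dirichlet series lies between two positive constants, so the
  growth at real part -A is that of the Gamma quotients alone. Each of the k quotients is known up
  to one power of |t|, whence the slack \<open>real k\<close>.\<close>

lemma degree_boundsI:
  assumes a: "a \<in> selberg_class" "selberg_function a F" and fe: "functional_equation_with F \<epsilon> Q k w \<mu>"
  shows "degree_bounds F (\<Sum>i<k. w i) (real k)"
  unfolding degree_bounds_def
proof (intro allI impI)
  fix A :: real assume A: "A \<ge> 1"
  have F: "F holomorphic_on -{1}" using a(2) by (rule selberg_function_holomorphic)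
  have w: "w i > 0" if "i < k" for i using fe that by (auto simp: functional_equation_with_def)
  have Q: "Q > 0" using fe by (auto simp: functional_equation_with_def)
  define r where "r = (\<lambda>t. (\<Prod>i<k. norm (Gamma (of_real (w i) * Complex (1 + A) t + \<mu> i)) / norm (Gamma (of_real (w i) * Complex (-A) t + \<mu> i))))"
  obtain c1 C1 T1 where 1: "c1 > 0" "C1 > 0" "T1 \<ge> 1" "\<And>t. \<bar>t\<bar> \<ge> T1 \<Longrightarrow>
     (\<forall>i<k. Gamma (of_real (w i) * Complex (-A) t + \<mu> i) \<noteq> 0 \<and> Im (of_real (w i) * Complex (-A) t + \<mu> i) \<noteq> 0) \<and>
     c1 * \<bar>t\<bar> powr ((\<Sum>i<k. w i) * (1 + 2 * A) - real k) \<le> r t \<and>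
     r t \<le> C1 * \<bar>t\<bar> powr ((\<Sum>i<k. w i) * (1 + 2 * A) + real k)"
    using Gamma_factors_ratio_bounds[of k w A \<mu>] w A unfolding r_def by blast
  obtain c2 C2 where 2: "c2 > 0" "C2 > 0" "\<And>s. Re s \<ge> 2 \<Longrightarrow> c2 \<le> norm (dirichlet_series a s) \<and> norm (dirichlet_series a s) \<le> C2"
    using selberg_bounds_right[OF a(1)] by blast
  have "Q powr (1 + 2 * A) * c1 * c2 * \<bar>t\<bar> powr ((\<Sum>i<k. w i) * (1 + 2 * A) - real k) \<le> norm (F (Complex (-A) t)) \<and>
     norm (F (Complex (-A) t)) \<le> Q powr (1 + 2 * A) * C1 * C2 * \<bar>t\<bar> powr ((\<Sum>i<k. w i) * (1 + 2 * A) + real k)"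
    if t: "\<bar>t\<bar> \<ge> T1" for t
  proof -
    have eq: "norm (F (Complex (-A) t)) = Q powr (1 + 2 * A) * r t * norm (F (Complex (1 + A) t))"
      unfolding r_def by (rule norm_reflected[OF F fe A]) (use 1(4)[OF t] in auto)
    have "F (Complex (1 + A) t) = dirichlet_series a (Complex (1 + A) t)"
      using a(2) A by (intro selberg_function_eq) auto
    hence b: "c2 \<le> norm (F (Complex (1 + A) t))" "norm (F (Complex (1 + A) t)) \<le> C2"
      using 2(3)[of "Complex (1 + A) t"] A by auto
    have r: "c1 * \<bar>t\<bar> powr ((\<Sum>i<k. w i) * (1 + 2 * A) - real k) \<le> r t"
      "r t \<le> C1 * \<bar>t\<bar> powr ((\<Sum>i<k. w i) * (1 + 2 * A) + real k)" "r t \<ge> 0"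
      using 1(4)[OF t] by (auto simp: r_def intro!: prod_nonneg)
    have "Q powr (1 + 2 * A) * c1 * c2 * \<bar>t\<bar> powr ((\<Sum>i<k. w i) * (1 + 2 * A) - real k) =
          Q powr (1 + 2 * A) * (c1 * \<bar>t\<bar> powr ((\<Sum>i<k. w i) * (1 + 2 * A) - real k)) * c2" by (simp add: mult_ac)
    also have "\<dots> \<le> Q powr (1 + 2 * A) * r t * norm (F (Complex (1 + A) t))"
      using r b 1 2 by (intro mult_mono) auto
    finally have lower: "Q powr (1 + 2 * A) * c1 * c2 * \<bar>t\<bar> powr ((\<Sum>i<k. w i) * (1 + 2 * A) - real k) \<le> norm (F (Complex (-A) t))"
      unfolding eq .
    have "Q powr (1 + 2 * A) * r t * norm (F (Complex (1 + A) t)) \<le>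
          Q powr (1 + 2 * A) * (C1 * \<bar>t\<bar> powr ((\<Sum>i<k. w i) * (1 + 2 * A) + real k)) * C2"
      using r b 1 2 by (intro mult_mono) auto
    with lower show ?thesis unfolding eq by (simp add: mult_ac)
  qed
  moreover have "Q powr (1 + 2 * A) * c1 * c2 > 0" "Q powr (1 + 2 * A) * C1 * C2 > 0" using 1 2 Q by auto
  ultimately show "\<exists>c>0. \<exists>C>0. \<exists>T\<ge>1. \<forall>t. \<bar>t\<bar> \<ge> T \<longrightarrow>
     c * \<bar>t\<bar> powr ((\<Sum>i<k. w i) * (1 + 2 * A) - real k) \<le> norm (F (Complex (-A) t)) \<and>
     norm (F (Complex (-A) t)) \<le> C * \<bar>t\<bar> powr ((\<Sum>i<k. w i) * (1 + 2 * A) + real k)"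
    using 1(3) by blast
qed

section \<open>Members of small degree\<close>

text \<open>The extra factors are those of the function to which Phragmen-Lindelof is applied: n^s
  grows at most like exp (L |s|) with L = ln n, and the Gaussian exp ((s - iT)^2) at most like exp
  ((|s| + T)^2).\<close>

lemma finite_order_growth:
  assumes g: "entire_of_finite_order g" and "L \<ge> 0" "T \<ge> 0"
  shows "\<exists>\<rho>>0. \<exists>R. \<forall>s. norm s \<ge> R \<longrightarrow>
           norm (g s) * exp (L * norm s) * exp ((norm s + T)\<^sup>2) \<le> exp (norm s powr \<rho>)"
proof -
  obtain \<rho>0 where "(\<lambda>s. norm (g s)) \<in> O[at_infinity](\<lambda>s. exp (norm s powr \<rho>0))"
    using g by (auto simp: entire_of_finite_order_def)
  then obtain C where "eventually (\<lambda>s. norm (norm (g s)) \<le> C * norm (exp (norm s powr \<rho>0))) at_infinity" and C: "C > 0"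
    by (elim landau_o.bigE)
  then obtain R0 where R0: "\<And>s. norm s \<ge> R0 \<Longrightarrow> norm (g s) \<le> C * exp (norm s powr \<rho>0)"
    by (auto simp: eventually_at_infinity)
  \<comment> \<open>Order at least 2 dominates the Gaussian; one further power of |s| then absorbs
    the constant B.\<close>
  define \<rho>1 where "\<rho>1 = max \<rho>0 2"
  define B where "B = \<bar>ln C\<bar> + 1 + L + (1 + T)\<^sup>2"
  have "norm (g s) * exp (L * norm s) * exp ((norm s + T)\<^sup>2) \<le> exp (norm s powr (\<rho>1 + 1))"
    if s: "norm s \<ge> max (max R0 1) B" for s
  proof -
    define x where "x = norm s"
    have x: "x \<ge> 1" "x \<ge> B" using s by (auto simp: x_def)
    have x1: "1 \<le> x powr \<rho>1" "x \<le> x powr \<rho>1" "x\<^sup>2 \<le> x powr \<rho>1" "x powr \<rho>0 \<le> x powr \<rho>1"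
    proof -
      show "1 \<le> x powr \<rho>1" using x by (intro ge_one_powr_ge_zero) (auto simp: \<rho>1_def)
      show "x \<le> x powr \<rho>1" using powr_mono[of 1 \<rho>1 x] x by (simp add: \<rho>1_def)
      show "x\<^sup>2 \<le> x powr \<rho>1" using powr_mono[of 2 \<rho>1 x] x by (simp add: \<rho>1_def powr_numeral)
      show "x powr \<rho>0 \<le> x powr \<rho>1" using x by (intro powr_mono) (auto simp: \<rho>1_def)
    qed
    have "(x + T)\<^sup>2 \<le> (x + x * T)\<^sup>2"
      using x assms mult_right_mono[of 1 x T] by (intro power_mono) auto
    also have "\<dots> = x\<^sup>2 * (1 + T)\<^sup>2" by (simp add: power2_eq_square algebra_simps)
    also have "\<dots> \<le> x powr \<rho>1 * (1 + T)\<^sup>2" using x1 by (intro mult_right_mono) auto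
    finally have "ln C + x powr \<rho>0 + L * x + (x + T)\<^sup>2 \<le> \<bar>ln C\<bar> * x powr \<rho>1 + x powr \<rho>1 + L * x powr \<rho>1 + x powr \<rho>1 * (1 + T)\<^sup>2"
      using x1 mult_left_mono[OF x1(1), of "\<bar>ln C\<bar>"] mult_left_mono[OF x1(2) assms(2)] by simp
    also have "\<dots> = B * x powr \<rho>1" by (simp add: B_def algebra_simps)
    also have "\<dots> \<le> x * x powr \<rho>1" using x by (intro mult_right_mono) auto
    also have "\<dots> = x powr (\<rho>1 + 1)" using x by (simp add: powr_add)
    finally have le: "ln C + x powr \<rho>0 + L * x + (x + T)\<^sup>2 \<le> x powr (\<rho>1 + 1)" .
    have "norm (g s) * exp (L * x) * exp ((x + T)\<^sup>2) \<le> (C * exp (x powr \<rho>0)) * exp (L * x) * exp ((x + T)\<^sup>2)"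
      using R0[of s] s by (intro mult_right_mono) (auto simp: x_def)
    also have "\<dots> = exp (ln C + x powr \<rho>0 + L * x + (x + T)\<^sup>2)" using C by (simp add: exp_add)
    also have "\<dots> \<le> exp (x powr (\<rho>1 + 1))" using le by simp
    finally show ?thesis by (simp add: x_def)
  qed
  moreover have "\<rho>1 + 1 > 0" by (simp add: \<rho>1_def)
  ultimately show ?thesis by blast
qed

lemma powr_exp_bounded:
  fixes \<mu> :: real
  shows "\<exists>C>0. \<forall>u\<ge>0. (1 + u) powr \<mu> * exp (- (u\<^sup>2)) \<le> C"
proof -
  have "((\<lambda>u::real. (1 + u) powr \<mu> * exp (- (u\<^sup>2))) \<longlongrightarrow> 0) at_top" by real_asymp
  hence "eventually (\<lambda>u::real. (1 + u) powr \<mu> * exp (- (u\<^sup>2)) < 1) at_top" by (rule order_tendstoD) simp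
  then obtain U where U: "\<And>u. u \<ge> U \<Longrightarrow> (1 + u) powr \<mu> * exp (- (u\<^sup>2)) < 1"
    by (auto simp: eventually_at_top_linorder)
  have "compact ((\<lambda>u::real. (1 + u) powr \<mu> * exp (- (u\<^sup>2))) ` {0..max 0 U})"
    by (intro compact_continuous_image continuous_intros) auto
  then obtain B where B: "\<And>u. u \<in> {0..max 0 U} \<Longrightarrow> norm ((1 + u) powr \<mu> * exp (- (u\<^sup>2))) \<le> B"
    using compact_imp_bounded by (force simp: bounded_iff)
  have "(1 + u) powr \<mu> * exp (- (u\<^sup>2)) \<le> max 1 B" if "u \<ge> 0" for u
    using U[of u] B[of u] that by (cases "u \<ge> U") auto
  thus ?thesis by (intro exI[of _ "max 1 B"]) auto
qed

text \<open>Horizontal segments of the contour are estimated by Phragmen-Lindelof after localising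
  with the factor \<open>exp ((s - iT)\<^sup>2)\<close>.\<close>

lemma horizontal_bound:
  assumes a: "selberg_function a F" and A: "A \<ge> 1" and c: "-A < c" "c \<noteq> 1"
    and left: "\<And>t. norm (F (Complex (-A) t)) \<le> C * (1 + \<bar>t\<bar>) powr \<mu>" and "\<mu> \<ge> 0"
    and right: "\<And>t. norm (F (Complex c t)) \<le> C"
  shows "\<exists>B\<ge>0. \<forall>n\<ge>1. \<forall>s. Im s \<ge> 1 \<and> -A \<le> Re s \<and> Re s \<le> c \<longrightarrow>
           norm (of_nat n powr s * F s) \<le> B * (real n powr (-A) * (1 + Im s) powr \<mu> + real n powr c)"
proof -
  obtain m g where g: "g holomorphic_on UNIV" "entire_of_finite_order g" "\<And>s. s \<noteq> 1 \<Longrightarrow> g s = (s - 1) ^ m * F s"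
    using selberg_functionE[OF a] by blast
  obtain C\<mu> where C\<mu>: "C\<mu> > 0" "\<And>u. u \<ge> 0 \<Longrightarrow> (1 + u) powr \<mu> * exp (- (u\<^sup>2)) \<le> C\<mu>"
    using powr_exp_bounded[of \<mu>] by blast
  define C' where "C' = max C 1"
  have C': "C \<le> C'" "C' > 0" by (auto simp: C'_def)
  define B where "B = (A + 3) ^ m * C' * (exp (A\<^sup>2) * C\<mu> + exp (c\<^sup>2))"
  have B: "B > 0" using A C' C\<mu> by (auto simp: B_def intro!: mult_pos_pos add_pos_pos)
  \<comment> \<open>The divisor (s + A + 1)^m has no zero in the strip and takes the place of (s -
    1)^m. The first comparison of the two is used on the boundary of the strip, the second at points
    of height at least 1.\<close>
  have q1: "norm (s - 1) ^ m \<le> (A + 3) ^ m * norm (s + of_real (A + 1)) ^ m" if "Re s \<ge> -A" for s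
  proof -
    have "1 \<le> Re (s + of_real (A + 1))" using that by simp
    hence 1: "1 \<le> norm (s + of_real (A + 1))" using complex_Re_le_cmod order_trans by blast
    have "norm (s - 1) \<le> norm (s + of_real (A + 1)) + norm (of_real (A + 2) :: complex)"
      using norm_triangle_ineq4[of "s + of_real (A + 1)" "of_real (A + 2)"] by (simp add: algebra_simps)
    also have "\<dots> \<le> norm (s + of_real (A + 1)) + (A + 2) * norm (s + of_real (A + 1))"
      using 1 A by (intro add_left_mono) (simp only: norm_of_real, simp)
    also have "\<dots> = (A + 3) * norm (s + of_real (A + 1))" by (simp add: algebra_simps)
    finally have "norm (s - 1) ^ m \<le> ((A + 3) * norm (s + of_real (A + 1))) ^ m" by (intro power_mono) auto
    thus ?thesis by (simp add: power_mult_distrib)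
  qed
  have q2: "norm (s + of_real (A + 1)) ^ m \<le> (A + 3) ^ m * norm (s - 1) ^ m" if "Im s \<ge> 1" for s
  proof -
    have 1: "1 \<le> norm (s - 1)" using abs_Im_le_cmod[of "s - 1"] that by simp
    have "norm (s + of_real (A + 1)) \<le> norm (s - 1) + norm (of_real (A + 2) :: complex)"
      using norm_triangle_ineq[of "s - 1" "of_real (A + 2)"] by (simp add: algebra_simps)
    also have "\<dots> \<le> norm (s - 1) + (A + 2) * norm (s - 1)"
      using 1 A by (intro add_left_mono) (simp only: norm_of_real, simp)
    also have "\<dots> = (A + 3) * norm (s - 1)" by (simp add: algebra_simps)
    finally have "norm (s + of_real (A + 1)) ^ m \<le> ((A + 3) * norm (s - 1)) ^ m" by (intro power_mono) auto
    thus ?thesis by (simp add: power_mult_distrib)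
  qed
  have "norm (of_nat n powr s * F s) \<le> ((A + 3) ^ m * B) * (real n powr (-A) * (1 + Im s) powr \<mu> + real n powr c)"
    if n: "n \<ge> 1" and s: "Im s \<ge> 1" "-A \<le> Re s" "Re s \<le> c" for n s
  proof -
    define T where "T = Im s"
    \<comment> \<open>The factor (z - 1)^m contained in g removes the pole and is compensated in
      size by (z + A + 1)^m. The Gaussian centred at height T lets the whole boundary be bounded in
      terms of T.\<close>
    define H where "H = (\<lambda>z. of_nat n powr z * (g z / (z + of_real (A + 1)) ^ m) * exp ((z - \<i> * of_real T)\<^sup>2))"
    define M where "M = B * (real n powr (-A) * (1 + T) powr \<mu> + real n powr c)"
    have M: "M > 0" using B n by (auto simp: M_def intro!: mult_pos_pos add_nonneg_pos)
    have expn: "norm (exp ((z - \<i> * of_real T)\<^sup>2)) = exp ((Re z)\<^sup>2 - (Im z - T)\<^sup>2)" for z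
      by (simp add: power2_eq_square)
    have nz: "z + (of_real A + 1) \<noteq> 0" if "Re z > -A - 1" for z using that by (auto simp: complex_eq_iff)
    have hol: "H holomorphic_on {z. Re z > -A - 1}"
      unfolding H_def using n nz
      by (intro holomorphic_intros holomorphic_on_subset[OF g(1)]) auto
    obtain \<rho> R where \<rho>: "\<rho> > 0" "\<And>z. norm z \<ge> R \<Longrightarrow>
           norm (g z) * exp (ln (real n) * norm z) * exp ((norm z + T)\<^sup>2) \<le> exp (norm z powr \<rho>)"
      using finite_order_growth[OF g(2), of "ln (real n)" T] n s by (auto simp: T_def)
    have "norm (H s) \<le> M"
    proof (rule phragmen_lindelof_strip[of "-A" c H R \<rho> M])
      show "continuous_on {s. -A \<le> Re s \<and> Re s \<le> c} H"
        by (intro holomorphic_on_imp_continuous_on holomorphic_on_subset[OF hol]) auto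
      show "H holomorphic_on {s. -A < Re s \<and> Re s < c}"
        by (intro holomorphic_on_subset[OF hol]) auto
      fix z assume z: "-A \<le> Re z" "Re z \<le> c" "R \<le> norm z"
      have "1 \<le> Re (z + of_real (A + 1))" using z by simp
      hence "1 \<le> norm (z + of_real (A + 1))" using complex_Re_le_cmod order_trans by blast
      hence 1: "1 \<le> norm (z + of_real (A + 1)) ^ m" by (rule one_le_power)
      have "norm (of_nat n powr z :: complex) = exp (Re z * ln (real n))"
        using n by (simp add: norm_nat_powr powr_def)
      also have "\<dots> \<le> exp (ln (real n) * norm z)"
        using n mult_right_mono[OF complex_Re_le_cmod, of "ln (real n)" z] by (simp add: mult.commute)
      finally have 2: "norm (of_nat n powr z :: complex) \<le> exp (ln (real n) * norm z)" .
      have "norm (z - \<i> * of_real T) \<le> norm z + T" using norm_triangle_ineq4[of z "\<i> * of_real T"] s by (simp add: norm_mult T_def)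
      hence "norm (z - \<i> * of_real T) ^ 2 \<le> (norm z + T) ^ 2" by (intro power_mono) auto
      hence "norm ((z - \<i> * of_real T)\<^sup>2) \<le> (norm z + T)\<^sup>2" by (simp add: norm_power)
      hence 3: "norm (exp ((z - \<i> * of_real T)\<^sup>2)) \<le> exp ((norm z + T)\<^sup>2)"
        using complex_Re_le_cmod[of "(z - \<i> * of_real T)\<^sup>2"] by simp
      have 4: "norm (g z) / norm (z + of_real (A + 1)) ^ m \<le> norm (g z)"
        using divide_left_mono[OF 1, of "norm (g z)"] 1 by simp
      have "norm (H z) = norm (of_nat n powr z :: complex) * (norm (g z) / norm (z + of_real (A + 1)) ^ m) * norm (exp ((z - \<i> * of_real T)\<^sup>2))"
        by (simp add: H_def norm_mult norm_divide norm_power)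
      also have "\<dots> \<le> exp (ln (real n) * norm z) * norm (g z) * exp ((norm z + T)\<^sup>2)"
        by (intro mult_mono 2 3 4) auto
      also have "\<dots> \<le> exp (norm z powr \<rho>)" using \<rho>(2)[OF z(3)] by (simp add: mult_ac)
      finally show "norm (H z) \<le> exp (norm z powr \<rho>)" .
    next
      fix z assume z: "Re z = -A \<or> Re z = c"
      have z1: "z \<noteq> 1" using z A c by auto
      have zA: "Re z \<ge> -A" using z c by auto
      have zz: "z + of_real (A + 1) \<noteq> 0" using zA by (auto simp: complex_eq_iff)
      have "norm (g z / (z + of_real (A + 1)) ^ m) = norm (z - 1) ^ m / norm (z + of_real (A + 1)) ^ m * norm (F z)"
        using g(3)[OF z1] by (simp add: norm_mult norm_divide norm_power)
      also have "\<dots> \<le> (A + 3) ^ m * norm (F z)"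
        using q1[OF zA] zz by (intro mult_right_mono) (auto simp: field_simps)
      finally have gz: "norm (g z / (z + of_real (A + 1)) ^ m) \<le> (A + 3) ^ m * norm (F z)" .
      have Hz: "norm (H z) = real n powr Re z * norm (g z / (z + of_real (A + 1)) ^ m) * exp ((Re z)\<^sup>2 - (Im z - T)\<^sup>2)"
        by (simp only: H_def norm_mult expn norm_nat_powr)
      have zC: "z = Complex (Re z) (Im z)" by simp
      show "norm (H z) \<le> M"
      proof (cases "Re z = -A")
        case True
        \<comment> \<open>This product separates T from the distance to T; the Gaussian then absorbs
          the power of the distance.\<close>
        have "1 + \<bar>Im z\<bar> \<le> (1 + T) * (1 + \<bar>Im z - T\<bar>)"
        proof -
          have 1: "0 \<le> T * \<bar>Im z - T\<bar>" using s by (simp add: T_def)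
          have 2: "\<bar>Im z\<bar> \<le> T + \<bar>Im z - T\<bar>" using s(1) unfolding T_def by linarith
          have "(1 + T) * (1 + \<bar>Im z - T\<bar>) = 1 + (T + \<bar>Im z - T\<bar>) + T * \<bar>Im z - T\<bar>"
            by (simp add: algebra_simps)
          thus ?thesis using 1 2 by linarith
        qed
        hence "(1 + \<bar>Im z\<bar>) powr \<mu> \<le> (1 + T) powr \<mu> * (1 + \<bar>Im z - T\<bar>) powr \<mu>"
          using s \<open>\<mu> \<ge> 0\<close> by (subst powr_mult[symmetric]) (auto intro!: powr_mono2 simp: T_def)
        hence "(1 + \<bar>Im z\<bar>) powr \<mu> * exp (- (\<bar>Im z - T\<bar>\<^sup>2)) \<le> (1 + T) powr \<mu> * ((1 + \<bar>Im z - T\<bar>) powr \<mu> * exp (- (\<bar>Im z - T\<bar>\<^sup>2)))"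
          by (simp add: mult_right_mono flip: mult.assoc)
        also have "\<dots> \<le> (1 + T) powr \<mu> * C\<mu>" by (intro mult_left_mono C\<mu>) auto
        finally have gau: "(1 + \<bar>Im z\<bar>) powr \<mu> * exp (- (\<bar>Im z - T\<bar>\<^sup>2)) \<le> (1 + T) powr \<mu> * C\<mu>" .
        have "norm (F z) \<le> C * (1 + \<bar>Im z\<bar>) powr \<mu>" using left[of "Im z"] True zC by simp
        also have "\<dots> \<le> C' * (1 + \<bar>Im z\<bar>) powr \<mu>" using C' by (intro mult_right_mono) auto
        finally have Fz: "norm (F z) \<le> C' * (1 + \<bar>Im z\<bar>) powr \<mu>" .
        have "norm (H z) \<le> real n powr (-A) * ((A + 3) ^ m * (C' * (1 + \<bar>Im z\<bar>) powr \<mu>)) * exp (A\<^sup>2 - (\<bar>Im z - T\<bar>)\<^sup>2)"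
          unfolding Hz using gz Fz A True
          by (auto intro!: mult_right_mono mult_left_mono elim!: order_trans)
        also have "\<dots> = real n powr (-A) * (A + 3) ^ m * C' * exp (A\<^sup>2) * ((1 + \<bar>Im z\<bar>) powr \<mu> * exp (- (\<bar>Im z - T\<bar>\<^sup>2)))"
          by (simp add: exp_diff exp_minus field_simps)
        also have "\<dots> \<le> real n powr (-A) * (A + 3) ^ m * C' * exp (A\<^sup>2) * ((1 + T) powr \<mu> * C\<mu>)"
          using A C' by (intro mult_left_mono gau) auto
        also have "\<dots> = ((A + 3) ^ m * C' * exp (A\<^sup>2) * C\<mu>) * (real n powr (-A) * (1 + T) powr \<mu>)" by (simp add: mult_ac)
        also have "\<dots> \<le> B * (real n powr (-A) * (1 + T) powr \<mu> + real n powr c)"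
          using A C' C\<mu> by (intro mult_mono) (auto simp: B_def algebra_simps)
        finally show ?thesis by (simp add: M_def)
      next
        case False
        hence Rez: "Re z = c" using z by auto
        have Fz: "norm (F z) \<le> C'" using right[of "Im z"] zC Rez C' by (metis order_trans)
        have "norm (H z) \<le> real n powr c * ((A + 3) ^ m * C') * exp (c\<^sup>2)"
          unfolding Hz Rez
        proof (intro mult_mono)
          show "norm (g z / (z + of_real (A + 1)) ^ m) \<le> (A + 3) ^ m * C'"
            using A by (intro order_trans[OF gz] mult_left_mono Fz) auto
        qed (use A C' in auto)
        also have "\<dots> = ((A + 3) ^ m * C' * exp (c\<^sup>2)) * real n powr c" by (simp add: mult_ac)
        also have "\<dots> \<le> B * (real n powr (-A) * (1 + T) powr \<mu> + real n powr c)"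
          using A C' C\<mu> by (intro mult_mono) (auto simp: B_def algebra_simps)
        finally show ?thesis by (simp add: M_def)
      qed
    qed (use c M \<rho> s in auto)
    have s1: "s \<noteq> 1" using s by auto
    have zz: "s + of_real (A + 1) \<noteq> 0" using s by (auto simp: complex_eq_iff)
    have "norm (of_nat n powr s * F s) * norm (s - 1) ^ m = norm (of_nat n powr s * g s)"
      using g(3)[OF s1] by (simp add: norm_mult norm_power)
    \<comment> \<open>At s itself the Gaussian has modulus exp ((Re s)^2) \<ge> 1, so it can be
      inserted for free.\<close>
    also have "\<dots> \<le> norm (of_nat n powr s * g s) * exp ((Re s)\<^sup>2)"
      using mult_left_mono[of 1 "exp ((Re s)\<^sup>2)" "norm (of_nat n powr s * g s)"] by simp
    also have "\<dots> = norm (H s) * norm (s + of_real (A + 1)) ^ m"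
      using zz expn[of s] by (simp add: H_def norm_mult norm_divide norm_power T_def)
    also have "\<dots> \<le> M * ((A + 3) ^ m * norm (s - 1) ^ m)"
      using M \<open>norm (H s) \<le> M\<close> q2[OF s(1)] by (intro mult_mono) auto
    finally have "norm (of_nat n powr s * F s) * norm (s - 1) ^ m \<le> ((A + 3) ^ m * M) * norm (s - 1) ^ m"
      by (simp add: mult_ac)
    hence "norm (of_nat n powr s * F s) \<le> (A + 3) ^ m * M" using s1 by simp
    thus ?thesis by (simp add: M_def T_def mult_ac)
  qed
  moreover have "(A + 3) ^ m * B \<ge> 0" using A B by auto
  ultimately show ?thesis by blast
qed

lemma selberg_function_continuation:
  assumes "selberg_function a F" "abs_conv a c" "c < Re s" "s \<noteq> 1"
  shows "F s = dirichlet_series a s"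
proof -
  define S where "S = {s. Re s > c} - {1}"
  have *: "open {s. Re s > c}" "connected {s. Re s > c}"
    by (rule open_halfspace_Re_gt, rule convex_connected[OF convex_halfspace_Re_gt])
  have S: "open S" "connected S"
    unfolding S_def using open_delete[OF *(1)] connected_open_delete[OF *] by auto
  show ?thesis
  proof (rule analytic_continuation_open[of "{s. Re s > max c 1}" S F "dirichlet_series a"])
    show "open {s. Re s > max c 1}" by (rule open_halfspace_Re_gt)
    have "of_real (max c 1 + 1) \<in> {s. Re s > max c 1}" by (auto simp: max_def)
    thus "{s. Re s > max c 1} \<noteq> {}" by blast
    show "{s. Re s > max c 1} \<subseteq> S" by (auto simp: S_def)
    show "F holomorphic_on S"
      by (rule holomorphic_on_subset[OF selberg_function_holomorphic[OF assms(1)]]) (auto simp: S_def)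
    show "dirichlet_series a holomorphic_on S"
      by (rule holomorphic_on_subset[OF holomorphic_dirichlet_series[OF assms(2)]]) (auto simp: S_def)
    show "F z = dirichlet_series a z" if "z \<in> {s. Re s > max c 1}" for z
      using that by (intro selberg_function_eq[OF assms(1)]) auto
    show "s \<in> S" using assms by (auto simp: S_def)
  qed (rule S)+
qed

text \<open>The mean value formula, moved to the line \<open>Re s = -A\<close> inside a rectangle of height \<open>T\<close>.\<close>

lemma coefficient_bound_shifted:
  assumes a: "selberg_function a F" "abs_conv a c0" and A: "A \<ge> 1" and c: "c0 < c" "-A < c" "c \<noteq> 1"
    and left: "\<And>t. norm (F (Complex (-A) t)) \<le> C0 * (1 + \<bar>t\<bar>) powr \<mu>" and \<mu>: "\<mu> \<ge> 0"
  shows "\<exists>C\<ge>0. \<forall>n\<ge>1. \<forall>T\<ge>1.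
           norm (a n) \<le> C * (real n powr (c + 1) / T + real n powr (-A) * T powr \<mu>)"
proof -
  have ac: "abs_conv a c" by (rule abs_conv_mono[OF a(2)]) (use c in auto)
  define S where "S = (\<Sum>m. norm (a m) * real m powr (-c))"
  have S0: "S \<ge> 0" unfolding S_def using ac by (intro suminf_nonneg) (auto simp: abs_conv_def)
  have Fc: "F (Complex c t) = dirichlet_series a (Complex c t)" for t
    by (rule selberg_function_continuation[OF a]) (use c in \<open>auto simp: complex_eq_iff\<close>)
  define C where "C = max C0 S"
  have C: "C \<ge> 0" "C0 \<le> C" "S \<le> C" using S0 by (auto simp: C_def)
  have left': "norm (F (Complex (-A) t)) \<le> C * (1 + \<bar>t\<bar>) powr \<mu>" for t
    by (rule order_trans[OF left]) (use C in \<open>auto intro!: mult_right_mono\<close>)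
  have right: "norm (F (Complex c t)) \<le> C" for t
    unfolding Fc using norm_dirichlet_series_le[OF ac, of "Complex c t"] C by (simp add: S_def)
  obtain B where B: "B \<ge> 0" "\<forall>n\<ge>1. \<forall>s. Im s \<ge> 1 \<and> -A \<le> Re s \<and> Re s \<le> c \<longrightarrow>
           norm (of_nat n powr s * F s) \<le> B * (real n powr (-A) * (1 + Im s) powr \<mu> + real n powr c)"
    using horizontal_bound[OF a(1) A c(2,3) left' \<mu> right] by (elim exE conjE) (rule that)
  define K where "K = 4 * S + 2 * (c + A) * B + (2 * (c + A) * B + C) * 3 powr \<mu>"
  have cA: "c + A > 0" using c by simp
  have "2 * (c + A) * B \<ge> 0" using cA B(1) by simp
  moreover from this have "(2 * (c + A) * B + C) * 3 powr \<mu> \<ge> 0" using C(1) by (intro mult_nonneg_nonneg) auto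
  ultimately have K: "K \<ge> 0" unfolding K_def using S0 by linarith
  have "norm (a n) \<le> K * (real n powr (c + 1) / T + real n powr (-A) * T powr \<mu>)" if n: "n \<ge> 1" and T: "T \<ge> 1" for n T
  proof -
    define f where "f = (\<lambda>s. of_nat n powr s * F s)"
    \<comment> \<open>On the convex upper half-plane f has a primitive P, and the possible pole at 1
      lies outside. Differences of P take the place of contour integrals.\<close>
    have "f holomorphic_on {s. Im s > 0}"
      unfolding f_def using n
      by (intro holomorphic_intros holomorphic_on_subset[OF selberg_function_holomorphic[OF a(1)]]) auto
    from holomorphic_convex_primitive'[OF convex_halfspace_Im_gt open_halfspace_Im_gt this]
    obtain P where P0: "\<And>s. s \<in> {s. Im s > 0} \<Longrightarrow> (P has_field_derivative f s) (at s within {s. Im s > 0})"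
      by blast
    have P: "(P has_field_derivative f s) (at s)" if "Im s > 0" for s
      using P0[of s] at_within_open[of s "{s. Im s > 0}"] that open_halfspace_Im_gt[of 0] by simp
    define E where "E = real n powr (-A) * (1 + 2 * T) powr \<mu>"
    have hor: "norm (P (Complex c y) - P (Complex (-A) y)) \<le> B * (E + real n powr c) * (c + A)" if y: "T \<le> y" "y \<le> 2 * T" for y
    proof -
      have "norm (P (Complex c y) - P (Complex (-A) y)) \<le> B * (E + real n powr c) * norm (Complex c y - Complex (-A) y)"
      proof (rule field_differentiable_bound[of "closed_segment (Complex (-A) y) (Complex c y)"])
        fix z assume "z \<in> closed_segment (Complex (-A) y) (Complex c y)"
        hence z: "Im z = y" "-A \<le> Re z" "Re z \<le> c"
          using c by (auto simp: closed_segment_same_Im closed_segment_eq_real_ivl)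
        show "(P has_field_derivative f z) (at z within closed_segment (Complex (-A) y) (Complex c y))"
          by (rule has_field_derivative_at_within[OF P]) (use z y T in auto)
        have "norm (f z) \<le> B * (real n powr (-A) * (1 + Im z) powr \<mu> + real n powr c)"
          unfolding f_def by (rule B(2)[rule_format]) (use n z y T in auto)
        also have "\<dots> \<le> B * (E + real n powr c)"
          unfolding E_def using z y T \<mu> B(1) by (intro mult_left_mono add_right_mono powr_mono2) auto
        finally show "norm (f z) \<le> B * (E + real n powr c)" .
      qed auto
      also have "Complex c y - Complex (-A) y = of_real (c + A)" by (simp add: complex_eq_iff)
      also have "norm (of_real (c + A) :: complex) = c + A" using cA by (subst norm_of_real) auto
      finally show ?thesis .
    qed
    have ver: "norm (P (Complex (-A) (2*T)) - P (Complex (-A) T)) \<le> C * E * T"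
    proof -
      have "norm (P (Complex (-A) (2*T)) - P (Complex (-A) T)) \<le> C * E * norm (Complex (-A) (2*T) - Complex (-A) T)"
      proof (rule field_differentiable_bound[of "closed_segment (Complex (-A) T) (Complex (-A) (2*T))"])
        fix z assume "z \<in> closed_segment (Complex (-A) T) (Complex (-A) (2*T))"
        hence z: "Re z = -A" "T \<le> Im z" "Im z \<le> 2 * T"
          using T by (auto simp: closed_segment_same_Re closed_segment_eq_real_ivl)
        hence zc: "z = Complex (-A) (Im z)" by (simp add: complex_eq_iff)
        show "(P has_field_derivative f z) (at z within closed_segment (Complex (-A) T) (Complex (-A) (2*T)))"
          by (rule has_field_derivative_at_within[OF P]) (use z T in auto)
        have "norm (f z) = real n powr (-A) * norm (F (Complex (-A) (Im z)))"
          using z by (simp add: f_def norm_mult norm_nat_powr flip: zc)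
        also have "\<dots> \<le> real n powr (-A) * (C * (1 + \<bar>Im z\<bar>) powr \<mu>)" by (intro mult_left_mono left') auto
        also have "\<dots> \<le> real n powr (-A) * (C * (1 + 2 * T) powr \<mu>)"
          using z T \<mu> C(1) by (intro mult_left_mono powr_mono2) auto
        finally show "norm (f z) \<le> C * E" by (simp add: E_def mult_ac)
      qed auto
      also have "Complex (-A) (2*T) - Complex (-A) T = \<i> * of_real T" by (simp add: complex_eq_iff)
      also have "norm (\<i> * of_real T :: complex) = T" using T by (simp add: norm_mult)
      finally show ?thesis .
    qed
    have tri: "norm (u + v - w) \<le> norm u + norm v + norm w" for u v w :: complex
      by (rule order_trans[OF norm_triangle_ineq4 add_right_mono[OF norm_triangle_ineq]])
    define I where "I = integral {T..2*T} (\<lambda>t. f (Complex c t))"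
    have der: "((\<lambda>t. P (Complex c t)) has_vector_derivative (\<i> * f (Complex c t))) (at t)" if "t > 0" for t
    proof -
      have "((\<lambda>z. P (of_real c + \<i> * z)) has_field_derivative (f (Complex c t) * \<i>)) (at (of_real t))"
      proof (rule DERIV_chain2[of P])
        show "(P has_field_derivative f (Complex c t)) (at (of_real c + \<i> * of_real t))"
          using P[of "Complex c t"] that by (simp add: Complex_eq)
      qed (auto intro!: derivative_eq_intros)
      from has_vector_derivative_real_field[OF this] show ?thesis by (simp add: Complex_eq mult_ac)
    qed
    have "((\<lambda>t. \<i> * f (Complex c t)) has_integral (P (Complex c (2*T)) - P (Complex c T))) {T..2*T}"
      by (rule fundamental_theorem_of_calculus)
         (use T in \<open>auto intro!: has_vector_derivative_at_within der\<close>)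
    hence "\<i> * I = P (Complex c (2*T)) - P (Complex c T)"
      unfolding I_def integral_mult_right[symmetric] by (rule integral_unique)
    hence "norm (\<i> * I) = norm (P (Complex c (2*T)) - P (Complex c T))" by simp
    hence "norm I = norm (P (Complex c (2*T)) - P (Complex c T))" by (simp add: norm_mult)
    \<comment> \<open>The right-hand vertical side is exchanged for the other three sides of the
      rectangle with real parts -A, c and heights T, 2T.\<close>
    also have "\<dots> \<le> norm (P (Complex c (2*T)) - P (Complex (-A) (2*T))) + norm (P (Complex (-A) (2*T)) - P (Complex (-A) T))
         + norm (P (Complex c T) - P (Complex (-A) T))"
      using tri[of "P (Complex c (2*T)) - P (Complex (-A) (2*T))" "P (Complex (-A) (2*T)) - P (Complex (-A) T)" "P (Complex c T) - P (Complex (-A) T)"]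
      by simp
    also have "\<dots> \<le> B * (E + real n powr c) * (c + A) + C * E * T + B * (E + real n powr c) * (c + A)"
      using T by (intro add_mono hor ver) auto
    finally have I: "norm I \<le> 2 * (c + A) * B * (E + real n powr c) + C * E * T" by (simp add: algebra_simps)
    have "norm (I - of_real T * a n) \<le> 4 * S * real n powr (c + 1)"
      unfolding I_def f_def Fc S_def by (rule dirichlet_series_mean_value) (use ac n T in auto)
    moreover have "norm (of_real T * a n) \<le> norm I + norm (I - of_real T * a n)"
      using norm_triangle_ineq4[of I "I - of_real T * a n"] by simp
    ultimately have "T * norm (a n) \<le> 4 * S * real n powr (c + 1) + (2 * (c + A) * B * (E + real n powr c) + C * E * T)"
      using I T by (simp add: norm_mult)
    \<comment> \<open>The estimates E \<le> ET and n^c \<le> n^(c+1) merge the horizontal sides into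
      the two terms of the final bound.\<close>
    also have "\<dots> \<le> 4 * S * real n powr (c + 1) + (2 * (c + A) * B * (E * T + real n powr (c + 1)) + C * E * T)"
    proof -
      have "E \<ge> 0" by (simp add: E_def)
      hence "E \<le> E * T" using mult_left_mono[of 1 T E] T by simp
      moreover have "real n powr c \<le> real n powr (c + 1)" using n by (intro powr_mono) auto
      ultimately show ?thesis using cA B(1) by (intro add_left_mono add_right_mono mult_left_mono add_mono) auto
    qed
    also have "\<dots> = (4 * S + 2 * (c + A) * B) * real n powr (c + 1) + (2 * (c + A) * B + C) * (E * T)"
      by (simp add: algebra_simps)
    also have "\<dots> = T * ((4 * S + 2 * (c + A) * B) * (real n powr (c + 1) / T) + (2 * (c + A) * B + C) * E)"
    proof -
      have "X * Y + Z * (E * T) = T * (X * (Y / T) + Z * E)" for X Y Z :: real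
        using T by (simp add: field_simps)
      thus ?thesis .
    qed
    finally have "T * norm (a n) \<le> T * ((4 * S + 2 * (c + A) * B) * (real n powr (c + 1) / T) + (2 * (c + A) * B + C) * E)" .
    hence "norm (a n) \<le> (4 * S + 2 * (c + A) * B) * (real n powr (c + 1) / T) + (2 * (c + A) * B + C) * E" using T by simp
    also have "\<dots> \<le> (4 * S + 2 * (c + A) * B) * (real n powr (c + 1) / T) + (2 * (c + A) * B + C) * (real n powr (-A) * (3 powr \<mu> * T powr \<mu>))"
    proof (intro add_left_mono mult_left_mono)
      have "(1 + 2 * T) powr \<mu> \<le> (3 * T) powr \<mu>" using T \<mu> by (intro powr_mono2) auto
      thus "E \<le> real n powr (-A) * (3 powr \<mu> * T powr \<mu>)" using T by (simp add: E_def powr_mult mult_left_mono)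
    qed (use cA B(1) C(1) in auto)
    also have "\<dots> = (4 * S + 2 * (c + A) * B) * (real n powr (c + 1) / T) + ((2 * (c + A) * B + C) * 3 powr \<mu>) * (real n powr (-A) * T powr \<mu>)"
      by (simp add: mult_ac)
    also have "\<dots> \<le> K * (real n powr (c + 1) / T) + K * (real n powr (-A) * T powr \<mu>)"
      using cA B(1) C(1) S0 T by (intro add_mono mult_right_mono) (auto simp: K_def)
    finally show ?thesis by (simp add: distrib_left)
  qed
  with K show ?thesis by blast
qed

text \<open>With T = n^3 the shifted bound has the two terms n^(c - 7/4) and n^(3\<mu> - A), where
  3\<mu> - A = 3D + 3K - (1 - 6D) A. The condition 6D < 1 lets a large A push the second exponent
  below the first. Coefficients of order n^(c - 7/4) converge absolutely at c - 1/2. The mean value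
  is taken on the line c + 1/4, which must avoid the pole at 1.\<close>

lemma small_degree_abs_conv_step:
  assumes a: "selberg_function a F" and deg: "degree_bounds F D K" and "D \<ge> 0" "6 * D < 1" "K \<ge> 0"
    and conv: "abs_conv a c" and c: "c + 1/4 \<noteq> 1"
  shows "abs_conv a (c - 1/2)"
proof -
  \<comment> \<open>The last entry solves 3\<mu> - A \<le> c - 2 for A; the entry 1 - c keeps -A to
    the left of the line c + 1/4.\<close>
  define A where "A = max (max 1 (1 - c)) ((3 * D + 3 * K - c + 2) / (1 - 6 * D))"
  have A: "A \<ge> 1" "A \<ge> 1 - c" "A \<ge> (3 * D + 3 * K - c + 2) / (1 - 6 * D)" by (auto simp: A_def)
  define \<mu> where "\<mu> = D * (1 + 2 * A) + K"
  have \<mu>: "\<mu> \<ge> 0" using assms A by (auto simp: \<mu>_def)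
  have "A * (1 - 6 * D) \<ge> 3 * D + 3 * K - c + 2" using A(3) assms by (simp add: field_simps)
  hence key: "3 * \<mu> - A \<le> c - 2" by (simp add: \<mu>_def algebra_simps)
  obtain C T where CT: "C > 0" "T \<ge> 1" "\<And>t. \<bar>t\<bar> \<ge> T \<Longrightarrow> norm (F (Complex (-A) t)) \<le> C * \<bar>t\<bar> powr \<mu>"
    using deg A(1) unfolding degree_bounds_def \<mu>_def by metis
  have "continuous_on {-T..T} (\<lambda>t. F (Complex (-A) t))"
  proof (rule continuous_on_compose2[of "-{1}" F])
    show "continuous_on (-{1}) F"
      by (rule holomorphic_on_imp_continuous_on[OF selberg_function_holomorphic[OF a]])
    show "continuous_on {-T..T} (Complex (-A))" unfolding Complex_eq by (intro continuous_intros)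
  qed (use A in \<open>auto simp: complex_eq_iff\<close>)
  hence "compact ((\<lambda>t. F (Complex (-A) t)) ` {-T..T})" by (rule compact_continuous_image) simp
  then obtain B where B: "\<And>t. t \<in> {-T..T} \<Longrightarrow> norm (F (Complex (-A) t)) \<le> B"
    using compact_imp_bounded by (force simp: bounded_iff)
  have left: "norm (F (Complex (-A) t)) \<le> max B C * (1 + \<bar>t\<bar>) powr \<mu>" for t
  proof (cases "\<bar>t\<bar> \<ge> T")
    case True
    have "norm (F (Complex (-A) t)) \<le> C * \<bar>t\<bar> powr \<mu>" by (rule CT(3)[OF True])
    also have "\<dots> \<le> max B C * (1 + \<bar>t\<bar>) powr \<mu>" using CT \<mu> by (intro mult_mono powr_mono2) auto
    finally show ?thesis .
  next
    case False
    hence "norm (F (Complex (-A) t)) \<le> B" by (intro B) auto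
    hence "norm (F (Complex (-A) t)) \<le> max B C * 1" by simp
    also have "\<dots> \<le> max B C * (1 + \<bar>t\<bar>) powr \<mu>"
      using CT \<mu> by (intro mult_left_mono ge_one_powr_ge_zero) auto
    finally show ?thesis .
  qed
  obtain C' where C': "C' \<ge> 0" "\<And>n T. n \<ge> 1 \<Longrightarrow> T \<ge> 1 \<Longrightarrow>
       norm (a n) \<le> C' * (real n powr (c + 1/4 + 1) / T + real n powr (-A) * T powr \<mu>)"
    using coefficient_bound_shifted[OF a conv A(1) _ _ c left \<mu>] A by auto
  have "norm (a n) \<le> (2 * C') * real n powr (c - 7/4)" if n: "n \<ge> 1" for n
  proof -
    have "norm (a n) \<le> C' * (real n powr (c + 1/4 + 1) / real n powr 3 + real n powr (-A) * (real n powr 3) powr \<mu>)"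
      by (rule C'(2)) (use n in auto)
    also have "real n powr (c + 1/4 + 1) / real n powr 3 = real n powr (c + 1/4 + 1 - 3)"
      by (rule powr_diff[symmetric])
    also have "c + 1/4 + 1 - 3 = c - 7/4" by simp
    also have "real n powr (-A) * (real n powr 3) powr \<mu> = real n powr (-A + 3 * \<mu>)"
      by (simp only: powr_powr powr_add)
    also have "-A + 3 * \<mu> = 3 * \<mu> - A" by simp
    also have "C' * (real n powr (c - 7/4) + real n powr (3 * \<mu> - A)) \<le> C' * (real n powr (c - 7/4) + real n powr (c - 7/4))"
      using n key C' by (intro mult_left_mono add_mono powr_mono) auto
    finally show ?thesis by simp
  qed
  thus ?thesis
    by (intro abs_conv_powrI[of a "2 * C'" "c - 7/4"]) (auto intro: eventually_mono[OF eventually_ge_at_top[of 1]])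
qed

text \<open>Steps of 1/2 downwards from 2. The line used at step j has abscissa 9/4 - j/2, which is
  never 1.\<close>

lemma small_degree_abs_conv:
  assumes "a \<in> selberg_class" "selberg_function a F" "degree_bounds F D K" "D \<ge> 0" "6 * D < 1" "K \<ge> 0"
  shows "abs_conv a c"
proof -
  have *: "abs_conv a (2 - real j / 2)" for j
  proof (induction j)
    case 0
    show ?case using selberg_abs_conv[OF assms(1), of 2] by simp
  next
    case (Suc j)
    have "2 - real j / 2 + 1/4 \<noteq> 1"
    proof
      assume "2 - real j / 2 + 1/4 = 1"
      hence "real (2 * j) = real 5" by simp
      hence "2 * j = 5" by (simp only: of_nat_eq_iff)
      thus False by presburger
    qed
    from small_degree_abs_conv_step[OF assms(2-6) Suc.IH this] show ?case by (simp add: algebra_simps add_divide_distrib)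
  qed
  obtain j :: nat where "real j \<ge> 2 * (2 - c)" using real_arch_simple by blast
  thus ?thesis using abs_conv_mono[OF *[of j], of c] by simp
qed

text \<open>Absolute convergence everywhere bounds F on every line Re s = -A, whereas for D > 0 and
  large A the lower degree bound grows with t.\<close>

lemma small_degree_eq_0:
  assumes "a \<in> selberg_class" "selberg_function a F" "degree_bounds F D K" "D \<ge> 0" "6 * D < 1" "K \<ge> 0"
  shows "D = 0"
proof (rule ccontr)
  assume "D \<noteq> 0"
  hence D: "D > 0" using assms by simp
  define A where "A = max 1 (K / D + 1)"
  have A: "A \<ge> 1" "A \<ge> K / D + 1" by (auto simp: A_def)
  have "D * (1 + 2 * A) \<ge> D * (K / D + 1)" using D A by (intro mult_left_mono) auto
  also have "D * (K / D + 1) = K + D" using D by (simp add: field_simps)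
  finally have e: "D * (1 + 2 * A) - K > 0" using D by linarith
  obtain c T where c: "c > 0" "T \<ge> 1" "\<And>t. \<bar>t\<bar> \<ge> T \<Longrightarrow> c * \<bar>t\<bar> powr (D * (1 + 2 * A) - K) \<le> norm (F (Complex (-A) t))"
    using assms(3) A(1) unfolding degree_bounds_def by metis
  note conv = small_degree_abs_conv[OF assms]
  define B where "B = (\<Sum>n. norm (a n) * real n powr (-(-A)))"
  have B: "norm (F (Complex (-A) t)) \<le> B" for t
  proof -
    have "F (Complex (-A) t) = dirichlet_series a (Complex (-A) t)"
      by (rule selberg_function_continuation[OF assms(2) conv[of "-A-1"]]) (use A in \<open>auto simp: complex_eq_iff\<close>)
    thus ?thesis using norm_dirichlet_series_le[OF conv[of "-A"], of "Complex (-A) t"] by (simp add: B_def)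
  qed
  have "filterlim (\<lambda>t::real. c * t powr (D * (1 + 2 * A) - K)) at_top at_top"
    using e c by real_asymp
  hence "eventually (\<lambda>t::real. c * t powr (D * (1 + 2 * A) - K) > B) at_top"
    by (simp add: filterlim_at_top_dense)
  moreover have "eventually (\<lambda>t::real. t \<ge> T) at_top" by (rule eventually_ge_at_top)
  ultimately have "eventually (\<lambda>t::real. False) at_top"
  proof eventually_elim
    case (elim t)
    hence "\<bar>t\<bar> = t" using c by simp
    thus ?case using c(3)[of t] B[of t] elim by simp
  qed
  thus False by simp
qed

section \<open>Euler coefficients and Dirichlet polynomials\<close>

lemma bigo_nat_bound:
  fixes f :: "nat \<Rightarrow> real"
  assumes "f \<in> O(\<lambda>n. real n powr \<theta>)"
  shows "\<exists>C\<ge>0. \<forall>n\<ge>1. \<bar>f n\<bar> \<le> C * real n powr \<theta>"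
proof -
  obtain C where "eventually (\<lambda>n. norm (f n) \<le> C * norm (real n powr \<theta>)) sequentially" and C: "C > 0"
    using assms by (elim landau_o.bigE)
  then obtain N where N: "\<And>n. n \<ge> N \<Longrightarrow> \<bar>f n\<bar> \<le> C * real n powr \<theta>"
    by (auto simp: eventually_sequentially)
  define M where "M = (\<Sum>n<N. \<bar>f n\<bar> / real n powr \<theta>)"
  have M: "M \<ge> 0" by (auto simp: M_def intro!: sum_nonneg)
  have "\<bar>f n\<bar> \<le> (C + M) * real n powr \<theta>" if n: "n \<ge> 1" for n
  proof (cases "n \<ge> N")
    case True
    thus ?thesis using N[of n] M by (simp add: distrib_right add_increasing2)
  next
    case False
    hence "\<bar>f n\<bar> / real n powr \<theta> \<le> M"
      unfolding M_def by (intro member_le_sum) auto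
    hence "\<bar>f n\<bar> \<le> M * real n powr \<theta>" using n by (simp add: field_simps)
    thus ?thesis using C by (simp add: distrib_right add_increasing)
  qed
  thus ?thesis using C M by (intro exI[of _ "C + M"]) auto
qed

text \<open>Only the divisors 1 and p occur in the recursion at p, and ln 1 = 0 removes the term
  with d = 1.\<close>

lemma euler_coeff_prime:
  assumes "a \<in> selberg_class" "abs_conv b c"
    and "\<And>s. Re s > 1 \<Longrightarrow> exp (dirichlet_series b s) = dirichlet_series a s" and "prime p"
  shows "b p = a p"
proof -
  let ?c = "max c 2"
  have "a p * of_real (ln (real p)) = dconv (\<lambda>d. b d * of_real (ln (real d))) a p"
    by (rule log_derivative_coeffs[where c = ?c])
       (use assms selberg_abs_conv[OF assms(1), of ?c] prime_ge_1_nat in \<open>auto intro: abs_conv_mono\<close>)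
  also have "\<dots> = b p * of_real (ln (real p))"
    using assms by (simp add: dconv_prime selberg_class_1)
  finally show ?thesis using prime_gt_1_nat[OF assms(4)] by simp
qed

text \<open>In the recursion at p^k every divisor other than p^k leaves a cofactor p^j with j > 0,
  where a vanishes.\<close>

lemma euler_coeff_primepow_zero:
  assumes "a \<in> selberg_class" "abs_conv b c"
    and "\<And>s. Re s > 1 \<Longrightarrow> exp (dirichlet_series b s) = dirichlet_series a s"
    and "prime p" "k > 0" and zero: "\<And>j. j > 0 \<Longrightarrow> a (p ^ j) = 0"
  shows "b (p ^ k) = 0"
proof -
  let ?c = "max c 2"
  let ?n = "p ^ k"
  have pk: "?n > 1" using assms(4,5) by (intro one_less_power prime_gt_1_nat)
  have "a ?n * of_real (ln (real ?n)) = dconv (\<lambda>d. b d * of_real (ln (real d))) a ?n"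
    by (rule log_derivative_coeffs[where c = ?c])
       (use assms selberg_abs_conv[OF assms(1), of ?c] pk in \<open>auto intro: abs_conv_mono\<close>)
  also have "dconv (\<lambda>d. b d * of_real (ln (real d))) a ?n = (\<Sum>d\<in>{?n}. b d * of_real (ln (real d)) * a (?n div d))"
    unfolding dconv_def
  proof (rule sum.mono_neutral_right)
    show "\<forall>d\<in>{d. d dvd ?n} - {?n}. b d * of_real (ln (real d)) * a (?n div d) = 0"
    proof
      fix d assume d: "d \<in> {d. d dvd ?n} - {?n}"
      then obtain j where j: "d = p ^ j" "j \<le> k" using assms(4) divides_primepow_nat by auto
      with d have "j < k" by (cases "j = k") auto
      moreover have "?n div d = p ^ (k - j)"
        unfolding j(1) using j(2) prime_gt_0_nat[OF assms(4)] by (simp add: power_diff)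
      ultimately show "b d * of_real (ln (real d)) * a (?n div d) = 0" using zero[of "k - j"] by simp
    qed
    show "finite {d. d dvd ?n}" using pk by (intro finite_divisors_nat) linarith
  qed auto
  moreover have "?n div ?n = 1" using pk by (intro div_self) linarith
  ultimately have "0 = b ?n * of_real (ln (real ?n))"
    using zero[OF assms(5)] by (simp add: selberg_class_1[OF assms(1)] del: div_self)
  moreover have "real ?n > 1" using pk by (simp only: of_nat_less_iff[where 'a = real, of 1, symmetric] of_nat_1)
  hence "ln (real ?n) > 0" by (rule ln_gt_zero)
  ultimately show ?thesis by (simp del: of_nat_power)
qed

text \<open>Over finitely many primes the series is majorised by finitely many geometric series with
  ratios p^(\<theta> - c) < 1. Convergence therefore starts at \<theta>, and not only at \<theta> +
  1 as for a general sequence of this size.\<close>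

lemma abs_conv_finite_primes:
  assumes "\<And>n. \<not> primepow n \<Longrightarrow> b n = 0"
    and "(\<lambda>n. norm (b n)) \<in> O(\<lambda>n. real n powr \<theta>)" and "\<theta> < c"
    and "\<And>p k. prime p \<Longrightarrow> p > N \<Longrightarrow> k > 0 \<Longrightarrow> b (p ^ k) = 0"
  shows "abs_conv b c"
proof -
  obtain C where C: "C \<ge> 0" "\<And>n. n \<ge> 1 \<Longrightarrow> norm (b n) \<le> C * real n powr \<theta>"
    using bigo_nat_bound[OF assms(2)] by auto
  define f where "f = (\<lambda>n. norm (b n) * real n powr (-c))"
  have sp: "f summable_on (range (\<lambda>k. p ^ k))" if "prime p" for p
  proof -
    have p: "p > 1" using that by (rule prime_gt_1_nat)
    have inj: "inj (\<lambda>k. p ^ k)" using p by (auto simp: inj_on_def)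
    define r where "r = real p powr (\<theta> - c)"
    have r: "r < 1" "r > 0" using p assms(3) by (auto simp: r_def powr_less_one)
    have "(\<lambda>k. f (p ^ k)) summable_on UNIV"
    proof (rule norm_summable_imp_summable_on, rule summable_comparison_test'[where N = 0])
      show "summable (\<lambda>k. C * r ^ k)" using r by (intro summable_mult summable_geometric) auto
      fix k :: nat
      have "f (p ^ k) \<le> (C * real (p ^ k) powr \<theta>) * real (p ^ k) powr (-c)"
        unfolding f_def using p by (intro mult_right_mono C) auto
      also have "\<dots> = C * real (p ^ k) powr (\<theta> - c)" by (simp flip: powr_add)
      also have "real (p ^ k) powr (\<theta> - c) = r ^ k"
        using p by (simp add: r_def powr_powr flip: powr_realpow) (simp add: mult.commute)
      finally show "norm (norm (f (p ^ k))) \<le> C * r ^ k" by (simp add: f_def)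
    qed
    thus ?thesis by (subst summable_on_reindex[OF inj]) (simp add: o_def)
  qed
  have SU: "f summable_on (\<Union>p\<in>P. range (\<lambda>k. p ^ k))" if "finite P" "P \<subseteq> {p. prime p}" for P
    using that by (induction P rule: finite_induct) (auto intro: summable_on_union sp)
  have "finite {p. prime p \<and> p \<le> N}" by (rule finite_subset[of _ "{..N}"]) auto
  hence "f summable_on (\<Union>p\<in>{p. prime p \<and> p \<le> N}. range (\<lambda>k. p ^ k))" by (rule SU) auto
  also have "?this \<longleftrightarrow> f summable_on UNIV"
  proof (rule summable_on_cong_neutral)
    fix n assume "n \<in> UNIV - (\<Union>p\<in>{p. prime p \<and> p \<le> N}. range (\<lambda>k. p ^ k))"
    moreover have "n \<in> (\<Union>p\<in>{p. prime p \<and> p \<le> N}. range (\<lambda>k. p ^ k))" if "f n \<noteq> 0"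
    proof -
      from that have "b n \<noteq> 0" by (auto simp: f_def)
      with assms(1) have "primepow n" by blast
      then obtain p k where "prime p" "k > 0" "n = p ^ k" by (auto simp: primepow_def)
      with \<open>b n \<noteq> 0\<close> assms(4) have "p \<le> N" by (meson not_le)
      with \<open>prime p\<close> \<open>n = p ^ k\<close> show ?thesis by auto
    qed
    ultimately show "f n = 0" by blast
  qed auto
  finally show ?thesis by (simp add: abs_conv_def f_def summable_on_UNIV_nonneg_real_iff)
qed

lemma series_one_conv: "abs_conv series_one c" 
  unfolding abs_conv_def by (rule summable_finite[of "{1}"]) (auto simp: series_one_def)

lemma dirichlet_series_one: "dirichlet_series series_one s = 1"
proof -
  have "dirichlet_series series_one s = (\<Sum>n\<in>{1}. series_one n * of_nat n powr (-s))"
    unfolding dirichlet_series_def by (rule suminf_finite) (auto simp: series_one_def)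
  thus ?thesis by (simp add: series_one_def)
qed

text \<open>A member of degree 0 is a Dirichlet polynomial. Its logarithm converges on \<open>Re s \<ge> 1/2\<close>
  because the Euler exponent \<open>\<theta>\<close> is below \<open>1/2\<close>, so by the functional equation \<open>1/F\<close> is entire and bounded.\<close>

lemma degree_zero_trivial:
  assumes a: "a \<in> selberg_class" "selberg_function a F" and fe: "functional_equation_with F \<epsilon> Q 0 w \<mu>"
    and conv: "\<And>c. abs_conv a c" and cont: "\<And>s. s \<noteq> 1 \<Longrightarrow> F s = dirichlet_series a s"
  shows "a = series_one"
proof -
  have Q: "Q > 0" using fe by (simp add: functional_equation_with_def)
  have hol: "dirichlet_series a holomorphic_on UNIV"
  proof -
    have "dirichlet_series a holomorphic_on (\<Union>n::nat. {s. Re s > - real n})"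
      by (intro holomorphic_on_UN_open holomorphic_dirichlet_series conv open_halfspace_Re_gt)
    also have "(\<Union>n::nat. {s. Re s > - real n}) = UNIV"
    proof -
      have "\<exists>n. Re s > - real n" for s using reals_Archimedean2[of "- Re s"] by (metis minus_less_iff)
      thus ?thesis by auto
    qed
    finally show ?thesis .
  qed
  \<comment> \<open>Without Gamma factors the functional equation relates the moduli by a pure power
    of Q.\<close>
  have refl: "norm (F (Complex (-A) t)) = Q powr (1 + 2 * A) * norm (F (Complex (1 + A) t))"
    if "Complex (-A) t \<noteq> 1" "Complex (-A) t \<noteq> 0" for A t
  proof -
    define s where "s = Complex (-A) t"
    have s': "cnj (1 - s) = Complex (1 + A) t" by (simp add: s_def complex_eq_iff)
    have "gamma_factor \<epsilon> Q 0 w \<mu> s * F s = cnj (gamma_factor \<epsilon> Q 0 w \<mu> (cnj (1 - s)) * F (cnj (1 - s)))"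
      by (rule functional_equation_at[OF selberg_function_holomorphic[OF a(2)] fe]) (use that in \<open>auto simp: s_def\<close>)
    hence "norm (gamma_factor \<epsilon> Q 0 w \<mu> s * F s) = norm (gamma_factor \<epsilon> Q 0 w \<mu> (cnj (1 - s)) * F (cnj (1 - s)))"
      by (simp only: complex_mod_cnj)
    moreover have "norm \<epsilon> = 1" using fe by (simp add: functional_equation_with_def)
    ultimately have "Q powr (-A) * norm (F s) = Q powr (1 + A) * norm (F (Complex (1 + A) t))"
      unfolding s' using Q by (simp add: gamma_factor_def norm_mult norm_powr_real_powr s_def)
    also have "Q powr (1 + A) = Q powr (-A) * Q powr (1 + 2 * A)"
      using powr_add[of Q "-A" "1 + 2 * A"] by (simp add: algebra_simps)
    finally show ?thesis using Q by (simp add: s_def)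
  qed
  obtain C where C: "C > 0" "\<And>s. Re s \<ge> 2 \<Longrightarrow> norm (dirichlet_series a s) \<le> C"
    using selberg_bounds_right[OF a(1)] by blast
  have coeff: "norm (a n) \<le> Q powr (1 + 2 * A) * C * real n powr (-A)" if "n \<ge> 1" "A \<ge> 1" for n A
  proof (rule dirichlet_coeff_bound[OF conv that(1)])
    fix t
    have "norm (dirichlet_series a (Complex (-A) t)) = Q powr (1 + 2 * A) * norm (dirichlet_series a (Complex (1 + A) t))"
      using refl[of A t] cont[of "Complex (-A) t"] cont[of "Complex (1+A) t"] that by (auto simp: complex_eq_iff)
    also have "\<dots> \<le> Q powr (1 + 2 * A) * C" using that by (intro mult_left_mono C) auto
    finally show "norm (dirichlet_series a (Complex (-A) t)) \<le> Q powr (1 + 2 * A) * C" .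
  qed
  \<comment> \<open>The bound is a constant times (Q^2 / n)^A with A arbitrarily large. So F is a
    Dirichlet polynomial of length at most Q^2.\<close>
  have a0: "a n = 0" if n: "real n > Q\<^sup>2" for n
  proof -
    have n1: "n \<ge> 1" using n Q by (cases n) auto
    have "norm (a n) \<le> Q * C * (Q\<^sup>2 / real n) powr A" if "A \<ge> 1" for A
    proof -
      have "Q powr (1 + 2 * A) = Q * (Q\<^sup>2) powr A"
        using Q by (simp add: powr_add powr_powr flip: powr_numeral)
      thus ?thesis using coeff[OF n1 that] Q n1 by (simp add: powr_divide powr_minus field_simps)
    qed
    moreover have "((\<lambda>A. Q * C * (Q\<^sup>2 / real n) powr A) \<longlongrightarrow> Q * C * 0) at_top"
    proof (intro tendsto_intros)
      have q: "Q\<^sup>2 / real n < 1" "Q\<^sup>2 / real n > 0" using n Q n1 by auto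
      define l where "l = ln (Q\<^sup>2 / real n)"
      have "l < 0" unfolding l_def using q by (intro ln_less_zero) auto
      hence "((\<lambda>A. exp (A * l)) \<longlongrightarrow> 0) at_top" by real_asymp
      thus "((\<lambda>A. (Q\<^sup>2 / real n) powr A) \<longlongrightarrow> 0) at_top" using q Q n1 by (simp add: powr_def l_def)
    qed
    ultimately have "norm (a n) \<le> Q * C * 0"
      by (intro tendsto_lowerbound[where F = "at_top :: real filter" and f = "\<lambda>A. Q * C * (Q\<^sup>2 / real n) powr A"])
         (auto intro: eventually_mono[OF eventually_ge_at_top[of 1]])
    thus ?thesis by simp
  qed
  \<comment> \<open>The coefficient at 1 does not vanish, so Q^2 \<ge> 1.\<close>
  have Q1: "Q \<ge> 1"
  proof (rule ccontr)
    assume "\<not> Q \<ge> 1"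
    hence "Q\<^sup>2 < 1\<^sup>2" using Q by (intro power_strict_mono) auto
    with a0[of 1] selberg_class_1[OF a(1)] show False by simp
  qed
  obtain N :: nat where N: "real N \<ge> Q\<^sup>2" using real_arch_simple by blast
  obtain b \<theta> where b: "\<And>n. \<not> primepow n \<Longrightarrow> b n = 0" "\<theta> < 1/2"
    "(\<lambda>n. norm (b n)) \<in> O(\<lambda>n. real n powr \<theta>)"
    "\<And>s. Re s > 1 \<Longrightarrow> exp (dirichlet_series b s) = dirichlet_series a s" "abs_conv b (3/2)"
    using euler_product_logE[OF a(1)] by metis
  \<comment> \<open>All powers of a prime p > N lie beyond the length of the polynomial, so such a
    prime has trivial Euler coefficients. With finitely many primes left, \<theta> < 1/2 gives
    convergence at 1/2.\<close>
  have "b (p ^ k) = 0" if p: "prime p" "p > N" "k > 0" for p k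
  proof (rule euler_coeff_primepow_zero[OF a(1) b(5,4) p(1,3)])
    fix j :: nat assume "j > 0"
    have "N < p" by fact
    also have "p \<le> p ^ j" using \<open>j > 0\<close> prime_ge_1_nat[OF p(1)] by (simp add: self_le_power)
    finally show "a (p ^ j) = 0" using N by (intro a0) (meson le_less_trans of_nat_less_iff)
  qed auto
  hence bconv: "abs_conv b (1/2)" by (intro abs_conv_finite_primes[OF b(1,3,2)]) auto
  define B where "B = (\<Sum>n. norm (b n) * real n powr (-(1/2)))"
  have right: "norm (dirichlet_series a s) \<ge> exp (-B)" if "Re s > 1/2" for s
  proof -
    have "exp (dirichlet_series b s) = dirichlet_series a s"
    proof (rule analytic_continuation_open[of "{s. Re s > 1}" "{s. Re s > 1/2}" "\<lambda>s. exp (dirichlet_series b s)"])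
      show "open {s. Re s > 1}" "open {s. Re s > 1/2}" by (rule open_halfspace_Re_gt)+
      have "2 \<in> {s. Re s > 1}" by simp
      thus "{s. Re s > 1} \<noteq> {}" by blast
      show "connected {s. Re s > 1/2}" by (intro convex_connected convex_halfspace_Re_gt)
      show "(\<lambda>s. exp (dirichlet_series b s)) holomorphic_on {s. Re s > 1/2}"
        by (intro holomorphic_intros holomorphic_on_compose[unfolded o_def, of _ _ exp] holomorphic_dirichlet_series bconv)
      show "dirichlet_series a holomorphic_on {s. Re s > 1/2}" by (rule holomorphic_on_subset[OF hol]) auto
    qed (use b(4) that in auto)
    hence "norm (dirichlet_series a s) = exp (Re (dirichlet_series b s))" by (metis norm_exp_eq_Re)
    moreover have "norm (dirichlet_series b s) \<le> B"
      unfolding B_def by (rule norm_dirichlet_series_le[OF bconv]) (use that in auto)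
    hence "\<bar>Re (dirichlet_series b s)\<bar> \<le> B" using abs_Re_le_cmod order_trans by blast
    ultimately show ?thesis by auto
  qed
  \<comment> \<open>Points left of the critical line are reflected to the right, which multiplies
    the modulus by a nonnegative power of Q. The line itself is left out because the lower bound is
    for Re s > 1/2, and 0 because the functional equation is evaluated off 0.\<close>
  have away: "norm (dirichlet_series a s) \<ge> exp (-B)" if "Re s \<noteq> 1/2" "s \<noteq> 0" for s
  proof (cases "Re s > 1/2")
    case False
    define A t where "A = - Re s" and "t = Im s"
    have s: "s = Complex (-A) t" by (simp add: A_def t_def complex_eq_iff)
    have A: "A > -1/2" using False that by (auto simp: A_def)
    have s1: "s \<noteq> 1" and s2: "Complex (1 + A) t \<noteq> 1" using False that s by (auto simp: complex_eq_iff)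
    have "exp (-B) \<le> 1 * norm (dirichlet_series a (Complex (1 + A) t))" using right[of "Complex (1 + A) t"] A by simp
    also have "\<dots> \<le> Q powr (1 + 2 * A) * norm (dirichlet_series a (Complex (1 + A) t))"
      using Q1 A by (intro mult_right_mono ge_one_powr_ge_zero) auto
    also have "\<dots> = norm (dirichlet_series a s)"
      using refl[of A t] cont[OF s1] cont[OF s2] s1 that(2) s by simp
    finally show ?thesis .
  qed (use right in auto)
  \<comment> \<open>The omitted points are approached horizontally, and continuity carries the bound
    over.\<close>
  have all: "norm (dirichlet_series a s) \<ge> exp (-B)" for s
  proof -
    have "isCont (dirichlet_series a) s"
      using holomorphic_on_imp_continuous_on[OF hol] by (simp add: continuous_on_eq_continuous_at)
    hence "((\<lambda>x. norm (dirichlet_series a (s + of_real x))) \<longlongrightarrow> norm (dirichlet_series a (s + of_real 0))) (at_right 0)"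
      by (intro tendsto_norm isCont_tendsto_compose[of _ "dirichlet_series a"] tendsto_intros) auto
    moreover have "eventually (\<lambda>x. x \<noteq> 1/2 - Re s \<and> x \<noteq> - Re s) (at_right 0)"
      by (intro eventually_conj eventually_neq_at_within)
    hence "eventually (\<lambda>x. exp (-B) \<le> norm (dirichlet_series a (s + of_real x))) (at_right 0)"
      by eventually_elim (intro away, auto simp: complex_eq_iff)
    ultimately show ?thesis by (intro tendsto_lowerbound[where f = "\<lambda>x. norm (dirichlet_series a (s + of_real x))"]) auto
  qed
  have nz: "dirichlet_series a s \<noteq> 0" for s using all[of s] exp_gt_zero[of "-B"] by (metis norm_zero not_le)
  have "(\<lambda>z. inverse (dirichlet_series a z)) constant_on UNIV"
  proof (rule Liouville_theorem)
    show "(\<lambda>z. inverse (dirichlet_series a z)) holomorphic_on UNIV" using nz by (intro holomorphic_intros hol) auto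
    show "bounded (range (\<lambda>z. inverse (dirichlet_series a z)))"
      unfolding bounded_iff
    proof (intro exI[of _ "exp B"] ballI, clarify)
      fix z
      have "norm (inverse (dirichlet_series a z)) \<le> inverse (exp (-B))"
        unfolding norm_inverse by (intro le_imp_inverse_le all) auto
      thus "norm (inverse (dirichlet_series a z)) \<le> exp B" by (simp add: exp_minus)
    qed
  qed
  then obtain c where c: "\<And>z. inverse (dirichlet_series a z) = c" by (auto simp: constant_on_def)
  have const: "dirichlet_series a z = inverse c" for z using c[of z] by (metis inverse_inverse_eq)
  have "a n = inverse c * series_one n" if "n \<ge> 1" for n
  proof (rule dirichlet_series_unique[OF conv _ that])
    show conv': "abs_conv (\<lambda>n. inverse c * series_one n) 0"
      unfolding abs_conv_def by (rule summable_finite[of "{1}"]) (auto simp: series_one_def)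
    fix t
    have "dirichlet_series (\<lambda>n. inverse c * series_one n) (Complex 0 t) =
            (\<Sum>n\<in>{1}. inverse c * series_one n * of_nat n powr (- Complex 0 t))"
      unfolding dirichlet_series_def by (rule suminf_finite) (auto simp: series_one_def)
    thus "dirichlet_series a (Complex 0 t) = dirichlet_series (\<lambda>n. inverse c * series_one n) (Complex 0 t)"
      by (simp add: const series_one_def)
  qed
  from this[of 1] this show ?thesis
    using selberg_class_0[OF a(1)] selberg_class_1[OF a(1)]
    by (auto simp: fun_eq_iff series_one_def Suc_le_eq) (metis neq0_conv One_nat_def)+
qed

section \<open>Factorization into primitive functions\<close>

text \<open>A half-degree below 1/6 is 0, and a sum of positive weights is 0 only if there are none.
  This leaves an empty product of Gamma factors.\<close>

lemma small_degree_trivial: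
  assumes a: "a \<in> selberg_class" "selberg_function a F" and fe: "functional_equation_with F \<epsilon> Q k w \<mu>"
    and small: "6 * (\<Sum>i<k. w i) < 1"
  shows "a = series_one"
proof -
  have w: "w i > 0" if "i < k" for i using fe that by (simp add: functional_equation_with_def)
  have nonneg: "(\<Sum>i<k. w i) \<ge> 0" using w by (intro sum_nonneg) (auto intro: less_imp_le)
  note deg = a degree_boundsI[OF a fe] nonneg small of_nat_0_le_iff
  have "k = 0"
  proof (rule ccontr)
    assume "k \<noteq> 0"
    hence "(\<Sum>i<k. w i) > 0" using w by (intro sum_pos) auto
    thus False using small_degree_eq_0[OF deg] by simp
  qed
  hence fe0: "functional_equation_with F \<epsilon> Q 0 w \<mu>" using fe by simp
  show ?thesis
  proof (rule degree_zero_trivial[OF a fe0 small_degree_abs_conv[OF deg]])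
    show "F s = dirichlet_series a s" if "s \<noteq> 1" for s
      by (rule selberg_function_continuation[OF a(2) small_degree_abs_conv[OF deg, of "Re s - 1"]]) (use that in auto)
  qed
qed

text \<open>A relation and not a function, because D is taken from whichever functional equation is
  at hand. The middle clause packages the gap between 0 and 1/6 that makes factorizations
  finite.\<close>

definition has_degree :: "(nat \<Rightarrow> complex) \<Rightarrow> real \<Rightarrow> bool" where
  "has_degree a D \<longleftrightarrow> D \<ge> 0 \<and> (6 * D < 1 \<longrightarrow> a = series_one) \<and>
     (\<exists>F K. selberg_function a F \<and> degree_bounds F D K)"

lemma has_degree_exists:
  assumes "a \<in> selberg_class"
  shows "\<exists>D. has_degree a D"
proof -
  obtain F where F: "selberg_function a F" using assms by (rule selberg_classE)
  then obtain \<epsilon> Q k w \<mu> where fe: "functional_equation_with F \<epsilon> Q k w \<mu>"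
    by (auto simp: selberg_function_def selberg_functional_equation_iff)
  have "(\<Sum>i<k. w i) \<ge> 0"
    using fe by (intro sum_nonneg) (auto simp: functional_equation_with_def intro: less_imp_le)
  hence "has_degree a (\<Sum>i<k. w i)"
    unfolding has_degree_def
    using degree_boundsI[OF assms F fe] small_degree_trivial[OF assms F fe] F by blast
  thus ?thesis ..
qed

text \<open>On the line Re s = -A the exponents differ by (D1 + D2 - D) (1 + 2A), up to the fixed
  slack K + K1 + K2. A positive difference would win for large A.\<close>

lemma degree_superadditive:
  assumes "degree_bounds F D K" "degree_bounds F1 D1 K1" "degree_bounds F2 D2 K2"
    and mult: "\<And>s. s \<noteq> 1 \<Longrightarrow> F s = F1 s * F2 s"
  shows "D1 + D2 \<le> D"
proof (rule ccontr)
  assume "\<not> D1 + D2 \<le> D"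
  define d where "d = D1 + D2 - D"
  have d: "d > 0" using \<open>\<not> D1 + D2 \<le> D\<close> by (simp add: d_def)
  define A where "A = max 1 ((K + K1 + K2) / d)"
  have A: "A \<ge> 1" "A \<ge> (K + K1 + K2) / d" by (auto simp: A_def)
  define e where "e = d * (1 + 2 * A) - (K + K1 + K2)"
  have "d * A \<ge> K + K1 + K2" using A d by (simp add: field_simps)
  moreover have "d * A > 0" using d A by auto
  ultimately have e: "e > 0" using d by (simp add: e_def algebra_simps)
  obtain C T where 0: "C > 0" "T \<ge> 1" "\<And>t. \<bar>t\<bar> \<ge> T \<Longrightarrow> norm (F (Complex (-A) t)) \<le> C * \<bar>t\<bar> powr (D * (1 + 2 * A) + K)"
    using assms(1) A(1) unfolding degree_bounds_def by metis
  obtain c1 T1 where 1: "c1 > 0" "T1 \<ge> 1" "\<And>t. \<bar>t\<bar> \<ge> T1 \<Longrightarrow> c1 * \<bar>t\<bar> powr (D1 * (1 + 2 * A) - K1) \<le> norm (F1 (Complex (-A) t))"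
    using assms(2) A(1) unfolding degree_bounds_def by metis
  obtain c2 T2 where 2: "c2 > 0" "T2 \<ge> 1" "\<And>t. \<bar>t\<bar> \<ge> T2 \<Longrightarrow> c2 * \<bar>t\<bar> powr (D2 * (1 + 2 * A) - K2) \<le> norm (F2 (Complex (-A) t))"
    using assms(3) A(1) unfolding degree_bounds_def by metis
  have bound: "c1 * c2 * t powr e \<le> C" if t: "t \<ge> T" "t \<ge> T1" "t \<ge> T2" for t
  proof -
    have tp: "t > 0" "\<bar>t\<bar> = t" using t 0(2) by auto
    define X where "X = t powr (D * (1 + 2 * A) + K)"
    have X: "X > 0" using tp by (simp add: X_def)
    have "(c1 * t powr (D1 * (1 + 2 * A) - K1)) * (c2 * t powr (D2 * (1 + 2 * A) - K2)) \<le>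
            norm (F1 (Complex (-A) t)) * norm (F2 (Complex (-A) t))"
      using 1(1) 1(3)[of t] 2(1) 2(3)[of t] t tp by (intro mult_mono) auto
    also have "\<dots> = norm (F (Complex (-A) t))"
      using A(1) by (subst mult) (auto simp: norm_mult complex_eq_iff)
    also have "\<dots> \<le> C * X" using 0(3)[of t] t tp by (simp add: X_def)
    also have "(c1 * t powr (D1 * (1 + 2 * A) - K1)) * (c2 * t powr (D2 * (1 + 2 * A) - K2)) = c1 * c2 * t powr e * X"
      by (simp add: X_def e_def d_def powr_add[symmetric] algebra_simps)
    finally show ?thesis using X by simp
  qed
  have "filterlim (\<lambda>t::real. (c1 * c2) * t powr e) at_top at_top"
    using e mult_pos_pos[OF 1(1) 2(1)] by real_asymp
  hence "eventually (\<lambda>t. (c1 * c2) * t powr e > C) at_top" by (simp add: filterlim_at_top_dense)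
  moreover have "eventually (\<lambda>t::real. t \<ge> T \<and> t \<ge> T1 \<and> t \<ge> T2) at_top"
    by (intro eventually_conj eventually_ge_at_top)
  ultimately have "eventually (\<lambda>t::real. False) at_top"
    by eventually_elim (use bound in force)
  thus False by simp
qed

text \<open>Degrees are growth rates of the continuations, so the identity of series is first
  extended to the plane without the point 1.\<close>

lemma has_degree_product:
  assumes "has_degree a D" "has_degree b D1" "has_degree c D2"
    and prod: "\<And>s. Re s > 1 \<Longrightarrow> dirichlet_series a s = dirichlet_series b s * dirichlet_series c s"
  shows "D1 + D2 \<le> D"
proof -
  obtain F K where F: "selberg_function a F" "degree_bounds F D K" using assms(1) by (auto simp: has_degree_def)
  obtain F1 K1 where F1: "selberg_function b F1" "degree_bounds F1 D1 K1" using assms(2) by (auto simp: has_degree_def)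
  obtain F2 K2 where F2: "selberg_function c F2" "degree_bounds F2 D2 K2" using assms(3) by (auto simp: has_degree_def)
  show ?thesis
  proof (rule degree_superadditive[OF F(2) F1(2) F2(2)])
    fix s :: complex assume s: "s \<noteq> 1"
    show "F s = F1 s * F2 s"
    proof (rule analytic_continuation_open[of "{s. Re s > 1}" "-{1}" F "\<lambda>s. F1 s * F2 s"])
      show "open {s. Re s > 1}" by (rule open_halfspace_Re_gt)
      have "2 \<in> {s. Re s > 1}" by simp
      thus "{s. Re s > 1} \<noteq> {}" by blast
      show "connected (-{1::complex})"
        using connected_open_delete[OF open_UNIV connected_UNIV, of "1::complex"] by (simp add: Compl_eq_Diff_UNIV)
      show "F holomorphic_on -{1}" by (rule selberg_function_holomorphic[OF F(1)])
      show "(\<lambda>s. F1 s * F2 s) holomorphic_on -{1}"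
        by (rule holomorphic_on_mult[OF selberg_function_holomorphic[OF F1(1)] selberg_function_holomorphic[OF F2(1)]])
      show "F z = F1 z * F2 z" if "z \<in> {s. Re s > 1}" for z
        using that prod[of z] by (simp add: selberg_function_eq[OF F(1)] selberg_function_eq[OF F1(1)] selberg_function_eq[OF F2(1)])
    qed (use s in auto)
  qed
qed

section \<open>Existence of factorizations\<close>

lemma prod_lessThan_add:
  fixes h :: "nat \<Rightarrow> 'a::comm_monoid_mult"
  shows "prod h {..<m + n} = prod h {..<m} * (\<Prod>i<n. h (m + i))"
  by (induction n) (simp_all add: mult_ac)

definition factorization :: "(nat \<Rightarrow> complex) \<Rightarrow> nat \<Rightarrow> (nat \<Rightarrow> nat \<Rightarrow> complex) \<Rightarrow> bool" where
  "factorization a k f \<longleftrightarrow> (\<forall>i<k. selberg_primitive (f i)) \<and>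
     (\<forall>s. Re s > 1 \<longrightarrow> dirichlet_series a s = (\<Prod>i<k. dirichlet_series (f i) s))"

text \<open>Induction on a natural number above 6D. A proper factorization has 6 D1 \<ge> 1 and 6 D2
  \<ge> 1, so by superadditivity each factor lies at least one unit lower.\<close>

theorem factorization_exists:
  assumes "a \<in> selberg_class"
  shows "\<exists>k f. factorization a k f"
proof -
  have "\<exists>k f. factorization a k f" if "a \<in> selberg_class" "has_degree a D" "6 * D < real n" for a D n
    using that
  proof (induction n arbitrary: a D rule: nat_induct)
    case 0
    thus ?case by (simp add: has_degree_def)
  next
    case (Suc n)
    consider "a = series_one" | "selberg_primitive a" | "a \<noteq> series_one" "\<not> selberg_primitive a" by blast
    thus ?case
    proof cases
      case 1
      thus ?thesis by (intro exI[of _ 0]) (simp add: factorization_def dirichlet_series_one)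
    next
      case 2
      thus ?thesis by (intro exI[of _ 1] exI[of _ "\<lambda>_. a"]) (simp add: factorization_def)
    next
      case 3
      then obtain b c where bc: "b \<in> selberg_class" "c \<in> selberg_class" "b \<noteq> series_one" "c \<noteq> series_one"
        "\<And>s. Re s > 1 \<Longrightarrow> dirichlet_series a s = dirichlet_series b s * dirichlet_series c s"
        using Suc.prems(1) by (auto simp: selberg_primitive_def)
      obtain D1 D2 where D: "has_degree b D1" "has_degree c D2" using has_degree_exists bc by metis
      have "D1 + D2 \<le> D" by (rule has_degree_product[OF Suc.prems(2) D bc(5)])
      moreover have "6 * D1 \<ge> 1" "6 * D2 \<ge> 1" using D bc(3,4) by (auto simp: has_degree_def)
      ultimately have "6 * D1 < real n" "6 * D2 < real n" using Suc.prems(3) by auto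
      then obtain k1 f1 k2 f2 where f: "factorization b k1 f1" "factorization c k2 f2"
        using Suc.IH bc(1,2) D by metis
      define h where "h = (\<lambda>i. if i < k1 then f1 i else f2 (i - k1))"
      have "factorization a (k1 + k2) h"
        unfolding factorization_def
      proof (intro conjI allI impI)
        fix i assume "i < k1 + k2"
        thus "selberg_primitive (h i)" using f by (auto simp: h_def factorization_def)
      next
        fix s :: complex assume s: "Re s > 1"
        have "(\<Prod>i<k1 + k2. dirichlet_series (h i) s) = (\<Prod>i<k1. dirichlet_series (f1 i) s) * (\<Prod>i<k2. dirichlet_series (f2 i) s)"
          unfolding prod_lessThan_add by (intro arg_cong2[of _ _ _ _ "(*)"] prod.cong) (auto simp: h_def)
        thus "dirichlet_series a s = (\<Prod>i<k1 + k2. dirichlet_series (h i) s)"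
          using f s bc(5)[OF s] by (simp add: factorization_def)
      qed
      thus ?thesis by blast
    qed
  qed
  moreover obtain D where "has_degree a D" using has_degree_exists[OF assms] ..
  moreover obtain n where "6 * D < real n" using reals_Archimedean2 by blast
  ultimately show ?thesis using assms by blast
qed

section \<open>Coefficients of products at primes\<close>

lemma primitive_in_class: "selberg_primitive a \<Longrightarrow> a \<in> selberg_class"
  by (simp add: selberg_primitive_def)

text \<open>The sequence of the product is built by repeated convolution, without asking whether the
  product lies in the class. As all leading coefficients are 1, the coefficients at primes
  add.\<close>

lemma product_series:
  fixes k :: nat
  assumes "\<And>i. i < k \<Longrightarrow> f i \<in> selberg_class"
  shows "\<exists>g. g 1 = 1 \<and> (\<forall>c>1. abs_conv g c) \<and>
           (\<forall>s. Re s > 1 \<longrightarrow> dirichlet_series g s = (\<Prod>i<k. dirichlet_series (f i) s)) \<and>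
           (\<forall>p. prime p \<longrightarrow> g p = (\<Sum>i<k. f i p))"
  using assms
proof (induction k)
  case 0
  show ?case
  proof (intro exI[of _ series_one] conjI allI impI)
    show "series_one p = (\<Sum>i<0. f i p)" if "prime p" for p
      using prime_gt_1_nat[OF that] by (simp add: series_one_def)
  qed (simp_all add: series_one_conv dirichlet_series_one, simp add: series_one_def)
next
  case (Suc k)
  then obtain g where g: "g 1 = 1" "\<And>c. c > 1 \<Longrightarrow> abs_conv g c"
    "\<And>s. Re s > 1 \<Longrightarrow> dirichlet_series g s = (\<Prod>i<k. dirichlet_series (f i) s)"
    "\<And>p. prime p \<Longrightarrow> g p = (\<Sum>i<k. f i p)" by force
  have fk: "f k \<in> selberg_class" using Suc.prems by simp
  show ?case
  proof (intro exI[of _ "dconv g (f k)"] conjI allI impI)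
    show "dconv g (f k) 1 = 1" unfolding dconv_1 using g(1) selberg_class_1[OF fk] by simp
    show "abs_conv (dconv g (f k)) c" if "c > 1" for c
      by (intro abs_conv_dconv g(2) selberg_abs_conv[OF fk] that)
    show "dirichlet_series (dconv g (f k)) s = (\<Prod>i<Suc k. dirichlet_series (f i) s)" if "Re s > 1" for s
      using dirichlet_series_dconv[OF g(2)[OF that] selberg_abs_conv[OF fk that], of s] g(3)[OF that] by simp
    show "dconv g (f k) p = (\<Sum>i<Suc k. f i p)" if "prime p" for p
      using g(1) g(4)[OF that] selberg_class_1[OF fk] by (simp add: dconv_prime[OF that])
  qed
qed

text \<open>Index 0 is invisible to the series; there the normalisation a(0) = 0 decides.\<close>

lemma selberg_class_eqI:
  assumes "a \<in> selberg_class" "b \<in> selberg_class" "\<And>s. Re s > 1 \<Longrightarrow> dirichlet_series a s = dirichlet_series b s"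
  shows "a = b"
proof
  fix n
  show "a n = b n"
  proof (cases "n = 0")
    case False
    show ?thesis
      by (rule dirichlet_series_unique[OF selberg_abs_conv[OF assms(1), of 2] selberg_abs_conv[OF assms(2), of 2]])
         (use False in \<open>auto intro!: assms(3)\<close>)
  qed (simp add: assms selberg_class_0)
qed

lemma factorization_coeff_prime:
  assumes "a \<in> selberg_class" "factorization a k f" "prime p"
  shows "a p = (\<Sum>i<k. f i p)"
proof -
  obtain g where g: "\<And>c. c > 1 \<Longrightarrow> abs_conv g c"
    "\<And>s. Re s > 1 \<Longrightarrow> dirichlet_series g s = (\<Prod>i<k. dirichlet_series (f i) s)"
    "\<And>p. prime p \<Longrightarrow> g p = (\<Sum>i<k. f i p)"
    using product_series[of k f] assms(2) primitive_in_class by (metis factorization_def)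
  have "a p = g p"
  proof (rule dirichlet_series_unique[OF selberg_abs_conv[OF assms(1), of 2] g(1)[of 2]])
    fix t show "dirichlet_series a (Complex 2 t) = dirichlet_series g (Complex 2 t)"
      using assms(2) g(2)[of "Complex 2 t"] by (simp add: factorization_def)
  qed (use prime_ge_1_nat[OF assms(3)] in auto)
  thus ?thesis using g(3)[OF assms(3)] by simp
qed

section \<open>The index and primitivity\<close>

lemma bigo_1_iff: "f \<in> O[F](\<lambda>_. 1) \<longleftrightarrow> (\<exists>C. eventually (\<lambda>x. norm (f x) \<le> C) F)"
  for f :: "'a \<Rightarrow> 'b::real_normed_field"
  by (auto elim!: landau_o.bigE intro: bigoI)

lemma selberg_index_unique:
  assumes "selberg_index a m" "selberg_index a n"
  shows "m = n"
proof (rule ccontr)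
  assume "m \<noteq> n"
  let ?S = "\<lambda>x::real. \<Sum>p | prime p \<and> real p \<le> x. (norm (a p))\<^sup>2 / real p"
  have "(\<lambda>x. (?S x - of_int n * ln (ln x)) - (?S x - of_int m * ln (ln x))) \<in> O[at_top](\<lambda>_. 1)"
    using assms unfolding selberg_index_def by (rule_tac sum_in_bigo(2))
  hence "(\<lambda>x::real. of_int (m - n) * ln (ln x)) \<in> O[at_top](\<lambda>_. 1)" by (simp add: algebra_simps)
  then obtain C where C: "eventually (\<lambda>x::real. \<bar>of_int (m - n) * ln (ln x)\<bar> \<le> C) at_top"
    unfolding bigo_1_iff real_norm_def by blast
  have "filterlim (\<lambda>x::real. ln (ln x)) at_top at_top" by real_asymp
  hence "eventually (\<lambda>x::real. ln (ln x) > \<bar>C\<bar>) at_top" by (simp add: filterlim_at_top_dense)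
  with C have "eventually (\<lambda>x::real. False) at_top"
  proof eventually_elim
    case (elim x)
    have "1 \<le> \<bar>of_int (m - n) :: real\<bar>" using \<open>m \<noteq> n\<close> by linarith
    hence "1 * ln (ln x) \<le> \<bar>of_int (m - n)\<bar> * ln (ln x)" using elim by (intro mult_right_mono) auto
    also have "\<dots> = \<bar>of_int (m - n) * ln (ln x)\<bar>" using elim by (simp add: abs_mult)
    finally show ?case using elim by linarith
  qed
  thus False by simp
qed

lemma finite_primes_le: "finite {p::nat. prime p \<and> real p \<le> x}"
  by (rule finite_subset[of _ "{..nat \<lfloor>x\<rfloor>}"]) (auto simp: le_nat_floor)

text \<open>Expand the square of the sum of the f_i(p) into pairs. A pair of equal functions
  contributes ln (ln x), a pair of different ones stays bounded. The index is thus the number of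
  ordered pairs of equal factors, that is, the sum of the squared multiplicities.\<close>

lemma factorization_index_orthonormal:
  assumes a: "a \<in> selberg_class" "factorization a k f"
    and orth: "\<And>i j. i < k \<Longrightarrow> j < k \<Longrightarrow> f i \<noteq> f j \<Longrightarrow>
        (\<lambda>x::real. \<Sum>p | prime p \<and> real p \<le> x. f i p * cnj (f j p) / of_nat p) \<in> O[at_top](\<lambda>_. 1)"
    and norm1: "\<And>i. i < k \<Longrightarrow> selberg_index (f i) 1"
  shows "selberg_index a (int (card {(i,j). i < k \<and> j < k \<and> f i = f j}))"
proof -
  define P where "P = (\<lambda>x::real. {p::nat. prime p \<and> real p \<le> x})"
  define I where "I = (\<lambda>i j x. \<Sum>p\<in>P x. f i p * cnj (f j p) / of_nat p)"
  define d where "d = (\<lambda>i j. if f i = f j then 1 else 0 :: real)"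
  have Iij: "(\<lambda>x. I i j x - of_real (d i j * ln (ln x))) \<in> O[at_top](\<lambda>_. 1)" if "i < k" "j < k" for i j
  proof (cases "f i = f j")
    case False
    thus ?thesis using orth[OF that] by (simp add: I_def d_def P_def)
  next
    case True
    have "I i j x - of_real (d i j * ln (ln x)) = of_real ((\<Sum>p\<in>P x. (norm (f i p))\<^sup>2 / real p) - of_int 1 * ln (ln x))" for x
      using True by (simp add: I_def d_def complex_norm_square flip: of_real_power)
    moreover have "(\<lambda>x. complex_of_real ((\<Sum>p\<in>P x. (norm (f i p))\<^sup>2 / real p) - of_int 1 * ln (ln x))) \<in> O[at_top](\<lambda>_. 1)"
      using norm1[OF that(1)] unfolding selberg_index_def P_def bigo_1_iff norm_of_real real_norm_def .
    ultimately show ?thesis by simp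
  qed
  have "(\<lambda>x. \<Sum>i<k. \<Sum>j<k. I i j x - of_real (d i j * ln (ln x))) \<in> O[at_top](\<lambda>_. 1)"
    by (intro big_sum_in_bigo Iij) auto
  also have "(\<lambda>x. \<Sum>i<k. \<Sum>j<k. I i j x - of_real (d i j * ln (ln x))) =
             (\<lambda>x. of_real ((\<Sum>p\<in>P x. (norm (a p))\<^sup>2 / real p) - (\<Sum>i<k. \<Sum>j<k. d i j) * ln (ln x)))"
  proof
    fix x
    have "(\<Sum>i<k. \<Sum>j<k. I i j x) = (\<Sum>p\<in>P x. (\<Sum>i<k. \<Sum>j<k. f i p * cnj (f j p)) / of_nat p)"
      unfolding I_def sum_divide_distrib
      by (subst sum.swap, subst (2) sum.swap) (simp add: sum.swap[of _ _ "P x"])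
    also have "\<dots> = (\<Sum>p\<in>P x. of_real ((norm (a p))\<^sup>2 / real p))"
    proof (rule sum.cong)
      fix p assume "p \<in> P x"
      hence "a p = (\<Sum>i<k. f i p)" by (intro factorization_coeff_prime[OF a]) (auto simp: P_def)
      hence "(\<Sum>i<k. \<Sum>j<k. f i p * cnj (f j p)) = a p * cnj (a p)"
        by (simp add: sum_product)
      thus "(\<Sum>i<k. \<Sum>j<k. f i p * cnj (f j p)) / of_nat p = of_real ((norm (a p))\<^sup>2 / real p)"
        by (simp add: complex_norm_square flip: of_real_power)
    qed simp
    finally have "(\<Sum>i<k. \<Sum>j<k. I i j x) = of_real (\<Sum>p\<in>P x. (norm (a p))\<^sup>2 / real p)" by simp
    thus "(\<Sum>i<k. \<Sum>j<k. I i j x - of_real (d i j * ln (ln x))) =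
        of_real ((\<Sum>p\<in>P x. (norm (a p))\<^sup>2 / real p) - (\<Sum>i<k. \<Sum>j<k. d i j) * ln (ln x))"
      by (simp add: sum_subtractf sum_distrib_right)
  qed
  also have "(\<Sum>i<k. \<Sum>j<k. d i j) = of_int (int (card {(i,j). i < k \<and> j < k \<and> f i = f j}))"
  proof -
    have "(\<Sum>i<k. \<Sum>j<k. d i j) = (\<Sum>z\<in>{..<k} \<times> {..<k}. d (fst z) (snd z))"
      by (simp add: sum.cartesian_product case_prod_unfold)
    also have "\<dots> = (\<Sum>z\<in>{(i,j). i < k \<and> j < k \<and> f i = f j}. 1)"
      by (rule sum.mono_neutral_cong_right) (auto simp: d_def)
    finally show ?thesis by simp
  qed
  finally show ?thesis
    unfolding selberg_index_def P_def bigo_1_iff norm_of_real real_norm_def .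
qed

text \<open>Conjecture (B) assigns index 1 to a primitive function only in the presence of a
  different one, hence the case distinction. If two factors differ, orthonormality applies. If all k
  factors equal one function of index n, then k^2 n = 1 with n an integer by (A).\<close>

lemma index_one_primitive:
  assumes A: "selberg_conjecture_A" and B: "selberg_conjecture_B"
    and a: "a \<in> selberg_class" "selberg_index a 1"
  shows "selberg_primitive a"
proof -
  obtain k f where f: "factorization a k f" using factorization_exists[OF a(1)] by blast
  have prim: "selberg_primitive (f i)" if "i < k" for i using f that by (simp add: factorization_def)
  have "k = 1"
  proof (cases "\<exists>i<k. \<exists>j<k. f i \<noteq> f j")
    case True
    have norm1: "selberg_index (f i) 1" if i: "i < k" for i
    proof -
      obtain j where "j < k" "f i \<noteq> f j" using True i by metis
      thus ?thesis using B prim i unfolding selberg_conjecture_B_def by blast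
    qed
    have "selberg_index a (int (card {(i,j). i < k \<and> j < k \<and> f i = f j}))"
      by (rule factorization_index_orthonormal[OF a(1) f])
         (use B prim norm1 in \<open>auto simp: selberg_conjecture_B_def\<close>)
    with a(2) have "card {(i,j). i < k \<and> j < k \<and> f i = f j} = 1" using selberg_index_unique by force
    \<comment> \<open>The diagonal pairs alone number k, so index 1 allows a single factor, contrary
      to the presence of two different ones.\<close>
    moreover have "card ((\<lambda>i. (i,i)) ` {..<k}) \<le> card {(i,j). i < k \<and> j < k \<and> f i = f j}"
      by (rule card_mono) (auto intro: finite_subset[of _ "{..<k} \<times> {..<k}"])
    moreover have "card ((\<lambda>i. (i,i)) ` {..<k}) = k" by (subst card_image) (auto simp: inj_on_def)
    ultimately have "k \<le> 1" by simp
    with True show ?thesis by (cases k) auto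
  next
    case False
    show ?thesis
    proof (cases "k = 0")
      \<comment> \<open>The empty product would have index 0.\<close>
      case True
      have "selberg_index a 0"
      proof -
        have "a p = 0" if "prime p" for p using factorization_coeff_prime[OF a(1) f that] True by simp
        hence "(\<Sum>p | prime p \<and> real p \<le> x. (norm (a p))\<^sup>2 / real p) = 0" for x by (intro sum.neutral) auto
        thus ?thesis by (simp add: selberg_index_def)
      qed
      with a(2) selberg_index_unique show ?thesis by force
    next
      case k: False
      obtain n where n: "selberg_index (f 0) n"
        using A prim[of 0] k primitive_in_class by (auto simp: selberg_conjecture_A_def)
      have fi: "f i = f 0" if "i < k" for i using False k that by blast
      have ap: "a p = of_nat k * f 0 p" if "prime p" for p
      proof -
        have "a p = (\<Sum>i<k. f i p)" by (rule factorization_coeff_prime[OF a(1) f that])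
        also have "\<dots> = (\<Sum>i<k. f 0 p)" by (intro sum.cong fun_cong[OF fi] refl) auto
        finally show ?thesis by simp
      qed
      have "(\<Sum>p | prime p \<and> real p \<le> x. (norm (a p))\<^sup>2 / real p) - of_int (int (k\<^sup>2) * n) * ln (ln x) =
            real (k\<^sup>2) * ((\<Sum>p | prime p \<and> real p \<le> x. (norm (f 0 p))\<^sup>2 / real p) - of_int n * ln (ln x))" for x
        by (simp add: ap norm_mult power_mult_distrib sum_distrib_left algebra_simps cong: sum.cong)
           (rule sum.cong, auto simp: ap norm_mult power_mult_distrib)
      hence "selberg_index a (int (k\<^sup>2) * n)"
        using n unfolding selberg_index_def by (simp add: landau_o.big.cmult_in_iff')
      hence "int (k\<^sup>2) * n = 1" using selberg_index_unique[OF _ a(2)] by blast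
      hence "int (k\<^sup>2) dvd 1" by (metis dvd_triv_left)
      hence "(int k)\<^sup>2 = 1" by simp
      hence "int k = 1 \<or> int k = -1" by (simp only: power2_eq_1_iff)
      thus ?thesis by auto
    qed
  qed
  hence "a = f 0" using f prim[of 0]
    by (intro selberg_class_eqI a primitive_in_class) (auto simp: factorization_def)
  with \<open>k = 1\<close> prim[of 0] show ?thesis by simp
qed

section \<open>The Riemann zeta function\<close>

text \<open>This is s - 1 times the error of the trapezoidal rule for u^(-s) on [n, n + 1]. The
  factor clears the denominator of the integral, so for n \<ge> 1 the expression is entire in
  s.\<close>

definition trap :: "nat \<Rightarrow> complex \<Rightarrow> complex" where
  "trap n s = (s - 1) * (of_nat n powr (-s) + of_nat (n + 1) powr (-s)) / 2
                + of_nat (n + 1) powr (1 - s) - of_nat n powr (1 - s)"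

text \<open>The Peano kernel form of the trapezoidal error: u (1 - u) / 2 against the second
  derivative s (s + 1) (n + u)^(-s-2). The explicit antiderivative G results from integrating by
  parts twice.\<close>

lemma trap_has_integral:
  assumes "n \<ge> 1"
  shows "((\<lambda>u. (s - 1) * s * (s + 1) / 2 * of_real (u * (1 - u)) * (of_nat n + of_real u) powr (-s - 2))
            has_integral trap n s) {0..1}"
proof -
  define y where "y = (\<lambda>z::complex. of_nat n + z)"
  define G where "G = (\<lambda>z. (s - 1) * (- (s / 2) * (z * (1 - z)) * y z powr (-s - 1) - (1 - 2 * z) / 2 * y z powr (-s)) + y z powr (1 - s))"
  have dpow: "((\<lambda>z. y z powr w) has_field_derivative w * y z powr (w - 1)) (at z)" if "Re z \<ge> 0" for w z
  proof -
    have "y z \<notin> \<real>\<^sub>\<le>\<^sub>0" using that assms by (auto simp: y_def complex_nonpos_Reals_iff)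
    thus ?thesis unfolding y_def by (auto intro!: derivative_eq_intros)
  qed
  have d: "(G has_field_derivative (s - 1) * s * (s + 1) / 2 * (z * (1 - z)) * y z powr (-s - 2)) (at z)" if "Re z \<ge> 0" for z
  proof -
    have d1: "((\<lambda>z. y z powr (-s - 1)) has_field_derivative (-s - 1) * y z powr (-s - 2)) (at z)"
      using dpow[OF that, of "-s - 1"] by (simp only: diff_diff_eq one_add_one)
    have d0: "((\<lambda>z. y z powr (-s)) has_field_derivative (-s) * y z powr (-s - 1)) (at z)"
      using dpow[OF that, of "-s"] by simp
    have dm: "((\<lambda>z. y z powr (1 - s)) has_field_derivative (1 - s) * y z powr (-s)) (at z)"
      using dpow[OF that, of "1 - s"] by simp
    define P0 P1 P2 where "P0 = y z powr (-s)" and "P1 = y z powr (-s - 1)" and "P2 = y z powr (-s - 2)"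
    have h: "(G has_field_derivative
        (s - 1) * ((- (s / 2) * (1 - 2 * z)) * P1 + ((-s - 1) * P2) * (- (s / 2) * (z * (1 - z)))
            - ((- 1) * P0 + ((-s) * P1) * ((1 - 2 * z) / 2))) + (1 - s) * P0) (at z)"
      unfolding G_def P0_def P1_def P2_def
      by (intro DERIV_add DERIV_cmult DERIV_diff DERIV_mult' DERIV_mult d1 d0 dm) (auto intro!: derivative_eq_intros)
    have eq: "(s - 1) * ((- (s / 2) * (1 - 2 * z)) * P1 + ((-s - 1) * P2) * (- (s / 2) * (z * (1 - z)))
            - ((- 1) * P0 + ((-s) * P1) * ((1 - 2 * z) / 2))) + (1 - s) * P0 = (s - 1) * s * (s + 1) / 2 * (z * (1 - z)) * P2"
      by (simp add: field_simps)
    show ?thesis using h[unfolded eq] unfolding P2_def .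
  qed
  have "((\<lambda>u. (s - 1) * s * (s + 1) / 2 * of_real (u * (1 - u)) * (of_nat n + of_real u) powr (-s - 2))
            has_integral (G (of_real 1) - G (of_real 0))) {0..1}"
  proof (rule fundamental_theorem_of_calculus)
    fix u :: real assume u: "u \<in> {0..1}"
    have "((\<lambda>u. G (of_real u)) has_vector_derivative (s - 1) * s * (s + 1) / 2 * (of_real u * (1 - of_real u)) * y (of_real u) powr (-s - 2)) (at u within {0..1})"
      using u by (intro has_vector_derivative_real_field d has_vector_derivative_at_within) auto
    thus "((\<lambda>u. G (of_real u)) has_vector_derivative (s - 1) * s * (s + 1) / 2 * of_real (u * (1 - u)) * (of_nat n + of_real u) powr (-s - 2)) (at u within {0..1})"
      by (simp add: y_def)
  qed auto
  moreover have "G (of_real 1) - G (of_real 0) = trap n s"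
    by (simp add: G_def y_def trap_def field_simps)
  ultimately show ?thesis by simp
qed

text \<open>The error gains two powers of n over the term itself, which is why the errors sum for Re
  s > -1. The hypothesis Re s \<ge> -2 makes the power of n + u largest at u = 0.\<close>

lemma norm_trap_le:
  assumes "n \<ge> 1" "Re s \<ge> -2"
  shows "norm (trap n s) \<le> norm ((s - 1) * s * (s + 1)) * real n powr (- Re s - 2)"
proof -
  have "norm (trap n s) \<le> (norm ((s - 1) * s * (s + 1)) * real n powr (- Re s - 2)) * measure lborel (cbox 0 (1::real))"
  proof (rule has_integral_bound)
    show "((\<lambda>u. (s - 1) * s * (s + 1) / 2 * of_real (u * (1 - u)) * (of_nat n + of_real u) powr (-s - 2))
            has_integral trap n s) (cbox 0 (1::real))"
      using trap_has_integral[OF assms(1)] by simp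
    show "norm ((s - 1) * s * (s + 1) / 2 * of_real (u * (1 - u)) * (of_nat n + of_real u) powr (-s - 2))
            \<le> norm ((s - 1) * s * (s + 1)) * real n powr (- Re s - 2)" if "u \<in> cbox 0 1" for u :: real
    proof -
      from that have u: "0 \<le> u" "u \<le> 1" by auto
      have "(of_nat n + of_real u :: complex) = of_real (real n + u)" by simp
      hence "norm ((of_nat n + of_real u) powr (-s - 2) :: complex) = (real n + u) powr (- Re s - 2)"
        using u by (simp only: norm_powr_real_powr Reals_of_real Re_complex_of_real) (simp add: norm_powr_real_powr)
      also have "\<dots> \<le> real n powr (- Re s - 2)" using assms u by (intro powr_mono2') auto
      finally have 1: "norm ((of_nat n + of_real u) powr (-s - 2) :: complex) \<le> real n powr (- Re s - 2)" .
      have "\<bar>u * (1 - u)\<bar> \<le> 1" using u mult_le_one[of u "1 - u"] by (simp add: abs_mult)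
      hence "norm ((s - 1) * s * (s + 1) / 2 * of_real (u * (1 - u))) \<le> norm ((s - 1) * s * (s + 1) / 2) * 1"
        unfolding norm_mult[of _ "of_real _"] norm_of_real by (intro mult_left_mono) auto
      also have "\<dots> \<le> norm ((s - 1) * s * (s + 1))" by (simp add: norm_divide)
      finally have 2: "norm ((s - 1) * s * (s + 1) / 2 * of_real (u * (1 - u))) \<le> norm ((s - 1) * s * (s + 1))" .
      show "norm ((s - 1) * s * (s + 1) / 2 * of_real (u * (1 - u)) * (of_nat n + of_real u) powr (-s - 2))
            \<le> norm ((s - 1) * s * (s + 1)) * real n powr (- Re s - 2)"
        unfolding norm_mult[of _ "_ powr _"] by (intro mult_mono 1 2) auto
    qed
  qed auto
  thus ?thesis by simp
qed

text \<open>\<open>(s - 1) \<zeta>(s)\<close> on \<open>Re s > -1\<close>, by Euler--Maclaurin summation.\<close>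

definition zeta_right :: "complex \<Rightarrow> complex" where
  "zeta_right s = (s + 1) / 2 + (\<Sum>n. trap (Suc n) s)"

lemma summable_trap_bound:
  assumes "c > -1"
  shows "summable (\<lambda>n. real (Suc n) powr (- c - 2))"
  using assms by (subst summable_Suc_iff) (simp add: summable_real_powr_iff)

lemma trap_bound_uniform:
  assumes "Re s \<ge> c" "c > -1" "norm ((s - 1) * s * (s + 1)) \<le> B"
  shows "norm (trap (Suc n) s) \<le> B * real (Suc n) powr (- c - 2)"
proof -
  have "norm (trap (Suc n) s) \<le> norm ((s - 1) * s * (s + 1)) * real (Suc n) powr (- Re s - 2)"
    by (rule norm_trap_le) (use assms in auto)
  also have "\<dots> \<le> B * real (Suc n) powr (- c - 2)"
    using assms order_trans[OF norm_ge_zero assms(3)] by (intro mult_mono powr_mono) auto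
  finally show ?thesis .
qed

lemma summable_norm_trap:
  assumes "Re s > -1"
  shows "summable (\<lambda>n. norm (trap (Suc n) s))"
proof (rule summable_comparison_test'[where N = 0])
  show "summable (\<lambda>n. norm ((s - 1) * s * (s + 1)) * real (Suc n) powr (- Re s - 2))"
    by (intro summable_mult summable_trap_bound assms)
qed (use trap_bound_uniform[OF order.refl assms order.refl] in auto)

lemma holomorphic_trap:
  assumes "n \<ge> 1"
  shows "trap n holomorphic_on A"
  unfolding trap_def[abs_def] using assms
  by (intro holomorphic_intros) (auto simp: complex_eq_iff)

lemma holomorphic_zeta_right: "zeta_right holomorphic_on {s. Re s > -1}"
proof -
  have "(\<lambda>s. \<Sum>n. trap (Suc n) s) holomorphic_on {s. Re s > -1}"
  proof (rule holomorphic_uniform_sequence)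
    show "open {s. Re s > -1}" by (rule open_halfspace_Re_gt)
    show "(\<lambda>s. \<Sum>n<N. trap (Suc n) s) holomorphic_on {s. Re s > -1}" for N
      by (intro holomorphic_intros holomorphic_trap) auto
    fix x :: complex assume x: "x \<in> {s. Re s > -1}"
    define d where "d = (Re x + 1) / 2"
    have d: "d > 0" using x by (simp add: d_def)
    have Re_ge: "Re s \<ge> Re x - d" if "s \<in> cball x d" for s
      using that abs_Re_le_cmod[of "x - s"] by (auto simp: dist_norm)
    define c where "c = Re x - d"
    have c: "c > -1" using x by (simp add: c_def d_def field_simps)
    have "compact ((\<lambda>s. (s - 1) * s * (s + 1)) ` cball x d)"
      by (intro compact_continuous_image continuous_intros) auto
    then obtain B where B: "\<And>s. s \<in> cball x d \<Longrightarrow> norm ((s - 1) * s * (s + 1)) \<le> B"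
      using compact_imp_bounded by (force simp: bounded_iff)
    have "uniform_limit (cball x d) (\<lambda>N s. \<Sum>n<N. trap (Suc n) s) (\<lambda>s. \<Sum>n. trap (Suc n) s) sequentially"
    proof (rule Weierstrass_m_test)
      show "summable (\<lambda>n. B * real (Suc n) powr (- c - 2))" by (intro summable_mult summable_trap_bound c)
      show "norm (trap (Suc n) s) \<le> B * real (Suc n) powr (- c - 2)" if "s \<in> cball x d" for n s
        by (rule trap_bound_uniform) (use c that B Re_ge in \<open>auto simp: c_def\<close>)
    qed
    moreover have "cball x d \<subseteq> {s. Re s > -1}" using Re_ge c by (force simp: c_def)
    ultimately show "\<exists>d>0. cball x d \<subseteq> {s. Re s > -1} \<and> uniform_limit (cball x d) (\<lambda>N s. \<Sum>n<N. trap (Suc n) s) (\<lambda>s. \<Sum>n. trap (Suc n) s) sequentially"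
      using d by blast
  qed
  thus ?thesis unfolding zeta_right_def[abs_def] by (intro holomorphic_intros) auto
qed

section \<open>Zeta as a Dirichlet series\<close>

definition zeta_coeff :: "nat \<Rightarrow> complex" where
  "zeta_coeff n = (if n = 0 then 0 else 1)"

lemma zeta_coeff_conv: "c > 1 \<Longrightarrow> abs_conv zeta_coeff c"
  by (rule abs_conv_powrI[of _ 1 0]) (auto simp: zeta_coeff_def intro: eventually_mono[OF eventually_gt_at_top[of 0]])

lemma tendsto_nat_powr_0:
  assumes "Re w < 0"
  shows "(\<lambda>n. (of_nat (n + 1) :: complex) powr w) \<longlonglongrightarrow> 0"
proof (rule tendsto_norm_zero_cancel)
  have "(\<lambda>n. real (n + 1) powr Re w) \<longlonglongrightarrow> 0" using assms by real_asymp
  thus "(\<lambda>n. norm ((of_nat (n + 1) :: complex) powr w)) \<longlonglongrightarrow> 0" by (simp only: norm_nat_powr)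
qed

text \<open>The trapezoidal terms telescope. The first summand enters with weight 1/2 and the
  integral starts at 1; what is missing is (s - 1)/2 + 1, the term (s + 1)/2 of
  \<open>zeta_right\<close>.\<close>

lemma zeta_right_eq:
  assumes s: "Re s > 1"
  shows "zeta_right s = (s - 1) * dirichlet_series zeta_coeff s"
proof -
  define t where "t = (\<lambda>n::nat. zeta_coeff n * of_nat n powr (-s))"
  have t: "t sums dirichlet_series zeta_coeff s"
    unfolding t_def by (rule dirichlet_series_sums[OF zeta_coeff_conv[OF s] order.refl])
  have t_lim: "(\<lambda>N. \<Sum>n<N+1. t n) \<longlonglongrightarrow> dirichlet_series zeta_coeff s"
    using LIMSEQ_Suc[of "\<lambda>N. \<Sum>n<N. t n"] t by (simp add: sums_def)
  have part: "(\<Sum>n<N. trap (Suc n) s) = (s - 1) * ((\<Sum>n<N+1. t n) - 1/2 + of_nat (N + 1) powr (-s) / 2) + of_nat (N + 1) powr (1 - s) - 1" for N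
  proof (induction N)
    case 0
    show ?case by (simp add: t_def zeta_coeff_def)
  next
    case (Suc N)
    define T P P' R R' where "T = (\<Sum>n<N+1. t n)" and "P = (of_nat (N + 1) powr (-s) :: complex)"
      and "P' = (of_nat (Suc N + 1) powr (-s) :: complex)" and "R = (of_nat (N + 1) powr (1 - s) :: complex)"
      and "R' = (of_nat (Suc N + 1) powr (1 - s) :: complex)"
    have T: "(\<Sum>n<Suc N + 1. t n) = T + P" by (simp add: T_def P_def t_def zeta_coeff_def)
    have tr: "trap (Suc N) s = (s - 1) * (P + P') / 2 + R' - R"
      by (simp add: trap_def P_def P'_def R_def R'_def)
    have "(\<Sum>n<Suc N. trap (Suc n) s) = ((s - 1) * (T - 1/2 + P / 2) + R - 1) + trap (Suc N) s"
      using Suc by (simp add: T_def P_def R_def)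
    also have "\<dots> = (s - 1) * (T + P - 1/2 + P' / 2) + R' - 1"
      unfolding tr by (simp add: field_simps)
    finally show ?case unfolding T P'_def R'_def .
  qed
  have "(\<lambda>N. (s - 1) * ((\<Sum>n<N+1. t n) - 1/2 + of_nat (N + 1) powr (-s) / 2) + of_nat (N + 1) powr (1 - s) - 1)
          \<longlonglongrightarrow> (s - 1) * (dirichlet_series zeta_coeff s - 1/2 + 0 / 2) + 0 - 1"
    by (intro tendsto_intros t_lim tendsto_nat_powr_0) (use s in auto)
  hence "(\<lambda>n. trap (Suc n) s) sums ((s - 1) * (dirichlet_series zeta_coeff s - 1/2 + 0 / 2) + 0 - 1)"
    unfolding sums_def part .
  thus ?thesis by (simp add: zeta_right_def sums_iff field_simps)
qed

lemma zeta_right_growth: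
  shows "\<exists>C. \<forall>s. Re s \<ge> -1/2 \<longrightarrow> norm (zeta_right s) \<le> C * (1 + norm s) ^ 3"
proof -
  define S where "S = (\<Sum>n. real (Suc n) powr (- (-1/2) - 2))"
  have sS: "summable (\<lambda>n. real (Suc n) powr (- (-1/2) - 2))" by (rule summable_trap_bound) simp
  have S: "S \<ge> 0" unfolding S_def by (intro suminf_nonneg sS) auto
  have "norm (zeta_right s) \<le> (1 + S) * (1 + norm s) ^ 3" if s: "Re s \<ge> -1/2" for s
  proof -
    define N where "N = 1 + norm s"
    have N: "N \<ge> 1" by (simp add: N_def)
    have le: "norm ((s - 1) * s * (s + 1)) \<le> N * N * N"
      unfolding norm_mult N_def
      using norm_triangle_ineq4[of s 1] norm_triangle_ineq[of s 1] by (intro mult_mono) auto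
    have "norm (\<Sum>n. trap (Suc n) s) \<le> (\<Sum>n. norm (trap (Suc n) s))"
      by (rule summable_norm[OF summable_norm_trap]) (use s in auto)
    also have "\<dots> \<le> (\<Sum>n. N ^ 3 * real (Suc n) powr (- (-1/2) - 2))"
      using s le by (intro suminf_le trap_bound_uniform summable_norm_trap summable_mult sS)
                    (auto simp: power3_eq_cube)
    also have "\<dots> = N ^ 3 * S" unfolding S_def by (rule suminf_mult[OF sS])
    finally have 1: "norm (\<Sum>n. trap (Suc n) s) \<le> N ^ 3 * S" .
    have "norm (s + 1) \<le> N" using norm_triangle_ineq[of s 1] by (simp add: N_def)
    also have "N \<le> 2 * N" using N by simp
    finally have "norm (s + 1) \<le> 2 * N" .
    hence "norm ((s + 1) / 2) \<le> N" by (simp add: norm_divide)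
    also have "N \<le> N ^ 3" using power_increasing[of 1 3 N] N by simp
    finally have "norm (zeta_right s) \<le> N ^ 3 + N ^ 3 * S"
      unfolding zeta_right_def using 1 by (intro order_trans[OF norm_triangle_ineq] add_mono)
    thus ?thesis by (simp add: N_def algebra_simps)
  qed
  thus ?thesis by blast
qed

text \<open>Logarithmic derivative of the product formula for the sine, at an imaginary argument.\<close>

lemma coth_partial_fractions:
  fixes y :: real
  assumes y: "y > 0"
  shows "(\<lambda>n. 2 * y / (y\<^sup>2 + 4 * pi\<^sup>2 * (real (Suc n))\<^sup>2)) sums ((1 + exp (-y)) / (2 * (1 - exp (-y))) - 1 / y)"
proof -
  define q where "q = (\<lambda>n::nat. 4 * pi\<^sup>2 * (real (Suc n))\<^sup>2)"
  have q: "q n > 0" for n by (simp add: q_def)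
  define L where "L = (\<lambda>x::real. ln (sinh (x / 2)) - ln (x / 2))"
  have qge: "q n \<ge> real (Suc n) ^ 2" for n
  proof -
    have "1 \<le> pi\<^sup>2" using pi_gt3 by (intro one_le_power) simp
    hence "4 * pi\<^sup>2 \<ge> 1" by simp
    thus ?thesis unfolding q_def using mult_right_mono[of 1 "4 * pi\<^sup>2" "(real (Suc n))\<^sup>2"] by simp
  qed
  have sq: "summable (\<lambda>n. 1 / q n)"
  proof (rule summable_comparison_test'[where N = 0])
    show "summable (\<lambda>n. inverse ((real (Suc n))\<^sup>2))"
      using inverse_power_summable[of 2, where 'a = real] summable_Suc_iff[of "\<lambda>n. inverse ((real n)\<^sup>2)"] by simp
    fix n :: nat
    show "norm (1 / q n) \<le> inverse ((real (Suc n))\<^sup>2)"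
      using qge[of n] q[of n] by (simp add: divide_inverse le_imp_inverse_le)
  qed
  have sums_ln: "(\<lambda>n. ln (1 + x\<^sup>2 / q n)) sums L x" if x: "x > 0" for x
  proof -
    \<comment> \<open>With this z the argument \<pi> z equals i x / 2, so the product for the sine
      becomes one for sinh (x / 2).\<close>
    define z where "z = \<i> * of_real (x / (2 * pi))"
    have tk: "(1 - z\<^sup>2 / of_nat k ^ 2 :: complex) = of_real (1 + x\<^sup>2 / q (k - 1))" if "k \<ge> 1" for k
      using that by (simp add: z_def q_def power_mult_distrib power_divide)
    have "(\<lambda>n. of_real pi * z * (\<Prod>k=1..n. 1 - z\<^sup>2 / of_nat k ^ 2)) \<longlonglongrightarrow> sin (of_real pi * z)"
      by (rule sin_product_formula_complex)
    also have "(\<lambda>n. of_real pi * z * (\<Prod>k=1..n. 1 - z\<^sup>2 / of_nat k ^ 2)) =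
               (\<lambda>n. \<i> * of_real (x / 2 * (\<Prod>k<n. 1 + x\<^sup>2 / q k)))"
    proof
      fix n
      have "(\<Prod>k=1..n. 1 - z\<^sup>2 / of_nat k ^ 2) = (\<Prod>k=1..n. of_real (1 + x\<^sup>2 / q (k - 1)))"
        by (rule prod.cong[OF refl], rule tk) auto
      also have "\<dots> = (\<Prod>k<n. of_real (1 + x\<^sup>2 / q k) :: complex)"
        by (rule prod.reindex_bij_witness[of _ Suc "\<lambda>k. k - 1"]) auto
      finally show "of_real pi * z * (\<Prod>k=1..n. 1 - z\<^sup>2 / of_nat k ^ 2) = \<i> * of_real (x / 2 * (\<Prod>k<n. 1 + x\<^sup>2 / q k))"
        by (simp add: z_def)
    qed
    also have "sin (of_real pi * z) = \<i> * of_real (sinh (x / 2))"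
    proof -
      have "of_real pi * z = \<i> * of_real (x / 2)" by (simp add: z_def)
      thus ?thesis by (simp only: sin_i_times) (simp add: sinh_field_def exp_minus flip: exp_of_real)
    qed
    finally have "(\<lambda>n. Im (\<i> * of_real (x / 2 * (\<Prod>k<n. 1 + x\<^sup>2 / q k)))) \<longlonglongrightarrow> Im (\<i> * of_real (sinh (x / 2)))"
      by (rule tendsto_Im)
    hence "(\<lambda>n. x / 2 * (\<Prod>k<n. 1 + x\<^sup>2 / q k)) \<longlonglongrightarrow> sinh (x / 2)"
      by (simp only: Im_i_times Re_complex_of_real)
    hence "(\<lambda>n. ln (x / 2 * (\<Prod>k<n. 1 + x\<^sup>2 / q k))) \<longlonglongrightarrow> ln (sinh (x / 2))"
      using x by (intro tendsto_ln) auto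
    moreover have pos: "1 + x\<^sup>2 / q k > 0" for k using q[of k] by (simp add: add_pos_nonneg)
    have pp: "(\<Prod>k<n. 1 + x\<^sup>2 / q k) > 0" for n by (intro prod_pos) (use pos in auto)
    have lp: "ln (\<Prod>k<n. 1 + x\<^sup>2 / q k) = (\<Sum>k<n. ln (1 + x\<^sup>2 / q k))" for n
      by (induction n) (simp_all add: ln_mult_pos[OF pp pos])
    have "ln (x / 2 * (\<Prod>k<n. 1 + x\<^sup>2 / q k)) = ln (x / 2) + (\<Sum>k<n. ln (1 + x\<^sup>2 / q k))" for n
      using x ln_mult_pos[OF _ pp, of "x / 2" n] lp by simp
    ultimately have "(\<lambda>n. ln (x / 2) + (\<Sum>k<n. ln (1 + x\<^sup>2 / q k))) \<longlonglongrightarrow> ln (sinh (x / 2))" by simp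
    from tendsto_diff[OF this tendsto_const[of "ln (x / 2)"]]
    show ?thesis by (simp add: sums_def L_def)
  qed
  \<comment> \<open>On a bounded interval the numerators 2x are bounded, which makes the
    differentiated series uniformly convergent.\<close>
  define S where "S = {0<..<y + 1}"
  have uc: "uniformly_convergent_on S (\<lambda>N x. \<Sum>n<N. 2 * x / (x\<^sup>2 + q n))"
  proof (rule Weierstrass_m_test')
    show "summable (\<lambda>n. 2 * (y + 1) * (1 / q n))" by (intro summable_mult sq)
    fix n x assume x: "x \<in> S"
    have "norm (2 * x / (x\<^sup>2 + q n)) = 2 * x / (x\<^sup>2 + q n)" using x q[of n] by (auto simp: S_def)
    also have "\<dots> \<le> 2 * (y + 1) / q n" using x q[of n] by (intro frac_le) (auto simp: S_def)
    finally show "norm (2 * x / (x\<^sup>2 + q n)) \<le> 2 * (y + 1) * (1 / q n)" by simp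
  qed
  have der: "((\<lambda>x. ln (1 + x\<^sup>2 / q n)) has_field_derivative 2 * x / (x\<^sup>2 + q n)) (at x within S)" for n x
  proof -
    have "1 + x\<^sup>2 / q n > 0" using q[of n] by (simp add: add_pos_nonneg)
    moreover have "x\<^sup>2 + q n > 0" using q[of n] by (simp add: add_nonneg_pos)
    ultimately show ?thesis
      using q[of n] by (auto intro!: derivative_eq_intros simp: field_simps)
  qed
  have "convex S" "y \<in> S" "y \<in> interior S" using y by (auto simp: S_def)
  note D = has_field_derivative_series'(2)[OF this(1) der uc this(2) sums_summable[OF sums_ln[OF y]] this(3)]
  have sh: "sinh (y / 2) > 0" using y by simp
  have "(L has_field_derivative (cosh (y / 2) * (1 / 2) / sinh (y / 2) - (1 / 2) / (y / 2))) (at y)"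
    unfolding L_def[abs_def] using y sh by (auto intro!: derivative_eq_intros)
  moreover have "(L has_field_derivative (\<Sum>n. 2 * y / (y\<^sup>2 + q n))) (at y)"
    by (rule has_field_derivative_transform_within_open[OF D, of "{0<..}"])
       (use y sums_ln in \<open>auto simp: sums_iff\<close>)
  ultimately have "(\<Sum>n. 2 * y / (y\<^sup>2 + q n)) = cosh (y / 2) * (1 / 2) / sinh (y / 2) - (1 / 2) / (y / 2)"
    by (rule DERIV_unique[symmetric])
  also have "cosh (y / 2) * (1 / 2) / sinh (y / 2) = (1 + exp (-y)) / (2 * (1 - exp (-y)))"
  proof -
    define E where "E = exp (y / 2)"
    have E: "E > 1" using y by (simp add: E_def)
    have em: "exp (- y) = 1 / E\<^sup>2" by (simp add: E_def exp_minus field_simps flip: exp_double)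
    have cs: "cosh (y / 2) = (E + 1 / E) / 2" "sinh (y / 2) = (E - 1 / E) / 2"
      by (simp_all add: cosh_field_def sinh_field_def E_def exp_minus field_simps)
    have "E * E > 1 * 1" using E by (intro mult_strict_mono) auto
    hence "E - 1 / E > 0" "1 - 1 / E\<^sup>2 > 0" using E by (simp_all add: field_simps power2_eq_square)
    moreover have "E - 1 / E = E * (1 - 1 / E\<^sup>2)" "E + 1 / E = E * (1 + 1 / E\<^sup>2)"
      using E by (simp_all add: field_simps power2_eq_square)
    ultimately show ?thesis unfolding em cs using E by simp
  qed
  finally have "(\<Sum>n. 2 * y / (y\<^sup>2 + q n)) = (1 + exp (-y)) / (2 * (1 - exp (-y))) - 1 / y" by simp
  moreover have "summable (\<lambda>n. 2 * y / (y\<^sup>2 + q n))"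
  proof (rule summable_comparison_test'[where N = 0])
    show "summable (\<lambda>n. 2 * y * (1 / q n))" by (intro summable_mult sq)
    fix n :: nat
    show "norm (2 * y / (y\<^sup>2 + q n)) \<le> 2 * y * (1 / q n)"
      using y q[of n] by (simp add: frac_le)
  qed
  ultimately show ?thesis by (simp add: sums_iff q_def)
qed

section \<open>Two evaluations of a Mellin transform\<close>

lemma nn_integral_Gamma_scaled:
  fixes a c :: real
  assumes "a > 0" "c > 0"
  shows "(\<integral>\<^sup>+ y. ennreal (indicator {0<..} y * (y powr (a - 1) * exp (- (c * y)))) \<partial>lborel) = ennreal (Gamma a * c powr (-a))"
proof -
  let ?f = "\<lambda>t::real. ennreal (indicator {0..} t * t powr (a - 1) / exp t)"
  have "ennreal (Gamma a) = (\<integral>\<^sup>+ t. ?f t \<partial>lborel)"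
    by (rule Gamma_conv_nn_integral_real) fact
  also have "\<dots> = ennreal \<bar>c\<bar> * (\<integral>\<^sup>+ y. ?f (0 + c * y) \<partial>lborel)"
    by (rule nn_integral_real_affine) (use assms in auto)
  also have "(\<integral>\<^sup>+ y. ?f (0 + c * y) \<partial>lborel) =
      (\<integral>\<^sup>+ y. ennreal (c powr (a - 1)) * ennreal (indicator {0<..} y * (y powr (a - 1) * exp (- (c * y)))) \<partial>lborel)"
  proof (intro nn_integral_cong)
    fix y :: real
    have "indicator {0..} (0 + c * y) * (0 + c * y) powr (a - 1) / exp (0 + c * y) =
            c powr (a - 1) * (indicator {0<..} y * (y powr (a - 1) * exp (- (c * y))) :: real)"
      using assms by (cases "y > 0"; cases "y = 0")
        (auto simp: indicator_def powr_mult exp_minus field_simps zero_le_mult_iff)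
    thus "?f (0 + c * y) = ennreal (c powr (a - 1)) * ennreal (indicator {0<..} y * (y powr (a - 1) * exp (- (c * y))))"
      by (simp add: ennreal_mult')
  qed
  also have "\<dots> = ennreal (c powr (a - 1)) * (\<integral>\<^sup>+ y. ennreal (indicator {0<..} y * (y powr (a - 1) * exp (- (c * y)))) \<partial>lborel)"
    by (rule nn_integral_cmult) measurable
  finally have "ennreal (Gamma a) = ennreal (c powr a) * (\<integral>\<^sup>+ y. ennreal (indicator {0<..} y * (y powr (a - 1) * exp (- (c * y)))) \<partial>lborel)"
    using assms by (simp add: mult.assoc[symmetric] ennreal_mult'[symmetric] powr_mult_base)
  hence "ennreal (c powr (-a)) * ennreal (Gamma a) = ennreal (c powr (-a)) * ennreal (c powr a) * (\<integral>\<^sup>+ y. ennreal (indicator {0<..} y * (y powr (a - 1) * exp (- (c * y)))) \<partial>lborel)"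
    by (simp only: mult.assoc)
  thus ?thesis using assms
    by (simp add: ennreal_mult'[symmetric] powr_add[symmetric] mult.commute)
qed

text \<open>The substitution v = y^2 in the Gamma integral. It is carried out with absolute
  integrability and then returned to nonnegative extended integrals, where sums and integrals of
  measurable functions may be exchanged freely.\<close>

lemma nn_integral_Gauss_Gamma:
  fixes x w :: real
  assumes "x > -1" "w > 0"
  shows "(\<integral>\<^sup>+ y. ennreal (indicator {0<..} y * (2 * y powr x * exp (- (w * y\<^sup>2)))) \<partial>lborel) =
           ennreal (Gamma ((x + 1) / 2) * w powr (- ((x + 1) / 2)))"
proof -
  define a where "a = (x + 1) / 2"
  define I where "I = Gamma a * w powr (-a)"
  have a: "a > 0" using assms by (simp add: a_def)
  define f where "f = (\<lambda>v::real. v powr (a - 1) * exp (- (w * v)))"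
  have "((\<lambda>v. indicator {0<..} v * f v) has_integral I) UNIV"
  proof (rule nn_integral_has_integral)
    show "(\<integral>\<^sup>+ v. ennreal (indicator {0<..} v * f v) \<partial>lborel) = ennreal I"
      unfolding f_def I_def by (rule nn_integral_Gamma_scaled[OF a assms(2)])
    show "0 \<le> I" using a by (auto simp: I_def intro!: mult_nonneg_nonneg less_imp_le[OF Gamma_real_pos])
  qed (auto simp: f_def)
  also have "(\<lambda>v. indicator {0<..} v * f v) = (\<lambda>v. if v \<in> {0<..} then f v else 0)"
    by (auto simp: indicator_def)
  finally have f: "(f has_integral I) {0<..}" by (simp only: has_integral_restrict_UNIV)
  have im: "(\<lambda>y::real. y\<^sup>2) ` {0<..} = {0<..}"
  proof (intro equalityI subsetI)
    fix v :: real assume "v \<in> {0<..}"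
    thus "v \<in> (\<lambda>y. y\<^sup>2) ` {0<..}" by (intro image_eqI[of _ _ "sqrt v"]) auto
  qed auto
  have "f absolutely_integrable_on ((\<lambda>y. y\<^sup>2) ` {0<..}) \<and> integral ((\<lambda>y. y\<^sup>2) ` {0<..}) f = I"
    unfolding im using f
    by (auto simp: integral_unique f_def intro!: nonnegative_absolutely_integrable_1)
  hence "(\<lambda>y. \<bar>2 * y\<bar> * f (y\<^sup>2)) absolutely_integrable_on {0<..} \<and> integral {0<..} (\<lambda>y. \<bar>2 * y\<bar> * f (y\<^sup>2)) = I"
    by (subst has_absolute_integral_change_of_variables_1')
       (auto intro!: derivative_eq_intros inj_onI simp: power2_eq_iff_nonneg)
  hence "((\<lambda>y. \<bar>2 * y\<bar> * f (y\<^sup>2)) has_integral I) {0<..}"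
    using set_lebesgue_integral_eq_integral(1) by (auto simp: has_integral_iff)
  hence "(\<integral>\<^sup>+ y. ennreal (indicator {0<..} y * (\<bar>2 * y\<bar> * f (y\<^sup>2))) \<partial>lborel) = ennreal I"
    by (intro nn_integral_has_integral_lebesgue) (auto simp: f_def)
  also have "(\<integral>\<^sup>+ y. ennreal (indicator {0<..} y * (\<bar>2 * y\<bar> * f (y\<^sup>2))) \<partial>lborel) =
             (\<integral>\<^sup>+ y. ennreal (indicator {0<..} y * (2 * y powr x * exp (- (w * y\<^sup>2)))) \<partial>lborel)"
  proof (intro nn_integral_cong arg_cong[of _ _ ennreal])
    fix y :: real
    show "indicator {0<..} y * (\<bar>2 * y\<bar> * f (y\<^sup>2)) = indicator {0<..} y * (2 * y powr x * exp (- (w * y\<^sup>2)))"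
    proof (cases "y > 0")
      case True
      have e: "x - 1 = 2 * (a - 1)" by (simp add: a_def field_simps)
      have "(y\<^sup>2) powr (a - 1) = y powr (x - 1)"
        unfolding e using True by (subst powr_powr[symmetric]) (simp add: powr_numeral)
      moreover have "y * y powr (x - 1) = y powr x" using True by (simp add: powr_mult_base)
      ultimately show ?thesis using True by (simp add: f_def)
    qed auto
  qed
  finally show ?thesis by (simp add: I_def a_def)
qed

text \<open>Write 1 / (y^2 + c^2) as the integral of exp (-w (y^2 + c^2)) over w > 0 and exchange
  the order. The inner integral is Gaussian and the outer one a Gamma integral, so the answer
  appears directly as a product of two Gamma values.\<close>

lemma nn_integral_Mellin_rational:
  fixes x c :: real
  assumes "x > -1" "x < 1" "c > 0"
  shows "(\<integral>\<^sup>+ y. ennreal (indicator {0<..} y * (2 * y powr x / (y\<^sup>2 + c\<^sup>2))) \<partial>lborel) =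
           ennreal (Gamma ((1 + x) / 2) * Gamma ((1 - x) / 2) * c powr (x - 1))"
proof -
  define k where "k = (\<lambda>(y::real) (w::real). indicator {0<..} y * indicator {0<..} w * (2 * y powr x * exp (- (w * (y\<^sup>2 + c\<^sup>2)))))"
  have "(\<integral>\<^sup>+ y. ennreal (indicator {0<..} y * (2 * y powr x / (y\<^sup>2 + c\<^sup>2))) \<partial>lborel) = (\<integral>\<^sup>+ y. (\<integral>\<^sup>+ w. ennreal (k y w) \<partial>lborel) \<partial>lborel)"
  proof (intro nn_integral_cong)
    fix y :: real
    have pos: "y\<^sup>2 + c\<^sup>2 > 0" using assms by (simp add: add_nonneg_pos)
    have "(\<integral>\<^sup>+ w. ennreal (k y w) \<partial>lborel) =
          (\<integral>\<^sup>+ w. ennreal (indicator {0<..} y * (2 * y powr x)) * ennreal (indicator {0<..} w * (w powr (1 - 1) * exp (- ((y\<^sup>2 + c\<^sup>2) * w)))) \<partial>lborel)"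
    proof (intro nn_integral_cong)
      fix w :: real
      have "k y w = (indicator {0<..} y * (2 * y powr x)) * (indicator {0<..} w * (w powr (1 - 1) * exp (- ((y\<^sup>2 + c\<^sup>2) * w))))"
        by (auto simp: k_def indicator_def mult.commute)
      thus "ennreal (k y w) = ennreal (indicator {0<..} y * (2 * y powr x)) * ennreal (indicator {0<..} w * (w powr (1 - 1) * exp (- ((y\<^sup>2 + c\<^sup>2) * w))))"
        by (simp only:) (rule ennreal_mult', auto)
    qed
    also have "\<dots> = ennreal (indicator {0<..} y * (2 * y powr x)) *
          (\<integral>\<^sup>+ w. ennreal (indicator {0<..} w * (w powr (1 - 1) * exp (- ((y\<^sup>2 + c\<^sup>2) * w)))) \<partial>lborel)"
      by (rule nn_integral_cmult) measurable
    also have "(\<integral>\<^sup>+ w. ennreal (indicator {0<..} w * (w powr (1 - 1) * exp (- ((y\<^sup>2 + c\<^sup>2) * w)))) \<partial>lborel) =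
          ennreal (Gamma 1 * (y\<^sup>2 + c\<^sup>2) powr (-1))"
      by (rule nn_integral_Gamma_scaled[OF zero_less_one pos])
    also have "ennreal (indicator {0<..} y * (2 * y powr x)) * ennreal (Gamma 1 * (y\<^sup>2 + c\<^sup>2) powr (-1)) =
                 ennreal (indicator {0<..} y * (2 * y powr x / (y\<^sup>2 + c\<^sup>2)))"
      using pos by (subst ennreal_mult''[symmetric]) (auto simp: powr_minus powr_one divide_inverse mult_ac)
    finally show "ennreal (indicator {0<..} y * (2 * y powr x / (y\<^sup>2 + c\<^sup>2))) = (\<integral>\<^sup>+ w. ennreal (k y w) \<partial>lborel)" ..
  qed
  also have "\<dots> = (\<integral>\<^sup>+ w. (\<integral>\<^sup>+ y. ennreal (k y w) \<partial>lborel) \<partial>lborel)"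
    by (rule lborel_pair.Fubini'[where f = "\<lambda>y w. ennreal (k y w)", symmetric]) (simp add: k_def case_prod_unfold, measurable)
  also have "\<dots> = (\<integral>\<^sup>+ w. ennreal (Gamma ((1 + x) / 2)) * ennreal (indicator {0<..} w * (w powr ((1 - x) / 2 - 1) * exp (- (c\<^sup>2 * w)))) \<partial>lborel)"
  proof (intro nn_integral_cong)
    fix w :: real
    show "(\<integral>\<^sup>+ y. ennreal (k y w) \<partial>lborel) = ennreal (Gamma ((1 + x) / 2)) * ennreal (indicator {0<..} w * (w powr ((1 - x) / 2 - 1) * exp (- (c\<^sup>2 * w))))"
    proof (cases "w > 0")
      case True
      have "(\<integral>\<^sup>+ y. ennreal (k y w) \<partial>lborel) =
            (\<integral>\<^sup>+ y. ennreal (exp (- (c\<^sup>2 * w))) * ennreal (indicator {0<..} y * (2 * y powr x * exp (- (w * y\<^sup>2)))) \<partial>lborel)"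
      proof (intro nn_integral_cong)
        fix y :: real
        have "k y w = exp (- (c\<^sup>2 * w)) * (indicator {0<..} y * (2 * y powr x * exp (- (w * y\<^sup>2))))"
          using True by (auto simp: k_def indicator_def exp_add[symmetric] algebra_simps)
        thus "ennreal (k y w) = ennreal (exp (- (c\<^sup>2 * w))) * ennreal (indicator {0<..} y * (2 * y powr x * exp (- (w * y\<^sup>2))))"
          by (simp only: ennreal_mult' exp_ge_zero)
      qed
      also have "\<dots> = ennreal (exp (- (c\<^sup>2 * w))) * ennreal (Gamma ((x + 1) / 2) * w powr (- ((x + 1) / 2)))"
        by (subst nn_integral_cmult) (auto simp: nn_integral_Gauss_Gamma[OF assms(1) True])
      also have "\<dots> = ennreal (Gamma ((1 + x) / 2)) * ennreal (indicator {0<..} w * (w powr ((1 - x) / 2 - 1) * exp (- (c\<^sup>2 * w))))"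
      proof -
        have "- ((x + 1) / 2) = (1 - x) / 2 - 1" by (simp add: field_simps)
        thus ?thesis using True assms
          by (simp add: ennreal_mult'[symmetric] add.commute mult_ac Gamma_real_nonneg)
      qed
      finally show ?thesis .
    qed (simp add: k_def)
  qed
  also have "\<dots> = ennreal (Gamma ((1 + x) / 2)) * ennreal (Gamma ((1 - x) / 2) * (c\<^sup>2) powr (- ((1 - x) / 2)))"
    by (subst nn_integral_cmult) (use assms nn_integral_Gamma_scaled[of "(1 - x) / 2" "c\<^sup>2"] in auto)
  also have "(c\<^sup>2) powr (- ((1 - x) / 2)) = c powr (x - 1)"
  proof -
    have e: "x - 1 = 2 * (- ((1 - x) / 2))" by (simp add: field_simps)
    show ?thesis using assms by (subst e, subst powr_powr[symmetric]) (simp add: powr_numeral)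
  qed
  finally show ?thesis using assms by (simp add: ennreal_mult'[symmetric] mult_ac Gamma_real_nonneg)
qed

text \<open>This is coth (y/2) / 2 - 1/y, equivalently 1 / (exp y - 1) + 1/2 - 1/y: the classical
  kernel whose Mellin transform is Gamma(s) \<zeta>(s) for -1 < Re s < 0.\<close>

definition coth_kernel :: "real \<Rightarrow> real" where
  "coth_kernel y = (1 + exp (-y)) / (2 * (1 - exp (-y))) - 1 / y"

text \<open>Partial fractions: each term 2y / (y^2 + (2 \<pi> n)^2) has a known Mellin transform,
  and the sum over n \<ge> 1 produces \<zeta>(1 - x).\<close>

lemma nn_integral_coth_right:
  fixes x :: real
  assumes x: "-1 < x" "x < 0"
  shows "(\<integral>\<^sup>+ y. ennreal (indicator {0<..} y * (coth_kernel y * y powr (x - 1))) \<partial>lborel) =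
          ennreal (Gamma ((1 + x) / 2) * Gamma ((1 - x) / 2) * (2 * pi) powr (x - 1) * (\<Sum>n. real (Suc n) powr (x - 1)))"
proof -
  define c where "c = (\<lambda>n. 2 * pi * real (Suc n))"
  have c: "c n > 0" for n by (simp add: c_def)
  have cp: "c n powr (x - 1) = (2 * pi) powr (x - 1) * real (Suc n) powr (x - 1)" for n
    unfolding c_def by (rule powr_mult)
  have "(\<integral>\<^sup>+ y. ennreal (indicator {0<..} y * (coth_kernel y * y powr (x - 1))) \<partial>lborel) =
        (\<integral>\<^sup>+ y. (\<Sum>n. ennreal (indicator {0<..} y * (2 * y powr x / (y\<^sup>2 + (c n)\<^sup>2)))) \<partial>lborel)"
  proof (intro nn_integral_cong)
    fix y :: real
    show "ennreal (indicator {0<..} y * (coth_kernel y * y powr (x - 1))) = (\<Sum>n. ennreal (indicator {0<..} y * (2 * y powr x / (y\<^sup>2 + (c n)\<^sup>2))))"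
    proof (cases "y > 0")
      case True
      have "(\<lambda>n. 2 * y / (y\<^sup>2 + 4 * pi\<^sup>2 * (real (Suc n))\<^sup>2) * y powr (x - 1)) sums (coth_kernel y * y powr (x - 1))"
        unfolding coth_kernel_def by (intro sums_mult2 coth_partial_fractions True)
      moreover have "2 * y / (y\<^sup>2 + 4 * pi\<^sup>2 * (real (Suc n))\<^sup>2) * y powr (x - 1) = 2 * y powr x / (y\<^sup>2 + (c n)\<^sup>2)" for n
      proof -
        have 1: "4 * pi\<^sup>2 * (real (Suc n))\<^sup>2 = (c n)\<^sup>2"
          by (simp only: c_def power_mult_distrib) simp
        have 2: "y * y powr (x - 1) = y powr x" using powr_mult_base[of y "x - 1"] True by simp
        have "2 * y / D * p = 2 * (y * p) / D" for D p :: real by simp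
        thus ?thesis unfolding 1 by (simp only: 2)
      qed
      ultimately have "(\<lambda>n. 2 * y powr x / (y\<^sup>2 + (c n)\<^sup>2)) sums (coth_kernel y * y powr (x - 1))" by simp
      hence "(\<Sum>n. ennreal (2 * y powr x / (y\<^sup>2 + (c n)\<^sup>2))) = ennreal (coth_kernel y * y powr (x - 1))"
        by (intro suminf_ennreal_eq) auto
      thus ?thesis using True by simp
    qed simp
  qed
  also have "\<dots> = (\<Sum>n. (\<integral>\<^sup>+ y. ennreal (indicator {0<..} y * (2 * y powr x / (y\<^sup>2 + (c n)\<^sup>2))) \<partial>lborel))"
    by (rule nn_integral_suminf) measurable
  also have "\<dots> = (\<Sum>n. ennreal (Gamma ((1 + x) / 2) * Gamma ((1 - x) / 2) * c n powr (x - 1)))"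
    using x c by (subst nn_integral_Mellin_rational) auto
  also have "\<dots> = ennreal (Gamma ((1 + x) / 2) * Gamma ((1 - x) / 2) * (2 * pi) powr (x - 1) * (\<Sum>n. real (Suc n) powr (x - 1)))"
  proof (rule suminf_ennreal_eq)
    have "summable (\<lambda>n. real (Suc n) powr (x - 1))"
      using x by (subst summable_Suc_iff) (simp add: summable_real_powr_iff)
    hence "(\<lambda>n. Gamma ((1 + x) / 2) * Gamma ((1 - x) / 2) * (2 * pi) powr (x - 1) * real (Suc n) powr (x - 1)) sums
        (Gamma ((1 + x) / 2) * Gamma ((1 - x) / 2) * (2 * pi) powr (x - 1) * (\<Sum>n. real (Suc n) powr (x - 1)))"
      by (intro sums_mult summable_sums)
    thus "(\<lambda>n. Gamma ((1 + x) / 2) * Gamma ((1 - x) / 2) * c n powr (x - 1)) sums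
        (Gamma ((1 + x) / 2) * Gamma ((1 - x) / 2) * (2 * pi) powr (x - 1) * (\<Sum>n. real (Suc n) powr (x - 1)))"
      unfolding cp by (simp only: mult.assoc)
    show "0 \<le> Gamma ((1 + x) / 2) * Gamma ((1 - x) / 2) * c n powr (x - 1)" for n
      using x by (intro mult_nonneg_nonneg Gamma_real_nonneg) auto
  qed
  finally show ?thesis .
qed

text \<open>\<open>trap_weight x n\<close> is the integral of \<open>v (1 - v) (n + v)\<^sup>-\<^sup>x\<^sup>-\<^sup>2\<close> over the unit interval.\<close>

definition trap_weight :: "real \<Rightarrow> nat \<Rightarrow> real" where
  "trap_weight x n = (if n = 0 then 1 / (-x) - 1 / (1 - x) else 2 * Re (trap n (of_real x)) / ((x - 1) * x * (x + 1)))"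

text \<open>For n \<ge> 1 this is the kernel form of \<open>trap\<close> divided by its constant.
  For n = 0 the integrand is v^(-x-1) - v^(-x), possibly singular at 0 but integrable because x <
  0.\<close>

lemma trap_weight_has_integral:
  assumes x: "-1 < x" "x < 0"
  shows "((\<lambda>v. v * (1 - v) * (real n + v) powr (-x - 2)) has_integral trap_weight x n) {0..1}"
proof (cases "n = 0")
  case True
  have "((\<lambda>v. v powr (-x - 1) - v powr (-x)) has_integral (1 powr (-x - 1 + 1) / (-x - 1 + 1) - 1 powr (-x + 1) / (-x + 1))) {0..1}"
    using x by (intro has_integral_diff has_integral_powr_from_0) auto
  moreover have "v powr (-x - 1) - v powr (-x) = v * (1 - v) * (real n + v) powr (-x - 2)" if "v \<in> {0..1}" for v
  proof (cases "v = 0")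
    case False
    hence v: "v > 0" using that by auto
    have "v * v powr (-x - 2) = v powr (-x - 1)" "v * v powr (-x - 1) = v powr (-x)"
    proof -
      have "1 + (-x - 2) = -x - 1" "1 + (-x - 1) = -x" by simp_all
      thus "v * v powr (-x - 2) = v powr (-x - 1)" "v * v powr (-x - 1) = v powr (-x)"
        using powr_mult_base[of v "-x - 2"] powr_mult_base[of v "-x - 1"] v by (simp_all only: less_imp_le)
    qed
    thus ?thesis using True by (simp add: algebra_simps)
  qed auto
  ultimately have "((\<lambda>v. v * (1 - v) * (real n + v) powr (-x - 2)) has_integral (1 powr (-x - 1 + 1) / (-x - 1 + 1) - 1 powr (-x + 1) / (-x + 1))) {0..1}"
    by (rule has_integral_eq[rotated])
  thus ?thesis using True by (simp add: trap_weight_def)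
next
  case False
  hence n: "n \<ge> 1" by simp
  define C where "C = (x - 1) * x * (x + 1)"
  have C: "C \<noteq> 0" using x by (simp add: C_def)
  have "((\<lambda>u. Re ((of_real x - 1) * of_real x * (of_real x + 1) / 2 * of_real (u * (1 - u)) * (of_nat n + of_real u) powr (- of_real x - 2)))
          has_integral Re (trap n (of_real x))) {0..1}"
    using has_integral_linear[OF trap_has_integral[OF n, of "of_real x"] bounded_linear_Re] by (simp add: o_def)
  moreover have "Re ((of_real x - 1) * of_real x * (of_real x + 1) / 2 * of_real (u * (1 - u)) * (of_nat n + of_real u) powr (- of_real x - 2)) =
        C / 2 * (u * (1 - u) * (real n + u) powr (-x - 2))" if "u \<in> {0..1}" for u
  proof -
    have "(of_nat n + of_real u :: complex) powr (- of_real x - 2) = of_real ((real n + u) powr (-x - 2))"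
      using that by (subst powr_of_real[symmetric]) auto
    hence "(of_real x - 1) * of_real x * (of_real x + 1) / 2 * of_real (u * (1 - u)) * (of_nat n + of_real u) powr (- of_real x - 2) =
          (of_real (C / 2 * (u * (1 - u) * (real n + u) powr (-x - 2))) :: complex)"
      by (simp add: C_def mult_ac)
    thus ?thesis by (simp only: Re_complex_of_real)
  qed
  ultimately have "((\<lambda>u. C / 2 * (u * (1 - u) * (real n + u) powr (-x - 2))) has_integral Re (trap n (of_real x))) {0..1}"
    by (rule has_integral_eq[rotated])
  hence "((\<lambda>u. 2 / C * (C / 2 * (u * (1 - u) * (real n + u) powr (-x - 2)))) has_integral 2 / C * Re (trap n (of_real x))) {0..1}"
    by (rule has_integral_mult_right)
  moreover have "2 / C * (C / 2 * z) = z" for z using C by simp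
  moreover have "2 / C * Re (trap n (of_real x)) = trap_weight x n"
    using False unfolding trap_weight_def C_def[symmetric] by simp
  ultimately show ?thesis by (simp only:)
qed

text \<open>The second evaluation expands in powers of exp (-y). The kernel times 1 - exp (-y)
  equals y^2 / 2 times the integral of v (1 - v) exp (-vy) over the unit interval, and integrating
  over y first leaves (n + v)^(-x-2).\<close>

lemma nn_integral_coth_left:
  fixes x :: real
  assumes x: "-1 < x" "x < 0"
  shows "(\<integral>\<^sup>+ y. ennreal (indicator {0<..} y * (coth_kernel y * y powr (x - 1))) \<partial>lborel) =
          (\<Sum>n. ennreal (Gamma (x + 2) / 2 * trap_weight x n))"
proof -
  define K where "K = (\<lambda>n y v. indicator {0<..} y * indicator {0..1} v * (v * (1 - v) / 2 * (y powr (x + 1) * exp (- ((real n + v) * y)))))"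
  have inner_v: "(\<integral>\<^sup>+ v. ennreal (K n y v) \<partial>lborel) =
        ennreal (y powr (x - 1) * ((1 + exp (-y)) / 2 - (1 - exp (-y)) / y) * exp (-y) ^ n)" if y: "y > 0" for n y
  proof -
    \<comment> \<open>Written in powers of 1/y, the antiderivative is a polynomial times an
      exponential.\<close>
    define a where "a = 1 / y"
    have ya: "y * a = 1" using y by (simp add: a_def)
    define P where "P = (\<lambda>v. - (v * (1 - v)) * a - (1 - 2 * v) * a\<^sup>2 + 2 * a ^ 3)"
    define B where "B = (\<lambda>v. P v * exp (- (v * y)))"
    have "((\<lambda>v. v * (1 - v) * exp (- (v * y))) has_integral (B 1 - B 0)) {0..1}"
    proof (rule fundamental_theorem_of_calculus)
      fix v :: real
      have E: "((\<lambda>v. exp (- (v * y))) has_real_derivative (- y * exp (- (v * y)))) (at v)"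
        by (auto intro!: derivative_eq_intros)
      have "(P has_real_derivative (- (1 - 2 * v) * a + 2 * a\<^sup>2)) (at v)"
        unfolding P_def by (auto intro!: derivative_eq_intros simp: algebra_simps)
      from DERIV_mult[OF this E]
      have bd: "(B has_real_derivative (- (1 - 2 * v) * a + 2 * a\<^sup>2) * exp (- (v * y)) + (- y * exp (- (v * y))) * P v) (at v)"
        by (simp add: B_def)
      have "y * P v = - (v * (1 - v)) * (y * a) - (1 - 2 * v) * a * (y * a) + 2 * a\<^sup>2 * (y * a)"
        by (simp add: P_def power2_eq_square power3_eq_cube algebra_simps)
      hence yP: "y * P v = - (v * (1 - v)) - (1 - 2 * v) * a + 2 * a\<^sup>2" by (simp add: ya)
      have "(- (1 - 2 * v) * a + 2 * a\<^sup>2) * exp (- (v * y)) + (- y * exp (- (v * y))) * P v =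
              ((- (1 - 2 * v) * a + 2 * a\<^sup>2) - y * P v) * exp (- (v * y))"
      proof -
        have "X * E + (- y * E) * p = (X - y * p) * E" for X E p :: real by (simp add: algebra_simps)
        thus ?thesis .
      qed
      also have "\<dots> = v * (1 - v) * exp (- (v * y))" unfolding yP by (simp add: algebra_simps)
      finally have eq: "(- (1 - 2 * v) * a + 2 * a\<^sup>2) * exp (- (v * y)) + (- y * exp (- (v * y))) * P v = v * (1 - v) * exp (- (v * y))" .
      from bd have "(B has_real_derivative v * (1 - v) * exp (- (v * y))) (at v)" unfolding eq .
      thus "(B has_vector_derivative v * (1 - v) * exp (- (v * y))) (at v within {0..1})"
        unfolding has_real_derivative_iff_has_vector_derivative by (rule has_vector_derivative_at_within)
    qed auto
    hence "((\<lambda>v. (y powr (x + 1) / 2 * exp (-y) ^ n) * (v * (1 - v) * exp (- (v * y)))) has_integral ((y powr (x + 1) / 2 * exp (-y) ^ n) * (B 1 - B 0))) {0..1}"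
      by (rule has_integral_mult_right)
    hence "(\<integral>\<^sup>+ v. ennreal (indicator {0..1} v * ((y powr (x + 1) / 2 * exp (-y) ^ n) * (v * (1 - v) * exp (- (v * y))))) \<partial>lborel) =
            ennreal ((y powr (x + 1) / 2 * exp (-y) ^ n) * (B 1 - B 0))"
      by (rule nn_integral_has_integral_lebesgue[rotated]) (use y in auto)
    also have "(\<lambda>v. indicator {0..1} v * ((y powr (x + 1) / 2 * exp (-y) ^ n) * (v * (1 - v) * exp (- (v * y))))) = K n y"
    proof
      fix v :: real
      have "exp (- ((real n + v) * y)) = exp (-y) ^ n * exp (- (v * y))"
        by (simp add: exp_of_nat_mult[symmetric] exp_add[symmetric] algebra_simps)
      thus "indicator {0..1} v * ((y powr (x + 1) / 2 * exp (-y) ^ n) * (v * (1 - v) * exp (- (v * y)))) = K n y v"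
        using y by (simp add: K_def mult_ac)
    qed
    also have "(y powr (x + 1) / 2 * exp (-y) ^ n) * (B 1 - B 0) = y powr (x - 1) * ((1 + exp (-y)) / 2 - (1 - exp (-y)) / y) * exp (-y) ^ n"
    proof -
      have "y powr (x + 1) = y powr (x - 1) * y\<^sup>2"
        using y powr_add[of y "x - 1" 2] by (simp add: add.commute)
      moreover have "y\<^sup>2 / 2 * (B 1 - B 0) = ((y * a)\<^sup>2 * (1 + exp (-y))) / 2 - (y * a)\<^sup>2 * a * (1 - exp (-y))"
        by (simp add: B_def P_def algebra_simps power2_eq_square power3_eq_cube)
      hence "y\<^sup>2 / 2 * (B 1 - B 0) = (1 + exp (-y)) / 2 - (1 - exp (-y)) / y" unfolding ya by (simp add: a_def)
      moreover have "(p * q / 2 * e) * d = p * (q / 2 * d) * e" for p q e d :: real by simp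
      ultimately show ?thesis by (simp only:)
    qed
    finally show ?thesis .
  qed
  have "(\<integral>\<^sup>+ y. ennreal (indicator {0<..} y * (coth_kernel y * y powr (x - 1))) \<partial>lborel) =
        (\<integral>\<^sup>+ y. (\<Sum>n. (\<integral>\<^sup>+ v. ennreal (K n y v) \<partial>lborel)) \<partial>lborel)"
  proof (intro nn_integral_cong)
    fix y :: real
    show "ennreal (indicator {0<..} y * (coth_kernel y * y powr (x - 1))) = (\<Sum>n. (\<integral>\<^sup>+ v. ennreal (K n y v) \<partial>lborel))"
    proof (cases "y > 0")
      case True
      define A where "A = y powr (x - 1) * ((1 + exp (-y)) / 2 - (1 - exp (-y)) / y)"
      have e: "exp (-y) < 1" using True by simp
      have "(1 + exp (-y)) / 2 - (1 - exp (-y)) / y = (1 - exp (-y)) * coth_kernel y"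
        using e True by (simp add: coth_kernel_def field_simps)
      \<comment> \<open>Positivity of the kernel is read off from its partial fractions; it permits
        summation in the extended reals.\<close>
      moreover have "coth_kernel y \<ge> 0"
        using True by (intro sums_le[OF _ sums_zero coth_partial_fractions[OF True, folded coth_kernel_def]]) auto
      ultimately have A: "A \<ge> 0" "A / (1 - exp (-y)) = coth_kernel y * y powr (x - 1)"
        using e by (auto simp: A_def)
      have "(\<lambda>n. A * exp (-y) ^ n) sums (A * (1 / (1 - exp (-y))))"
        using e by (intro sums_mult geometric_sums) auto
      hence "(\<lambda>n. A * exp (-y) ^ n) sums (coth_kernel y * y powr (x - 1))" using A(2) by simp
      hence "(\<Sum>n. ennreal (A * exp (-y) ^ n)) = ennreal (coth_kernel y * y powr (x - 1))"
        using A(1) by (intro suminf_ennreal_eq) auto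
      thus ?thesis using True by (simp add: inner_v[OF True] A_def)
    qed (simp add: K_def)
  qed
  also have "\<dots> = (\<Sum>n. (\<integral>\<^sup>+ y. (\<integral>\<^sup>+ v. ennreal (K n y v) \<partial>lborel) \<partial>lborel))"
    by (rule nn_integral_suminf) (simp add: K_def)
  also have "\<dots> = (\<Sum>n. ennreal (Gamma (x + 2) / 2 * trap_weight x n))"
  proof (rule suminf_cong)
    fix n
    have "(\<integral>\<^sup>+ y. (\<integral>\<^sup>+ v. ennreal (K n y v) \<partial>lborel) \<partial>lborel) = (\<integral>\<^sup>+ v. (\<integral>\<^sup>+ y. ennreal (K n y v) \<partial>lborel) \<partial>lborel)"
      by (rule lborel_pair.Fubini'[where f = "\<lambda>y v. ennreal (K n y v)", symmetric]) (simp add: K_def case_prod_unfold, measurable)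
    also have "\<dots> = (\<integral>\<^sup>+ v. ennreal (indicator {0..1} v * (Gamma (x + 2) / 2 * (v * (1 - v) * (real n + v) powr (-x - 2)))) \<partial>lborel)"
    proof (intro nn_integral_cong)
      fix v :: real
      show "(\<integral>\<^sup>+ y. ennreal (K n y v) \<partial>lborel) = ennreal (indicator {0..1} v * (Gamma (x + 2) / 2 * (v * (1 - v) * (real n + v) powr (-x - 2))))"
      proof (cases "v > 0 \<and> v \<le> 1")
        case True
        have "(\<integral>\<^sup>+ y. ennreal (K n y v) \<partial>lborel) =
              (\<integral>\<^sup>+ y. ennreal (v * (1 - v) / 2) * ennreal (indicator {0<..} y * (y powr (x + 2 - 1) * exp (- ((real n + v) * y)))) \<partial>lborel)"
        proof (intro nn_integral_cong)
          fix y :: real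
          have "K n y v = (v * (1 - v) / 2) * (indicator {0<..} y * (y powr (x + 2 - 1) * exp (- ((real n + v) * y))))"
            using True by (simp add: K_def add.commute)
          thus "ennreal (K n y v) = ennreal (v * (1 - v) / 2) * ennreal (indicator {0<..} y * (y powr (x + 2 - 1) * exp (- ((real n + v) * y))))"
            by (simp only:) (rule ennreal_mult', use True in auto)
        qed
        also have "\<dots> = ennreal (v * (1 - v) / 2) * ennreal (Gamma (x + 2) * (real n + v) powr (- (x + 2)))"
          by (subst nn_integral_cmult) (use x True nn_integral_Gamma_scaled[of "x + 2" "real n + v"] in auto)
        also have "\<dots> = ennreal (indicator {0..1} v * (Gamma (x + 2) / 2 * (v * (1 - v) * (real n + v) powr (-x - 2))))"
        proof -
          have "- (x + 2) = -x - 2" by simp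
          thus ?thesis using True by (subst ennreal_mult'[symmetric]) (auto simp: mult_ac)
        qed
        finally show ?thesis .
      next
        case False
        hence "v = 0 \<or> v \<notin> {0..1}" by auto
        thus ?thesis by (auto simp: K_def)
      qed
    qed
    also have "\<dots> = ennreal (Gamma (x + 2) / 2 * trap_weight x n)"
      using x by (intro nn_integral_has_integral_lebesgue has_integral_mult_right trap_weight_has_integral)
                 (auto intro!: mult_nonneg_nonneg)
    finally show "(\<integral>\<^sup>+ y. (\<integral>\<^sup>+ v. ennreal (K n y v) \<partial>lborel) \<partial>lborel) = ennreal (Gamma (x + 2) / 2 * trap_weight x n)" .
  qed
  finally show ?thesis .
qed

section \<open>The functional equation on a real interval\<close>

lemma trap_of_real:
  "trap n (of_real x) = of_real ((x - 1) * (real n powr (-x) + real (n + 1) powr (-x)) / 2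
      + real (n + 1) powr (1 - x) - real n powr (1 - x))"
proof -
  have "(of_nat k :: complex) powr (of_real y) = of_real (real k powr y)" for k y
    by (subst powr_of_real[symmetric]) auto
  from this[of _ "-x"] this[of _ "1 - x"] show ?thesis
    unfolding trap_def by (simp only: of_real_minus of_real_diff of_real_1) simp
qed

lemma trap_weight_nonneg:
  assumes "-1 < x" "x < 0"
  shows "trap_weight x n \<ge> 0"
  by (rule has_integral_nonneg[OF trap_weight_has_integral[OF assms]]) auto

text \<open>On this interval the isolated term (x + 1)/2 is exactly the contribution of the cell
  [0, 1], the weight with n = 0. So the whole value becomes one sum of weights over n \<ge>
  0.\<close>

lemma zeta_right_of_real:
  assumes x: "-1 < x" "x < 0"
  shows "summable (trap_weight x)"
    and "zeta_right (of_real x) = of_real ((x - 1) * x * (x + 1) / 2 * (\<Sum>n. trap_weight x n))"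
proof -
  define C where "C = (x - 1) * x * (x + 1)"
  have C: "C \<noteq> 0" using x by (simp add: C_def)
  have tw: "Re (trap (Suc n) (of_real x)) = C / 2 * trap_weight x (Suc n)" for n
    using C unfolding trap_weight_def C_def[symmetric] by simp
  have ts: "(\<lambda>n. trap (Suc n) (of_real x)) sums (\<Sum>n. trap (Suc n) (of_real x))"
    by (rule summable_sums[OF summable_norm_cancel[OF summable_norm_trap]]) (use x in simp)
  have tr: "(\<lambda>n. C / 2 * trap_weight x (Suc n)) sums Re (\<Sum>n. trap (Suc n) (of_real x))"
    using sums_Re[OF ts] unfolding tw .
  from sums_mult[OF tr, of "2 / C"] have "(\<lambda>n. trap_weight x (Suc n)) sums (2 / C * Re (\<Sum>n. trap (Suc n) (of_real x)))"
    using C by simp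
  hence total: "trap_weight x sums (2 / C * Re (\<Sum>n. trap (Suc n) (of_real x)) + trap_weight x 0)"
    by (subst (asm) sums_Suc_iff) simp
  thus "summable (trap_weight x)" by (rule sums_summable)
  have "(\<Sum>n. trap (Suc n) (of_real x)) = (of_real (Re (\<Sum>n. trap (Suc n) (of_real x))) :: complex)"
  proof -
    have "(\<lambda>n. Im (trap (Suc n) (of_real x))) sums Im (\<Sum>n. trap (Suc n) (of_real x))" by (rule sums_Im[OF ts])
    hence "Im (\<Sum>n. trap (Suc n) (of_real x)) = 0" unfolding trap_of_real by (simp add: sums_iff)
    thus ?thesis by (simp add: complex_eq_iff)
  qed
  moreover have "C / 2 * (\<Sum>n. trap_weight x n) = Re (\<Sum>n. trap (Suc n) (of_real x)) + (x + 1) / 2"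
  proof -
    have "C / 2 * trap_weight x 0 = (x + 1) / 2"
      using x by (simp add: C_def trap_weight_def field_simps)
    moreover have "(\<Sum>n. trap_weight x n) = 2 / C * Re (\<Sum>n. trap (Suc n) (of_real x)) + trap_weight x 0"
      using total by (simp add: sums_iff)
    ultimately show ?thesis using C by (simp add: distrib_left)
  qed
  ultimately show "zeta_right (of_real x) = of_real ((x - 1) * x * (x + 1) / 2 * (\<Sum>n. trap_weight x n))"
    unfolding zeta_right_def C_def[symmetric] by simp
qed

text \<open>The functional equation solved for (s - 1) \<zeta>(s). The argument s/2 + 1 of
  \<open>rGamma\<close> comes from rGamma (s/2) = (s/2) rGamma (s/2 + 1), whose factor s cancels
  against the one in \<open>zeta_right\<close> (1 - s) = -s \<zeta>(1 - s).\<close>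

definition zeta_left :: "complex \<Rightarrow> complex" where
  "zeta_left s = (1 - s) / 2 * of_real pi powr (s - 1/2) * Gamma ((1 - s) / 2) * rGamma (s / 2 + 1) * zeta_right (1 - s)"

text \<open>Equate the two evaluations of the Mellin transform. They involve Gamma (x + 2) and Gamma
  ((1 + x)/2); Legendre duplication trades their quotient for Gamma (x/2 + 1).\<close>

lemma functional_equation_real:
  fixes x :: real
  assumes x: "-1 < x" "x < 0"
  shows "zeta_right (of_real x) = zeta_left (of_real x)"
proof -
  define J where "J = (\<Sum>n. trap_weight x n)"
  define Z where "Z = (\<Sum>n. real (Suc n) powr (x - 1))"
  define G1 G2 G3 where "G1 = Gamma ((1 + x) / 2)" and "G2 = Gamma ((1 - x) / 2)" and "G3 = Gamma (x / 2 + 1)"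
  have pos: "G1 > 0" "G2 > 0" "G3 > 0" using x by (auto simp: G1_def G2_def G3_def intro!: Gamma_real_pos)
  have sw: "summable (trap_weight x)" and zr: "zeta_right (of_real x) = of_real ((x - 1) * x * (x + 1) / 2 * J)"
    unfolding J_def by (rule zeta_right_of_real[OF x])+
  have Z0: "Z \<ge> 0" unfolding Z_def using x
    by (intro suminf_nonneg) (subst summable_Suc_iff, auto simp: summable_real_powr_iff)
  have "(\<Sum>n. ennreal (Gamma (x + 2) / 2 * trap_weight x n)) = ennreal (Gamma (x + 2) / 2 * J)"
  proof (rule suminf_ennreal_eq)
    show "0 \<le> Gamma (x + 2) / 2 * trap_weight x n" for n
      using x by (intro mult_nonneg_nonneg trap_weight_nonneg) auto
    show "(\<lambda>n. Gamma (x + 2) / 2 * trap_weight x n) sums (Gamma (x + 2) / 2 * J)"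
      unfolding J_def by (intro sums_mult summable_sums sw)
  qed
  hence "ennreal (Gamma (x + 2) / 2 * J) = ennreal (G1 * G2 * (2 * pi) powr (x - 1) * Z)"
    using nn_integral_coth_left[OF x] nn_integral_coth_right[OF x] by (simp add: G1_def G2_def Z_def)
  moreover have "J \<ge> 0" unfolding J_def by (intro suminf_nonneg sw trap_weight_nonneg x)
  ultimately have main: "Gamma (x + 2) / 2 * J = G1 * G2 * (2 * pi) powr (x - 1) * Z"
    using x pos Z0 by (subst (asm) ennreal_inj) (auto intro!: mult_nonneg_nonneg)
  have dup: "G1 * G3 = exp (- x * ln 2) * sqrt pi * Gamma (x + 1)"
  proof -
    define z :: complex where "z = of_real ((1 + x) / 2)"
    have nz: "of_real r \<notin> (\<int>\<^sub>\<le>\<^sub>0 :: complex set)" if "r > 0" for r :: real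
      using that by (auto elim!: nonpos_Ints_cases simp: complex_eq_iff)
    have z2: "z + 1/2 = of_real (x / 2 + 1)" by (simp add: z_def field_simps)
    have "Gamma z * Gamma (z + 1/2) = exp ((1 - 2 * z) * of_real (ln 2)) * of_real (sqrt pi) * Gamma (2 * z)"
    proof (rule Gamma_legendre_duplication)
      show "z \<notin> \<int>\<^sub>\<le>\<^sub>0" unfolding z_def by (rule nz) (use x in simp)
      show "z + 1/2 \<notin> \<int>\<^sub>\<le>\<^sub>0" unfolding z2 by (rule nz) (use x in simp)
    qed
    also have "2 * z = of_real (x + 1)" by (simp add: z_def)
    also have "1 - of_real (x + 1) = (of_real (-x) :: complex)" by simp
    also have "exp (of_real (- x) * of_real (ln 2) :: complex) = of_real (exp (- x * ln 2))"
      by (subst of_real_mult[symmetric], rule exp_of_real)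
    also have "Gamma z = of_real G1" unfolding z_def G1_def by (rule Gamma_complex_of_real)
    also have "Gamma (z + 1/2) = of_real G3" unfolding z2 G3_def by (rule Gamma_complex_of_real)
    also have "Gamma (of_real (x + 1) :: complex) = of_real (Gamma (x + 1))" by (rule Gamma_complex_of_real)
    finally have "complex_of_real (G1 * G3) = of_real (exp (- x * ln 2) * sqrt pi * Gamma (x + 1))"
      by (simp only: of_real_mult)
    thus ?thesis by (simp only: of_real_eq_iff)
  qed
  have G2': "Gamma (x + 2) = (x + 1) * Gamma (x + 1)"
  proof -
    have "x + 1 \<notin> \<int>\<^sub>\<le>\<^sub>0" using x by (auto dest: nonpos_Ints_nonpos)
    from Gamma_plus1[OF this] show ?thesis by (simp add: add.assoc)
  qed
  have e2: "exp (- x * ln 2) = 2 powr (-x)" by (simp add: powr_def)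
  have h: "(x + 1) * J = pi powr (x - 1/2) * G2 * Z / G3"
  proof -
    have "2 powr (-x) * sqrt pi * ((x + 1) * Gamma (x + 1) / 2 * J) = 2 powr (-x) * sqrt pi * (G1 * G2 * (2 * pi) powr (x - 1) * Z)"
      using main unfolding G2' by simp
    also have "2 powr (-x) * sqrt pi * ((x + 1) * Gamma (x + 1) / 2 * J) = (G1 * G3) * ((x + 1) / 2 * J)"
      unfolding dup e2 by (simp add: mult_ac)
    finally have "G3 * ((x + 1) / 2 * J) = 2 powr (-x) * sqrt pi * (G2 * (2 * pi) powr (x - 1) * Z)"
      using pos by simp
    also have "2 powr (-x) * sqrt pi * (G2 * (2 * pi) powr (x - 1) * Z) = pi powr (x - 1/2) / 2 * (G2 * Z)"
    proof -
      have "(2 * pi) powr (x - 1) = 2 powr (x - 1) * pi powr (x - 1)" by (rule powr_mult)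
      moreover have "2 powr (-x) * 2 powr (x - 1) = (1 / 2 :: real)"
        by (subst powr_add[symmetric]) (simp add: powr_minus_divide)
      moreover have "sqrt pi * pi powr (x - 1) = pi powr (x - 1/2)"
        by (simp add: powr_half_sqrt[symmetric] flip: powr_add)
      moreover have "a * b * (G2 * (c * d) * Z) = (a * c) * (b * d) * (G2 * Z)" for a b c d by simp
      ultimately show ?thesis by (simp only:)
    qed
    finally show ?thesis using pos by (simp add: field_simps)
  qed
  have "(x - 1) * x * (x + 1) / 2 * J = (x - 1) * x / 2 * ((x + 1) * J)" by simp
  hence zr': "zeta_right (of_real x) = of_real ((x - 1) * x / 2 * (pi powr (x - 1/2) * G2 * Z / G3))"
    unfolding zr by (simp only: h)
  have zr1: "zeta_right (1 - of_real x) = of_real (-x * Z)"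
  proof -
    have s: "Re (1 - of_real x :: complex) > 1" using x by simp
    have "(\<lambda>n. of_real (real (Suc n) powr (x - 1)) :: complex) sums of_real Z"
      unfolding Z_def using x
      by (intro sums_of_real summable_sums) (subst summable_Suc_iff, simp add: summable_real_powr_iff)
    moreover have "of_real (real (Suc n) powr (x - 1)) = zeta_coeff (Suc n) * of_nat (Suc n) powr (- (1 - of_real x))" for n
    proof -
      have "(of_nat (Suc n) :: complex) powr (of_real (x - 1)) = of_real (real (Suc n) powr (x - 1))"
        by (subst powr_of_real[symmetric]) auto
      thus ?thesis by (simp add: zeta_coeff_def)
    qed
    ultimately have "(\<lambda>n. zeta_coeff (Suc n) * of_nat (Suc n) powr (- (1 - of_real x))) sums of_real Z" by simp
    hence "(\<lambda>n. zeta_coeff n * of_nat n powr (- (1 - of_real x))) sums (of_real Z + zeta_coeff 0 * of_nat 0 powr (- (1 - of_real x)))"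
      by (rule sums_Suc)
    hence "dirichlet_series zeta_coeff (1 - of_real x) = of_real Z"
      by (simp add: dirichlet_series_def sums_iff zeta_coeff_def)
    thus ?thesis unfolding zeta_right_eq[OF s] by simp
  qed
  have "zeta_left (of_real x) = of_real ((1 - x) / 2 * pi powr (x - 1/2) * G2 * (1 / G3) * (-x * Z))"
  proof -
    have "of_real pi powr (of_real x - 1/2) = (of_real (pi powr (x - 1/2)) :: complex)"
      by (subst powr_of_real[symmetric]) auto
    moreover have "Gamma ((1 - of_real x) / 2) = (of_real G2 :: complex)"
      using Gamma_complex_of_real[of "(1 - x) / 2"] by (simp add: G2_def)
    moreover have "rGamma (of_real x / 2 + 1) = (of_real (1 / G3) :: complex)"
      using Gamma_complex_of_real[of "x / 2 + 1"] by (simp add: G3_def rGamma_inverse_Gamma inverse_eq_divide)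
    ultimately show ?thesis unfolding zeta_left_def zr1 by simp
  qed
  moreover have "(1 - x) / 2 * pi powr (x - 1/2) * G2 * (1 / G3) * (-x * Z) = (x - 1) * x / 2 * (pi powr (x - 1/2) * G2 * Z / G3)"
  proof -
    have 1: "(1 - x) * (- x) = (x - 1) * x" by (simp add: algebra_simps)
    have "b / 2 * P * g * (1 / G) * (c * z) = (b * c) / 2 * (P * g * z / G)" for b c P g G z :: real by simp
    thus ?thesis by (simp only: 1)
  qed
  ultimately show ?thesis unfolding zr' by (simp only:)
qed

section \<open>Continuation of zeta to the whole plane\<close>

lemma zeta_left_holomorphic: "zeta_left holomorphic_on {s. Re s < 1}"
proof -
  have G: "(1 - s) / 2 \<notin> \<int>\<^sub>\<le>\<^sub>0" if "Re s < 1" for s :: complex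
    using that by (auto elim!: nonpos_Ints_cases simp: complex_eq_iff)
  have "(\<lambda>s. zeta_right (1 - s)) holomorphic_on {s. Re s < 1}"
    by (rule holomorphic_on_compose_gen[OF _ holomorphic_zeta_right, unfolded o_def]) (auto intro!: holomorphic_intros)
  thus ?thesis unfolding zeta_left_def[abs_def]
    by (intro holomorphic_intros) (use G in auto)
qed

text \<open>The identity theorem on the strip: both functions agree on the real interval (-1, 0),
  which accumulates at -1/2.\<close>

lemma zeta_left_eq_right:
  assumes "-1 < Re s" "Re s < 1"
  shows "zeta_right s = zeta_left s"
proof -
  define S where "S = {s. -1 < Re s} \<inter> {s. Re s < 1}"
  have S: "open S" "connected S"
    unfolding S_def
    by (intro open_Int open_halfspace_Re_gt open_halfspace_Re_lt)
       (intro convex_connected convex_Int convex_halfspace_Re_gt convex_halfspace_Re_lt)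
  have "zeta_right s - zeta_left s = 0"
  proof (rule analytic_continuation[OF _ S, where f = "\<lambda>s. zeta_right s - zeta_left s" and w = s and U = "of_real ` {-1<..<0}" and \<xi> = "of_real (-1/2)"])
    show "(\<lambda>s. zeta_right s - zeta_left s) holomorphic_on S"
      by (intro holomorphic_on_diff holomorphic_on_subset[OF holomorphic_zeta_right] holomorphic_on_subset[OF zeta_left_holomorphic])
         (auto simp: S_def)
    have "(-1/2::real) islimpt {-1<..<0}" by (simp add: islimpt_greaterThanLessThan1 open_imp_islimpt interior_limit_point)
    thus "complex_of_real (-1/2) islimpt of_real ` {-1<..<0}"
    proof (rule islimpt_isCont_image)
      show "isCont complex_of_real (-1/2)" by (intro continuous_intros)
      show "eventually (\<lambda>x. complex_of_real x \<noteq> of_real (-1/2)) (at (-1/2))"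
        unfolding of_real_eq_iff by (simp add: eventually_at_filter)
    qed
  qed (use assms functional_equation_real in \<open>auto simp: S_def\<close>)
  thus ?thesis by simp
qed

definition zeta_entire :: "complex \<Rightarrow> complex" where
  "zeta_entire s = (if Re s > 0 then zeta_right s else zeta_left s)"

lemma zeta_entire_right: "Re s > -1 \<Longrightarrow> zeta_entire s = zeta_right s"
  and zeta_entire_left: "Re s < 1 \<Longrightarrow> zeta_entire s = zeta_left s"
  using zeta_left_eq_right[of s] by (auto simp: zeta_entire_def)

lemma holomorphic_zeta_entire: "zeta_entire holomorphic_on UNIV"
proof -
  have "zeta_entire holomorphic_on {s. Re s > -1}"
    by (rule holomorphic_transform[OF holomorphic_zeta_right]) (simp add: zeta_entire_right)
  moreover have "zeta_entire holomorphic_on {s. Re s < 1}"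
    by (rule holomorphic_transform[OF zeta_left_holomorphic]) (simp add: zeta_entire_left)
  ultimately have "zeta_entire holomorphic_on ({s. Re s > -1} \<union> {s. Re s < 1})"
    by (intro holomorphic_on_Un open_halfspace_Re_gt open_halfspace_Re_lt)
  also have "{s. Re s > -1} \<union> {s. Re s < 1} = UNIV" by auto
  finally show ?thesis .
qed

lemma zeta_entire_1: "zeta_entire 1 = 1"
proof -
  have "trap (Suc n) 1 = 0" for n by (simp add: trap_def del: of_nat_Suc of_nat_add)
  thus ?thesis by (simp add: zeta_entire_def zeta_right_def)
qed

text \<open>Schwarz reflection. It removes the conjugation from the functional equation that the
  class prescribes.\<close>

lemma cnj_zeta_right:
  assumes "Re s > -1"
  shows "cnj (zeta_right s) = zeta_right (cnj s)"
proof -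
  have *: "cnj (of_nat n powr w) = of_nat n powr cnj w" for n w by (subst cnj_powr) auto
  have c: "cnj (trap n s) = trap n (cnj s)" for n
    by (simp only: trap_def complex_cnj_add complex_cnj_diff complex_cnj_mult complex_cnj_divide
        complex_cnj_minus complex_cnj_one complex_cnj_numeral *)
  have "(\<lambda>n. trap (Suc n) s) sums (\<Sum>n. trap (Suc n) s)"
    by (rule summable_sums[OF summable_norm_cancel[OF summable_norm_trap[OF assms]]])
  hence "(\<lambda>n. trap (Suc n) (cnj s)) sums cnj (\<Sum>n. trap (Suc n) s)"
    unfolding c[symmetric] by (simp only: sums_cnj)
  thus ?thesis by (simp add: zeta_right_def sums_iff)
qed

lemma cnj_zeta_entire: "cnj (zeta_entire s) = zeta_entire (cnj s)"
proof (cases "Re s > 0")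
  case False
  have "cnj (of_real pi powr (s - 1/2)) = of_real pi powr (cnj s - 1/2)" by (subst cnj_powr) auto
  thus ?thesis using False cnj_zeta_right[of "1 - s"]
    by (simp add: zeta_entire_def zeta_left_def cnj_Gamma cnj_rGamma)
qed (simp add: zeta_entire_def cnj_zeta_right)

text \<open>At s = 1 division by zero yields the value 0, which is what
  \<open>nicely_meromorphic_on\<close> demands at a pole.\<close>

definition zeta_fun :: "complex \<Rightarrow> complex" where
  "zeta_fun s = zeta_entire s / (s - 1)"

lemma cnj_zeta_fun: "cnj (zeta_fun s) = zeta_fun (cnj s)"
  by (simp add: zeta_fun_def cnj_zeta_entire)

section \<open>The completed zeta function\<close>

definition completed_zeta :: "complex \<Rightarrow> complex" where
  "completed_zeta s = of_real pi powr (- s / 2) * Gamma (s / 2) * zeta_fun s"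

text \<open>Excluding the integers keeps both s and 1 - s away from all poles of Gamma and zeta, and
  the exceptional set stays discrete.\<close>

lemma completed_zeta_reflect_left:
  assumes "Re s < 1" "s \<notin> \<int>"
  shows "completed_zeta s = completed_zeta (1 - s)"
proof -
  have s: "s \<noteq> 0" "s \<noteq> 1" "s / 2 \<notin> \<int>\<^sub>\<le>\<^sub>0"
  proof -
    show "s \<noteq> 0" "s \<noteq> 1" using assms by auto
    show "s / 2 \<notin> \<int>\<^sub>\<le>\<^sub>0"
    proof
      assume "s / 2 \<in> \<int>\<^sub>\<le>\<^sub>0"
      hence "s / 2 \<in> \<int>" using nonpos_Ints_Int by blast
      hence "2 * (s / 2) \<in> \<int>" by (intro Ints_mult) auto
      with assms show False by simp
    qed
  qed
  define Z where "Z = zeta_right (1 - s)"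
  have e1: "zeta_entire s = (1 - s) / 2 * of_real pi powr (s - 1/2) * Gamma ((1 - s) / 2) * rGamma (s / 2 + 1) * Z"
    using assms by (simp add: zeta_entire_left zeta_left_def Z_def)
  have e2: "zeta_entire (1 - s) = Z" using assms by (simp add: zeta_entire_def Z_def)
  have G: "Gamma (s / 2) * rGamma (s / 2 + 1) = 2 / s"
  proof -
    have "s / 2 * rGamma (s / 2 + 1) = rGamma (s / 2)" by (rule rGamma_plus1)
    moreover have "Gamma (s / 2) * rGamma (s / 2) = 1"
      using s(3) by (simp add: rGamma_inverse_Gamma Gamma_eq_zero_iff)
    ultimately have "Gamma (s / 2) * (s / 2 * rGamma (s / 2 + 1)) = 1" by simp
    thus ?thesis using s(1) by (simp add: field_simps)
  qed
  have P: "(of_real pi :: complex) powr (- s / 2) * of_real pi powr (s - 1/2) = of_real pi powr (- (1 - s) / 2)"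
  proof -
    have "- s / 2 + (s - 1/2) = - (1 - s) / 2" by (simp add: field_simps)
    thus ?thesis by (simp only: powr_add[symmetric])
  qed
  have "completed_zeta s = (of_real pi powr (- s / 2) * of_real pi powr (s - 1/2)) * (Gamma (s / 2) * rGamma (s / 2 + 1)) *
          ((1 - s) / 2 / (s - 1)) * Gamma ((1 - s) / 2) * Z"
    unfolding completed_zeta_def zeta_fun_def e1 by simp
  also have "(1 - s) / 2 / (s - 1) = - 1 / 2" using s by (simp add: field_simps)
  finally show ?thesis
    unfolding P G completed_zeta_def zeta_fun_def e2 using s by (simp add: field_simps)
qed

lemma completed_zeta_reflect:
  assumes "s \<notin> \<int>"
  shows "completed_zeta s = completed_zeta (1 - s)"
proof (cases "Re s < 1")
  case True
  thus ?thesis using assms by (rule completed_zeta_reflect_left)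
next
  case False
  have "1 - s \<notin> \<int>" using assms Ints_diff[of 1 "1 - s"] by auto
  thus ?thesis using completed_zeta_reflect_left[of "1 - s"] False by simp
qed

section \<open>Zeta has finite order\<close>

lemma Gamma_real_le_exp_square:
  "\<exists>K>0. \<forall>x\<ge>1/4. Gamma (x::real) \<le> K * exp (x\<^sup>2)"
proof -
  have nI: "x \<notin> \<int>\<^sub>\<le>\<^sub>0" if "x > 0" for x :: real using that by (auto dest: nonpos_Ints_nonpos)
  have "continuous_on {1/4..5/4} (Gamma :: real \<Rightarrow> real)"
    by (intro continuous_intros) (use nI in force)
  hence "compact ((Gamma :: real \<Rightarrow> real) ` {1/4..5/4})" by (rule compact_continuous_image) simp
  then obtain K0 where K0: "\<And>x::real. x \<in> {1/4..5/4} \<Longrightarrow> norm (Gamma x) \<le> K0"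
    using compact_imp_bounded by (force simp: bounded_iff)
  define K where "K = max K0 1"
  have K: "K > 0" by (simp add: K_def)
  have base: "Gamma x \<le> K" if "x \<in> {1/4..5/4}" for x :: real
    using K0[OF that] by (simp add: K_def)
  have "Gamma x \<le> K * exp (x\<^sup>2)" if "1/4 \<le> x" "x \<le> 5/4 + real n" for x n
    using that
  proof (induction n arbitrary: x)
    case 0
    have "Gamma x \<le> K * 1" using base[of x] 0 by simp
    also have "\<dots> \<le> K * exp (x\<^sup>2)" using K by (intro mult_left_mono) auto
    finally show ?case .
  next
    case (Suc n)
    show ?case
    proof (cases "x \<le> 5/4 + real n")
      case False
      have x1: "x - 1 > 0" "1/4 \<le> x - 1" "x - 1 \<le> 5/4 + real n" using False Suc.prems by auto
      \<comment> \<open>The step costs a factor x - 1 \<le> exp (2x - 1), and 2x - 1 is the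
        increment from (x - 1)^2 to x^2, so the bound reproduces itself.\<close>
      have "Gamma x = (x - 1) * Gamma (x - 1)" using Gamma_plus1[OF nI[OF x1(1)]] by simp
      also have "\<dots> \<le> exp (2 * x - 1) * (K * exp ((x - 1)\<^sup>2))"
      proof (intro mult_mono Suc.IH x1)
        show "x - 1 \<le> exp (2 * x - 1)" using exp_ge_add_one_self[of "2 * x - 1"] x1 by linarith
        show "0 \<le> Gamma (x - 1)" using x1 by (intro Gamma_real_nonneg)
      qed auto
      also have "\<dots> = K * exp (2 * x - 1 + (x - 1)\<^sup>2)" by (simp add: exp_add)
      also have "2 * x - 1 + (x - 1)\<^sup>2 = x\<^sup>2" by (simp add: power2_eq_square algebra_simps)
      finally show ?thesis .
    qed (use Suc in auto)
  qed
  moreover have "\<exists>n. x \<le> 5/4 + real n" for x using real_arch_simple[of "x - 5/4"] by (auto simp: algebra_simps)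
  ultimately show ?thesis using K by blast
qed

lemma norm_sin_le_exp_norm: "norm (sin (z::complex)) \<le> exp (norm z)"
  using cmod_sin_le_exp[of 1 z] order_trans[OF _ iffD2[OF exp_le_cancel_iff abs_Im_le_cmod[of z]]] by simp

text \<open>All factors but one are elementary or have arguments in the right half-plane. The
  reciprocal Gamma value is traded by the reflection formula for a sine and a Gamma value at 1 -
  s/2.\<close>

lemma zeta_left_growth:
  "\<exists>C>0. \<forall>s. Re s \<le> 1/2 \<and> norm s \<ge> 2 \<longrightarrow>
     norm (zeta_left s) \<le> C * (1 + norm s) ^ 4 * exp (9 * (1 + norm s) + 2 * (1 + norm s)\<^sup>2)"
proof -
  obtain K where K: "K > 0" "\<And>x::real. x \<ge> 1/4 \<Longrightarrow> Gamma x \<le> K * exp (x\<^sup>2)"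
    using Gamma_real_le_exp_square by blast
  obtain C0 where C0: "\<And>s. Re s \<ge> -1/2 \<Longrightarrow> norm (zeta_right s) \<le> C0 * (1 + norm s) ^ 3"
    using zeta_right_growth by blast
  define C1 where "C1 = max C0 1"
  have C1: "C1 > 0" "C0 \<le> C1" by (auto simp: C1_def)
  have Gz: "norm (Gamma z) \<le> K * exp (N\<^sup>2)" if "Re z \<ge> 1/4" "norm z \<le> N" for z N
  proof -
    have "norm (Gamma z) \<le> Gamma (Re z)" by (rule norm_Gamma_le_Gamma_Re) (use that in auto)
    also have "\<dots> \<le> K * exp ((Re z)\<^sup>2)" by (rule K(2)) fact
    also have "\<dots> \<le> K * exp (N\<^sup>2)"
      using K that complex_Re_le_cmod[of z] by (intro mult_left_mono) (auto intro!: power_mono)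
    finally show ?thesis .
  qed
  have "norm (zeta_left s) \<le> (K * K * (8 * C1)) * (1 + norm s) ^ 4 * exp (9 * (1 + norm s) + 2 * (1 + norm s)\<^sup>2)"
    if s: "Re s \<le> 1/2" "norm s \<ge> 2" for s
  proof -
    define N where "N = 1 + norm s"
    have N: "N \<ge> 3" using s by (simp add: N_def)
    have n1: "norm (1 - s) \<le> N" using norm_triangle_ineq4[of 1 s] by (simp add: N_def)
    have f1: "norm ((1 - s) / 2) \<le> N" using n1 N by (simp add: norm_divide)
    have f2: "norm (of_real pi powr (s - 1/2) :: complex) \<le> exp (2 * N)"
    proof -
      have "norm (of_real pi powr (s - 1/2) :: complex) = exp (Re (s - 1/2) * ln pi)"
        using pi_gt_zero by (simp add: norm_powr_real)
      also have "Re (s - 1/2) * ln pi \<le> N * 2"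
      proof (rule mult_mono)
        show "Re (s - 1/2) \<le> N" using complex_Re_le_cmod[of s] by (simp add: N_def)
        show "ln pi \<le> 2"
        proof -
          have "ln pi \<le> pi - 1" by (rule ln_le_minus_one) simp
          thus ?thesis using pi_less_4 ln_le_minus_one[of "pi / 2"] ln_2_less_1 by (simp add: ln_div)
        qed
        show "0 \<le> ln pi" using pi_gt3 by (intro ln_ge_zero) simp
      qed (use N in auto)
      finally show ?thesis by (simp add: mult.commute)
    qed
    have f3: "norm (Gamma ((1 - s) / 2)) \<le> K * exp (N\<^sup>2)"
      by (rule Gz[OF _ f1]) (use s in simp)
    have f4: "norm (rGamma (s / 2 + 1)) \<le> exp (4 * N) * (K * exp (N\<^sup>2))"
    proof -
      have s0: "s \<noteq> 0" using s by auto
      \<comment> \<open>Reflection at s/2 + 1 produces rGamma (-s/2). One functional step moves this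
        to 1 - s/2, of real part at least 3/4, and the factor |s|/2 gained on the way is at least
        1.\<close>
      have h1: "- (s / 2) * rGamma (1 - s / 2) = rGamma (- (s / 2))"
        using rGamma_plus1[of "- (s / 2)"] by (simp add: add.commute)
      have h2: "rGamma (s / 2 + 1) * rGamma (- (s / 2)) = sin (of_real pi * (s / 2 + 1)) / of_real pi"
        using rGamma_reflection_complex[of "s / 2 + 1"] by simp
      have h3: "rGamma (1 - s / 2) * Gamma (1 - s / 2) = 1"
      proof -
        have "1 - s / 2 \<notin> \<int>\<^sub>\<le>\<^sub>0" using s by (auto dest: nonpos_Ints_Int elim!: nonpos_Ints_cases simp: complex_eq_iff)
        thus ?thesis by (simp add: rGamma_inverse_Gamma Gamma_eq_zero_iff)
      qed
      have "sin (of_real pi * (s / 2 + 1)) / of_real pi * Gamma (1 - s / 2) =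
              rGamma (s / 2 + 1) * (- (s / 2)) * (rGamma (1 - s / 2) * Gamma (1 - s / 2))"
        unfolding h2[symmetric] h1[symmetric] by (simp only: mult.assoc)
      hence "rGamma (s / 2 + 1) * (- (s / 2)) = sin (of_real pi * (s / 2 + 1)) / of_real pi * Gamma (1 - s / 2)"
        unfolding h3 by simp
      hence "norm (rGamma (s / 2 + 1) * (- (s / 2))) = norm (sin (of_real pi * (s / 2 + 1)) / of_real pi * Gamma (1 - s / 2))"
        by (rule arg_cong)
      hence "norm (rGamma (s / 2 + 1)) * (norm s / 2) = norm (sin (of_real pi * (s / 2 + 1))) / pi * norm (Gamma (1 - s / 2))"
        by (simp only: norm_mult norm_divide norm_minus_cancel norm_numeral norm_of_real) simp
      moreover have "norm (rGamma (s / 2 + 1)) * 1 \<le> norm (rGamma (s / 2 + 1)) * (norm s / 2)"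
        using s by (intro mult_left_mono) auto
      moreover have "norm (sin (of_real pi * (s / 2 + 1))) / pi * norm (Gamma (1 - s / 2)) \<le> exp (4 * N) * (K * exp (N\<^sup>2))"
      proof (rule mult_mono)
        have "norm (sin (of_real pi * (s / 2 + 1))) \<le> exp (norm (of_real pi * (s / 2 + 1)))" by (rule norm_sin_le_exp_norm)
        also have "norm (of_real pi * (s / 2 + 1)) \<le> 4 * N"
        proof -
          have "norm (s / 2 + 1) \<le> N" using norm_triangle_ineq[of "s / 2" 1] s by (simp add: N_def norm_divide)
          thus ?thesis unfolding norm_mult using pi_less_4 N by (intro mult_mono) auto
        qed
        finally have "norm (sin (of_real pi * (s / 2 + 1))) \<le> exp (4 * N)" by simp
        moreover have "norm (sin (of_real pi * (s / 2 + 1))) / pi \<le> norm (sin (of_real pi * (s / 2 + 1))) / 1"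
          using pi_gt3 by (intro divide_left_mono) auto
        ultimately show "norm (sin (of_real pi * (s / 2 + 1))) / pi \<le> exp (4 * N)" by simp
        show "norm (Gamma (1 - s / 2)) \<le> K * exp (N\<^sup>2)"
        proof (rule Gz)
          show "norm (1 - s / 2) \<le> N" using norm_triangle_ineq4[of 1 "s / 2"] s by (simp add: N_def norm_divide)
        qed (use s in simp)
      qed auto
      ultimately show ?thesis by linarith
    qed
    have f5: "norm (zeta_right (1 - s)) \<le> C1 * (8 * N ^ 3)"
    proof -
      have "norm (zeta_right (1 - s)) \<le> C0 * (1 + norm (1 - s)) ^ 3" by (rule C0) (use s in simp)
      also have "\<dots> \<le> C1 * (2 * N) ^ 3" using C1 n1 N by (intro mult_mono power_mono) auto
      finally show ?thesis by (simp add: power_mult_distrib)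
    qed
    have "norm (zeta_left s) \<le> N * exp (2 * N) * (K * exp (N\<^sup>2)) * (exp (4 * N) * (K * exp (N\<^sup>2))) * (C1 * (8 * N ^ 3))"
      unfolding zeta_left_def norm_mult using N K C1
      by (intro mult_mono f1 f2 f3 f4 f5 mult_nonneg_nonneg norm_ge_zero) auto
    also have "\<dots> = (K * K * (8 * C1)) * N ^ 4 * exp (6 * N + 2 * N\<^sup>2)"
    proof -
      have "6 * N + 2 * N\<^sup>2 = 2 * N + N\<^sup>2 + (4 * N + N\<^sup>2)" by simp
      hence e: "exp (6 * N + 2 * N\<^sup>2) = exp (2 * N) * exp (N\<^sup>2) * (exp (4 * N) * exp (N\<^sup>2))" by (simp only: exp_add)
      show ?thesis unfolding e by (simp add: power4_eq_xxxx power3_eq_cube mult_ac)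
    qed
    also have "\<dots> \<le> (K * K * (8 * C1)) * N ^ 4 * exp (9 * N + 2 * N\<^sup>2)"
      using K C1 N by (intro mult_left_mono) auto
    finally show ?thesis by (simp add: N_def)
  qed
  moreover have "K * K * (8 * C1) > 0" using K C1 by simp
  ultimately show ?thesis by blast
qed

lemma zeta_entire_finite_order: "entire_of_finite_order zeta_entire"
  unfolding entire_of_finite_order_def
proof (intro conjI exI)
  show "zeta_entire holomorphic_on UNIV" by (rule holomorphic_zeta_entire)
  obtain C where C: "C > 0" "\<And>s. Re s \<le> 1/2 \<Longrightarrow> norm s \<ge> 2 \<Longrightarrow>
     norm (zeta_left s) \<le> C * (1 + norm s) ^ 4 * exp (9 * (1 + norm s) + 2 * (1 + norm s)\<^sup>2)"
    using zeta_left_growth by blast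
  obtain C0 where C0: "\<And>s. Re s \<ge> -1/2 \<Longrightarrow> norm (zeta_right s) \<le> C0 * (1 + norm s) ^ 3"
    using zeta_right_growth by blast
  define D where "D = max C C0"
  have D: "D > 0" "C \<le> D" "C0 \<le> D" using C by (auto simp: D_def)
  define B where "B = (\<lambda>x::real. D * (1 + x) ^ 4 * exp (9 * (1 + x) + 2 * (1 + x)\<^sup>2))"
  have bound: "norm (zeta_entire s) \<le> B (norm s)" if s: "norm s \<ge> 2" for s
  proof (cases "Re s \<le> 1/2")
    case True
    have "norm (zeta_entire s) \<le> C * (1 + norm s) ^ 4 * exp (9 * (1 + norm s) + 2 * (1 + norm s)\<^sup>2)"
      using C(2)[OF True s] True by (simp add: zeta_entire_left)
    also have "\<dots> \<le> B (norm s)" unfolding B_def using D by (intro mult_right_mono) auto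
    finally show ?thesis .
  next
    case False
    have "norm (zeta_entire s) \<le> C0 * (1 + norm s) ^ 3" using C0[of s] False by (simp add: zeta_entire_right)
    also have "\<dots> \<le> D * (1 + norm s) ^ 4" using D by (intro mult_mono power_increasing) auto
    also have "\<dots> \<le> B (norm s)"
      unfolding B_def using D mult_left_mono[of 1 "exp (9 * (1 + norm s) + 2 * (1 + norm s)\<^sup>2)" "D * (1 + norm s) ^ 4"] by simp
    finally show ?thesis .
  qed
  have "B \<in> O(\<lambda>x. exp (x powr 3))" unfolding B_def using D by real_asymp
  hence "(\<lambda>s::complex. B (norm s)) \<in> O[at_infinity](\<lambda>s. exp (norm s powr 3))"
    by (rule landau_o.big.compose) (rule filterlim_norm_at_top)
  moreover have "(\<lambda>s. norm (zeta_entire s)) \<in> O[at_infinity](\<lambda>s. B (norm s))"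
  proof (rule bigoI[where c = 1])
    show "eventually (\<lambda>s. norm (norm (zeta_entire s)) \<le> 1 * norm (B (norm s))) at_infinity"
      unfolding eventually_at_infinity
    proof (intro exI[of _ 2] allI impI)
      fix s :: complex assume "2 \<le> norm s"
      from bound[OF this] show "norm (norm (zeta_entire s)) \<le> 1 * norm (B (norm s))" by simp
    qed
  qed
  ultimately show "(\<lambda>s. norm (zeta_entire s)) \<in> O[at_infinity](\<lambda>s. exp (norm s powr 3))"
    using landau_o.big_trans by blast
qed

text \<open>The choice Q = 1 / sqrt \<pi> makes Q^s equal to \<pi>^(-s/2), and one Gamma factor of
  weight 1/2 completes it.\<close>

lemma zeta_functional_equation:
  "functional_equation_with zeta_fun 1 (1 / sqrt pi) 1 (\<lambda>_. 1/2) (\<lambda>_. 0)"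
proof -
  have g: "gamma_factor 1 (1 / sqrt pi) 1 (\<lambda>_. 1/2) (\<lambda>_. 0) s * zeta_fun s = completed_zeta s" for s
  proof -
    have l: "ln (1 / sqrt pi) = - (ln pi / 2)" by (simp add: ln_div ln_sqrt)
    have "complex_of_real (1 / sqrt pi) powr s = exp (s * of_real (ln (1 / sqrt pi)))"
    proof -
      have "Ln (complex_of_real (1 / sqrt pi)) = of_real (ln (1 / sqrt pi))" by (rule Ln_of_real) simp
      moreover have "complex_of_real (1 / sqrt pi) \<noteq> 0" by simp
      ultimately show ?thesis by (simp only: powr_def if_False)
    qed
    also have "\<dots> = of_real pi powr (- s / 2)" unfolding l by (simp add: powr_def Ln_of_real)
    finally show ?thesis by (simp add: gamma_factor_def completed_zeta_def)
  qed
  have cnj_c: "cnj (completed_zeta s) = completed_zeta (cnj s)" for s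
  proof -
    have "cnj (of_real pi powr (- s / 2)) = of_real pi powr (- cnj s / 2)" by (subst cnj_powr) auto
    thus ?thesis by (simp add: completed_zeta_def cnj_Gamma cnj_zeta_fun)
  qed
  have "\<forall>\<^sub>\<approx>s\<in>UNIV. (s::complex) \<notin> \<int>"
  proof (subst eventually_cosparse_open_eq, safe)
    fix z :: complex
    \<comment> \<open>The integers other than z form a closed set, so z has a punctured
      neighbourhood free of integers.\<close>
    have "open (- (\<int> - {z}))" by (intro open_Compl closed_subset_Ints) auto
    hence "eventually (\<lambda>s. s \<in> - (\<int> - {z})) (at z)" by (intro eventually_at_in_open') auto
    moreover have "eventually (\<lambda>s. s \<noteq> z) (at z)" by (simp add: eventually_at_filter)
    ultimately show "eventually (\<lambda>s. s \<notin> \<int>) (at z)" by eventually_elim auto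
  qed auto
  hence "\<forall>\<^sub>\<approx>s\<in>UNIV. completed_zeta s = cnj (completed_zeta (cnj (1 - s)))"
    unfolding cnj_c complex_cnj_cnj by eventually_elim (rule completed_zeta_reflect)
  thus ?thesis unfolding functional_equation_with_def g by simp
qed

lemma zeta_continues: "continues_series zeta_fun zeta_coeff"
  unfolding continues_series_def
proof (intro conjI allI impI)
  show "zeta_fun s = dirichlet_series zeta_coeff s" if "Re s > 1" for s
    using that by (auto simp: zeta_fun_def zeta_entire_def zeta_right_eq)
  show "zeta_fun nicely_meromorphic_on UNIV"
    unfolding nicely_meromorphic_on_def
  proof (intro conjI ballI)
    have "zeta_entire analytic_on UNIV" using holomorphic_zeta_entire by (simp add: analytic_on_open)
    hence "zeta_entire meromorphic_on UNIV" by (rule analytic_on_imp_meromorphic_on)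
    thus "zeta_fun meromorphic_on UNIV"
      unfolding zeta_fun_def[abs_def] by (intro meromorphic_intros)
    fix z :: complex
    have cont: "isCont zeta_entire w" for w
      using holomorphic_on_imp_continuous_on[OF holomorphic_zeta_entire] by (simp add: continuous_on_eq_continuous_at)
    show "is_pole zeta_fun z \<and> zeta_fun z = 0 \<or> zeta_fun \<midarrow>z\<rightarrow> zeta_fun z"
    proof (cases "z = 1")
      case True
      have "is_pole (\<lambda>s. zeta_entire s / (s - 1)) 1"
      proof (rule is_pole_divide[OF cont])
        have "((\<lambda>s::complex. s - 1) \<longlongrightarrow> 1 - 1) (at 1)" by (intro tendsto_intros)
        thus "filterlim (\<lambda>s::complex. s - 1) (at 0) (at 1)" by (auto simp: filterlim_at eventually_at_filter)
      qed (simp add: zeta_entire_1)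
      thus ?thesis using True by (simp add: zeta_fun_def[abs_def])
    next
      case False
      hence "isCont zeta_fun z" unfolding zeta_fun_def[abs_def] by (intro continuous_intros cont) auto
      thus ?thesis by (simp add: isCont_def)
    qed
  qed
qed

lemma zeta_selberg_function: "selberg_function zeta_coeff zeta_fun"
  unfolding selberg_function_def
proof (intro conjI)
  show "selberg_functional_equation zeta_fun"
    using zeta_functional_equation unfolding selberg_functional_equation_iff by blast
  show "selberg_analyticity zeta_fun"
    unfolding selberg_analyticity_def
    by (intro exI[of _ 1] exI[of _ zeta_entire] conjI zeta_entire_finite_order) (auto simp: zeta_fun_def)
qed (rule zeta_continues)

section \<open>The Euler product of zeta\<close>

definition zeta_log_coeff :: "nat \<Rightarrow> complex" where
  "zeta_log_coeff n = of_real (mangoldt n / ln (real n))"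

lemma zeta_log_coeff_bounds: "0 \<le> mangoldt n / ln (real n)" "mangoldt n / ln (real n) \<le> (1::real)"
proof -
  have "mangoldt n \<le> ln (real n)" if "primepow n"
    using that aprimedivisor_le_nat[of n] primepow_gt_Suc_0[of n] aprimedivisor_pos_nat[of n]
    by (simp add: mangoldt_def)
  moreover have "ln (real n) > 0" if "primepow n" using primepow_gt_Suc_0[OF that] by (intro ln_gt_zero) simp
  ultimately show "0 \<le> mangoldt n / ln (real n)" "mangoldt n / ln (real n) \<le> (1::real)"
    by (cases "primepow n"; simp add: mangoldt_nonneg; simp add: mangoldt_def)+
qed

lemma zeta_log_coeff_conv: "c > 1 \<Longrightarrow> abs_conv zeta_log_coeff c"
proof (rule abs_conv_powrI[of _ 1 0])
  have "norm (zeta_log_coeff n) \<le> 1" for n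
    unfolding zeta_log_coeff_def norm_of_real using zeta_log_coeff_bounds[of n] by simp
  thus "eventually (\<lambda>n. norm (zeta_log_coeff n) \<le> 1 * real n powr 0) sequentially"
    by (intro eventually_mono[OF eventually_gt_at_top[of 0]]) simp
qed simp

text \<open>Every term with n \<ge> 2 gains the factor 2^(c - x). The limit serves to fix a constant
  of integration.\<close>

lemma dirichlet_series_limit:
  assumes "abs_conv a c" "a 0 = 0"
  shows "((\<lambda>x. dirichlet_series a (of_real x)) \<longlongrightarrow> a 1) at_top"
proof -
  define S where "S = (\<Sum>n. norm (a n) * real n powr (-c))"
  have sm: "summable (\<lambda>n. norm (a n) * real n powr (-c))" using assms by (simp add: abs_conv_def)
  have bound: "norm (dirichlet_series a (of_real x) - a 1) \<le> S * 2 powr (c - x)" if x: "x \<ge> c" for x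
  proof -
    let ?f = "\<lambda>n. a n * of_nat n powr (- of_real x)"
    have sums: "?f sums dirichlet_series a (of_real x)" by (rule dirichlet_series_sums[OF assms(1)]) (use x in simp)
    have "(\<lambda>n. ?f n - (if n = 1 then ?f 1 else 0)) sums (dirichlet_series a (of_real x) - ?f 1)"
      by (intro sums_diff sums sums_single)
    hence s: "(\<lambda>n. ?f n - (if n = 1 then ?f 1 else 0)) sums (dirichlet_series a (of_real x) - a 1)" by simp
    have le: "norm (?f n - (if n = 1 then ?f 1 else 0)) \<le> (norm (a n) * real n powr (-c)) * 2 powr (c - x)" for n
    proof (cases "n \<le> 1")
      case True
      hence "n = 0 \<or> n = 1" by auto
      thus ?thesis using assms(2) by auto
    next
      case False
      have "norm (?f n) = norm (a n) * real n powr (-c) * real n powr (c - x)"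
        using norm_dirichlet_term[of a n "of_real x"] by (simp add: powr_add[symmetric])
      also have "\<dots> \<le> norm (a n) * real n powr (-c) * 2 powr (c - x)"
        using False x by (intro mult_left_mono powr_mono2') auto
      finally show ?thesis using False by simp
    qed
    have "norm (dirichlet_series a (of_real x) - a 1) \<le> (\<Sum>n. (norm (a n) * real n powr (-c)) * 2 powr (c - x))"
      unfolding sums_unique[OF s] by (rule norm_suminf_le[OF le summable_mult2[OF sm]])
    also have "\<dots> = S * 2 powr (c - x)" unfolding S_def by (rule suminf_mult2[OF sm, symmetric])
    finally show ?thesis .
  qed
  have "((\<lambda>x::real. S * 2 powr (c - x)) \<longlongrightarrow> 0) at_top" by real_asymp
  hence "((\<lambda>x. dirichlet_series a (of_real x) - a 1) \<longlongrightarrow> 0) at_top"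
    by (rule Lim_null_comparison[rotated]) (rule eventually_mono[OF eventually_ge_at_top[of c] bound])
  thus ?thesis by (simp add: LIM_zero_iff)
qed

text \<open>The convolution identity ln = \<Lambda> * 1 says that both sides have the same
  logarithmic derivative. Their quotient is constant, and its value 1 is read off at real
  infinity.\<close>

lemma zeta_euler:
  assumes s: "Re s > 1"
  shows "exp (dirichlet_series zeta_log_coeff s) = dirichlet_series zeta_coeff s"
proof -
  define S where "S = {s::complex. Re s > 1}"
  let ?Z = "dirichlet_series zeta_coeff" and ?B = "dirichlet_series zeta_log_coeff"
  let ?L = "\<lambda>a n. a n * complex_of_real (ln (real n))"
  have LB: "?L zeta_log_coeff = mangoldt"
  proof
    fix n show "?L zeta_log_coeff n = mangoldt n"
    proof (cases "primepow n")
      case True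
      have "ln (real n) > 0" using primepow_gt_Suc_0[OF True] by (intro ln_gt_zero) simp
      thus ?thesis by (simp add: zeta_log_coeff_def of_real_mangoldt flip: of_real_mult)
    qed (simp add: zeta_log_coeff_def mangoldt_def)
  qed
  have LZ: "?L zeta_coeff = dconv mangoldt zeta_coeff"
  proof
    fix n show "?L zeta_coeff n = dconv mangoldt zeta_coeff n"
    proof (cases "n = 0")
      case False
      have "dconv mangoldt zeta_coeff n = (\<Sum>d | d dvd n. mangoldt d)"
        unfolding dconv_def using False by (intro sum.cong) (auto simp: zeta_coeff_def dvd_div_eq_0_iff)
      thus ?thesis using mangoldt_sum[OF False, where 'a = complex] False by (simp add: zeta_coeff_def)
    qed (simp add: dconv_def zeta_coeff_def)
  qed
  have der: "((\<lambda>s. ?Z s * exp (- ?B s)) has_field_derivative 0) (at z)" if "z \<in> S" for z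
  proof -
    define c where "c = (1 + Re z) / 2"
    have c: "1 < c" "c < Re z" using that by (auto simp: c_def S_def)
    note DZ = has_field_derivative_dirichlet_series[OF zeta_coeff_conv[OF c(1)] c(2)]
    note DB = has_field_derivative_dirichlet_series[OF zeta_log_coeff_conv[OF c(1)] c(2)]
    have mc: "abs_conv mangoldt (Re z)"
      unfolding LB[symmetric] by (rule abs_conv_mult_ln[OF zeta_log_coeff_conv[OF c(1)] c(2)])
    have "dirichlet_series (?L zeta_coeff) z = dirichlet_series mangoldt z * ?Z z"
      unfolding LZ by (rule dirichlet_series_dconv[OF mc zeta_coeff_conv]) (use c in auto)
    hence eq: "- dirichlet_series (?L zeta_coeff) z * exp (- ?B z) + exp (- ?B z) * - (- dirichlet_series (?L zeta_log_coeff) z) * ?Z z = 0"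
      unfolding LB by simp
    have "((\<lambda>s. ?Z s * exp (- ?B s)) has_field_derivative
        (- dirichlet_series (?L zeta_coeff) z * exp (- ?B z) + exp (- ?B z) * - (- dirichlet_series (?L zeta_log_coeff) z) * ?Z z)) (at z)"
      by (rule DERIV_mult[OF DZ DERIV_chain2[OF DERIV_exp DERIV_minus[OF DB]]])
    thus ?thesis unfolding eq .
  qed
  obtain k where k: "\<And>z. z \<in> S \<Longrightarrow> ?Z z * exp (- ?B z) = k"
    using has_field_derivative_zero_constant[of S "\<lambda>s. ?Z s * exp (- ?B s)"] der convex_halfspace_Re_gt[of 1]
    by (auto simp: S_def intro: has_field_derivative_at_within)
  have "((\<lambda>x. ?Z (of_real x) * exp (- ?B (of_real x))) \<longlongrightarrow> zeta_coeff 1 * exp (- zeta_log_coeff 1)) at_top"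
    by (intro tendsto_intros dirichlet_series_limit[of _ 2] zeta_coeff_conv zeta_log_coeff_conv)
       (auto simp: zeta_coeff_def zeta_log_coeff_def)
  moreover have "eventually (\<lambda>x. ?Z (of_real x) * exp (- ?B (of_real x)) = k) at_top"
    using eventually_gt_at_top[of 1] by eventually_elim (rule k, simp add: S_def)
  hence "((\<lambda>x::real. ?Z (of_real x) * exp (- ?B (of_real x))) \<longlongrightarrow> k) at_top" by (rule tendsto_eventually)
  ultimately have "k = zeta_coeff 1 * exp (- zeta_log_coeff 1)" using tendsto_unique trivial_limit_at_top_linorder by blast
  hence "k = 1" by (simp add: zeta_coeff_def zeta_log_coeff_def)
  with k[of s] s have "?Z s * exp (- ?B s) = 1" by (simp add: S_def)
  thus ?thesis by (simp add: exp_minus field_simps)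
qed

theorem zeta_in_selberg_class: "zeta_coeff \<in> selberg_class"
  unfolding selberg_class_def mem_Collect_eq
proof (intro conjI)
  show "zeta_coeff 0 = 0" by (simp add: zeta_coeff_def)
  show "ramanujan_hypothesis zeta_coeff"
    unfolding ramanujan_hypothesis_def
  proof (intro allI impI bigoI[where c = 1])
    fix e :: real assume e: "e > 0"
    show "eventually (\<lambda>n. norm (norm (zeta_coeff n)) \<le> 1 * norm (real n powr e)) sequentially"
      using eventually_gt_at_top[of 0]
    proof eventually_elim
      case (elim n)
      thus ?case using e by (simp add: zeta_coeff_def ge_one_powr_ge_zero Suc_le_eq)
    qed
  qed
  show "selberg_euler_product zeta_coeff"
    unfolding selberg_euler_product_def
  proof (intro conjI exI[of _ zeta_log_coeff] exI[of _ "0::real"] allI impI)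
    show "zeta_coeff 1 = 1" by (simp add: zeta_coeff_def)
    show "zeta_log_coeff n = 0" if "\<not> primepow n" for n using that by (simp add: zeta_log_coeff_def mangoldt_def)
    show "(\<lambda>n. norm (zeta_log_coeff n)) \<in> O(\<lambda>n. real n powr 0)"
    proof (rule bigoI[where c = 1])
      have "norm (zeta_log_coeff n) \<le> 1" for n
        unfolding zeta_log_coeff_def norm_of_real using zeta_log_coeff_bounds[of n] by simp
      thus "eventually (\<lambda>n. norm (norm (zeta_log_coeff n)) \<le> 1 * norm (real n powr 0)) sequentially"
        by (intro eventually_mono[OF eventually_gt_at_top[of 0]]) simp
    qed
    fix s :: complex assume s: "Re s > 1"
    show "summable (\<lambda>n. zeta_log_coeff n * of_nat n powr (-s))"
      using dirichlet_series_sums[OF zeta_log_coeff_conv[OF s]] by (auto simp: sums_iff)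
    show "exp (dirichlet_series zeta_log_coeff s) = dirichlet_series zeta_coeff s" by (rule zeta_euler[OF s])
  qed simp
  show "\<exists>F. continues_series F zeta_coeff \<and> selberg_analyticity F \<and> selberg_functional_equation F"
    using zeta_selberg_function unfolding selberg_function_def by blast
qed

section \<open>Sums over primes\<close>

definition prime_part :: "(nat \<Rightarrow> complex) \<Rightarrow> nat \<Rightarrow> complex" where
  "prime_part a n = (if prime n then a n else 0)"

lemma prime_part_conv:
  assumes "abs_conv a c"
  shows "abs_conv (prime_part a) c"
  unfolding abs_conv_def
proof (rule summable_comparison_test'[where N = 0])
  show "summable (\<lambda>n. norm (a n) * real n powr (-c))" using assms by (simp add: abs_conv_def)
qed (simp add: prime_part_def)

text \<open>For fixed p the sum of p^(k (\<theta> - 1)) over k \<ge> 2 is geometric, of size p^(2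
  (\<theta> - 1)). This exponent is below -1 precisely because \<theta> < 1/2.\<close>

lemma abs_conv_higher_prime_powers:
  assumes r: "\<And>n. n \<ge> 1 \<Longrightarrow> norm (r n) \<le> C * real n powr \<theta>" and \<theta>: "\<theta> < 1/2" and C: "C \<ge> 0"
    and supp: "\<And>n. r n \<noteq> 0 \<Longrightarrow> \<exists>p k. prime p \<and> k \<ge> 2 \<and> n = p ^ k"
  shows "abs_conv r 1"
  unfolding abs_conv_def
proof (rule summableI_nonneg_bounded)
  \<comment> \<open>Since p \<ge> 2, this bounds every ratio p^(\<theta> - 1), so one constant 1 /
    (1 - y) serves all geometric sums.\<close>
  define y where "y = (2::real) powr (\<theta> - 1)"
  have y: "0 < y" "y < 1" using \<theta> by (auto simp: y_def powr_less_one)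
  have s2: "summable (\<lambda>n. real n powr (2 * (\<theta> - 1)))" using \<theta> by (simp add: summable_real_powr_iff)
  define Z where "Z = (\<Sum>n. real n powr (2 * (\<theta> - 1)))"
  show "0 \<le> norm (r n) * real n powr - 1" for n by simp
  fix N :: nat
  \<comment> \<open>A finite box that contains every pair with k \<ge> 2 and p^k < N, because p
    \<le> p^k and k < p^k.\<close>
  define I where "I = {p. prime p \<and> p < N} \<times> {2..<N + 2}"
  have finP: "finite {p::nat. prime p \<and> p < N}" by (rule finite_subset[of _ "{..<N}"]) auto
  have finI: "finite I" using finP by (simp add: I_def)
  define f where "f = (\<lambda>n::nat. C * real n powr (\<theta> - 1))"
  have f0: "f n \<ge> 0" for n using C by (simp add: f_def)
  have fr: "norm (r n) * real n powr - 1 \<le> f n" if "n \<ge> 1" for n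
  proof -
    have "norm (r n) * real n powr - 1 \<le> C * real n powr \<theta> * real n powr - 1"
      by (intro mult_right_mono r that) auto
    also have "\<dots> = f n"
    proof -
      have "real n powr \<theta> * real n powr - 1 = real n powr (\<theta> - 1)" by (simp add: powr_diff powr_minus_divide)
      thus ?thesis by (simp only: f_def mult.assoc)
    qed
    finally show ?thesis .
  qed
  have sub: "{n. n < N \<and> r n \<noteq> 0} \<subseteq> (\<lambda>(p,k). p ^ k) ` I"
  proof
    fix n assume n: "n \<in> {n. n < N \<and> r n \<noteq> 0}"
    then obtain p k where pk: "prime p" "k \<ge> 2" "n = p ^ k" using supp by blast
    have "p \<le> p ^ k" using pk prime_ge_1_nat[OF pk(1)] by (simp add: self_le_power)
    moreover have "k < p ^ k" using prime_gt_1_nat[OF pk(1)] by (intro power_gt_expt) simp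
    ultimately have "(p, k) \<in> I" using n pk by (auto simp: I_def)
    thus "n \<in> (\<lambda>(p,k). p ^ k) ` I" using pk(3) by force
  qed
  have "(\<Sum>n<N. norm (r n) * real n powr - 1) = (\<Sum>n\<in>{n. n < N \<and> r n \<noteq> 0}. norm (r n) * real n powr - 1)"
    by (rule sum.mono_neutral_right) auto
  also have "\<dots> \<le> (\<Sum>n\<in>{n. n < N \<and> r n \<noteq> 0}. f n)"
  proof (rule sum_mono)
    fix n assume "n \<in> {n. n < N \<and> r n \<noteq> 0}"
    then obtain p k where "prime p" "n = p ^ k" using supp by blast
    hence "n \<ge> 1" using prime_ge_1_nat[of p] by simp
    thus "norm (r n) * real n powr - 1 \<le> f n" by (rule fr)
  qed
  also have "\<dots> \<le> (\<Sum>n\<in>(\<lambda>(p,k). p ^ k) ` I. f n)"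
    by (rule sum_mono2[OF _ sub]) (use finI f0 in auto)
  also have "\<dots> \<le> (\<Sum>z\<in>I. (f \<circ> (\<lambda>(p,k). p ^ k)) z)"
    by (rule sum_image_le) (use finI f0 in auto)
  also have "\<dots> = (\<Sum>p | prime p \<and> p < N. \<Sum>k\<in>{2..<N+2}. f (p ^ k))"
    unfolding I_def sum.cartesian_product by (rule sum.cong) auto
  also have "\<dots> \<le> (\<Sum>p | prime p \<and> p < N. C / (1 - y) * real p powr (2 * (\<theta> - 1)))"
  proof (rule sum_mono)
    fix p assume "p \<in> {p. prime p \<and> p < N}"
    hence p: "prime p" by simp
    define x where "x = real p powr (\<theta> - 1)"
    have p2: "p \<ge> 2" using p by (rule prime_ge_2_nat)
    have x: "0 < x" "x \<le> y" using p2 \<theta> by (auto simp: x_def y_def intro!: powr_mono2')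
    have fp: "f (p ^ k) = C * x ^ k" for k
    proof -
      have "real (p ^ k) powr (\<theta> - 1) = x ^ k"
        using p2 by (simp add: x_def powr_powr flip: powr_realpow) (simp add: mult.commute)
      thus ?thesis by (simp add: f_def)
    qed
    have geo: "(\<Sum>k<N. x ^ k) \<le> 1 / (1 - y)"
    proof -
      have sg: "summable (\<lambda>k. y ^ k)" using y by (intro summable_geometric) auto
      have "(\<Sum>k<N. x ^ k) \<le> (\<Sum>k<N. y ^ k)" using x by (intro sum_mono power_mono) auto
      also have "\<dots> \<le> (\<Sum>k. y ^ k)" using y by (intro sum_le_suminf sg) auto
      also have "\<dots> = 1 / (1 - y)" using y by (intro suminf_geometric) auto
      finally show ?thesis .
    qed
    have "(\<Sum>k\<in>{2..<N+2}. f (p ^ k)) = (\<Sum>k<N. C * x\<^sup>2 * x ^ k)"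
      unfolding fp
    proof (rule sum.reindex_bij_witness[of _ "\<lambda>k. k + 2" "\<lambda>k. k - 2"])
      fix k assume "k \<in> {2..<N+2}"
      hence "2 \<le> k" by simp
      hence "x ^ k = x ^ (2 + (k - 2))" by (simp only: le_add_diff_inverse)
      thus "C * x\<^sup>2 * x ^ (k - 2) = C * x ^ k" by (simp only: power_add mult.assoc)
    qed auto
    also have "\<dots> = C * x\<^sup>2 * (\<Sum>k<N. x ^ k)" by (rule sum_distrib_left[symmetric])
    also have "\<dots> \<le> C * x\<^sup>2 * (1 / (1 - y))" using C by (intro mult_left_mono geo) auto
    also have "x\<^sup>2 = real p powr (2 * (\<theta> - 1))"
      using p2 by (simp add: x_def powr_powr mult.commute flip: powr_numeral)
    finally show "(\<Sum>k\<in>{2..<N+2}. f (p ^ k)) \<le> C / (1 - y) * real p powr (2 * (\<theta> - 1))" by (simp add: mult_ac)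
  qed
  also have "\<dots> = C / (1 - y) * (\<Sum>p | prime p \<and> p < N. real p powr (2 * (\<theta> - 1)))"
    by (rule sum_distrib_left[symmetric])
  also have "\<dots> \<le> C / (1 - y) * Z"
    unfolding Z_def using C y finP by (intro mult_left_mono sum_le_suminf s2) auto
  finally show "(\<Sum>n<N. norm (r n) * real n powr - 1) \<le> C / (1 - y) * Z" .
qed

text \<open>The logarithm splits into a part over primes, where the Euler coefficients equal a(p),
  and a part over higher prime powers that converges absolutely up to Re s = 1. The latter is the
  bounded error.\<close>

lemma log_norm_prime_sum:
  assumes a: "a \<in> selberg_class"
  shows "\<exists>R. \<forall>s. Re s > 1 \<longrightarrow>
           \<bar>ln (norm (dirichlet_series a s)) - Re (dirichlet_series (prime_part a) s)\<bar> \<le> R \<and> dirichlet_series a s \<noteq> 0"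
proof -
  obtain b \<theta> where b: "\<And>n. \<not> primepow n \<Longrightarrow> b n = 0" "\<theta> < 1/2"
    "(\<lambda>n. norm (b n)) \<in> O(\<lambda>n. real n powr \<theta>)"
    "\<And>s. Re s > 1 \<Longrightarrow> exp (dirichlet_series b s) = dirichlet_series a s" "abs_conv b (3/2)"
    using euler_product_logE[OF a] by metis
  define r where "r = (\<lambda>n. b n - prime_part a n)"
  have bp: "b p = a p" if "prime p" for p by (rule euler_coeff_prime[OF a b(5,4) that]) auto
  have r_eq: "r n = (if prime n then 0 else b n)" for n by (simp add: r_def prime_part_def bp)
  obtain C where C: "C \<ge> 0" "\<And>n. n \<ge> 1 \<Longrightarrow> norm (b n) \<le> C * real n powr \<theta>"
    using bigo_nat_bound[OF b(3)] by auto
  have rc: "abs_conv r 1"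
  proof (rule abs_conv_higher_prime_powers[OF _ b(2) C(1)])
    show "norm (r n) \<le> C * real n powr \<theta>" if "n \<ge> 1" for n using C that by (simp add: r_eq)
    fix n assume n: "r n \<noteq> 0"
    hence "primepow n" "\<not> prime n" using b(1)[of n] by (auto simp: r_eq split: if_splits)
    then obtain p k where pk: "prime p" "k > 0" "n = p ^ k" by (auto simp: primepow_def)
    with \<open>\<not> prime n\<close> have "k \<noteq> 1" by auto
    with pk show "\<exists>p k. prime p \<and> k \<ge> 2 \<and> n = p ^ k" by (intro exI[of _ p] exI[of _ k]) auto
  qed
  define R where "R = (\<Sum>n. norm (r n) * real n powr (-1))"
  have "\<bar>ln (norm (dirichlet_series a s)) - Re (dirichlet_series (prime_part a) s)\<bar> \<le> R \<and> dirichlet_series a s \<noteq> 0"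
    if s: "Re s > 1" for s
  proof
    define c where "c = Re s"
    have pc: "abs_conv (prime_part a) c" using s by (intro prime_part_conv selberg_abs_conv[OF a]) (auto simp: c_def)
    have rc': "abs_conv r c" by (rule abs_conv_mono[OF rc]) (use s in \<open>auto simp: c_def\<close>)
    have "(\<lambda>n. r n * of_nat n powr (-s) + prime_part a n * of_nat n powr (-s)) sums (dirichlet_series r s + dirichlet_series (prime_part a) s)"
      by (intro sums_add dirichlet_series_sums[OF rc'] dirichlet_series_sums[OF pc]) (auto simp: c_def)
    hence Db: "dirichlet_series b s = dirichlet_series r s + dirichlet_series (prime_part a) s"
      by (simp add: r_def dirichlet_series_def sums_iff left_diff_distrib)
    have e: "dirichlet_series a s = exp (dirichlet_series b s)" using b(4)[OF s] by simp
    show "dirichlet_series a s \<noteq> 0" unfolding e by simp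
    have "ln (norm (dirichlet_series a s)) = Re (dirichlet_series b s)" unfolding e by simp
    hence "\<bar>ln (norm (dirichlet_series a s)) - Re (dirichlet_series (prime_part a) s)\<bar> = \<bar>Re (dirichlet_series r s)\<bar>"
      by (simp add: Db)
    also have "\<dots> \<le> norm (dirichlet_series r s)" by (rule abs_Re_le_cmod)
    also have "\<dots> \<le> R" unfolding R_def by (rule norm_dirichlet_series_le[OF rc]) (use s in simp)
    finally show "\<bar>ln (norm (dirichlet_series a s)) - Re (dirichlet_series (prime_part a) s)\<bar> \<le> R" .
  qed
  thus ?thesis by blast
qed

section \<open>Summation by parts over primes\<close>

lemma abel_summation_bound:
  fixes u :: "nat \<Rightarrow> complex" and v :: "nat \<Rightarrow> real"
  assumes "\<And>N. norm (\<Sum>n<N. u n) \<le> C" "\<And>n. v (Suc n) \<le> v n" "\<And>n. v n \<ge> 0"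
  shows "norm (\<Sum>n<N. u n * of_real (v n)) \<le> C * v 0"
proof -
  define S where "S = (\<lambda>N. \<Sum>n<N. u n)"
  have id: "(\<Sum>n<N. u n * of_real (v n)) = S N * of_real (v N) + (\<Sum>n<N. S (Suc n) * of_real (v n - v (Suc n)))" for N
  proof (induction N)
    case (Suc N)
    have "S (Suc N) = S N + u N" by (simp add: S_def)
    thus ?case using Suc by (simp add: algebra_simps)
  qed (simp add: S_def)
  have S: "norm (S n) \<le> C" for n using assms(1) by (simp add: S_def)
  have "norm (\<Sum>n<N. u n * of_real (v n)) \<le> norm (S N * of_real (v N)) + norm (\<Sum>n<N. S (Suc n) * of_real (v n - v (Suc n)))"
    unfolding id by (rule norm_triangle_ineq)
  also have "\<dots> \<le> C * v N + (\<Sum>n<N. C * (v n - v (Suc n)))"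
  proof (rule add_mono)
    show "norm (S N * of_real (v N)) \<le> C * v N"
      using S assms(3) by (simp add: norm_mult mult_right_mono)
    show "norm (\<Sum>n<N. S (Suc n) * of_real (v n - v (Suc n))) \<le> (\<Sum>n<N. C * (v n - v (Suc n)))"
    proof (rule order_trans[OF norm_sum], rule sum_mono)
      fix n
      have "norm (of_real (v n - v (Suc n)) :: complex) = v n - v (Suc n)"
        unfolding norm_of_real using assms(2)[of n] by simp
      thus "norm (S (Suc n) * of_real (v n - v (Suc n))) \<le> C * (v n - v (Suc n))"
        unfolding norm_mult using S[of "Suc n"] assms(2)[of n] by (simp add: mult_right_mono)
    qed
  qed
  also have "(\<Sum>n<N. C * (v n - v (Suc n))) = C * (v 0 - v N)"
    by (simp add: sum_distrib_left[symmetric] sum_lessThan_telescope')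
  finally show ?thesis by (simp add: algebra_simps)
qed

lemma prime_sum_lessThan:
  "(\<Sum>n<Suc N. prime_part g n / of_nat n) = (\<Sum>p | prime p \<and> real p \<le> real N. g p / of_nat p)"
  by (rule sum.mono_neutral_cong_right) (auto simp: prime_part_def)

text \<open>Bounded partial sums survive the monotone weights n^(-\<delta>), with a bound
  independent of \<delta>. This is the passage from sums over p \<le> x to the behaviour at 1 +
  \<delta>.\<close>

lemma bounded_prime_sum:
  assumes O: "(\<lambda>x::real. \<Sum>p | prime p \<and> real p \<le> x. g p / of_nat p) \<in> O[at_top](\<lambda>_. 1)"
    and conv: "\<And>c. c > 1 \<Longrightarrow> abs_conv g c"
  shows "\<exists>C. \<forall>\<delta>>0. norm (dirichlet_series (prime_part g) (of_real (1 + \<delta>))) \<le> C"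
proof -
  define u where "u = (\<lambda>n. prime_part g n / of_nat n)"
  obtain C0 where "eventually (\<lambda>x::real. norm (\<Sum>p | prime p \<and> real p \<le> x. g p / of_nat p) \<le> C0) at_top"
    using O unfolding bigo_1_iff by blast
  then obtain X where X: "\<And>x. x \<ge> X \<Longrightarrow> norm (\<Sum>p | prime p \<and> real p \<le> x. g p / of_nat p) \<le> C0"
    by (auto simp: eventually_at_top_linorder)
  obtain M :: nat where M: "real M \<ge> X" using real_arch_simple by blast
  define C where "C = max C0 (\<Sum>n<Suc M. norm (u n))"
  have bound: "norm (\<Sum>n<N. u n) \<le> C" for N
  proof (cases "N > M")
    case True
    then obtain N' where N': "N = Suc N'" "N' \<ge> M" by (cases N) auto
    have "norm (\<Sum>n<N. u n) \<le> C0" unfolding N'(1) u_def prime_sum_lessThan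
      by (rule X) (use M N' in linarith)
    thus ?thesis by (simp add: C_def)
  next
    case False
    have "norm (\<Sum>n<N. u n) \<le> (\<Sum>n<N. norm (u n))" by (rule norm_sum)
    also have "\<dots> \<le> (\<Sum>n<Suc M. norm (u n))" using False by (intro sum_mono2) auto
    finally show ?thesis by (simp add: C_def)
  qed
  have "norm (dirichlet_series (prime_part g) (of_real (1 + \<delta>))) \<le> C" if d: "\<delta> > 0" for \<delta>
  proof -
    \<comment> \<open>At index 0 the power would be 0 and spoil monotonicity; the value 1 is
      harmless because the term there vanishes.\<close>
    define v where "v = (\<lambda>n::nat. if n = 0 then 1 else real n powr (-\<delta>))"
    have v: "v (Suc n) \<le> v n" "v n \<ge> 0" for n
    proof -
      show "v (Suc n) \<le> v n"
      proof (cases "n = 0")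
        case False
        thus ?thesis using d by (auto simp: v_def intro!: powr_mono2')
      qed (simp add: v_def)
    qed (simp add: v_def)
    have tm: "prime_part g n * of_nat n powr (- of_real (1 + \<delta>)) = u n * of_real (v n)" for n
    proof (cases "n = 0")
      case False
      have "(of_nat n :: complex) powr (- of_real (1 + \<delta>)) = of_real (real n powr (- (1 + \<delta>)))"
        by (subst of_real_minus[symmetric], subst powr_of_real[symmetric]) auto
      also have "real n powr (- (1 + \<delta>)) = v n / real n"
        using False powr_add[of "real n" "-\<delta>" "-1"] by (simp add: v_def powr_minus_divide algebra_simps)
      finally show ?thesis by (simp add: u_def)
    qed (simp add: u_def prime_part_def)
    have "(\<lambda>N. \<Sum>n<N. u n * of_real (v n)) \<longlonglongrightarrow> dirichlet_series (prime_part g) (of_real (1 + \<delta>))"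
      using dirichlet_series_sums[OF prime_part_conv[OF conv[of "1 + \<delta>"]], of "of_real (1 + \<delta>)"] d
      unfolding tm sums_def by simp
    hence "(\<lambda>N. norm (\<Sum>n<N. u n * of_real (v n))) \<longlonglongrightarrow> norm (dirichlet_series (prime_part g) (of_real (1 + \<delta>)))"
      by (rule tendsto_norm)
    thus ?thesis
    proof (rule tendsto_upperbound)
      have "norm (\<Sum>n<N. u n * of_real (v n)) \<le> C" for N
        using abel_summation_bound[of u C v N, OF bound v(1) v(2)] by (simp add: v_def)
      thus "eventually (\<lambda>N. norm (\<Sum>n<N. u n * of_real (v n)) \<le> C) sequentially" by simp
    qed simp
  qed
  thus ?thesis by blast
qed

section \<open>Imaginary shifts\<close>

definition shift :: "real \<Rightarrow> (nat \<Rightarrow> complex) \<Rightarrow> nat \<Rightarrow> complex" where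
  "shift t a n = a n * of_nat n powr (- (\<i> * of_real t))"

lemma norm_shift: "n > 0 \<Longrightarrow> norm (shift t a n) = norm (a n)"
  by (simp add: shift_def norm_mult norm_nat_powr)

lemma norm_shift_le: "norm (shift t a n) \<le> norm (a n)"
  by (cases "n = 0") (simp_all add: norm_shift, simp add: shift_def)

lemma dirichlet_series_shift: "dirichlet_series (shift t a) s = dirichlet_series a (s + \<i> * of_real t)"
proof -
  have "shift t a n * of_nat n powr (-s) = a n * of_nat n powr (- (s + \<i> * of_real t))" for n
    by (simp add: shift_def powr_add[symmetric] mult.assoc add.commute)
  thus ?thesis by (simp only: dirichlet_series_def)
qed

text \<open>A pole at 1 would move to 1 - it, where the class allows none unless t = 0; this is the
  role of the hypothesis that F is entire. In the functional equation Q^(it) is absorbed into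
  \<epsilon> and i w t into \<mu>, which preserves |\<epsilon>| and Re \<mu>.\<close>

lemma shift_in_class:
  assumes a: "a \<in> selberg_class" and F: "selberg_function a F" and entire: "F holomorphic_on UNIV"
  shows "shift t a \<in> selberg_class"
  unfolding selberg_class_def mem_Collect_eq
proof (intro conjI)
  show "shift t a 0 = 0" by (simp add: shift_def)
  have bigo_shift: "(\<lambda>n. norm (shift t b n)) \<in> O(g)" if "(\<lambda>n. norm (b n)) \<in> O(g)" for b and g :: "nat \<Rightarrow> real"
  proof -
    have "(\<lambda>n. norm (shift t b n)) \<in> O(\<lambda>n. norm (b n))"
      by (rule bigoI[where c = 1]) (simp add: norm_shift_le)
    thus ?thesis using that by (rule landau_o.big_trans)
  qed
  show "ramanujan_hypothesis (shift t a)"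
    using a bigo_shift by (auto simp: selberg_class_def ramanujan_hypothesis_def)
  show "selberg_euler_product (shift t a)"
  proof -
    obtain b \<theta> where b: "\<And>n. \<not> primepow n \<Longrightarrow> b n = 0" "\<theta> < 1/2"
      "(\<lambda>n. norm (b n)) \<in> O(\<lambda>n. real n powr \<theta>)"
      "\<And>s. Re s > 1 \<Longrightarrow> summable (\<lambda>n. b n * of_nat n powr (- s))"
      "\<And>s. Re s > 1 \<Longrightarrow> exp (dirichlet_series b s) = dirichlet_series a s"
      using a by (auto simp: selberg_class_def selberg_euler_product_def)
    have tm: "shift t b n * of_nat n powr (-s) = b n * of_nat n powr (- (s + \<i> * of_real t))" for n s
      by (simp add: shift_def powr_add[symmetric] mult.assoc add.commute)
    show ?thesis
      unfolding selberg_euler_product_def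
    proof (intro conjI exI[of _ "shift t b"] exI[of _ \<theta>] allI impI)
      show "shift t a 1 = 1" using selberg_class_1[OF a] by (simp add: shift_def)
      show "shift t b n = 0" if "\<not> primepow n" for n using b(1)[OF that] by (simp add: shift_def)
      show "(\<lambda>n. norm (shift t b n)) \<in> O(\<lambda>n. real n powr \<theta>)" by (rule bigo_shift[OF b(3)])
      fix s :: complex assume "Re s > 1"
      hence s: "Re (s + \<i> * of_real t) > 1" by simp
      show "summable (\<lambda>n. shift t b n * of_nat n powr (- s))" unfolding tm by (rule b(4)[OF s])
      show "exp (dirichlet_series (shift t b) s) = dirichlet_series (shift t a) s"
        unfolding dirichlet_series_shift by (rule b(5)[OF s])
    qed (rule b(2))
  qed
  define F' where "F' = (\<lambda>s. F (s + \<i> * of_real t))"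
  have F'hol: "F' holomorphic_on UNIV"
    unfolding F'_def by (rule holomorphic_on_compose_gen[OF _ entire, unfolded o_def]) (auto intro!: holomorphic_intros)
  show "\<exists>F. continues_series F (shift t a) \<and> selberg_analyticity F \<and> selberg_functional_equation F"
  proof (intro exI[of _ F'] conjI)
    show "continues_series F' (shift t a)"
      unfolding continues_series_def
    proof (intro conjI allI impI)
      show "F' nicely_meromorphic_on UNIV"
        using F'hol by (intro analytic_on_imp_nicely_meromorphic_on) (simp add: analytic_on_open)
      show "F' s = dirichlet_series (shift t a) s" if "Re s > 1" for s
        unfolding F'_def dirichlet_series_shift by (rule selberg_function_eq[OF F]) (use that in simp)
    qed
    show "selberg_analyticity F'"
      unfolding selberg_analyticity_def
    proof (intro exI[of _ 0] exI[of _ F'] conjI)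
      obtain m g where g: "entire_of_finite_order g" "\<And>s. s \<noteq> 1 \<Longrightarrow> g s = (s - 1) ^ m * F s"
        using selberg_functionE[OF F] by metis
      obtain \<rho> R where \<rho>: "\<rho> > 0" "\<And>s. norm s \<ge> R \<Longrightarrow>
           norm (g s) * exp (0 * norm s) * exp ((norm s + 0)\<^sup>2) \<le> exp (norm s powr \<rho>)"
        using finite_order_growth[OF g(1), of 0 0] by auto
      have Fb: "norm (F z) \<le> exp (norm z powr \<rho>)" if z: "norm z \<ge> max R 2" for z
      proof -
        have z1: "z \<noteq> 1" using z by auto
        \<comment> \<open>Far from 1 the factor (z - 1)^m has modulus at least 1, so the growth
          bound passes from g to F.\<close>
        have "1 \<le> norm (z - 1)" using z norm_triangle_ineq2[of z 1] by simp
        hence "1 \<le> norm (z - 1) ^ m" by (rule one_le_power)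
        hence "norm (F z) \<le> norm (z - 1) ^ m * norm (F z)" using mult_right_mono[of 1 "norm (z - 1) ^ m" "norm (F z)"] by simp
        also have "\<dots> = norm (g z)" using g(2)[OF z1] by (simp add: norm_mult norm_power)
        also have "\<dots> \<le> norm (g z) * exp ((norm z)\<^sup>2)" using mult_left_mono[of 1 "exp ((norm z)\<^sup>2)" "norm (g z)"] by simp
        also have "\<dots> \<le> exp (norm z powr \<rho>)" using \<rho>(2)[of z] z by simp
        finally show ?thesis .
      qed
      have F'b: "norm (F' s) \<le> exp (norm s powr (\<rho> + 1))" if s: "norm s \<ge> max (max R 2 + \<bar>t\<bar>) (2 powr \<rho>)" for s
      proof -
        define z where "z = s + \<i> * of_real t"
        have nt: "norm (\<i> * of_real t :: complex) = \<bar>t\<bar>" by (simp add: norm_mult)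
        have "norm z \<ge> norm s - \<bar>t\<bar>" using norm_diff_ineq[of s "\<i> * of_real t"] nt by (simp add: z_def)
        moreover have "norm s \<ge> max R 2 + \<bar>t\<bar>" using s by simp
        ultimately have "norm z \<ge> max R 2" by linarith
        hence "norm (F' s) \<le> exp (norm z powr \<rho>)" unfolding F'_def z_def[symmetric] by (rule Fb)
        also have "norm z powr \<rho> \<le> (2 * norm s) powr \<rho>"
        proof (rule powr_mono2)
          have "norm z \<le> norm s + \<bar>t\<bar>" using norm_triangle_ineq[of s "\<i> * of_real t"] nt by (simp add: z_def)
          moreover have "max R 2 + \<bar>t\<bar> \<le> norm s" using s by simp
          ultimately show "norm z \<le> 2 * norm s" by linarith
        qed (use \<rho> in auto)
        also have "\<dots> = 2 powr \<rho> * norm s powr \<rho>" by (rule powr_mult)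
        also have "\<dots> \<le> norm s * norm s powr \<rho>" using s by (intro mult_right_mono) auto
        also have "\<dots> = norm s powr (\<rho> + 1)" using powr_mult_base[of "norm s" \<rho>] by (simp add: add.commute)
        finally show ?thesis by simp
      qed
      show "entire_of_finite_order F'"
        unfolding entire_of_finite_order_def
      proof (intro conjI exI F'hol)
        show "(\<lambda>s. norm (F' s)) \<in> O[at_infinity](\<lambda>s. exp (norm s powr (\<rho> + 1)))"
        proof (rule bigoI[where c = 1])
          show "eventually (\<lambda>s. norm (norm (F' s)) \<le> 1 * norm (exp (norm s powr (\<rho> + 1)))) at_infinity"
            unfolding eventually_at_infinity
            by (intro exI[of _ "max (max R 2 + \<bar>t\<bar>) (2 powr \<rho>)"] allI impI) (use F'b in simp)
        qed
      qed
    qed simp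
    show "selberg_functional_equation F'"
    proof -
      obtain \<epsilon> Q k w \<mu> where fe: "functional_equation_with F \<epsilon> Q k w \<mu>"
        using F by (auto simp: selberg_function_def selberg_functional_equation_iff)
      have Q: "Q > 0" "norm \<epsilon> = 1" using fe by (auto simp: functional_equation_with_def)
      define \<epsilon>' where "\<epsilon>' = \<epsilon> * of_real Q powr (\<i> * of_real t)"
      define \<mu>' where "\<mu>' = (\<lambda>i. \<mu> i + of_real (w i) * (\<i> * of_real t))"
      define \<Phi> where "\<Phi> = (\<lambda>s. gamma_factor \<epsilon> Q k w \<mu> s * F s)"
      have \<Phi>': "gamma_factor \<epsilon>' Q k w \<mu>' s * F' s = \<Phi> (s + \<i> * of_real t)" for s
        by (simp add: \<Phi>_def F'_def gamma_factor_def \<epsilon>'_def \<mu>'_def powr_add algebra_simps)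
      have "\<forall>\<^sub>\<approx>s\<in>UNIV. \<Phi> s = cnj (\<Phi> (cnj (1 - s)))"
        using fe unfolding functional_equation_with_def \<Phi>_def by blast
      hence ev: "eventually (\<lambda>s. \<Phi> s = cnj (\<Phi> (cnj (1 - s)))) (at z)" for z
        by (rule eventually_cosparse_imp_eventually_at) simp
      have "\<forall>\<^sub>\<approx>s\<in>UNIV. \<Phi> (s + \<i> * of_real t) = cnj (\<Phi> (cnj (1 - s) + \<i> * of_real t))"
      proof (subst eventually_cosparse_open_eq, safe)
        fix z :: complex
        have "((\<lambda>s. s + \<i> * of_real t) \<longlongrightarrow> z + \<i> * of_real t) (at z)" by (intro tendsto_intros)
        hence "filterlim (\<lambda>s. s + \<i> * of_real t) (at (z + \<i> * of_real t)) (at z)"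
          by (auto simp: filterlim_at eventually_at_filter)
        from eventually_compose_filterlim[OF ev this]
        have "eventually (\<lambda>s. \<Phi> (s + \<i> * of_real t) = cnj (\<Phi> (cnj (1 - (s + \<i> * of_real t))))) (at z)" .
        \<comment> \<open>The reflection s \<mapsto> cnj (1 - s) preserves imaginary parts, so it
          commutes with the shift.\<close>
        moreover have "cnj (1 - (s + \<i> * of_real t)) = cnj (1 - s) + \<i> * of_real t" for s by (simp add: algebra_simps)
        ultimately show "eventually (\<lambda>s. \<Phi> (s + \<i> * of_real t) = cnj (\<Phi> (cnj (1 - s) + \<i> * of_real t))) (at z)"
          by (simp only:)
      qed auto
      hence "functional_equation_with F' \<epsilon>' Q k w \<mu>'"
        unfolding functional_equation_with_def \<Phi>' using fe
        by (auto simp: functional_equation_with_def \<epsilon>'_def \<mu>'_def norm_mult norm_powr_real_powr)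
      thus ?thesis unfolding selberg_functional_equation_iff by blast
    qed
  qed
qed

lemma selberg_index_shift:
  assumes "selberg_index a n"
  shows "selberg_index (shift t a) n"
proof -
  have "(\<Sum>p | prime p \<and> real p \<le> x. (norm (shift t a p))\<^sup>2 / real p) = (\<Sum>p | prime p \<and> real p \<le> x. (norm (a p))\<^sup>2 / real p)" for x
    by (rule sum.cong) (auto simp: norm_shift prime_gt_0_nat)
  thus ?thesis using assms by (simp add: selberg_index_def)
qed

section \<open>Boundary values on the line of real part 1\<close>

lemma continuation_along_ray:
  assumes F: "continues_series F a" and cont: "isCont F (Complex 1 t)"
  shows "((\<lambda>\<delta>. dirichlet_series a (Complex (1 + \<delta>) t)) \<longlongrightarrow> F (Complex 1 t)) (at_right 0)"
proof -
  have "((\<lambda>\<delta>. Complex (1 + \<delta>) t) \<longlongrightarrow> Complex (1 + 0) t) (at_right 0)" by (intro tendsto_intros)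
  hence "((\<lambda>\<delta>. F (Complex (1 + \<delta>) t)) \<longlongrightarrow> F (Complex 1 t)) (at_right 0)"
    by (intro isCont_tendsto_compose[OF cont]) simp
  moreover have "eventually (\<lambda>\<delta>. F (Complex (1 + \<delta>) t) = dirichlet_series a (Complex (1 + \<delta>) t)) (at_right 0)"
    using F by (intro eventually_mono[OF eventually_at_right_less]) (auto simp: continues_series_def)
  ultimately show ?thesis by (simp add: tendsto_cong)
qed

lemma continues_series_isCont:
  assumes "continues_series F a" "\<not> is_pole F s"
  shows "isCont F s"
  using assms by (auto simp: continues_series_def nicely_meromorphic_on_def isCont_def)

section \<open>The pole of zeta and its index\<close>

lemma zeta_residue_limit:
  "((\<lambda>\<delta>. \<delta> * norm (dirichlet_series zeta_coeff (of_real (1 + \<delta>)))) \<longlongrightarrow> 1) (at_right 0)"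
proof -
  have cont: "isCont zeta_entire 1"
    using holomorphic_on_imp_continuous_on[OF holomorphic_zeta_entire] by (simp add: continuous_on_eq_continuous_at)
  have "((\<lambda>\<delta>. 1 + of_real \<delta> :: complex) \<longlongrightarrow> 1 + of_real 0) (at_right 0)" by (intro tendsto_intros)
  hence "((\<lambda>\<delta>. norm (zeta_entire (1 + of_real \<delta>))) \<longlongrightarrow> norm (zeta_entire 1)) (at_right 0)"
    by (intro tendsto_norm isCont_tendsto_compose[OF cont]) simp
  moreover have "eventually (\<lambda>\<delta>. norm (zeta_entire (1 + of_real \<delta>)) =
      \<delta> * norm (dirichlet_series zeta_coeff (of_real (1 + \<delta>)))) (at_right 0)"
  proof (rule eventually_mono[OF eventually_at_right_less])
    fix \<delta> :: real assume d: "0 < \<delta>"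
    have "dirichlet_series zeta_coeff (of_real (1 + \<delta>)) = zeta_entire (of_real (1 + \<delta>)) / of_real \<delta>"
      using selberg_function_eq[OF zeta_selberg_function, of "of_real (1 + \<delta>)"] d by (simp add: zeta_fun_def)
    thus "norm (zeta_entire (1 + of_real \<delta>)) = \<delta> * norm (dirichlet_series zeta_coeff (of_real (1 + \<delta>)))"
      using d by (simp add: norm_divide)
  qed
  ultimately show ?thesis by (simp add: tendsto_cong zeta_entire_1)
qed

text \<open>The simple pole gives ln |\<zeta>(1 + \<delta>)| = ln (1/\<delta>) + o(1), and the sum
  over primes differs from this logarithm by a bounded amount.\<close>

lemma prime_zeta_near_1:
  "\<exists>R. eventually (\<lambda>\<delta>. \<bar>Re (dirichlet_series (prime_part zeta_coeff) (of_real (1 + \<delta>))) - ln (1 / \<delta>)\<bar> \<le> R) (at_right 0)"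
proof -
  obtain R where R: "\<And>s. Re s > 1 \<Longrightarrow>
      \<bar>ln (norm (dirichlet_series zeta_coeff s)) - Re (dirichlet_series (prime_part zeta_coeff) s)\<bar> \<le> R"
    using log_norm_prime_sum[OF zeta_in_selberg_class] by blast
  have "((\<lambda>\<delta>. ln (\<delta> * norm (dirichlet_series zeta_coeff (of_real (1 + \<delta>))))) \<longlongrightarrow> ln 1) (at_right 0)"
    by (intro tendsto_ln zeta_residue_limit) simp
  hence ev: "eventually (\<lambda>\<delta>. \<bar>ln (\<delta> * norm (dirichlet_series zeta_coeff (of_real (1 + \<delta>))))\<bar> < 1) (at_right 0)"
    by (auto simp: tendsto_iff dist_real_def)
  have "eventually (\<lambda>\<delta>. \<delta> * norm (dirichlet_series zeta_coeff (of_real (1 + \<delta>))) > 0) (at_right 0)"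
    by (rule order_tendstoD(1)[OF zeta_residue_limit]) simp
  with ev have "eventually (\<lambda>\<delta>. \<bar>Re (dirichlet_series (prime_part zeta_coeff) (of_real (1 + \<delta>))) - ln (1 / \<delta>)\<bar> \<le> R + 1) (at_right 0)"
    using eventually_at_right_less[of 0]
  proof eventually_elim
    fix \<delta> :: real
    assume *: "\<bar>ln (\<delta> * norm (dirichlet_series zeta_coeff (of_real (1 + \<delta>))))\<bar> < 1"
      "\<delta> * norm (dirichlet_series zeta_coeff (of_real (1 + \<delta>))) > 0" "0 < \<delta>"
    have "norm (dirichlet_series zeta_coeff (of_real (1 + \<delta>))) > 0" using *(2,3) by (simp only: zero_less_mult_pos)
    hence "ln (\<delta> * norm (dirichlet_series zeta_coeff (of_real (1 + \<delta>)))) =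
        ln (norm (dirichlet_series zeta_coeff (of_real (1 + \<delta>)))) - ln (1 / \<delta>)"
      using *(3) by (simp add: ln_mult_pos ln_div)
    with R[of "of_real (1 + \<delta>)"] *(1,3)
    show "\<bar>Re (dirichlet_series (prime_part zeta_coeff) (of_real (1 + \<delta>))) - ln (1 / \<delta>)\<bar> \<le> R + 1"
      by simp
  qed
  thus ?thesis by blast
qed

text \<open>Rankin's device: p^(-\<delta>) \<ge> x^(-\<delta>) for p \<le> x, and the terms with p >
  x are nonnegative.\<close>

lemma prime_zeta_lower_bound:
  assumes d: "\<delta> > 0" and x: "x \<ge> 1"
  shows "x powr (-\<delta>) * (\<Sum>p | prime p \<and> real p \<le> x. 1 / real p)
           \<le> Re (dirichlet_series (prime_part zeta_coeff) (of_real (1 + \<delta>)))"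
proof -
  define h where "h = (\<lambda>n. if prime n then real n powr (- (1 + \<delta>)) else 0)"
  have "prime_part zeta_coeff n * of_nat n powr (- of_real (1 + \<delta>)) = of_real (h n)" for n
  proof (cases "prime n")
    case True
    have "(of_nat n :: complex) powr (- of_real (1 + \<delta>)) = of_real (real n powr (- (1 + \<delta>)))"
      by (subst of_real_minus[symmetric], subst powr_of_real[symmetric]) auto
    thus ?thesis using True prime_gt_0_nat[OF True] by (simp add: h_def prime_part_def zeta_coeff_def)
  qed (simp add: h_def prime_part_def)
  moreover have "(\<lambda>n. prime_part zeta_coeff n * of_nat n powr (- of_real (1 + \<delta>))) sums
      dirichlet_series (prime_part zeta_coeff) (of_real (1 + \<delta>))"
    by (rule dirichlet_series_sums[OF prime_part_conv[OF zeta_coeff_conv[of "1 + \<delta>"]]]) (use d in auto)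
  ultimately have "(\<lambda>n. complex_of_real (h n)) sums dirichlet_series (prime_part zeta_coeff) (of_real (1 + \<delta>))"
    by (simp only:)
  hence h: "h sums Re (dirichlet_series (prime_part zeta_coeff) (of_real (1 + \<delta>)))"
    using sums_Re by fastforce
  have "x powr (-\<delta>) * (\<Sum>p | prime p \<and> real p \<le> x. 1 / real p) = (\<Sum>p | prime p \<and> real p \<le> x. x powr (-\<delta>) * (1 / real p))"
    by (rule sum_distrib_left)
  also have "\<dots> \<le> sum h {p. prime p \<and> real p \<le> x}"
  proof (rule sum_mono)
    fix p assume "p \<in> {p. prime p \<and> real p \<le> x}"
    hence p: "prime p" "real p \<le> x" "real p > 0" by (auto simp: prime_gt_0_nat)
    have "x powr (-\<delta>) * (1 / real p) \<le> real p powr (-\<delta>) * (1 / real p)"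
      by (intro mult_right_mono powr_mono2') (use p d in auto)
    also have "\<dots> = h p" using p powr_add[of "real p" "-\<delta>" "-1"] by (simp add: h_def powr_minus_divide algebra_simps)
    finally show "x powr (-\<delta>) * (1 / real p) \<le> h p" .
  qed
  also have "\<dots> \<le> suminf h" using h by (intro sum_le_suminf finite_primes_le) (auto simp: sums_iff h_def)
  finally show ?thesis using h by (simp add: sums_iff)
qed

text \<open>An index at most 0 would keep the prime sum bounded near 1. If the index were at least 2, the
  primes up to \<open>exp (1 / (2\<delta>))\<close> alone would contribute \<open>2 exp (-1/2) ln (1/\<delta>)\<close>, up to a constant,
  to a sum of size \<open>ln (1/\<delta>)\<close>.\<close>

lemma zeta_index:
  assumes A: selberg_conjecture_A
  shows "selberg_index zeta_coeff 1"
proof -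
  define T where "T = (\<lambda>\<delta>. Re (dirichlet_series (prime_part zeta_coeff) (of_real (1 + \<delta>))))"
  define S where "S = (\<lambda>x::real. \<Sum>p | prime p \<and> real p \<le> x. 1 / real p)"
  obtain n where n: "selberg_index zeta_coeff n"
    using A zeta_in_selberg_class by (auto simp: selberg_conjecture_A_def)
  have "(\<Sum>p | prime p \<and> real p \<le> x. (norm (zeta_coeff p))\<^sup>2 / real p) = S x" for x
    unfolding S_def by (rule sum.cong) (auto simp: zeta_coeff_def)
  with n obtain C where C: "eventually (\<lambda>x. \<bar>S x - of_int n * ln (ln x)\<bar> \<le> C) at_top"
    by (auto simp: selberg_index_def bigo_1_iff)
  obtain R where R: "eventually (\<lambda>\<delta>. \<bar>T \<delta> - ln (1 / \<delta>)\<bar> \<le> R) (at_right 0)"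
    using prime_zeta_near_1 unfolding T_def by blast
  have L: "filterlim (\<lambda>\<delta>::real. ln (1 / \<delta>)) at_top (at_right 0)" by real_asymp
  have "n > 0"
  proof (rule ccontr)
    assume "\<not> n > 0"
    hence n0: "real_of_int n \<le> 0" by simp
    have ln_norm: "norm (\<Sum>p | prime p \<and> real p \<le> x. zeta_coeff p / of_nat p) = S x" for x
    proof -
      have "(\<Sum>p | prime p \<and> real p \<le> x. zeta_coeff p / of_nat p) = of_real (S x)"
        unfolding S_def of_real_sum by (rule sum.cong) (auto simp: zeta_coeff_def)
      moreover have "S x \<ge> 0" unfolding S_def by (rule sum_nonneg) simp
      ultimately show ?thesis by simp
    qed
    have "eventually (\<lambda>x::real. ln (ln x) \<ge> 0) at_top" by real_asymp
    with C have "eventually (\<lambda>x. S x \<le> C) at_top"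
    proof eventually_elim
      fix x assume *: "\<bar>S x - of_int n * ln (ln x)\<bar> \<le> C" "ln (ln x) \<ge> 0"
      have "of_int n * ln (ln x) \<le> 0" using n0 *(2) by (rule mult_nonpos_nonneg)
      thus "S x \<le> C" using *(1) by linarith
    qed
    hence "(\<lambda>x::real. \<Sum>p | prime p \<and> real p \<le> x. zeta_coeff p / of_nat p) \<in> O[at_top](\<lambda>_. 1)"
      unfolding bigo_1_iff ln_norm by blast
    from bounded_prime_sum[OF this zeta_coeff_conv] obtain K where
      K: "\<And>\<delta>. \<delta> > 0 \<Longrightarrow> norm (dirichlet_series (prime_part zeta_coeff) (of_real (1 + \<delta>))) \<le> K" by blast
    have "eventually (\<lambda>\<delta>::real. ln (1 / \<delta>) \<ge> R + K + 1) (at_right 0)"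
      using L by (simp add: filterlim_at_top)
    with R have "eventually (\<lambda>\<delta>::real. False) (at_right 0)"
      using eventually_at_right_less[of 0]
    proof eventually_elim
      fix \<delta> :: real assume *: "\<bar>T \<delta> - ln (1 / \<delta>)\<bar> \<le> R" "ln (1 / \<delta>) \<ge> R + K + 1" "0 < \<delta>"
      have "T \<delta> \<le> K" unfolding T_def using K[OF *(3)] complex_Re_le_cmod order_trans by blast
      thus False using * by linarith
    qed
    thus False by simp
  qed
  moreover have "n < 2"
  proof (rule ccontr)
    assume "\<not> n < 2"
    hence n2: "real_of_int n \<ge> 2" by simp
    \<comment> \<open>At x = exp (1 / (2\<delta>)) the weight x^(-\<delta>) is exactly exp (-1/2).
      What matters is 2q > 1; the bound 3/5 follows from e < 2.72 < 25/9 and leaves a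
      margin.\<close>
    define q where "q = exp (- 1 / 2 :: real)"
    have q: "q > 3 / 5"
    proof -
      have "exp (1 :: real) < (5 / 3)\<^sup>2" using e_less_272 by (simp add: power2_eq_square)
      also have "exp (1 :: real) = (exp (1 / 2))\<^sup>2" by (simp flip: exp_double)
      finally have "exp (1 / 2 :: real) < 5 / 3" by (rule power2_less_imp_less) simp
      thus ?thesis by (simp add: q_def exp_minus field_simps)
    qed
    have x_lim: "filterlim (\<lambda>\<delta>::real. exp (1 / (2 * \<delta>))) at_top (at_right 0)" by real_asymp
    note Cx = eventually_compose_filterlim[OF C x_lim]
    \<comment> \<open>Collects the bounded losses 2 ln 2 and C. Then 2ql \<le> l + R + K together
      with q > 3/5 forces l \<le> 5 (R + K).\<close>
    define K where "K = q * (2 * ln 2 + C)"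
    have "eventually (\<lambda>\<delta>::real. ln (1 / \<delta>) \<ge> max 1 (5 * (R + K) + 1)) (at_right 0)"
      using L unfolding filterlim_at_top by blast
    with R Cx have "eventually (\<lambda>\<delta>::real. False) (at_right 0)"
      using eventually_at_right_less[of 0]
    proof eventually_elim
      fix \<delta> :: real
      assume *: "\<bar>T \<delta> - ln (1 / \<delta>)\<bar> \<le> R"
        "\<bar>S (exp (1 / (2 * \<delta>))) - of_int n * ln (ln (exp (1 / (2 * \<delta>))))\<bar> \<le> C"
        "ln (1 / \<delta>) \<ge> max 1 (5 * (R + K) + 1)" "0 < \<delta>"
      define l where "l = ln (1 / \<delta>)"
      have l: "l \<ge> 1" "l \<ge> 5 * (R + K) + 1" using *(3) by (auto simp: l_def)
      have ll: "ln (ln (exp (1 / (2 * \<delta>)))) = l - ln 2" using *(4) by (simp add: l_def ln_div ln_mult_pos)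
      have ln2: "ln 2 \<le> (1::real)" using ln_2_less_1 by simp
      have "2 * (l - ln 2) \<le> of_int n * (l - ln 2)" using n2 l ln2 by (intro mult_right_mono) auto
      hence "S (exp (1 / (2 * \<delta>))) \<ge> 2 * (l - ln 2) - C" using *(2) unfolding ll by linarith
      hence "q * (2 * (l - ln 2) - C) \<le> q * S (exp (1 / (2 * \<delta>)))" using q by (intro mult_left_mono) auto
      also have "q * S (exp (1 / (2 * \<delta>))) = exp (1 / (2 * \<delta>)) powr (-\<delta>) * S (exp (1 / (2 * \<delta>)))"
        using *(4) by (simp add: q_def powr_def)
      also have "\<dots> \<le> T \<delta>"
        unfolding T_def S_def by (rule prime_zeta_lower_bound) (use *(4) in auto)
      finally have "q * (2 * (l - ln 2) - C) \<le> l + R" using *(1) unfolding l_def by linarith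
      hence up: "2 * (q * l) \<le> l + R + K" by (simp add: K_def algebra_simps)
      have low: "3 * l \<le> 5 * (q * l)" using mult_right_mono[of "3 / 5" q l] q l by simp
      have False if "2 * m \<le> l + R + K" "3 * l \<le> 5 * m" for m using that l(2) by argo
      thus False using up low by blast
    qed
    thus False by simp
  qed
  ultimately have "n = 1" by simp
  thus ?thesis using n by simp
qed

lemma zeta_primitive:
  assumes "selberg_conjecture_A" "selberg_conjecture_B"
  shows "selberg_primitive zeta_coeff"
  by (rule index_one_primitive[OF assms zeta_in_selberg_class zeta_index[OF assms(1)]])

text \<open>The coefficients of log \<zeta> are nonnegative, and 3 + 4 cos x + cos (2x) = 2 (1 + cos
  x)^2 \<ge> 0.\<close>

lemma zeta_3_4_1:
  assumes \<sigma>: "\<sigma> > 1"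
  shows "norm (dirichlet_series zeta_coeff (Complex \<sigma> 0)) ^ 3 * norm (dirichlet_series zeta_coeff (Complex \<sigma> t)) ^ 4 *
           norm (dirichlet_series zeta_coeff (Complex \<sigma> (2 * t))) \<ge> 1"
proof -
  define B where "B = (\<lambda>u. Re (dirichlet_series zeta_log_coeff (Complex \<sigma> u)))"
  define b where "b = (\<lambda>n. mangoldt n / ln (real n) * real n powr (-\<sigma>))"
  have nz: "norm (dirichlet_series zeta_coeff (Complex \<sigma> u)) = exp (B u)" for u
    using zeta_euler[of "Complex \<sigma> u", symmetric] \<sigma> by (simp add: B_def)
  have Bs: "(\<lambda>n. b n * cos (u * ln (real n))) sums B u" for u
  proof -
    have "Re (zeta_log_coeff n * of_nat n powr (- Complex \<sigma> u)) = b n * cos (u * ln (real n))" for n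
    proof (cases "n = 0")
      case False
      have "Re (of_nat n powr (- Complex \<sigma> u)) = real n powr (-\<sigma>) * cos (u * ln (real n))"
        using False by (simp add: powr_def Ln_of_nat Re_exp)
      thus ?thesis by (simp add: zeta_log_coeff_def b_def)
    qed (simp add: b_def)
    moreover have "(\<lambda>n. Re (zeta_log_coeff n * of_nat n powr (- Complex \<sigma> u))) sums B u"
      unfolding B_def by (intro sums_Re dirichlet_series_sums[OF zeta_log_coeff_conv[OF \<sigma>]]) simp
    ultimately show ?thesis by (simp only:)
  qed
  have sum: "(\<lambda>n. 3 * (b n * cos (0 * ln (real n))) + 4 * (b n * cos (t * ln (real n))) + b n * cos (2 * t * ln (real n))) sums
      (3 * B 0 + 4 * B t + B (2 * t))"
    by (intro sums_add sums_mult Bs)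
  have nonneg: "3 * (b n * cos (0 * ln (real n))) + 4 * (b n * cos (t * ln (real n))) + b n * cos (2 * t * ln (real n)) \<ge> 0" for n
  proof -
    have "cos (2 * t * ln (real n)) = 2 * (cos (t * ln (real n)))\<^sup>2 - 1"
      using cos_double_cos[of "t * ln (real n)"] by (simp add: mult.assoc)
    hence "3 * (b n * cos (0 * ln (real n))) + 4 * (b n * cos (t * ln (real n))) + b n * cos (2 * t * ln (real n))
        = b n * (2 * (1 + cos (t * ln (real n)))\<^sup>2)"
      by (simp only:) (simp add: power2_eq_square algebra_simps)
    moreover have "b n \<ge> 0" using zeta_log_coeff_bounds(1)[of n] unfolding b_def by (rule mult_nonneg_nonneg) simp
    ultimately show ?thesis by simp
  qed
  have "3 * B 0 + 4 * B t + B (2 * t) \<ge> 0"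
    by (rule sums_le[OF nonneg sums_zero sum])
  hence "exp (3 * B 0 + 4 * B t + B (2 * t)) \<ge> 1" by simp
  thus ?thesis
    unfolding nz exp_add exp_of_nat_mult[of 3, simplified] exp_of_nat_mult[of 4, simplified] .
qed

text \<open>A zero at 1 + it would make |\<zeta>(1 + \<delta> + it)| at most of order \<delta>. In
  the 3-4-1 product its fourth power outweighs the third power of the pole, so the product would
  tend to 0 instead of staying at least 1. At t = 0 the pole itself gives the bound.\<close>

lemma zeta_lower_bound_on_line:
  "\<exists>c>0. eventually (\<lambda>\<delta>. norm (dirichlet_series zeta_coeff (Complex (1 + \<delta>) t)) \<ge> c) (at_right 0)"
proof (cases "t = 0")
  case True
  have "eventually (\<lambda>\<delta>. 1 / 2 < \<delta> * norm (dirichlet_series zeta_coeff (of_real (1 + \<delta>)))) (at_right 0)"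
    by (rule order_tendstoD(1)[OF zeta_residue_limit]) simp
  moreover have "eventually (\<lambda>\<delta>::real. \<delta> < 1) (at_right 0)" by real_asymp
  ultimately have "eventually (\<lambda>\<delta>. norm (dirichlet_series zeta_coeff (Complex (1 + \<delta>) t)) \<ge> 1 / 2) (at_right 0)"
  proof eventually_elim
    fix \<delta> :: real assume *: "1 / 2 < \<delta> * norm (dirichlet_series zeta_coeff (of_real (1 + \<delta>)))" "\<delta> < 1"
    have "\<delta> * norm (dirichlet_series zeta_coeff (of_real (1 + \<delta>))) \<le> 1 * norm (dirichlet_series zeta_coeff (of_real (1 + \<delta>)))"
      by (intro mult_right_mono) (use * in auto)
    thus "norm (dirichlet_series zeta_coeff (Complex (1 + \<delta>) t)) \<ge> 1 / 2"
      using * True by (simp add: complex_of_real_def)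
  qed
  thus ?thesis by (intro exI[of _ "1 / 2"]) simp
next
  case False
  define s where "s = Complex 1 t"
  have cont: "isCont zeta_fun (Complex 1 u)" if "u \<noteq> 0" for u
    by (rule selberg_function_isCont[OF zeta_selberg_function]) (use that in \<open>simp add: complex_eq_iff\<close>)
  have lim: "((\<lambda>\<delta>. norm (dirichlet_series zeta_coeff (Complex (1 + \<delta>) u))) \<longlongrightarrow> norm (zeta_fun (Complex 1 u))) (at_right 0)"
    if "u \<noteq> 0" for u
    by (intro tendsto_norm continuation_along_ray[OF zeta_continues] cont that)
  have nz: "zeta_fun s \<noteq> 0"
  proof
    assume z0: "zeta_fun s = 0"
    have "zeta_fun holomorphic_on -{1}" by (rule selberg_function_holomorphic[OF zeta_selberg_function])
    hence "zeta_fun field_differentiable at s"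
      by (rule holomorphic_on_imp_differentiable_at) (use False in \<open>auto simp: s_def complex_eq_iff\<close>)
    then obtain D where D: "(zeta_fun has_field_derivative D) (at s)"
      by (auto simp: field_differentiable_def)
    have "((\<lambda>h. (zeta_fun (s + h) - zeta_fun s) / h) \<longlongrightarrow> D) (at 0)" using D by (simp add: DERIV_def)
    moreover have "filterlim (\<lambda>\<delta>::real. complex_of_real \<delta>) (at 0) (at_right 0)"
    proof -
      have "((\<lambda>\<delta>::real. complex_of_real \<delta>) \<longlongrightarrow> of_real 0) (at_right 0)" by (intro tendsto_intros)
      thus ?thesis by (auto simp: filterlim_at eventually_at_filter)
    qed
    ultimately have "((\<lambda>\<delta>. (zeta_fun (s + of_real \<delta>) - zeta_fun s) / of_real \<delta>) \<longlongrightarrow> D) (at_right 0)"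
      by (rule filterlim_compose)
    hence "((\<lambda>\<delta>. norm ((zeta_fun (s + of_real \<delta>) - zeta_fun s) / of_real \<delta>)) \<longlongrightarrow> norm D) (at_right 0)"
      by (rule tendsto_norm)
    moreover have "eventually (\<lambda>\<delta>. norm ((zeta_fun (s + of_real \<delta>) - zeta_fun s) / of_real \<delta>) =
        norm (dirichlet_series zeta_coeff (Complex (1 + \<delta>) t)) / \<delta>) (at_right 0)"
    proof (rule eventually_mono[OF eventually_at_right_less])
      fix \<delta> :: real assume d: "0 < \<delta>"
      have "s + of_real \<delta> = Complex (1 + \<delta>) t" by (simp add: s_def complex_eq_iff)
      moreover have "zeta_fun (Complex (1 + \<delta>) t) = dirichlet_series zeta_coeff (Complex (1 + \<delta>) t)"
        by (rule selberg_function_eq[OF zeta_selberg_function]) (use d in simp)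
      ultimately show "norm ((zeta_fun (s + of_real \<delta>) - zeta_fun s) / of_real \<delta>) =
        norm (dirichlet_series zeta_coeff (Complex (1 + \<delta>) t)) / \<delta>"
        using z0 d by (simp add: norm_divide)
    qed
    ultimately have q: "((\<lambda>\<delta>. norm (dirichlet_series zeta_coeff (Complex (1 + \<delta>) t)) / \<delta>) \<longlongrightarrow> norm D) (at_right 0)"
      by (simp add: tendsto_cong)
    have t2: "2 * t \<noteq> 0" using False by simp
    \<comment> \<open>Three factors \<delta> normalise the pole and four factors 1/\<delta> the
      zero; one \<delta> remains and forces the limit 0.\<close>
    have "((\<lambda>\<delta>. (\<delta> * norm (dirichlet_series zeta_coeff (of_real (1 + \<delta>)))) ^ 3 *
        (norm (dirichlet_series zeta_coeff (Complex (1 + \<delta>) t)) / \<delta>) ^ 4 * \<delta> *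
        norm (dirichlet_series zeta_coeff (Complex (1 + \<delta>) (2 * t)))) \<longlongrightarrow>
        1 ^ 3 * norm D ^ 4 * 0 * norm (zeta_fun (Complex 1 (2 * t)))) (at_right 0)"
      by (intro tendsto_intros tendsto_mult tendsto_power zeta_residue_limit q lim t2)
    moreover have "eventually (\<lambda>\<delta>. 1 \<le> (\<delta> * norm (dirichlet_series zeta_coeff (of_real (1 + \<delta>)))) ^ 3 *
        (norm (dirichlet_series zeta_coeff (Complex (1 + \<delta>) t)) / \<delta>) ^ 4 * \<delta> *
        norm (dirichlet_series zeta_coeff (Complex (1 + \<delta>) (2 * t)))) (at_right 0)"
    proof (rule eventually_mono[OF eventually_at_right_less])
      fix \<delta> :: real assume d: "0 < \<delta>"
      have "(\<delta> * x) ^ 3 * (y / \<delta>) ^ 4 * \<delta> * z = x ^ 3 * y ^ 4 * z" for x y z :: real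
        using d by (simp add: field_simps power_mult_distrib power_divide eval_nat_numeral)
      moreover have "complex_of_real (1 + \<delta>) = Complex (1 + \<delta>) 0" by (rule complex_of_real_def)
      ultimately show "1 \<le> (\<delta> * norm (dirichlet_series zeta_coeff (of_real (1 + \<delta>)))) ^ 3 *
        (norm (dirichlet_series zeta_coeff (Complex (1 + \<delta>) t)) / \<delta>) ^ 4 * \<delta> *
        norm (dirichlet_series zeta_coeff (Complex (1 + \<delta>) (2 * t)))"
        using zeta_3_4_1[of "1 + \<delta>" t] d by (simp only:)
    qed
    ultimately have "1 \<le> 1 ^ 3 * norm D ^ 4 * 0 * norm (zeta_fun (Complex 1 (2 * t)))"
      by (rule tendsto_lowerbound) simp
    thus False by simp
  qed
  have "eventually (\<lambda>\<delta>. norm (zeta_fun s) / 2 < norm (dirichlet_series zeta_coeff (Complex (1 + \<delta>) t))) (at_right 0)"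
    by (rule order_tendstoD(1)[OF lim[OF False]]) (use nz in \<open>simp add: s_def\<close>)
  thus ?thesis using nz by (intro exI[of _ "norm (zeta_fun s) / 2"]) (auto elim: eventually_mono)
qed

section \<open>Nonvanishing for primitive functions\<close>

lemma primitive_log_bounded:
  assumes B: selberg_conjecture_B and f: "selberg_primitive f" "f \<noteq> zeta_coeff"
    and zeta: "selberg_primitive zeta_coeff"
  shows "\<exists>c>0. \<exists>C. \<forall>\<delta>>0. c \<le> norm (dirichlet_series f (of_real (1 + \<delta>))) \<and> norm (dirichlet_series f (of_real (1 + \<delta>))) \<le> C"
proof -
  have fc: "f \<in> selberg_class" using f(1) by (rule primitive_in_class)
  \<comment> \<open>The coefficients of zeta at primes are 1, so orthogonality to zeta speaks of the
    plain sum of f(p)/p.\<close>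
  have "(\<Sum>p | prime p \<and> real p \<le> x. f p * cnj (zeta_coeff p) / of_nat p) = (\<Sum>p | prime p \<and> real p \<le> x. f p / of_nat p)" for x
    by (rule sum.cong) (auto simp: zeta_coeff_def)
  with B f zeta have "(\<lambda>x::real. \<Sum>p | prime p \<and> real p \<le> x. f p / of_nat p) \<in> O[at_top](\<lambda>_. 1)"
    by (fastforce simp: selberg_conjecture_B_def)
  from bounded_prime_sum[OF this selberg_abs_conv[OF fc]] obtain K where
    K: "\<And>\<delta>. \<delta> > 0 \<Longrightarrow> norm (dirichlet_series (prime_part f) (of_real (1 + \<delta>))) \<le> K" by blast
  obtain R where R: "\<And>s. Re s > 1 \<Longrightarrow>
      \<bar>ln (norm (dirichlet_series f s)) - Re (dirichlet_series (prime_part f) s)\<bar> \<le> R \<and> dirichlet_series f s \<noteq> 0"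
    using log_norm_prime_sum[OF fc] by blast
  have "exp (-(R + K)) \<le> norm (dirichlet_series f (of_real (1 + \<delta>))) \<and> norm (dirichlet_series f (of_real (1 + \<delta>))) \<le> exp (R + K)"
    if d: "\<delta> > 0" for \<delta>
  proof -
    have "\<bar>Re (dirichlet_series (prime_part f) (of_real (1 + \<delta>)))\<bar> \<le> K"
      using abs_Re_le_cmod K[OF d] by (rule order_trans)
    moreover have R': "\<bar>ln (norm (dirichlet_series f (of_real (1 + \<delta>)))) - Re (dirichlet_series (prime_part f) (of_real (1 + \<delta>)))\<bar> \<le> R"
      "dirichlet_series f (of_real (1 + \<delta>)) \<noteq> 0"
      using R[of "of_real (1 + \<delta>)"] d by auto
    ultimately have "-(R + K) \<le> ln (norm (dirichlet_series f (of_real (1 + \<delta>))))" "ln (norm (dirichlet_series f (of_real (1 + \<delta>)))) \<le> R + K"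
      by linarith+
    moreover have "norm (dirichlet_series f (of_real (1 + \<delta>))) > 0" using R'(2) by simp
    ultimately show ?thesis by (metis exp_le_cancel_iff exp_ln)
  qed
  thus ?thesis by (intro exI[of _ "exp (-(R + K))"] conjI exI[of _ "exp (R + K)"]) auto
qed

text \<open>A pole at 1 would drive |F(1 + \<delta>)| to infinity. Without a pole F is continuous at
  1 by the normalisation of the continuation, and the singularity is removable.\<close>

lemma primitive_entire:
  assumes F: "selberg_function f F" and C: "\<And>\<delta>. \<delta> > 0 \<Longrightarrow> norm (dirichlet_series f (of_real (1 + \<delta>))) \<le> C"
  shows "F holomorphic_on UNIV"
proof -
  have cs: "continues_series F f" using F by (simp add: selberg_function_def)
  have "\<not> is_pole F 1"
  proof
    assume "is_pole F 1"
    moreover have "filterlim (\<lambda>\<delta>::real. complex_of_real (1 + \<delta>)) (at 1) (at_right 0)"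
    proof -
      have "((\<lambda>\<delta>::real. complex_of_real (1 + \<delta>)) \<longlongrightarrow> of_real (1 + 0)) (at_right 0)" by (intro tendsto_intros)
      thus ?thesis by (auto simp: filterlim_at eventually_at_filter)
    qed
    ultimately have "filterlim (\<lambda>\<delta>::real. F (of_real (1 + \<delta>))) at_infinity (at_right 0)"
      unfolding is_pole_def by (rule filterlim_compose)
    hence "filterlim (\<lambda>\<delta>::real. norm (F (of_real (1 + \<delta>)))) at_top (at_right 0)"
      by (rule filterlim_at_infinity_imp_norm_at_top)
    hence "eventually (\<lambda>\<delta>::real. norm (F (of_real (1 + \<delta>))) \<ge> C + 1) (at_right 0)"
      by (simp add: filterlim_at_top)
    hence "eventually (\<lambda>\<delta>::real. False) (at_right 0)" using eventually_at_right_less[of 0]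
    proof eventually_elim
      fix \<delta> :: real assume "norm (F (of_real (1 + \<delta>))) \<ge> C + 1" "0 < \<delta>"
      thus False using C[of \<delta>] selberg_function_eq[OF F, of "of_real (1 + \<delta>)"] by simp
    qed
    thus False by simp
  qed
  hence "isCont F 1" by (rule continues_series_isCont[OF cs])
  hence "isCont F z" for z using selberg_function_isCont[OF F, of z] by (cases "z = 1") auto
  hence "continuous_on UNIV F" by (simp add: continuous_on_eq_continuous_at)
  moreover have "F holomorphic_on UNIV - {1}"
    using selberg_function_holomorphic[OF F] by (simp add: Compl_eq_Diff_UNIV)
  ultimately show ?thesis by (rule no_isolated_singularity) auto
qed

text \<open>The imaginary shift of an entire primitive function is again primitive, because the index does
  not see the shift; so orthogonality to \<open>\<zeta>\<close> applies to every point of the line.\<close>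

lemma primitive_lower_bound_on_line:
  assumes A: selberg_conjecture_A and B: selberg_conjecture_B and f: "selberg_primitive f"
  shows "\<exists>c>0. eventually (\<lambda>\<delta>. norm (dirichlet_series f (Complex (1 + \<delta>) t)) \<ge> c) (at_right 0)"
proof (cases "f = zeta_coeff")
  case True
  thus ?thesis using zeta_lower_bound_on_line by simp
next
  case False
  note zeta = zeta_primitive[OF A B]
  have fc: "f \<in> selberg_class" using f by (rule primitive_in_class)
  then obtain F where F: "selberg_function f F" by (rule selberg_classE)
  obtain c C where cC: "c > 0" "\<And>\<delta>. \<delta> > 0 \<Longrightarrow> c \<le> norm (dirichlet_series f (of_real (1 + \<delta>)))"
    "\<And>\<delta>. \<delta> > 0 \<Longrightarrow> norm (dirichlet_series f (of_real (1 + \<delta>))) \<le> C"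
    using primitive_log_bounded[OF B f False zeta] by blast
  have entire: "F holomorphic_on UNIV" by (rule primitive_entire[OF F cC(3)])
  define g where "g = shift t f"
  have gc: "g \<in> selberg_class" unfolding g_def by (rule shift_in_class[OF fc F entire])
  \<comment> \<open>Here (B) is applied to the distinct primitive functions f and zeta.\<close>
  have "selberg_index f 1" using B f zeta False by (auto simp: selberg_conjecture_B_def)
  hence "selberg_index g 1" unfolding g_def by (rule selberg_index_shift)
  with gc have g: "selberg_primitive g" by (rule index_one_primitive[OF A B])
  have Dg: "dirichlet_series g (of_real (1 + \<delta>)) = dirichlet_series f (Complex (1 + \<delta>) t)" for \<delta>
    unfolding g_def dirichlet_series_shift by (rule arg_cong[of _ _ "dirichlet_series f"]) (simp add: complex_eq_iff)
  \<comment> \<open>If the shift were zeta, f would grow like 1/\<delta> along the ray at height t,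
    although F is continuous there.\<close>
  have "g \<noteq> zeta_coeff"
  proof
    assume gz: "g = zeta_coeff"
    have "isCont F (Complex 1 t)"
      using holomorphic_on_imp_continuous_on[OF entire] by (simp add: continuous_on_eq_continuous_at)
    hence "((\<lambda>\<delta>. dirichlet_series f (Complex (1 + \<delta>) t)) \<longlongrightarrow> F (Complex 1 t)) (at_right 0)"
      using F by (intro continuation_along_ray) (auto simp: selberg_function_def)
    hence "((\<lambda>\<delta>. \<delta> * norm (dirichlet_series f (Complex (1 + \<delta>) t))) \<longlongrightarrow> 0 * norm (F (Complex 1 t))) (at_right 0)"
      by (intro tendsto_intros)
    moreover have "((\<lambda>\<delta>. \<delta> * norm (dirichlet_series f (Complex (1 + \<delta>) t))) \<longlongrightarrow> 1) (at_right 0)"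
      using zeta_residue_limit unfolding gz[symmetric] Dg .
    ultimately show False using tendsto_unique[OF trivial_limit_at_right_real] by fastforce
  qed
  then obtain c' where "c' > 0" "\<And>\<delta>. \<delta> > 0 \<Longrightarrow> c' \<le> norm (dirichlet_series g (of_real (1 + \<delta>)))"
    using primitive_log_bounded[OF B g _ zeta] by blast
  thus ?thesis unfolding Dg
    by (intro exI[of _ c'] conjI eventually_mono[OF eventually_at_right_less]) auto
qed

theorem proposition4p6:
  fixes a :: "nat \<Rightarrow> complex" and F :: "complex \<Rightarrow> complex"
  assumes "selberg_conjecture_A" and "selberg_conjecture_B" and "selberg_conjecture_C"
    and "a \<in> selberg_class"
    and "continues_series F a"
  shows "\<forall>s. Re s = 1 \<longrightarrow> \<not> (F s = 0 \<and> \<not> is_pole F s)"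
proof (intro allI impI notI, elim conjE)
  fix s assume s: "Re s = 1" "F s = 0" "\<not> is_pole F s"
  define t where "t = Im s"
  have s_eq: "s = Complex 1 t" using s(1) by (simp add: t_def complex_eq_iff)
  \<comment> \<open>Off its poles the continuation is continuous, so the assumed zero is the limit
    of the series from the right.\<close>
  have "((\<lambda>\<delta>. dirichlet_series a (Complex (1 + \<delta>) t)) \<longlongrightarrow> 0) (at_right 0)"
    using continuation_along_ray[OF assms(5)] continues_series_isCont[OF assms(5) s(3)] s(2) unfolding s_eq by metis
  hence lim: "((\<lambda>\<delta>. norm (dirichlet_series a (Complex (1 + \<delta>) t))) \<longlongrightarrow> 0) (at_right 0)"
    by (rule tendsto_norm_zero)
  obtain k f where "factorization a k f"
    using factorization_exists[OF assms(4)] by blast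
  hence kf: "\<And>i. i < k \<Longrightarrow> selberg_primitive (f i)"
    and prod: "\<And>s. Re s > 1 \<Longrightarrow> dirichlet_series a s = (\<Prod>i<k. dirichlet_series (f i) s)"
    by (simp_all add: factorization_def)
  \<comment> \<open>All factors are estimated on the ray to the right of s, where the factorization
    is an identity of convergent series.\<close>
  have "\<forall>i\<in>{..<k}. \<exists>c>0. eventually (\<lambda>\<delta>. norm (dirichlet_series (f i) (Complex (1 + \<delta>) t)) \<ge> c) (at_right 0)"
    using kf by (intro ballI primitive_lower_bound_on_line[OF assms(1,2)]) simp
  then obtain c where c: "\<And>i. i < k \<Longrightarrow> c i > (0::real)"
    "\<And>i. i < k \<Longrightarrow> eventually (\<lambda>\<delta>. norm (dirichlet_series (f i) (Complex (1 + \<delta>) t)) \<ge> c i) (at_right 0)"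
    by (auto dest!: bchoice)
  have "eventually (\<lambda>\<delta>. \<forall>i\<in>{..<k}. norm (dirichlet_series (f i) (Complex (1 + \<delta>) t)) \<ge> c i) (at_right 0)"
    by (rule eventually_ball_finite) (use c in auto)
  hence "eventually (\<lambda>\<delta>. (\<Prod>i<k. c i) \<le> norm (dirichlet_series a (Complex (1 + \<delta>) t))) (at_right 0)"
    using eventually_at_right_less[of 0]
  proof eventually_elim
    fix \<delta> :: real
    assume *: "\<forall>i\<in>{..<k}. norm (dirichlet_series (f i) (Complex (1 + \<delta>) t)) \<ge> c i" "0 < \<delta>"
    have "(\<Prod>i<k. c i) \<le> (\<Prod>i<k. norm (dirichlet_series (f i) (Complex (1 + \<delta>) t)))"
      using * c(1) by (intro prod_mono) (auto intro: less_imp_le)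
    also have "\<dots> = norm (dirichlet_series a (Complex (1 + \<delta>) t))"
      using prod[of "Complex (1 + \<delta>) t"] *(2) by (simp add: prod_norm)
    finally show "(\<Prod>i<k. c i) \<le> norm (dirichlet_series a (Complex (1 + \<delta>) t))" .
  qed
  hence "(\<Prod>i<k. c i) \<le> 0" by (rule tendsto_lowerbound[OF lim]) simp
  moreover have "(\<Prod>i<k. c i) > 0" using c(1) by (intro prod_pos) auto
  ultimately show False by simp
qed

end
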